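(* Let $\Phi$ be an irreducible crystallographic root system of rank $\ell$, $\Phi^+$ a positive system, and $k$ a positive integer. Then the freeness of the extended Catalan arrangement $\mathrm{Cat}^k$ in $\mathbb{R}^{\ell+1}$ depends only on its intersection lattice; that is, every arrangement of linear hyperplanes in $\mathbb{R}^{\ell+1}$ whose intersection lattice is isomorphic to $L(\mathrm{Cat}^k)$ is free.
   Context: An arrangement $\mathcal{A}$ in a real vector space $V$ of dimension $n$ is a finite set of linear hyperplanes; with $S$ the polynomial ring of $V$ and $\alpha_H$ a linear form with kernel $H$, $D(\mathcal{A})=\{\theta\in\operatorname{Der}S\mid\theta(\alpha_H)\in S\alpha_H\ \text{for all }H\in\mathcal{A}\}$, and $\mathcal{A}$ is free if $D(\mathcal{A})$ is a free $S$-module (with a homogeneous basis). The intersection lattice is $L(\mathcal{A})=\{\bigcap_{H\in\mathcal{B}}H\mid\mathcal{B}\subset\mathcal{A}\}$, partially ordered by (reverse) inclusion. Let $\Phi$ lie in $\mathbb{R}^\ell$, regard each $\alpha\in\Phi^+$ as a linear form on $\mathbb{R}^\ell$ via the invariant inner product, and let $z$ be an additional coordinate, so $\mathbb{R}^{\ell+1}$ has coordinate ring $S[z]$ with $S$ the coordinate ring of $\mathbb{R}^\ell$. For $\alpha\in\Phi^+$ and $j\in\mathbb{Z}$ put $H_\alpha^j=\{\alpha=jz\}\subset\mathbb{R}^{\ell+1}$. The extended Catalan arrangement is $\mathrm{Cat}^k=\{H_\alpha^j\mid\alpha\in\Phi^+,\ j\in\mathbb{Z},\ -k\le j\le k\}\cup\{z=0\}$.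 *)

theory Defs
  imports
    "HOL-Analysis.Analysis"
    "HOL-Library.Poly_Mapping"
    "HOL-Library.Function_Algebras"
begin

section \<open>Root systems\<close>

definition refl_along :: "'v::euclidean_space \<Rightarrow> 'v \<Rightarrow> 'v" where
  "refl_along \<alpha> x = x - (2 * (x \<bullet> \<alpha>) / (\<alpha> \<bullet> \<alpha>)) *\<^sub>R \<alpha>"

text \<open>Root systems are reduced and span the ambient space, so the rank is its dimension.\<close>

definition root_system :: "'v::euclidean_space set \<Rightarrow> bool" where
  "root_system \<Phi> \<longleftrightarrow>
     finite \<Phi> \<and> 0 \<notin> \<Phi> \<and> span \<Phi> = UNIV \<and>
     (\<forall>\<alpha>\<in>\<Phi>. \<Phi> \<inter> span {\<alpha>} = {\<alpha>, - \<alpha>}) \<and>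
     (\<forall>\<alpha>\<in>\<Phi>. refl_along \<alpha> ` \<Phi> = \<Phi>)"

definition crystallographic :: "'v::euclidean_space set \<Rightarrow> bool" where
  "crystallographic \<Phi> \<longleftrightarrow> (\<forall>\<alpha>\<in>\<Phi>. \<forall>\<beta>\<in>\<Phi>. 2 * (\<beta> \<bullet> \<alpha>) / (\<alpha> \<bullet> \<alpha>) \<in> \<int>)"

definition irreducible_roots :: "'v::euclidean_space set \<Rightarrow> bool" where
  "irreducible_roots \<Phi> \<longleftrightarrow>
     \<Phi> \<noteq> {} \<and>
     \<not> (\<exists>\<Phi>1 \<Phi>2. \<Phi>1 \<noteq> {} \<and> \<Phi>2 \<noteq> {} \<and> \<Phi> = \<Phi>1 \<union> \<Phi>2 \<and> \<Phi>1 \<inter> \<Phi>2 = {} \<and>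
          (\<forall>\<alpha>\<in>\<Phi>1. \<forall>\<beta>\<in>\<Phi>2. \<alpha> \<bullet> \<beta> = 0))"

definition positive_system :: "'v::euclidean_space set \<Rightarrow> 'v set \<Rightarrow> bool" where
  "positive_system \<Phi> P \<longleftrightarrow>
     (\<exists>\<gamma>. (\<forall>\<alpha>\<in>\<Phi>. \<alpha> \<bullet> \<gamma> \<noteq> 0) \<and> P = {\<alpha>\<in>\<Phi>. \<alpha> \<bullet> \<gamma> > 0})"


section \<open>Arrangements and their intersection lattices\<close>

definition linear_hyperplane :: "'v::euclidean_space set \<Rightarrow> bool" where
  "linear_hyperplane H \<longleftrightarrow> (\<exists>a. a \<noteq> 0 \<and> H = {x. a \<bullet> x = 0})"

definition arrangement :: "'v::euclidean_space set set \<Rightarrow> bool" where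
  "arrangement \<A> \<longleftrightarrow> finite \<A> \<and> (\<forall>H\<in>\<A>. linear_hyperplane H)"

text \<open>The empty intersection \<open>\<Inter>{} = UNIV\<close> is the ambient space.\<close>

definition intersection_lattice :: "'v set set \<Rightarrow> 'v set set" where
  "intersection_lattice \<A> = {\<Inter>\<B> | \<B>. \<B> \<subseteq> \<A>}"

text \<open>Order isomorphism with respect to reverse inclusion.\<close>

definition lattice_isomorphic :: "'v set set \<Rightarrow> 'w set set \<Rightarrow> bool" where
  "lattice_isomorphic L M \<longleftrightarrow>
     (\<exists>f. bij_betw f L M \<and> (\<forall>X\<in>L. \<forall>Y\<in>L. X \<supseteq> Y \<longleftrightarrow> f X \<supseteq> f Y))"


section \<open>Logarithmic derivations and freeness\<close>

text \<open>The polynomial ring of \<^typ>\<open>real^'n\<close>, with one variable per coordinate: finitely supported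
  maps from exponent vectors to real coefficients.\<close>

type_synonym 'n polyring = "('n \<Rightarrow>\<^sub>0 nat) \<Rightarrow>\<^sub>0 real"

definition Const :: "real \<Rightarrow> 'n polyring" where
  "Const c = Poly_Mapping.single 0 c"

definition Var :: "'n \<Rightarrow> 'n polyring" where
  "Var i = Poly_Mapping.single (Poly_Mapping.single i 1) 1"

definition lin_form :: "real^'n \<Rightarrow> 'n::finite polyring" where
  "lin_form a = (\<Sum>i\<in>UNIV. Const (a $ i) * Var i)"

text \<open>The zero polynomial is homogeneous of every degree.\<close>

definition homogeneous :: "nat \<Rightarrow> 'n::finite polyring \<Rightarrow> bool" where
  "homogeneous d p \<longleftrightarrow>
     (\<forall>m\<in>Poly_Mapping.keys p. (\<Sum>i\<in>UNIV. Poly_Mapping.lookup m i) = d)"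

definition Der :: "('n polyring \<Rightarrow> 'n polyring) set" where
  "Der = {\<theta>. (\<forall>p q. \<theta> (p + q) = \<theta> p + \<theta> q) \<and>
             (\<forall>c p. \<theta> (Const c * p) = Const c * \<theta> p) \<and>
             (\<forall>p q. \<theta> (p * q) = \<theta> p * q + p * \<theta> q)}"

text \<open>A derivation is homogeneous of polynomial degree \<open>d\<close> if its coefficients \<open>\<theta> (Var i)\<close> with
  respect to the partial derivatives are.\<close>

definition homogeneous_der :: "nat \<Rightarrow> ('n::finite polyring \<Rightarrow> 'n polyring) \<Rightarrow> bool" where
  "homogeneous_der d \<theta> \<longleftrightarrow> (\<forall>i. homogeneous d (\<theta> (Var i)))"

text \<open>The defining form of a hyperplane is unique up to a nonzero scalar, which does not affect the
  divisibility, so all of them are admitted.\<close>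

definition log_der :: "(real^'n) set set \<Rightarrow> ('n::finite polyring \<Rightarrow> 'n polyring) set" where
  "log_der \<A> =
     {\<theta>\<in>Der. \<forall>H\<in>\<A>. \<forall>a. H = {x. a \<bullet> x = 0} \<longrightarrow> lin_form a dvd \<theta> (lin_form a)}"

definition der_scale ::
    "'n polyring \<Rightarrow> ('n polyring \<Rightarrow> 'n polyring) \<Rightarrow> ('n polyring \<Rightarrow> 'n polyring)" where
  "der_scale p \<theta> = (\<lambda>f. p * \<theta> f)"

interpretation der: module der_scale
  by unfold_locales (auto simp: der_scale_def fun_eq_iff algebra_simps)

definition free_arrangement :: "(real^'n::finite) set set \<Rightarrow> bool" where
  "free_arrangement \<A> \<longleftrightarrow>
     (\<exists>B. (\<forall>\<theta>\<in>B. \<exists>d. homogeneous_der d \<theta>) \<and> der.independent B \<and> der.span B = log_der \<A>)"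


section \<open>The extended Catalan arrangement\<close>

text \<open>Coordinates of the enlarged space are indexed by \<^typ>\<open>'n option\<close>: \<open>Some i\<close> are the original
  ones and \<open>None\<close> is the additional coordinate \<open>z\<close>.\<close>

definition base_part :: "real^('n option) \<Rightarrow> real^'n::finite" where
  "base_part x = (\<chi> i. x $ Some i)"

definition cat_hyperplane :: "real^'n::finite \<Rightarrow> int \<Rightarrow> (real^('n option)) set" where
  "cat_hyperplane \<alpha> j = {x. \<alpha> \<bullet> base_part x = of_int j * x $ None}"

definition Cat :: "(real^'n::finite) set \<Rightarrow> nat \<Rightarrow> (real^('n option)) set set" where
  "Cat P k =
     {cat_hyperplane \<alpha> j | \<alpha> j. \<alpha> \<in> P \<and> - int k \<le> j \<and> j \<le> int k} \<union> {{x. x $ None = 0}}"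

end

theory Submission
 imports Defs
begin

text \<open>
 The hyperplanes of the Catalan arrangement are added one at a time, ordered by the values of the
 affine roots at a generic point close to the origin. Adding a hyperplane to a free arrangement
 preserves freeness as soon as some tangent field of the smallest possible degree is transversal
 to it. Such a field exists away from the origin by induction, since the localizations come from
 smaller root systems; if it did not exist globally, an ideal primary to the origin would be
 generated by too few polynomials of positive degree. The exponents to be compared are counted by
 the heights of affine roots, and the bound needed there is the duality of the exponents of a root
 system, read off from the eigenvalues of a Coxeter element.

 In rank at least two a lattice isomorphism determines the arrangement up to a linear map: the
 relations \<open>\<alpha> + \<beta> = \<gamma>\<close> between roots fix every normal, up to scalars, in terms of the simple ones
 and the hyperplane at infinity. In rank one every arrangement in the plane is free.
\<close>

text \<open>The smallest possible degree \<open>dd N a\<close> is the number of hyperplanes minus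
  the number of their traces on \<open>hyp a\<close>: on \<open>hyp a\<close> the function
  \<open>a \<cdot> F\<close> of every tangent field \<open>F\<close> is divisible by a product of
  that many forms. So only a basis field of exactly this degree can be transversal, and adding
  \<open>hyp a\<close> raises that one exponent by one. Exponents above \<open>dd N a\<close> are
  thus counted by the earlier hyperplanes with the same \<open>dd\<close>, and these must be few
  compared with the rank.

  The order by values at \<open>p\<close> is stable under localization: the affine roots vanishing
  at \<open>q\<close> form a finite system in which the segment is again initial, for the direction
  \<open>p - q\<close>. In the finite case \<open>dd\<close> is the height minus one. In the affine
  case it grows with the level, with slope the Coxeter number \<open>h\<close>, so that affine roots
  of equal \<open>dd\<close> come from two heights with sum \<open>h + 1\<close>; this is where the
  duality of exponents enters. Every affine segment contains the hyperplane at infinity, and fields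
  have no \<open>z\<close> component, so the Euler field can be split off until the end.\<close>

notation inner (infixl "\<cdot>" 70)

section \<open>Homogeneous polynomial functions\<close>

text \<open>Homogeneous polynomial functions are generated without coordinates, so that composition
  with linear maps, restriction to lines and division by linear forms can all be proved by this
  induction. The zero function has every degree.\<close>

inductive hp :: "nat => ('a::euclidean_space => real) => bool" where
 hp_const: "hp 0 (%_. c)"
| hp_add: "hp d f ==> hp d g ==> hp d (%x. f x + g x)"
| hp_lin: "hp d f ==> hp (Suc d) (%x. (a\<cdot>x) * f x)"

text \<open>The condition on the coefficient of a field of degree \<open>e\<close> in an expansion
  of degree \<open>d\<close>. Natural subtraction would turn a negative degree into 0, so that case
  demands the zero function explicitly.\<close>

abbreviation hq :: "nat => nat => ('a::euclidean_space => real) => bool" where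
 "hq d e f \<equiv> if e\<le>d then hp (d - e) f else f=(%_. 0)"

lemma hp_zero: "hp d (%_. 0)"
proof (induction d)
 case 0
 show ?case by (rule hp_const)
next
 case (Suc d)
 from hp_lin[OF this, of 0] show ?case by simp
qed

lemma hp_cmult: "hp d f ==> hp d (%x. c * f x)"
proof (induction rule: hp.induct)
 case (hp_const c')
 show ?case by (rule hp.hp_const)
next
 case (hp_add d f g)
 thus ?case using hp.hp_add[OF hp_add(3,4)] by (simp add: algebra_simps)
next
 case (hp_lin d f a)
 thus ?case using hp.hp_lin[OF hp_lin(2), of a] by (simp add: algebra_simps)
qed

lemma hp_minus: "hp d f ==> hp d (%x. - f x)" using hp_cmult[of d f "-1"] by simp

lemma hp_diff: "hp d f ==> hp d g ==> hp d (%x. f x - g x)" using hp_add[OF _ hp_minus, of d f g] by simp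

lemma hp_mult: "hp d f ==> hp e g ==> hp (d + e) (%x. f x * g x)"
proof (induction rule: hp.induct)
 case (hp_const c)
 thus ?case by (simp add: hp_cmult)
next
 case (hp_add d f h)
 thus ?case using hp.hp_add[OF hp_add(3,4)[OF hp_add(5)]] by (simp add: algebra_simps)
next
 case (hp_lin d f a)
 thus ?case using hp.hp_lin[OF hp_lin(2)[OF hp_lin(3)], of a] by (simp add: algebra_simps)
qed

lemma hp_linear: "hp (Suc 0) (%x. a\<cdot>x)" using hp_lin[OF hp_const[of 1], of a] by simp

lemma hp_power: "hp d f ==> hp (d * n) (%x. f x ^ n)"
proof (induction n)
 case 0
 thus ?case using hp_const[of 1] by simp
next
 case (Suc n)
 thus ?case using hp_mult[OF Suc(2) Suc(1)[OF Suc(2)]] by simp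
qed

lemma hp_sum: "(\<And>i. i\<in>I ==> hp d (f i)) ==> hp d (%x. \<Sum>i\<in>I. f i x)"
proof (induction I rule: infinite_finite_induct)
 case (insert i I)
 thus ?case by (simp add: hp_add)
qed (auto intro: hp_zero)

lemma hp_prod: "finite I ==> (\<And>i. i\<in>I ==> hp (d i) (f i)) ==> hp (\<Sum>i\<in>I. d i) (%x. \<Prod>i\<in>I. f i x)"
proof (induction I rule: finite_induct)
 case (insert i I)
 thus ?case by (simp add: hp_mult)
qed (auto intro: hp_const)

lemma hp_prod_lin: "hp (card N) (%x. \<Prod>v\<in>N. v\<cdot>x)"
proof (cases "finite N")
 case True
 thus ?thesis using hp_prod[OF True hp_linear] by simp
next
 case False
 thus ?thesis using hp_const[of 1] by simp
qed

lemma hp_compose: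
 fixes T :: "'b::euclidean_space => 'a::euclidean_space"
 assumes "linear T"
 shows "hp d f ==> hp d (%x. f (T x))"
proof (induction rule: hp.induct)
 case (hp_lin d f a)
 have "a\<cdot>T x=adjoint T a\<cdot>x" for x using adjoint_works[OF assms, of x a] by (simp add: inner_commute)
 with hp.hp_lin[OF hp_lin(2), of "adjoint T a"] show ?case by simp
qed (auto intro: hp.intros)

lemma hp_scale: "hp d f ==> f (t*\<^sub>Rx)=t ^ d * f x" by (induction rule: hp.induct) (auto simp: algebra_simps)

lemma hp_line: "hp d f ==> \<exists>p. \<forall>t. f (x + t*\<^sub>Ry)=poly p t"
proof (induction rule: hp.induct)
 case (hp_const c)
 show ?case by (rule exI[of _ "[:c:]"]) simp
next
 case (hp_add d f g)
 then obtain p q where "\<forall>t. f (x + t*\<^sub>Ry)=poly p t" "\<forall>t. g (x + t*\<^sub>Ry)=poly q t" by blast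
 thus ?case by (intro exI[of _ "p + q"]) simp
next
 case (hp_lin d f a)
 then obtain p where "\<forall>t. f (x + t*\<^sub>Ry)=poly p t" by blast
 thus ?case by (intro exI[of _ "[:a\<cdot>x, a\<cdot>y:] * p"]) (simp add: inner_add_right algebra_simps)
qed

lemma hp_cont: "hp d f ==> continuous_on S f" by (induction rule: hp.induct) (auto intro!: continuous_intros)

definition hyp :: "'a::euclidean_space => 'a set" where
 "hyp a={x. a\<cdot>x=0}"

text \<open>For \<open>a = 0\<close> division by zero gives 0, so \<open>proj 0\<close> is the
  identity while \<open>hyp 0\<close> is the whole space. Statements about \<open>hyp a\<close> are
  later used with \<open>a = 0\<close> to speak about all of space.\<close>

definition proj :: "'a::euclidean_space => 'a => 'a" where
 "proj a x=x - ((a\<cdot>x) / (a\<cdot>a))*\<^sub>Ra"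

lemma linear_proj: "linear (proj a)" unfolding proj_def
 by (rule linearI) (auto simp: algebra_simps inner_add_right add_divide_distrib)

lemma proj_in: "proj a x\<in>hyp a" by (simp add: proj_def hyp_def inner_diff_right)

lemma hyp_0: "hyp 0=UNIV" by (simp add: hyp_def)

lemma subspace_hyp: "subspace (hyp a)" by (auto simp: hyp_def subspace_def inner_add_right)

text \<open>Division with remainder by the form \<open>a\<close>; the remainder is the function made
  constant along \<open>a\<close>. In degree 0 the quotient must vanish, which
  \<open>hp (d - 1)\<close> alone would not say.\<close>

lemma hp_taylor:
 "hp d f ==> \<exists>g. (if d=0 then g=(%_. 0) else hp (d - 1) g) \<and> (\<forall>x. f x=f (proj a x) + (a\<cdot>x) * g x)"
proof (induction rule: hp.induct)
 case (hp_const c)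
 thus ?case by auto
next
 case (hp_add d f g)
 from hp_add(3) obtain f' where f': "if d=0 then f'=(%_. 0) else hp (d - 1) f'"
  "\<forall>x. f x=f (proj a x) + (a\<cdot>x) * f' x" by blast
 from hp_add(4) obtain g' where g': "if d=0 then g'=(%_. 0) else hp (d - 1) g'"
  "\<forall>x. g x=g (proj a x) + (a\<cdot>x) * g' x" by blast
 have "f x + g x=f (proj a x) + g (proj a x) + (a\<cdot>x) * (f' x + g' x)" for x
  using f'(2)[rule_format, of x] g'(2)[rule_format, of x] by (simp add: distrib_left)
 moreover have "if d=0 then (%x. f' x + g' x)=(%_. 0) else hp (d - 1) (%x. f' x + g' x)"
  using f'(1) g'(1) hp.hp_add[of "d - 1" f' g'] by (cases "d=0") simp_all
 ultimately show ?case by blast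
next
 case (hp_lin d f b)
 then obtain g where g: "if d=0 then g=(%_. 0) else hp (d - 1) g"
  "\<forall>x. f x=f (proj a x) + (a\<cdot>x) * g x" by blast
 let ?k = "(b\<cdot>a) / (a\<cdot>a)"
 let ?g = "%x. ?k * f (proj a x) + (b\<cdot>x) * g x"
 have "hp d (%x. (b\<cdot>x) * g x)"
 proof (cases d)
  case 0
  thus ?thesis using g by (auto intro: hp_zero)
 next
  case (Suc n)
  thus ?thesis using g hp.hp_lin[of n g b] by auto
 qed
 hence "hp d ?g" by (intro hp_add hp_cmult hp_compose[OF linear_proj] hp_lin(1))
 hence "if Suc d=0 then ?g=(%_. 0) else hp (Suc d - 1) ?g" by simp
 moreover have "(b\<cdot>x) * f x=(b\<cdot>proj a x) * f (proj a x) + (a\<cdot>x) * ?g x" for x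
 proof -
  have "b\<cdot>x=b\<cdot>proj a x + (a\<cdot>x) * ?k" by (simp add: proj_def inner_diff_right)
  hence "(b\<cdot>x) * f x=(b\<cdot>x) * f (proj a x) + (b\<cdot>x) * ((a\<cdot>x) * g x)"
   using g(2)[rule_format, of x] by (metis distrib_left)
  also have "(b\<cdot>x) * f (proj a x)=(b\<cdot>proj a x) * f (proj a x) + (a\<cdot>x) * ?k * f (proj a x)"
   by (simp add: proj_def inner_diff_right algebra_simps)
  finally show ?thesis by (simp add: algebra_simps)
 qed
 ultimately show ?case by blast
qed

text \<open>Restrict to the line joining two points of non-vanishing.\<close>

lemma hp_domain:
 assumes "hp d f" "hp e g" "subspace S" "\<And>x. x\<in>S ==> f x * g x=0"
 shows "(\<forall>x\<in>S. f x=0) \<or> (\<forall>x\<in>S. g x=0)"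
proof (rule ccontr)
 assume "\<not> ?thesis"
 then obtain x y where xy: "x\<in>S" "f x~=0" "y\<in>S" "g y~=0" by blast
 obtain p where p: "\<And>t. f (x + t*\<^sub>R(y - x))=poly p t" using hp_line[OF assms(1)] by metis
 obtain q where q: "\<And>t. g (x + t*\<^sub>R(y - x))=poly q t" using hp_line[OF assms(2)] by metis
 have "x + t*\<^sub>R(y - x)\<in>S" for t using assms(3) xy by (simp add: subspace_add subspace_diff subspace_scale)
 hence "poly (p * q) t=0" for t using assms(4)[of "x + t*\<^sub>R(y - x)"] p q by simp
 hence "p * q=0" using poly_all_0_iff_0 by blast
 moreover have "poly p 0~=0" using p[of 0] xy by simp
 moreover have "poly q 1~=0" using q[of 1] xy by simp
 ultimately show False by auto
qed

lemma hp_prod_nonzero: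
 assumes "finite I" "subspace S" "\<And>i. i\<in>I ==> hp (d i) (f i)" "\<And>i. i\<in>I ==> \<exists>x\<in>S. f i x~=0"
 shows "\<exists>x\<in>S. (\<Prod>i\<in>I. f i x)~=0" using assms(1,3,4)
proof (induction I rule: finite_induct)
 case empty
 thus ?case using subspace_0[OF assms(2)] by auto
next
 case (insert i I)
 have *: "hp (\<Sum>i\<in>I. d i) (%x. \<Prod>i\<in>I. f i x)" using insert by (intro hp_prod) auto
 have "\<not> (\<forall>x\<in>S. f i x=0)" using insert by auto
 moreover have "\<not> (\<forall>x\<in>S. (\<Prod>i\<in>I. f i x)=0)" using insert by auto
 ultimately show ?case
  using hp_domain[OF insert(4)[OF insertI1] * assms(2)] prod.insert[OF insert(1,2)] by metis
qed

lemma hp_div: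
 assumes "hp d f" "\<And>x. x\<in>hyp a ==> y\<cdot>x=0 ==> f x=0" "\<exists>x\<in>hyp a. y\<cdot>x~=0"
 shows "\<exists>g. hp (d - 1) g \<and> (\<forall>x\<in>hyp a. f x=(y\<cdot>x) * g x)"
proof -
 \<comment> \<open>Only the component of \<open>y\<close> inside \<open>hyp a\<close> matters there,
   and projecting along that component does not leave \<open>hyp a\<close>.\<close>
 let ?y = "proj a y"
 have yx: "?y\<cdot>x=y\<cdot>x" if "x\<in>hyp a" for x using that by (simp add: proj_def hyp_def inner_diff_left)
 obtain g where g: "if d=0 then g=(%_. 0) else hp (d - 1) g"
  "\<And>x. f x=f (proj ?y x) + (?y\<cdot>x) * g x" using hp_taylor[OF assms(1), of ?y] by blast
 have "f (proj ?y x)=0" if "x\<in>hyp a" for x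
 proof (rule assms(2))
  show *: "proj ?y x\<in>hyp a" unfolding proj_def[of ?y]
   by (intro subspace_diff subspace_scale subspace_hyp that proj_in)
  show "y\<cdot>proj ?y x=0" using yx[OF *] proj_in[of ?y x] by (simp add: hyp_def)
 qed
 hence "\<forall>x\<in>hyp a. f x=(y\<cdot>x) * g x" using g(2) yx by (metis add_0)
 moreover have "hp (d - 1) g" using g(1) by (auto intro: hp_zero split: if_splits)
 ultimately show ?thesis by blast
qed

lemma hp_cancel:
 assumes "hp d f" "hp e g" "hp k h" "subspace S" "\<exists>x\<in>S. h x~=0"
  "\<And>x. x\<in>S ==> h x * f x=h x * g x" "x\<in>S"
 shows "f x=g x"
proof -
 have "\<exists>x\<in>S. h x~=0 \<and> f x~=g x" if neq: "f x~=g x"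
 proof (rule ccontr)
  assume H: "\<not> ?thesis"
  obtain y where y: "y\<in>S" "h y~=0" using assms(5) by blast
  obtain p where p: "\<And>t. f (x + t*\<^sub>R(y - x))=poly p t" using hp_line[OF assms(1)] by metis
  obtain q where q: "\<And>t. g (x + t*\<^sub>R(y - x))=poly q t" using hp_line[OF assms(2)] by metis
  obtain r where r: "\<And>t. h (x + t*\<^sub>R(y - x))=poly r t" using hp_line[OF assms(3)] by metis
  have "x + t*\<^sub>R(y - x)\<in>S" for t
   using assms(4) y assms(7) by (simp add: subspace_add subspace_diff subspace_scale)
  hence "poly (r * (p - q)) t=0" for t
   using H p q r by (metis mult_eq_0_iff poly_diff poly_mult right_minus_eq)
  hence "r * (p - q)=0" using poly_all_0_iff_0 by blast
  moreover have "r~=0" using r[of 1] y by auto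
  ultimately have "p=q" by simp
  thus False using p[of 0] q[of 0] neq by simp
 qed
 thus ?thesis using assms(6) by (metis mult_left_cancel)
qed

text \<open>Passing from a point to its double multiplies the two equal values by different powers
  of 2.\<close>

lemma hp_unique_deg:
 assumes "hp d f" "hp e g" "d~=e" "subspace S" "\<And>x. x\<in>S ==> f x=g x" "x\<in>S"
 shows "f x=0"
proof -
 have "f (2*\<^sub>Rx)=g (2*\<^sub>Rx)" "f x=g x" using assms(5,6) subspace_scale[OF assms(4)] by blast+
 hence "2 ^ d * f x=2 ^ e * f x" using hp_scale[OF assms(1), of 2 x] hp_scale[OF assms(2), of 2 x] by metis
 moreover have "(2::real) ^ d~=2 ^ e" using assms(3) by simp
 ultimately show ?thesis by (metis mult_right_cancel)
qed

section \<open>Polynomial fields tangent to hyperplanes\<close>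

definition hf :: "nat => ('a::euclidean_space => 'a) => bool" where
 "hf d F \<longleftrightarrow> (\<forall>v. hp d (%x. v\<cdot>F x))"

definition tang :: "'a::euclidean_space set => ('a => 'a) => bool" where
 "tang N F \<longleftrightarrow> (\<forall>v\<in>N. \<forall>x\<in>hyp v. v\<cdot>F x=0)"

definition npar :: "'a::euclidean_space set => bool" where
 "npar N \<longleftrightarrow> finite N \<and> 0\<notin>N \<and> (\<forall>u\<in>N. \<forall>v\<in>N. u~=v --> u\<notin>span {v})"

text \<open>When no \<open>v\<close> is parallel to \<open>a\<close>, the planes
  \<open>span {a, v}\<close> correspond to the traces of the hyperplanes on \<open>hyp a\<close>. So
  this is the size of the arrangement minus the size of its restriction, which
  \<open>tang_div\<close> shows to be the degree of a common divisor of all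
  \<open>a \<cdot> F\<close> on \<open>hyp a\<close>.\<close>

definition dd :: "'a::euclidean_space set => 'a => nat" where
 "dd N a=card N - card ((%v. span {a, v}) ` N)"

text \<open>One normal for each trace on \<open>hyp a\<close>; the product over the remaining
  normals \<open>N - R\<close> is the common divisor just mentioned.\<close>

definition trv :: "'a::euclidean_space => 'a set => 'a set => bool" where
 "trv a N R \<longleftrightarrow> R\<subseteq>N \<and> inj_on (%v. span {a, v}) R \<and> (%v. span {a, v}) ` R=(%v. span {a, v}) ` N"

definition step_ok :: "'a::euclidean_space set => 'a set => 'a => bool" where
 "step_ok E N a \<longleftrightarrow> (\<exists>t. hf (dd N a) t \<and> range t\<subseteq>E \<and> tang N t \<and> (\<exists>w\<in>hyp a. a\<cdot>t w~=0))"

text \<open>A homogeneous basis, with degrees \<open>e\<close>, of the module of fields tangent to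
  \<open>N\<close> with values in \<open>E\<close>. Independence is stated for continuous
  coefficients: this covers inhomogeneous polynomials and survives division by a linear form, by
  \<open>hyp_dense\<close>.\<close>

definition fbas :: "'a::euclidean_space set => 'a set => nat => (nat => nat) => (nat => 'a => 'a) => bool" where
 "fbas E N r e F \<longleftrightarrow>
  (\<forall>i<r. hf (e i) (F i) \<and> range (F i)\<subseteq>E \<and> tang N (F i)) \<and>
  (\<forall>d G. hf d G --> range G\<subseteq>E --> tang N G -->
    (\<exists>f. (\<forall>i<r. hq d (e i) (f i)) \<and>
      (\<forall>x. G x=(\<Sum>i<r. f i x*\<^sub>RF i x)))) \<and>
  (\<forall>f. (\<forall>i<r. continuous_on UNIV (f i)) --> (\<forall>x. (\<Sum>i<r. f i x*\<^sub>RF i x)=0) -->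
    (\<forall>i<r. \<forall>x. f i x=0))"

lemma hp_0D: "hp 0 f ==> \<exists>c. f=(%_. c)"
proof -
 have "hp d f ==> d=0 ==> \<exists>c. f=(%_. c)" for d f by (induction rule: hp.induct) auto
 thus "hp 0 f ==> \<exists>c. f=(%_. c)" by blast
qed

lemma ortho_witness:
 fixes S :: "'a::euclidean_space set"
 assumes "u\<notin>span S"
 shows "\<exists>x. (\<forall>y\<in>S. y\<cdot>x=0) \<and> u\<cdot>x~=0"
proof -
 obtain y z where yz: "y\<in>span S" "\<And>w. w\<in>span S ==> orthogonal z w" "u=y + z"
  using orthogonal_subspace_decomp_exists[of S u] by blast
 have "z~=0" using yz assms by auto
 moreover have "y\<cdot>z=0" using yz(1,2) by (metis orthogonal_def inner_commute)
 ultimately have "u\<cdot>z~=0" using yz(3) by (simp add: inner_add_left)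
 moreover have "\<forall>y\<in>S. y\<cdot>z=0" using yz(2) span_base by (metis orthogonal_def inner_commute)
 ultimately show ?thesis by blast
qed

lemma hp_prod_lin_nonzero:
 fixes S :: "'a::euclidean_space set"
 assumes "finite K" "subspace S" "\<And>v. v\<in>K ==> \<exists>x\<in>S. v\<cdot>x~=0"
 shows "\<exists>x\<in>S. (\<Prod>v\<in>K. v\<cdot>x)~=0"
 by (rule hp_prod_nonzero[of K S "%_. Suc 0", OF assms(1,2) hp_linear assms(3)])

lemma in_span1: "x\<in>span {b} \<longleftrightarrow> (\<exists>t. x=t*\<^sub>R(b::'a::real_vector))" unfolding span_singleton by blast

lemma in_span2: "x\<in>span {a, b} \<longleftrightarrow> (\<exists>s t. x=s*\<^sub>Ra + t*\<^sub>R(b::'a::real_vector))"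
 unfolding span_insert[of a] mem_Collect_eq in_span1 by (simp only: diff_eq_eq add.commute)

lemma span2_eqI:
 assumes "u\<in>span {a, v}" "u\<notin>span {a::'a::real_vector}"
 shows "span {a, u}=span {a, v}" "\<exists>s t. t~=0 \<and> u=s*\<^sub>Ra + t*\<^sub>Rv"
proof -
 obtain s t where st: "u=s*\<^sub>Ra + t*\<^sub>Rv" using assms(1) in_span2[of u a v] by metis
 have t: "t~=0" using st assms(2) in_span1[of u a] by auto
 thus "\<exists>s t. t~=0 \<and> u=s*\<^sub>Ra + t*\<^sub>Rv" using st by blast
 have "v=(- s / t)*\<^sub>Ra + (1 / t)*\<^sub>Ru" using st t by (simp add: algebra_simps)
 hence "v\<in>span {a, u}" using in_span2[of v a u] by metis
 thus "span {a, u}=span {a, v}" using assms(1) by (intro span_eq[THEN iffD2]) (auto intro: span_base)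
qed

lemma npar_subset: "npar N ==> M\<subseteq>N ==> npar M" unfolding npar_def using finite_subset[of M N] by blast

lemma npar_notin: "npar (insert a N) ==> a\<notin>N ==> v\<in>N ==> v\<notin>span {a}" unfolding npar_def by (metis insertCI)

lemma tang_subset: "tang N F ==> M\<subseteq>N ==> tang M F" unfolding tang_def by blast

lemma trv_exists: "\<exists>R. trv a N R"
proof -
 obtain U where "U\<subseteq>N" "inj_on (%v. span {a, v}) U" "(%v. span {a, v}) ` N=(%v. span {a, v}) ` U"
  using subset_image_inj[THEN iffD1, OF order_refl] by metis
 hence "trv a N U" unfolding trv_def by simp
 thus ?thesis ..
qed

lemma trv_card:
 assumes "trv a N R" "finite N"
 shows "card (N - R)=dd N a"
proof -
 have "card R=card ((%v. span {a, v}) ` N)" using assms unfolding trv_def by (metis card_image)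
 thus ?thesis unfolding dd_def using assms by (metis card_Diff_subset finite_subset trv_def)
qed

section \<open>Divisibility by products of linear forms on a hyperplane\<close>

lemma lin_div:
 assumes "npar K" "hp e f" "\<And>v x. v\<in>K ==> v\<cdot>x=0 ==> f x=0"
 shows "\<exists>k. hp (e - card K) k \<and> (\<forall>x. f x=(\<Prod>v\<in>K. v\<cdot>x) * k x)"
proof -
 have "finite K" using assms(1) by (simp add: npar_def)
 thus ?thesis using assms
 proof (induction K rule: finite_induct)
  case empty
  thus ?case by auto
 next
  case (insert u K)
  obtain k where k: "hp (e - card K) k" "\<And>x. f x=(\<Prod>v\<in>K. v\<cdot>x) * k x"
   using insert.IH[OF npar_subset[OF insert(4)] insert(5)] insert(6) by blast
  have "\<exists>x\<in>hyp u. v\<cdot>x~=0" if "v\<in>K" for v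
  proof -
   have "v\<notin>span {u}" using insert(2,4) that unfolding npar_def by auto
   from ortho_witness[OF this] show ?thesis by (auto simp: hyp_def)
  qed
  hence "\<exists>x\<in>hyp u. (\<Prod>v\<in>K. v\<cdot>x)~=0" by (rule hp_prod_lin_nonzero[OF insert(1) subspace_hyp])
  moreover have "(\<Prod>v\<in>K. v\<cdot>x) * k x=0" if "x\<in>hyp u" for x
   using insert(6)[of u x] that k(2) by (simp add: hyp_def)
  ultimately have "\<forall>x\<in>hyp u. k x=0" using hp_domain[OF hp_prod_lin k(1) subspace_hyp] by blast
  moreover have "\<exists>x\<in>hyp 0. u\<cdot>x~=0"
   using insert(4) unfolding npar_def hyp_0 by (metis UNIV_I insertI1 inner_eq_zero_iff)
  ultimately obtain g where "hp (e - card K - 1) g" "\<forall>x\<in>hyp 0. k x=(u\<cdot>x) * g x"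
   using hp_div[OF k(1), of 0 u] by (auto simp: hyp_def)
  thus ?case using insert(1,2) k(2) by (intro exI[of _ g]) (auto simp: hyp_0 mult_ac)
 qed
qed

text \<open>A form \<open>v\<close> is prime on \<open>hyp a\<close>, and \<open>C\<close> does not
  vanish on all of its zero set there, so \<open>v\<close> divides \<open>g\<close>. The forms of
  \<open>M\<close> are peeled off one by one.\<close>

lemma coprime_div:
 assumes "finite M" "hp c C" "hp k h"
  "\<And>v. v\<in>M ==> \<exists>x\<in>hyp a. v\<cdot>x~=0"
  "\<And>v. v\<in>M ==> \<exists>x\<in>hyp a. v\<cdot>x=0 \<and> C x~=0"
  "hp e g" "\<And>x. x\<in>hyp a ==> C x * g x=(\<Prod>v\<in>M. v\<cdot>x) * h x"
 shows "\<exists>g'. hp (e - card M) g' \<and> (\<forall>x\<in>hyp a. g x=(\<Prod>v\<in>M. v\<cdot>x) * g' x)" using assms(1,4-7)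
proof (induction M arbitrary: g e rule: finite_induct)
 case empty
 thus ?case by auto
next
 case (insert v M)
 let ?S = "hyp a\<inter>hyp v"
 have "\<forall>x\<in>?S. C x * g x=0" using insert(1,2,7) by (auto simp: hyp_def)
 hence "\<forall>x\<in>?S. g x=0"
  using hp_domain[OF assms(2) insert(6) subspace_inter[OF subspace_hyp subspace_hyp], of a v] insert(5)[of v]
  by (auto simp: hyp_def)
 then obtain g1 where g1: "hp (e - 1) g1" "\<And>x. x\<in>hyp a ==> g x=(v\<cdot>x) * g1 x"
  using hp_div[OF insert(6), of a v] insert(4)[of v] by (auto simp: hyp_def)
 have "C x * g1 x=(\<Prod>v\<in>M. v\<cdot>x) * h x" if "x\<in>hyp a" for x
 proof (rule hp_cancel[OF hp_mult[OF assms(2) g1(1)] hp_mult[OF hp_prod_lin assms(3)] hp_linear subspace_hyp _ _ that])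
  show "\<exists>x\<in>hyp a. v\<cdot>x~=0" using insert(4) by simp
  show "(v\<cdot>y) * (C y * g1 y)=(v\<cdot>y) * ((\<Prod>v\<in>M. v\<cdot>y) * h y)" if "y\<in>hyp a" for y
   using insert(7)[OF that] insert(1,2) g1(2)[OF that] by (simp add: mult_ac)
 qed
 then obtain g' where "hp (e - 1 - card M) g'" "\<forall>x\<in>hyp a. g1 x=(\<Prod>v\<in>M. v\<cdot>x) * g' x"
  using insert.IH[OF insert(4,5) g1(1)] by blast
 thus ?case using insert(1,2) g1(2) by (intro exI[of _ g']) (auto simp: mult_ac)
qed

text \<open>With \<open>r\<close> a representative of the class \<open>K\<close> of \<open>v\<close> with the same trace on \<open>hyp a\<close>, the function
 \<open>(a \<cdot> x) (r \<cdot> F x) - (r \<cdot> x) (a \<cdot> F x)\<close> is divisible by every form in \<open>K\<close>.\<close>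

lemma tang_div_class:
 assumes "npar (insert a N)" "a\<notin>N" "hf e F" "tang N F" "r\<in>N" "K={v\<in>N. span {a, v}=span {a, r}}"
 shows "\<exists>k. hp (e + 1 - card K) k \<and> (\<forall>x\<in>hyp a. a\<cdot>F x=(\<Prod>v\<in>K - {r}. v\<cdot>x) * k x)"
proof -
 have npK: "npar K" using assms(1,6) by (auto intro: npar_subset)
 have finK: "finite K" using npK by (simp add: npar_def)
 have ra: "r\<notin>span {a}" using npar_notin[OF assms(1,2,5)] .
 let ?R = "%x. (a\<cdot>x) * (r\<cdot>F x) - (r\<cdot>x) * (a\<cdot>F x)"
 have hpR: "hp (1 + e) ?R" using assms(3) unfolding hf_def by (metis hp_diff hp_mult hp_linear One_nat_def)
 have "?R x=0" if v: "v\<in>K" "v\<cdot>x=0" for v x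
 proof -
  have "v\<in>span {a, r}" using v(1) assms(6) span_base[of v "{a, v}"] by auto
  moreover have "v\<notin>span {a}" using v(1) assms(1,2,6) npar_notin by blast
  ultimately obtain s t where st: "t~=0" "v=s*\<^sub>Ra + t*\<^sub>Rr" using span2_eqI(2) by blast
  have "v\<cdot>F x=0" using assms(4,6) v by (auto simp: tang_def hyp_def)
  hence 1: "s * (a\<cdot>F x) + t * (r\<cdot>F x)=0" using st by (simp add: inner_add_left)
  have 2: "s * (a\<cdot>x) + t * (r\<cdot>x)=0" using st v(2) by (simp add: inner_add_left)
  have "t * ?R x=(a\<cdot>x) * (t * (r\<cdot>F x)) - (t * (r\<cdot>x)) * (a\<cdot>F x)" by (simp add: algebra_simps)
  also have "\<dots>=(a\<cdot>x) * (- s * (a\<cdot>F x)) - (- s * (a\<cdot>x)) * (a\<cdot>F x)"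
  proof -
   have "t * (r\<cdot>F x)=- s * (a\<cdot>F x)" "t * (r\<cdot>x)=- s * (a\<cdot>x)" using 1 2 by linarith+
   thus ?thesis by simp
  qed
  finally show ?thesis using st(1) by simp
 qed
 then obtain k where k: "hp (1 + e - card K) k" "\<And>x. ?R x=(\<Prod>v\<in>K. v\<cdot>x) * k x"
  using lin_div[OF npK hpR] by blast
 have rK: "r\<in>K" using assms(5,6) by simp
 have "a\<cdot>F x=(\<Prod>v\<in>K - {r}. v\<cdot>x) * - k x" if "x\<in>hyp a" for x
 proof (rule hp_cancel[OF _ hp_mult[OF hp_prod_lin hp_minus[OF k(1)]] hp_linear subspace_hyp _ _ that])
  show "hp e (%x. a\<cdot>F x)" using assms(3) by (simp add: hf_def)
  show "\<exists>x\<in>hyp a. r\<cdot>x~=0" using ortho_witness[OF ra] by (auto simp: hyp_def)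
  show "(r\<cdot>y) * (a\<cdot>F y)=(r\<cdot>y) * ((\<Prod>v\<in>K - {r}. v\<cdot>y) * - k y)" if "y\<in>hyp a" for y
  proof -
   have "- ((r\<cdot>y) * (a\<cdot>F y))=(\<Prod>v\<in>K. v\<cdot>y) * k y" using k(2)[of y] that by (simp add: hyp_def)
   also have "(\<Prod>v\<in>K. v\<cdot>y)=(r\<cdot>y) * (\<Prod>v\<in>K - {r}. v\<cdot>y)" using prod.remove[OF finK rK] by blast
   finally show ?thesis by simp
  qed
 qed
 thus ?thesis using hp_minus[OF k(1)] by (intro exI[of _ "%x. - k x"]) auto
qed

text \<open>The divisors coming from different classes have no common factor on
  \<open>hyp a\<close>, so they multiply up. A class contributes all its forms except the
  representative, which gives the product over \<open>N - R\<close>, of degree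
  \<open>dd N a\<close>.\<close>

lemma tang_div:
 assumes "npar (insert a N)" "a\<notin>N" "trv a N R" "hf e F" "tang N F"
 shows "\<exists>g. hp (e - card (N - R)) g \<and> (\<forall>x\<in>hyp a. a\<cdot>F x=(\<Prod>v\<in>N - R. v\<cdot>x) * g x)"
proof -
 have finN: "finite N" using assms(1) by (simp add: npar_def)
 have RN: "R\<subseteq>N" using assms(3) by (simp add: trv_def)
 define M where "M R'={v\<in>N - R. \<exists>r\<in>R'. span {a, v}=span {a, r}}" for R'
 have finM: "finite (M R')" for R' using finN by (simp add: M_def)
 have "finite R" using RN finN finite_subset by blast
 have "\<exists>g. hp (e - card (M R')) g \<and> (\<forall>x\<in>hyp a. a\<cdot>F x=(\<Prod>v\<in>M R'. v\<cdot>x) * g x)"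
  if "finite R'" "R'\<subseteq>R" for R' using that
 proof (induction R' rule: finite_induct)
  case empty
  have "hp e (%x. a\<cdot>F x)" using assms(4) by (simp add: hf_def)
  thus ?case by (auto simp: M_def)
 next
  case (insert r R')
  obtain g where g: "hp (e - card (M R')) g" "\<And>x. x\<in>hyp a ==> a\<cdot>F x=(\<Prod>v\<in>M R'. v\<cdot>x) * g x"
   using insert by blast
  let ?K = "{v\<in>N. span {a, v}=span {a, r}}"
  have rR: "r\<in>R" "r\<in>N" using insert(4) RN by auto
  obtain k where k: "hp (e + 1 - card ?K) k" "\<And>x. x\<in>hyp a ==> a\<cdot>F x=(\<Prod>v\<in>?K - {r}. v\<cdot>x) * k x"
   using tang_div_class[OF assms(1,2,4,5) rR(2) refl] by blast
  have inj: "s=\<tau>" if "s\<in>R" "\<tau>\<in>R" "span {a, s}=span {a, \<tau>}" for s \<tau>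
   using assms(3) that unfolding trv_def inj_on_def by blast
  have Kr: "?K - {r}=M {r}" using inj[OF _ rR(1)] rR unfolding M_def by blast
  have disj: "M R'\<inter>M {r}={}"
  proof -
   have "span {a, r'}~=span {a, r}" if "r'\<in>R'" for r' using inj[of r' r] that insert(2,4) rR by blast
   thus ?thesis by (auto simp: M_def)
  qed
  have Mi: "M (insert r R')=M R'\<union>M {r}" by (auto simp: M_def)
  have "\<exists>g'. hp (e - card (M R') - card (M {r})) g' \<and> (\<forall>x\<in>hyp a. g x=(\<Prod>v\<in>M {r}. v\<cdot>x) * g' x)"
  proof (rule coprime_div[OF finM hp_prod_lin k(1) _ _ g(1)])
   fix v assume v: "v\<in>M {r}"
   hence vN: "v\<in>N" by (simp add: M_def)
   hence "v\<notin>span {a}" using npar_notin assms(1,2) by blast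
   from ortho_witness[OF this] show "\<exists>x\<in>hyp a. v\<cdot>x~=0" by (auto simp: hyp_def)
   have "\<exists>x\<in>hyp a\<inter>hyp v. u\<cdot>x~=0" if "u\<in>M R'" for u
   proof -
    have "u\<notin>span {a, v}"
    proof
     assume "u\<in>span {a, v}"
     moreover have "u\<notin>span {a}" using that npar_notin assms(1,2) by (auto simp: M_def)
     ultimately have "span {a, u}=span {a, v}" using span2_eqI by blast
     hence "u\<in>M {r}" using that v by (auto simp: M_def)
     thus False using disj that by blast
    qed
    from ortho_witness[OF this] show ?thesis by (auto simp: hyp_def)
   qed
   hence "\<exists>x\<in>hyp a\<inter>hyp v. (\<Prod>u\<in>M R'. u\<cdot>x)~=0"
    by (rule hp_prod_lin_nonzero[OF finM subspace_inter[OF subspace_hyp subspace_hyp]])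
   thus "\<exists>x\<in>hyp a. v\<cdot>x=0 \<and> (\<Prod>u\<in>M R'. u\<cdot>x)~=0" by (auto simp: hyp_def)
  next
   show "(\<Prod>v\<in>M R'. v\<cdot>x) * g x=(\<Prod>v\<in>M {r}. v\<cdot>x) * k x" if "x\<in>hyp a" for x
    using g(2)[OF that] k(2)[OF that] Kr by simp
  qed
  then obtain g' where g': "hp (e - card (M R') - card (M {r})) g'" "\<And>x. x\<in>hyp a ==> g x=(\<Prod>v\<in>M {r}. v\<cdot>x) * g' x"
   by blast
  have "card (M (insert r R'))=card (M R') + card (M {r})"
   unfolding Mi by (rule card_Un_disjoint[OF finM finM disj])
  moreover have "(\<Prod>v\<in>M (insert r R'). v\<cdot>x)=(\<Prod>v\<in>M R'. v\<cdot>x) * (\<Prod>v\<in>M {r}. v\<cdot>x)" for x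
   unfolding Mi by (rule prod.union_disjoint[OF finM finM disj])
  ultimately show ?case using g g' by (intro exI[of _ g']) (auto simp: mult_ac)
 qed
 from this[OF \<open>finite R\<close> subset_refl] have
  "\<exists>g. hp (e - card (M R)) g \<and> (\<forall>x\<in>hyp a. a\<cdot>F x=(\<Prod>v\<in>M R. v\<cdot>x) * g x)" .
 moreover have "M R=N - R"
 proof -
  have "\<exists>r\<in>R. span {a, v}=span {a, r}" if "v\<in>N" for v
   using assms(3) that unfolding trv_def by (metis (no_types, lifting) imageE image_eqI)
  thus ?thesis by (auto simp: M_def)
 qed
 ultimately show ?thesis by simp
qed

text \<open>The cofactor left by \<open>tang_div\<close> would have negative degree. Truncated
  subtraction makes it a constant instead, and the clash between the degrees \<open>e\<close> and
  \<open>dd N a\<close> forces the value 0.\<close>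

lemma tang_div_zero:
 assumes "npar (insert a N)" "a\<notin>N" "hf e F" "tang N F" "e < dd N a" "x\<in>hyp a"
 shows "a\<cdot>F x=0"
proof -
 obtain R where R: "trv a N R" using trv_exists by blast
 have finN: "finite N" using assms(1) by (simp add: npar_def)
 have c: "card (N - R)=dd N a" using trv_card[OF R finN] .
 obtain g where g: "hp (e - card (N - R)) g" "\<And>x. x\<in>hyp a ==> a\<cdot>F x=(\<Prod>v\<in>N - R. v\<cdot>x) * g x"
  using tang_div[OF assms(1,2) R assms(3,4)] by blast
 have g0: "hp 0 g" using g(1) c assms(5) by simp
 have "hp e (%x. a\<cdot>F x)" using assms(3) by (simp add: hf_def)
 from hp_unique_deg[OF this hp_mult[OF hp_prod_lin g0] _ subspace_hyp g(2) assms(6)]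
 show ?thesis using c assms(5) by simp
qed

section \<open>Extending a basis of tangent fields by one hyperplane\<close>

lemma fbasD:
 assumes "fbas E N r e F"
 shows "\<And>i. i < r ==> hf (e i) (F i)" "\<And>i x. i < r ==> F i x\<in>E" "\<And>i. i < r ==> tang N (F i)"
  "\<And>d G. hf d G ==> range G\<subseteq>E ==> tang N G ==>
    \<exists>f. (\<forall>i<r. hq d (e i) (f i)) \<and> (\<forall>x. G x=(\<Sum>i<r. f i x*\<^sub>RF i x))"
  "\<And>f i x. (\<And>i. i < r ==> continuous_on UNIV (f i)) ==> (\<And>x. (\<Sum>i<r. f i x*\<^sub>RF i x)=0) ==>
    i < r ==> f i x=0"
proof -
 show "\<And>i. i < r ==> hf (e i) (F i)" "\<And>i. i < r ==> tang N (F i)" using assms unfolding fbas_def by auto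
 show "\<And>i x. i < r ==> F i x\<in>E" using assms unfolding fbas_def by (meson rangeI subsetD)
 show "\<And>d G. hf d G ==> range G\<subseteq>E ==> tang N G ==>
    \<exists>f. (\<forall>i<r. hq d (e i) (f i)) \<and> (\<forall>x. G x=(\<Sum>i<r. f i x*\<^sub>RF i x))"
  using assms unfolding fbas_def by presburger
 show "\<And>f i x. (\<And>i. i < r ==> continuous_on UNIV (f i)) ==> (\<And>x. (\<Sum>i<r. f i x*\<^sub>RF i x)=0) ==>
    i < r ==> f i x=0" using assms unfolding fbas_def by presburger
qed

text \<open>In the expansion of a transversal field of degree \<open>dd N a\<close>, basis fields of
  larger degree have coefficient 0 and those of smaller degree are tangent to \<open>hyp a\<close>.
  So some basis field of exactly this degree is transversal.\<close>

lemma step_index: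
 assumes "npar (insert a N)" "a\<notin>N" "fbas E N r e F" "step_ok E N a"
 shows "\<exists>i<r. e i=dd N a \<and> (\<exists>w\<in>hyp a. a\<cdot>F i w~=0)"
proof -
 obtain u w where t: "hf (dd N a) u" "range u\<subseteq>E" "tang N u" "w\<in>hyp a" "a\<cdot>u w~=0"
  using assms(4) unfolding step_ok_def by blast
 obtain f where f: "\<And>i. i < r ==> hq (dd N a) (e i) (f i)"
  "\<And>x. u x=(\<Sum>i<r. f i x*\<^sub>RF i x)" using fbasD(4)[OF assms(3) t(1-3)] by blast
 have "a\<cdot>u w=(\<Sum>i<r. f i w * (a\<cdot>F i w))" by (simp add: f(2) inner_sum_right)
 hence "\<exists>i<r. f i w * (a\<cdot>F i w)~=0" using t(5) sum.neutral[of "{..<r}" "%i. f i w * (a\<cdot>F i w)"] by force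
 then obtain i where i: "i < r" "f i w~=0" "a\<cdot>F i w~=0" by auto
 have "e i\<le>dd N a" using f(1)[OF i(1)] i(2) by (auto split: if_splits)
 moreover have "\<not> e i < dd N a"
  using tang_div_zero[OF assms(1,2) fbasD(1)[OF assms(3) i(1)] fbasD(3)[OF assms(3) i(1)] _ t(4)] i(3) by blast
 ultimately show ?thesis using i t(4) by (intro exI[of _ i]) auto
qed

lemma hyp_dense:
 assumes "a~=0" "continuous_on UNIV f" "\<And>x. (a\<cdot>x) * f x=(0::real)"
 shows "f x=0"
proof (rule ccontr)
 assume "f x~=0"
 let ?g = "%t::real. f (x + t*\<^sub>Ra)"
 have "continuous_on UNIV ?g" by (rule continuous_on_compose2[OF assms(2)]) (auto intro!: continuous_intros)
 hence "(?g \<longlongrightarrow> ?g 0) (at 0)" unfolding continuous_on_def by blast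
 hence "eventually (%t. ?g t~=0) (at 0)" using \<open>f x \<noteq> 0\<close> by (intro tendsto_imp_eventually_ne) auto
 moreover have "eventually (%t. a\<cdot>(x + t*\<^sub>Ra)~=0) (at (0::real))"
 proof (cases "a\<cdot>x=0")
  case True
  thus ?thesis using assms(1) by (auto simp: inner_add_right eventually_at intro: exI[of _ 1])
 next
  case False
  have "((%t. a\<cdot>(x + t*\<^sub>Ra)) \<longlongrightarrow> a\<cdot>(x + 0*\<^sub>Ra)) (at (0::real))" by (intro tendsto_intros)
  thus ?thesis using False by (intro tendsto_imp_eventually_ne) auto
 qed
 ultimately have "eventually (%t. ?g t~=0 \<and> a\<cdot>(x + t*\<^sub>Ra)~=0) (at (0::real))" by (rule eventually_conj)
 hence "eventually (%t. False) (at (0::real))"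
  by (rule eventually_mono) (use assms(3) in \<open>auto simp: mult_eq_0_iff\<close>)
 thus False by simp
qed

lemma hf_scale: "hp d f ==> hf e F ==> hf (d + e) (%x. f x*\<^sub>RF x)"
 unfolding hf_def inner_scaleR_right by (intro allI hp_mult) auto

lemma hf_diff: "hf e F ==> hf e G ==> hf e (%x. F x - G x)"
 unfolding hf_def inner_diff_right by (intro allI hp_diff) auto

text \<open>The addition theorem: the transversal basis field is multiplied by the form
  \<open>a\<close>, and the others are corrected by multiples of it until they are tangent to
  \<open>hyp a\<close>. Only one exponent changes.\<close>

lemma step_fbas:
 assumes np: "npar (insert a N)" "a\<notin>N" and fb: "fbas E N r e F" and ok: "step_ok E N a" and E: "subspace E"
 shows "\<exists>i0<r. e i0=dd N a \<and> (\<exists>F'. fbas E (insert a N) r (e(i0 := Suc (dd N a))) F')"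
proof -
 let ?d = "dd N a"
 obtain i0 w where i0: "i0 < r" "e i0=?d" "w\<in>hyp a" "a\<cdot>F i0 w~=0"
  using step_index[OF np fb ok] by blast
 have a0: "a~=0" using np by (auto simp: npar_def)
 obtain R where R: "trv a N R" using trv_exists by blast
 have cR: "card (N - R)=?d" using trv_card[OF R] np by (auto simp: npar_def)
 define B where "B x=(\<Prod>v\<in>N - R. v\<cdot>x)" for x
 note Fi = fbasD(1-3)[OF fb]
 have "\<exists>g. hp (e i - ?d) g \<and> (\<forall>x\<in>hyp a. a\<cdot>F i x=B x * g x)" if "i < r" for i
  using tang_div[OF np R Fi(1)[OF that] Fi(3)[OF that]] cR by (simp add: B_def)
 then obtain g where g: "\<And>i. i < r ==> hp (e i - ?d) (g i)"
  "\<And>i x. i < r ==> x\<in>hyp a ==> a\<cdot>F i x=B x * g i x" by metis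
 \<comment> \<open>The cofactor has degree 0 because \<open>e i0\<close> equals the degree of the
   divisor \<open>B\<close>.\<close>
 obtain c where c: "g i0=(%_. c)" using hp_0D[of "g i0"] g(1)[OF i0(1)] i0(2) by auto
 have c0: "c~=0" using g(2)[OF i0(1,3)] i0(4) c by auto
 \<comment> \<open>On \<open>hyp a\<close> both \<open>a \<cdot> F i\<close> and
   \<open>a \<cdot> F i0\<close> are multiples of \<open>B\<close>, the latter by the constant
   \<open>c\<close>; so \<open>h i\<close> is their quotient. Where \<open>e i - ?d\<close>
   truncates, \<open>F i\<close> is already tangent and no correction is made.\<close>
 define h where "h i=(if e i < ?d then (%_. 0) else (%x. (1 / c) * g i x))" for i
 have hh: "hp (e i - ?d) (h i)" if "i < r" for i
  using g(1)[OF that] hp_cmult[OF g(1)[OF that], of "1/c"] by (auto simp: h_def hp_zero)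
 define F' where "F' i=(if i=i0 then (%x. (a\<cdot>x)*\<^sub>RF i0 x) else (%x. F i x - h i x*\<^sub>RF i0 x))" for i
 let ?e = "e(i0 := Suc ?d)"
 have tan: "a\<cdot>F' i x=0" if "i < r" "x\<in>hyp a" for i x
 proof (cases "i=i0")
  case True
  thus ?thesis using that(2) by (simp add: F'_def hyp_def)
 next
  case False
  have "a\<cdot>F' i x=a\<cdot>F i x - h i x * (B x * c)"
   using False g(2)[OF i0(1) that(2)] c by (simp add: F'_def inner_diff_right)
  also have "\<dots>=0"
  proof (cases "e i < ?d")
   case True
   thus ?thesis using tang_div_zero[OF np Fi(1)[OF that(1)] Fi(3)[OF that(1)] True that(2)] by (simp add: h_def)
  next
   case False
   thus ?thesis using g(2)[OF that] c0 by (simp add: h_def)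
  qed
  finally show ?thesis .
 qed
 have 1: "hf (?e i) (F' i) \<and> range (F' i)\<subseteq>E \<and> tang (insert a N) (F' i)" if i: "i < r" for i
 proof (intro conjI)
  show "range (F' i)\<subseteq>E"
   using Fi(2)[OF i] Fi(2)[OF i0(1)] E by (auto simp: F'_def subspace_diff subspace_scale)
  show "tang (insert a N) (F' i)"
   using tan[OF i] Fi(3)[OF i] Fi(3)[OF i0(1)] unfolding tang_def by (auto simp: F'_def inner_diff_right)
  show "hf (?e i) (F' i)"
  proof (cases "i=i0")
   case True
   thus ?thesis using hf_scale[OF hp_linear Fi(1)[OF i0(1)], of a] i0(2) by (simp add: F'_def)
  next
   case False
   have "hf (e i) (%x. h i x*\<^sub>RF i0 x)"
   proof (cases "e i < ?d")
    case True
    thus ?thesis by (simp add: h_def hf_def hp_zero)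
   next
    case False
    thus ?thesis using hf_scale[OF hh[OF i] Fi(1)[OF i0(1)]] i0(2) by simp
   qed
   thus ?thesis using False hf_diff[OF Fi(1)[OF i]] by (simp add: F'_def)
  qed
 qed
 have sumF': "(\<Sum>i<r. f i x*\<^sub>RF' i x)=(\<Sum>i<r. (if i=i0 then f i0 x * (a\<cdot>x) - (\<Sum>j\<in>{..<r}-{i0}. f j x * h j x) else f i x)*\<^sub>RF i x)" for f x
 using i0 by (simp add: sum.remove F'_def scaleR_diff_right sum_subtractf scaleR_sum_left scaleR_diff_left)
 have 2: "\<exists>f. (\<forall>i<r. hq d (?e i) (f i)) \<and> (\<forall>x. G x=(\<Sum>i<r. f i x*\<^sub>RF' i x))"
  if G: "hf d G" "range G\<subseteq>E" "tang (insert a N) G" for d G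
 proof -
  obtain f where f: "\<And>i. i < r ==> hq d (e i) (f i)"
   "\<And>x. G x=(\<Sum>i<r. f i x*\<^sub>RF i x)"
   using fbasD(4)[OF fb G(1,2) tang_subset[OF G(3) subset_insertI]] by blast
  \<comment> \<open>The coefficient of the old \<open>F i0\<close> once the other \<open>F i\<close>
    are rewritten through \<open>F' i\<close>. Tangency of \<open>G\<close> makes it vanish on
    \<open>hyp a\<close>, so it is divisible by the form \<open>a\<close>, which turns
    \<open>F i0\<close> into \<open>F' i0\<close>.\<close>
  define k where "k x=f i0 x + (\<Sum>j\<in>{..<r}-{i0}. f j x * h j x)" for x
  have hk: "hq d (?d) k"
  proof (cases "?d\<le>d")
   case True
   have "hp (d - ?d) (%x. f j x * h j x)" if j: "j < r" for j
   proof (cases "?d\<le>e j \<and> e j\<le>d")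
    case T: True
    hence "hp (d - e j + (e j - ?d)) (%x. f j x * h j x)" using f(1)[OF j] by (intro hp_mult hh[OF j]) auto
    thus ?thesis using T by simp
   next
    case False
    hence "f j=(%_. 0) \<or> h j=(%_. 0)" using f(1)[OF j] by (auto simp: h_def)
    thus ?thesis by (auto intro: hp_zero)
   qed
   hence "hp (d - ?d) (%x. \<Sum>j\<in>{..<r}-{i0}. f j x * h j x)" by (intro hp_sum) auto
   thus ?thesis using True f(1)[OF i0(1)] i0(2) hp_add unfolding k_def[abs_def] by simp
  next
   case False
   have "f j x * h j x=0" if "j < r" for j x
    using f(1)[OF that] False by (cases "e j\<le>d") (auto simp: h_def)
   hence "k x=0" for x using f(1)[OF i0(1)] False i0(2) by (auto simp: k_def intro!: sum.neutral)
   thus ?thesis using False by auto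
  qed
  have Gk: "G x=(\<Sum>i\<in>{..<r}-{i0}. f i x*\<^sub>RF' i x) + k x*\<^sub>RF i0 x" for x
  proof -
   have "G x=f i0 x*\<^sub>RF i0 x + (\<Sum>i\<in>{..<r}-{i0}. f i x*\<^sub>RF i x)"
    unfolding f(2) using i0(1) by (simp add: sum.remove)
   moreover have "(\<Sum>i\<in>{..<r}-{i0}. f i x*\<^sub>RF' i x)=(\<Sum>i\<in>{..<r}-{i0}. f i x*\<^sub>RF i x) - (\<Sum>j\<in>{..<r}-{i0}. f j x * h j x)*\<^sub>RF i0 x"
    by (simp add: F'_def scaleR_diff_right sum_subtractf scaleR_sum_left)
   ultimately show ?thesis by (simp add: k_def scaleR_add_left)
  qed
  have kz: "k x=0" if "x\<in>hyp a" for x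
  proof -
   have "k x * (a\<cdot>F i0 x)=0" if "x\<in>hyp a" for x
   proof -
    have "a\<cdot>G x=0" using G(3) that by (auto simp: tang_def)
    thus ?thesis unfolding Gk using tan[OF _ that] by (auto simp: inner_add_right inner_sum_right)
   qed
   moreover have "hp (if ?d\<le>d then d - ?d else 0) k" using hk by (auto intro: hp_zero)
   moreover have "hp (e i0) (%x. a\<cdot>F i0 x)" using Fi(1)[OF i0(1)] by (simp add: hf_def)
   ultimately show ?thesis
    using hp_domain[of _ k "e i0" "%x. a\<cdot>F i0 x", OF _ _ subspace_hyp[of a]] i0(3,4) that by blast
  qed
  have "\<exists>l. (hq d (Suc ?d) l) \<and> (\<forall>x. k x=(a\<cdot>x) * l x)"
  proof (cases "Suc ?d\<le>d")
   case True
   hence "hp (d - ?d) k" using hk by auto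
   moreover have "\<exists>x\<in>hyp 0. a\<cdot>x~=0" using a0 by (metis UNIV_I hyp_0 inner_eq_zero_iff)
   ultimately obtain l where "hp (d - ?d - 1) l" "\<forall>x\<in>hyp 0. k x=(a\<cdot>x) * l x"
    using hp_div[of "d - ?d" k 0 a] kz by (auto simp: hyp_def)
   thus ?thesis using True by (intro exI[of _ l]) (auto simp: hyp_0)
  next
   case False
   have "k x=0" for x
   proof (cases "?d\<le>d")
    case True
    hence "hp 0 k" using hk False by (metis Suc_leI diff_is_0_eq' le_eq_less_or_eq nle_le)
    thus ?thesis using kz[OF i0(3)] hp_0D[of k] by auto
   qed (use hk in auto)
   thus ?thesis using False by (intro exI[of _ "%_. 0"]) auto
  qed
  then obtain l where l: "hq d (Suc ?d) l" "\<And>x. k x=(a\<cdot>x) * l x" by blast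
  define f' where "f'=f(i0 := l)"
  have "G x=(\<Sum>i<r. f' i x*\<^sub>RF' i x)" for x
  proof -
   have "(\<Sum>i<r. f' i x*\<^sub>RF' i x)=l x*\<^sub>RF' i0 x + (\<Sum>i\<in>{..<r}-{i0}. f i x*\<^sub>RF' i x)"
    using i0(1) by (simp add: sum.remove[of "{..<r}" i0] f'_def)
   thus ?thesis unfolding Gk l(2) by (simp add: F'_def mult.commute)
  qed
  moreover have "hq d (?e i) (f' i)" if "i < r" for i
   using f(1)[OF that] l(1) by (simp add: f'_def)
  ultimately show ?thesis by blast
 qed
 have Fcont: "continuous_on UNIV (h i)" if "i < r" for i using hp_cont[OF hh[OF that]] .
 have 3: "f i x=0" if f: "\<And>i. i < r ==> continuous_on UNIV (f i)" "\<And>x. (\<Sum>i<r. f i x*\<^sub>RF' i x)=0" and i: "i < r" for f i x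
 proof -
  let ?f = "%i x. if i=i0 then f i0 x * (a\<cdot>x) - (\<Sum>j\<in>{..<r}-{i0}. f j x * h j x) else f i x"
  have z: "?f j x=0" if "j < r" for j x
  proof (rule fbasD(5)[OF fb, of ?f])
   show "continuous_on UNIV (?f i)" if "i < r" for i
    using that f(1) i0(1) Fcont by (cases "i=i0") (auto intro!: continuous_intros)
   show "(\<Sum>i<r. ?f i x*\<^sub>RF i x)=0" for x using sumF'[of f x] f(2)[of x] by simp
  qed (fact that)
  show ?thesis
  proof (cases "i=i0")
   case False
   thus ?thesis using z[OF i] by simp
  next
   case True
   have "f j x=0" if "j < r" "j~=i0" for j x using z[OF that(1), of x] that(2) by simp
   hence "(a\<cdot>x) * f i0 x=0" for x using z[OF i0(1), of x] by (simp add: mult.commute)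
   thus ?thesis using hyp_dense[OF a0 f(1)[OF i0(1)]] True by blast
  qed
 qed
 have "fbas E (insert a N) r ?e F'" unfolding fbas_def using 1 2 3 by blast
 thus ?thesis using i0(1,2) by blast
qed

section \<open>Adding a hyperplane to a free arrangement\<close>

interpretation rf: vector_space "%(c::real) (f::'a => real) x. c * f x"
 by unfold_locales (auto simp: fun_eq_iff algebra_simps)

lemma rf_span_mult:
 assumes "f\<in>rf.span A" "\<And>u. u\<in>A ==> (%x. u x * h x)\<in>rf.span B"
 shows "(%x. f x * h x)\<in>rf.span B" using assms(1)
proof (induction rule: rf.span_induct_alt)
 case base
 thus ?case using rf.span_zero by (simp add: zero_fun_def)
next
 case (step c u v)
 have "(%x. (c * u x + v x) * h x)=(%x. c * (u x * h x)) + (%x. v x * h x)"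
  by (auto simp: fun_eq_iff algebra_simps)
 thus ?case using rf.span_add[OF rf.span_scale[OF assms(2)[OF step(1)]] step(2)] by (simp add: plus_fun_def)
qed

lemma rf_span_sum:
 "(\<And>i. i\<in>I ==> f i\<in>rf.span B) ==> (%x. \<Sum>i\<in>I. f i x)\<in>rf.span B"
proof (induction I rule: infinite_finite_induct)
 case (insert i I)
 thus ?case using rf.span_add[of "f i" B "%x. \<Sum>i\<in>I. f i x"] by (simp add: plus_fun_def)
qed (auto simp: rf.span_zero[unfolded zero_fun_def])

lemma rf_span_subsetD: "f\<in>rf.span A ==> (\<And>u. u\<in>A ==> u\<in>rf.span B) ==> f\<in>rf.span B"
 using rf.span_minimal[OF _ rf.subspace_span, of A B] by blast

text \<open>Fewer than \<open>q\<close> homogeneous polynomials of positive degree cannot generate powers of \<open>q\<close>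
 independent linear forms: count dimensions of spaces of polynomial functions on a grid.\<close>

lemma graded_dimension:
 fixes y w :: "nat => 'a::euclidean_space" and g :: "nat => 'a => real"
 assumes dual: "\<And>i j. i < q ==> j < q ==> y i\<cdot>w j=(if i=j then 1 else 0)"
  and J: "finite J"
  and g: "\<And>j. j\<in>J ==> hp (\<delta> j) (g j)" "\<And>j. j\<in>J ==> \<delta> j\<ge>1"
  and pow: "\<And>i. i < q ==> \<exists>f. (\<forall>j\<in>J. hq s (\<delta> j) (f j)) \<and>
    (\<forall>x\<in>span (w ` {..<q}). (y i\<cdot>x) ^ s=(\<Sum>j\<in>J. f j x * g j x))"
 shows "q\<le>card J"
proof -
 define \<pi> where "\<pi> x=(\<Sum>i<q. (y i\<cdot>x)*\<^sub>Rw i)" for x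
 have lin: "linear \<pi>" unfolding \<pi>_def
  by (rule linearI) (auto simp: inner_add_right scaleR_add_left sum.distrib scaleR_sum_right)
 have \<pi>in: "\<pi> x\<in>span (w ` {..<q})" for x unfolding \<pi>_def by (intro span_sum span_scale span_base) auto
 have y\<pi>: "y i\<cdot>\<pi> x=y i\<cdot>x" if "i < q" for i x
  using that by (simp add: \<pi>_def inner_sum_right dual if_distrib cong: if_cong)
 define mon where "mon l x=(\<Prod>i<q. (y i\<cdot>x) ^ l i)" for l :: "nat => nat" and x
 define gm where "gm b x=(\<Prod>j\<in>J. g j (\<pi> x) ^ b j)" for b :: "nat => nat" and x
 \<comment> \<open>By the relations \<open>pow\<close>, modulo the \<open>g j\<close> only monomials
   with all exponents below \<open>s\<close> survive. Each \<open>g j\<close> has positive degree,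
   so at most \<open>d\<close> factors of this kind occur in degree \<open>d\<close>, and
   \<open>T d\<close> spans the functions of that degree (\<open>red\<close>).\<close>
 define T where "T m={(%x. mon l x * gm b x) | l b. (\<forall>i<q. l i < s) \<and> sum b J\<le>m}" for m :: nat
 have T_mono: "T m\<subseteq>T m'" if "m\<le>m'" for m m' using that unfolding T_def by force
 have T_mult: "(%x. f x * g j (\<pi> x))\<in>rf.span (T (Suc m))" if "f\<in>rf.span (T m)" "j\<in>J" for f j m
 proof (rule rf_span_mult[OF that(1)])
  fix u assume "u\<in>T m"
  then obtain l b where ub: "u=(%x. mon l x * gm b x)" "\<forall>i<q. l i < s" "sum b J\<le>m" by (auto simp: T_def)
  have "gm (b(j := Suc (b j))) x=gm b x * g j (\<pi> x)" for x
  proof -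
   have "gm (b(j := Suc (b j))) x=g j (\<pi> x) ^ Suc (b j) * (\<Prod>k\<in>J - {j}. g k (\<pi> x) ^ b k)"
    unfolding gm_def using J that(2) by (simp add: prod.remove)
   also have "\<dots>=g j (\<pi> x) * gm b x" unfolding gm_def using J that(2) by (simp add: prod.remove)
   finally show ?thesis by simp
  qed
  moreover have "sum (b(j := Suc (b j))) J\<le>Suc m"
  proof -
   have "sum (b(j := Suc (b j))) J=Suc (b j) + sum b (J - {j})" using J that(2) by (simp add: sum.remove)
   also have "\<dots>=Suc (sum b J)" using J that(2) by (simp add: sum.remove)
   finally show ?thesis using ub(3) by simp
  qed
  ultimately have "(%x. u x * g j (\<pi> x))\<in>T (Suc m)" unfolding T_def ub(1) using ub(2)
   by (intro CollectI exI[of _ l] exI[of _ "b(j := Suc (b j))"]) (simp add: mult_ac)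
  thus "(%x. u x * g j (\<pi> x))\<in>rf.span (T (Suc m))" by (rule rf.span_base)
 qed
 have mon_hp: "hp (sum l {..<q}) (mon l)" for l
 proof -
  have "hp (\<Sum>i<q. Suc 0 * l i) (%x. \<Prod>i<q. (y i\<cdot>x) ^ l i)" by (intro hp_prod hp_power hp_linear) auto
  thus ?thesis unfolding mon_def[abs_def] by simp
 qed
 have to_mon: "(%x. f (\<pi> x))\<in>rf.span {mon e | e. sum e {..<q}=d}" if "hp d f" for d f using that
 proof (induction rule: hp.induct)
  case (hp_const c)
  have "mon (%_. 0)=(%_. 1)" by (auto simp: mon_def)
  hence "(%_. 1)\<in>{mon e | e. sum e {..<q}=0}" by (intro CollectI exI[of _ "%_. 0"]) auto
  from rf.span_scale[OF rf.span_base[OF this], of c] show ?case by simp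
 next
  case (hp_add d f g)
  thus ?case using rf.span_add[OF hp_add(3,4)] by (simp add: plus_fun_def)
 next
  case (hp_lin d f a)
  have "(%x. f (\<pi> x) * (y i\<cdot>x))\<in>rf.span {mon e | e. sum e {..<q}=Suc d}" if "i < q" for i
  proof (rule rf_span_mult[OF hp_lin(2)])
   fix u assume "u\<in>{mon e | e. sum e {..<q}=d}"
   then obtain e where e: "u=mon e" "sum e {..<q}=d" by auto
   have "mon (e(i := Suc (e i)))=(%x. u x * (y i\<cdot>x))"
    unfolding mon_def e(1) using that by (auto simp: prod.remove[of _ i] fun_eq_iff)
   moreover have "sum (e(i := Suc (e i))) {..<q}=Suc d" using e(2) that by (simp add: sum.remove[of _ i])
   ultimately show "(%x. u x * (y i\<cdot>x))\<in>rf.span {mon e | e. sum e {..<q}=Suc d}"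
    by (intro rf.span_base CollectI exI[of _ "e(i := Suc (e i))"]) simp
  qed
  hence "(%x. \<Sum>i<q. (a\<cdot>w i) * (f (\<pi> x) * (y i\<cdot>x)))\<in>rf.span {mon e | e. sum e {..<q}=Suc d}"
   by (intro rf_span_sum rf.span_scale) auto
  moreover have "(a\<cdot>\<pi> x) * f (\<pi> x)=(\<Sum>i<q. (a\<cdot>w i) * (f (\<pi> x) * (y i\<cdot>x)))" for x
   by (simp add: \<pi>_def inner_sum_right sum_distrib_left sum_distrib_right mult_ac)
  ultimately show ?case by simp
 qed
 have red: "(%x. f (\<pi> x))\<in>rf.span (T d)" if "hp d f" for d f using that
 proof (induction d arbitrary: f rule: less_induct)
  case (less d)
  have "mon e\<in>rf.span (T d)" if e: "sum e {..<q}=d" for e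
  proof (cases "\<forall>i<q. e i < s")
   case True
   have "mon e=(%x. mon e x * gm (%_. 0) x)" by (simp add: gm_def)
   hence "mon e\<in>T d" unfolding T_def using True by (intro CollectI exI[of _ e] exI[of _ "%_. 0"]) auto
   thus ?thesis by (rule rf.span_base)
  next
   case False
   then obtain i where i: "i < q" "s\<le>e i" by auto
   obtain f where f: "\<And>j. j\<in>J ==> hq s (\<delta> j) (f j)"
    "\<And>x. x\<in>span (w ` {..<q}) ==> (y i\<cdot>x) ^ s=(\<Sum>j\<in>J. f j x * g j x)" using pow[OF i(1)] by blast
   define e' where "e'=e(i := e i - s)"
   have se: "sum e' {..<q}=d - s" "s\<le>d"
   proof -
    have "sum e' {..<q} + s=d" using e i by (simp add: sum.remove[of _ i] e'_def)
    thus "sum e' {..<q}=d - s" "s\<le>d" by auto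
   qed
   have mm: "mon e x=mon e' x * (y i\<cdot>x) ^ s" for x
   proof -
    have "(y i\<cdot>x) ^ e i=(y i\<cdot>x) ^ (e i - s) * (y i\<cdot>x) ^ s" using i(2) by (simp flip: power_add)
    thus ?thesis unfolding mon_def e'_def using i(1) by (simp add: prod.remove[of _ i] mult_ac)
   qed
   have mon\<pi>: "mon l (\<pi> x)=mon l x" for l x by (simp add: mon_def y\<pi>)
   have eq: "mon e=(%x. \<Sum>j\<in>J. (mon e' (\<pi> x) * f j (\<pi> x)) * g j (\<pi> x))"
   proof
    fix x
    have "mon e x=mon e' (\<pi> x) * (y i\<cdot>\<pi> x) ^ s" using mm y\<pi>[OF i(1)] mon\<pi> by metis
    also have "(y i\<cdot>\<pi> x) ^ s=(\<Sum>j\<in>J. f j (\<pi> x) * g j (\<pi> x))" by (rule f(2)[OF \<pi>in])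
    finally show "mon e x=(\<Sum>j\<in>J. (mon e' (\<pi> x) * f j (\<pi> x)) * g j (\<pi> x))"
     by (simp add: sum_distrib_left mult.assoc)
   qed
   have "(%x. (mon e' (\<pi> x) * f j (\<pi> x)) * g j (\<pi> x))\<in>rf.span (T d)" if j: "j\<in>J" for j
   proof (cases "\<delta> j\<le>s")
    case True
    have "hp (d - s + (s - \<delta> j)) (%x. mon e' x * f j x)"
     using hp_mult[OF mon_hp[of e'], of "s - \<delta> j" "f j"] f(1)[OF j] True se by simp
    hence h: "hp (d - \<delta> j) (%x. mon e' x * f j x)" using True se(2) by simp
    have lt: "d - \<delta> j < d" using g(2)[OF j] True se(2) by simp
    from T_mult[OF less(1)[OF lt h] j] show ?thesis
     using rf.span_mono[OF T_mono[of "Suc (d - \<delta> j)" d]] lt by fastforce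
   next
    case False
    hence "f j=(%_. 0)" using f(1)[OF j] by simp
    thus ?thesis using rf.span_zero[of "T d"] by (simp add: zero_fun_def)
   qed
   thus ?thesis unfolding eq by (rule rf_span_sum)
  qed
  thus ?case using rf_span_subsetD[OF to_mon[OF less(2)]] by blast
 qed
 define pl where "pl D=rf.span {h::'a=>real. \<exists>d\<le>D. hp d h}" for D :: nat
 have pl_aff: "(%x. f x * (b\<cdot>x + c))\<in>pl (Suc D)" if "f\<in>pl D" for f b c D unfolding pl_def
 proof (rule rf_span_mult[OF that[unfolded pl_def]])
  fix u :: "'a => real" assume "u\<in>{h. \<exists>d\<le>D. hp d h}"
  then obtain d where d: "d\<le>D" "hp d u" by auto
  have "(%x. (b\<cdot>x) * u x)\<in>{h. \<exists>d\<le>Suc D. hp d h}" using hp_lin[OF d(2)] d(1) by blast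
  moreover have "(%x. c * u x)\<in>{h. \<exists>d\<le>Suc D. hp d h}" using hp_cmult[OF d(2)] d(1) le_SucI by blast
  ultimately have "(%x. (b\<cdot>x) * u x) + (%x. c * u x)\<in>rf.span {h. \<exists>d\<le>Suc D. hp d h}"
   by (intro rf.span_add rf.span_base)
  moreover have "(%x. (b\<cdot>x) * u x) + (%x. c * u x)=(%x. u x * (b\<cdot>x + c))"
   by (auto simp: fun_eq_iff algebra_simps)
  ultimately show "(%x. u x * (b\<cdot>x + c))\<in>rf.span {h. \<exists>d\<le>Suc D. hp d h}" by simp
 qed
 have pl_prod: "(%x. \<Prod>i\<in>I. b i\<cdot>x + c i)\<in>pl (card I)" if "finite I" for I and b :: "nat \<times> nat => 'a" and c
  using that
 proof (induction I rule: finite_induct)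
  case empty
  have "(%x. 1)\<in>{h::'a=>real. \<exists>d\<le>0. hp d h}" using hp_const by blast
  from rf.span_base[OF this] show ?case by (simp add: pl_def)
 next
  case (insert i I)
  thus ?case using pl_aff[OF insert.IH, of "b i" "c i"] by (simp add: mult.commute)
 qed
 have pl_T: "(%x. f (\<pi> x))\<in>rf.span (T D)" if "f\<in>pl D" for f D using that unfolding pl_def
 proof (induction rule: rf.span_induct_alt)
  case base
  thus ?case using rf.span_zero[of "T D"] by (simp add: zero_fun_def)
 next
  case (step c u v)
  then obtain d where d: "d\<le>D" "hp d u" by auto
  have "(%x. u (\<pi> x))\<in>rf.span (T D)" using red[OF d(2)] rf.span_mono[OF T_mono[OF d(1)]] by blast
  from rf.span_add[OF rf.span_scale[OF this, of c] step(2)] show ?case by (simp add: plus_fun_def)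
 qed
 \<comment> \<open>On the left is the number of Lagrange polynomials of the grid with
   \<open>N + 1\<close> values in each of \<open>q\<close> directions. They are independent and of
   degree \<open>q * N\<close>, so they lie in the span of \<open>T (q * N)\<close>; the right side
   bounds the size of that set.\<close>
 have key: "(N + 1) ^ q\<le>s ^ q * (q * N + 1) ^ card J" for N
 proof -
  define V where "V=({..<q} \<rightarrow>\<^sub>E {..N})"
  have finV: "finite V" unfolding V_def by (intro finite_PiE) auto
  define p where "p v x=(\<Prod>i<q. \<Prod>m\<in>{..N} - {v i}. ((y i\<cdot>x) - real m) / (real (v i) - real m))" for v :: "nat => nat" and x
  define G where "G u=(\<Sum>i<q. real (u i)*\<^sub>Rw i)" for u :: "nat => nat"
  have yG: "y i\<cdot>G u=real (u i)" if "i < q" for i u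
   using that by (simp add: G_def inner_sum_right dual if_distrib cong: if_cong)
  have pG: "p v (G u)=(if u=v then 1 else 0)" if uv: "u\<in>V" "v\<in>V" for u v
  proof (cases "u=v")
   case True
   thus ?thesis by (auto simp: p_def yG intro!: prod.neutral)
  next
   case False
   then obtain i where i: "i < q" "u i~=v i" using uv PiE_ext[of u "{..<q}" "%_. {..N}" v] unfolding V_def by auto
   have "u i\<in>{..N} - {v i}" using uv(1) i by (auto simp: V_def)
   hence "(\<Prod>m\<in>{..N} - {v i}. ((y i\<cdot>G u) - real m) / (real (v i) - real m))=0"
    using i by (intro prod_zero bexI[of _ "u i"]) (auto simp: yG)
   hence "p v (G u)=0" unfolding p_def using i(1) by (intro prod_zero) auto
   thus ?thesis using False by simp
  qed
  have p\<pi>: "p v (\<pi> x)=p v x" for v x by (simp add: p_def y\<pi>)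
  have inj: "inj_on p V" by (rule inj_onI) (metis pG zero_neq_one)
  have ind: "rf.independent (p ` V)"
  proof (rule rf.independent_if_scalars_zero)
   show "finite (p ` V)" using finV by simp
  next
   fix c u assume c: "(\<Sum>v\<in>p ` V. (%x. c v * v x))=0" and "u\<in>p ` V"
   then obtain v where v: "v\<in>V" "u=p v" by auto
   have "0=(\<Sum>f\<in>p ` V. (%x. c f * f x)) (G v)" using c by simp
   also have "\<dots>=(\<Sum>f\<in>p ` V. c f * f (G v))" by (induction rule: infinite_finite_induct) auto
   also have "\<dots>=(\<Sum>u\<in>V. c (p u) * p u (G v))" using inj by (simp add: sum.reindex)
   also have "\<dots>=c (p v)" using v(1) finV by (simp add: pG if_distrib cong: if_cong)
   finally show "c u=0" using v by simp
  qed
  have inT: "p v\<in>rf.span (T (q * N))" if v: "v\<in>V" for v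
  proof -
   let ?I = "SIGMA i:{..<q}. {..N} - {v i}"
   let ?c = "\<Prod>i<q. \<Prod>m\<in>{..N} - {v i}. 1 / (real (v i) - real m)"
   have cI: "card ?I=q * N"
   proof -
    have "card ({..N} - {v i})=N" if "i < q" for i
     using v that by (subst card_Diff_singleton) (auto simp: V_def PiE_iff)
    thus ?thesis by (simp add: card_SigmaI)
   qed
   have "(%x. \<Prod>z\<in>?I. y (fst z)\<cdot>x + (- real (snd z)))\<in>pl (q * N)"
    using pl_prod[of ?I "%z. y (fst z)" "%z. - real (snd z)"] cI by auto
   hence "(%x. ?c * (\<Prod>z\<in>?I. y (fst z)\<cdot>x + (- real (snd z))))\<in>pl (q * N)"
    unfolding pl_def by (rule rf.span_scale)
   moreover have "(%x. ?c * (\<Prod>z\<in>?I. y (fst z)\<cdot>x + (- real (snd z))))=p v"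
   proof
    fix x
    have "(\<Prod>z\<in>?I. y (fst z)\<cdot>x + (- real (snd z)))=(\<Prod>i<q. \<Prod>m\<in>{..N} - {v i}. (y i\<cdot>x) - real m)"
     by (subst prod.Sigma) (auto simp: case_prod_beta)
    thus "?c * (\<Prod>z\<in>?I. y (fst z)\<cdot>x + (- real (snd z)))=p v x"
     unfolding p_def by (simp add: prod.distrib flip: prod.distrib)
   qed
   ultimately have "p v\<in>pl (q * N)" by simp
   from pl_T[OF this] show ?thesis by (simp add: p\<pi>)
  qed
  let ?P = "(%(l, b). (%x. mon l x * gm b x)) ` (({..<q} \<rightarrow>\<^sub>E {..<s}) \<times> (J \<rightarrow>\<^sub>E {..q * N}))"
  have TP: "T (q * N)\<subseteq>?P"
  proof
   fix u assume "u\<in>T (q * N)"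
   then obtain l b where ub: "u=(%x. mon l x * gm b x)" "\<forall>i<q. l i < s" "sum b J\<le>q * N" by (auto simp: T_def)
   have "mon l=mon (restrict l {..<q})" by (auto simp: mon_def fun_eq_iff)
   moreover have "gm b=gm (restrict b J)" by (auto simp: gm_def fun_eq_iff)
   moreover have "restrict l {..<q}\<in>{..<q} \<rightarrow>\<^sub>E {..<s}" using ub(2) by auto
   moreover have "restrict b J\<in>J \<rightarrow>\<^sub>E {..q * N}"
    using ub(3) member_le_sum[OF _ _ J, of _ b] by (auto simp: restrict_def) (meson le_trans)
   ultimately show "u\<in>?P" using ub(1) by (intro image_eqI[of _ _ "(restrict l {..<q}, restrict b J)"]) auto
  qed
  have finP: "finite (({..<q} \<rightarrow>\<^sub>E {..<s}) \<times> (J \<rightarrow>\<^sub>E {..q * N}))"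
   using J by (intro finite_cartesian_product finite_PiE) auto
  have "card (p ` V)\<le>card ?P"
   using rf.independent_span_bound[OF finite_imageI[OF finP] ind] inT rf.span_mono[OF TP] by blast
  also have "\<dots>\<le>card (({..<q} \<rightarrow>\<^sub>E {..<s}) \<times> (J \<rightarrow>\<^sub>E {..q * N}))" by (rule card_image_le[OF finP])
  also have "\<dots>=s ^ q * (q * N + 1) ^ card J" using J by (simp add: card_cartesian_product card_PiE)
  finally show ?thesis using inj by (simp add: card_image V_def card_PiE)
 qed
 show ?thesis
 proof (rule ccontr)
  assume "\<not> q\<le>card J"
  hence lt: "card J < q" by simp
  \<comment> \<open>Chosen so that \<open>?N + 1\<close> exceeds \<open>s ^ q * q ^ q\<close>. In
    \<open>key\<close> the left side grows with exponent \<open>q\<close>, the right side only with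
    exponent \<open>card J\<close>.\<close>
  let ?N = "(s * q) ^ q"
  have "(?N + 1) ^ card J * (?N + 1)\<le>(?N + 1) ^ q"
   using lt power_increasing[of "Suc (card J)" q "?N + 1"] by (simp add: mult.commute)
  also have "\<dots>\<le>s ^ q * (q * ?N + 1) ^ card J" by (rule key)
  also have "\<dots>\<le>s ^ q * (q * (?N + 1)) ^ card J" using lt by (intro mult_left_mono power_mono) auto
  also have "\<dots>=s ^ q * q ^ card J * (?N + 1) ^ card J" by (simp only: power_mult_distrib mult.assoc)
  also have "\<dots>\<le>s ^ q * q ^ q * (?N + 1) ^ card J"
   using lt by (intro mult_right_mono mult_left_mono power_increasing) auto
  finally have "?N + 1\<le>(s * q) ^ q" by (simp add: power_mult_distrib mult.commute)
  thus False by simp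
 qed
qed

text \<open>\<open>K m f\<close> stands for membership of the degree \<open>m\<close> function
  \<open>f\<close> in a graded ideal. In every term of the binomial expansion either
  \<open>u\<close> has exponent at least \<open>M\<close> or \<open>v\<close> has exponent at least
  \<open>T\<close>.\<close>

lemma binomial_closure:
 fixes K :: "nat => ('a::euclidean_space => real) => bool"
 assumes add: "\<And>m f g. K m f ==> K m g ==> K m (%x. f x + g x)"
  and mult: "\<And>m k f h. K m f ==> hp k h ==> K (k + m) (%x. h x * f x)"
  and u: "hp 1 u" "K M (%x. u x ^ M)" and v: "hp 1 v" "K T (%x. v x ^ T)" and T: "T\<ge>1"
 shows "K (M + T) (%x. (u x + v x) ^ (M + T))"
proof -
 have tm: "K (M + T) (%x. of_nat ((M + T) choose k) * u x ^ k * v x ^ (M + T - k))" if "k\<le>M + T" for k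
 proof (cases "M\<le>k")
  case True
  have "hp (1 * (k - M) + 1 * (M + T - k)) (%x. u x ^ (k - M) * v x ^ (M + T - k))"
   by (intro hp_mult hp_power u v)
  from mult[OF u(2) hp_cmult[OF this, of "of_nat ((M + T) choose k)"]]
  have "K (k - M + (M + T - k) + M) (%x. of_nat ((M + T) choose k) * (u x ^ (k - M) * v x ^ (M + T - k)) * u x ^ M)"
   by simp
  moreover have "u x ^ k=u x ^ (k - M) * u x ^ M" for x using True by (simp flip: power_add)
  ultimately show ?thesis using True that by (simp add: mult_ac add.commute)
 next
  case False
  hence le: "T\<le>M + T - k" by simp
  have "hp (1 * k + 1 * (M - k)) (%x. u x ^ k * v x ^ (M - k))" by (intro hp_mult hp_power u v)
  from mult[OF v(2) hp_cmult[OF this, of "of_nat ((M + T) choose k)"]]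
  have "K (k + (M - k) + T) (%x. of_nat ((M + T) choose k) * (u x ^ k * v x ^ (M - k)) * v x ^ T)" by simp
  moreover have "v x ^ (M + T - k)=v x ^ (M - k) * v x ^ T" for x using False by (simp flip: power_add)
  ultimately show ?thesis using False by (simp add: mult_ac)
 qed
 have "K (M + T) (%x. \<Sum>k\<le>n. of_nat ((M + T) choose k) * u x ^ k * v x ^ (M + T - k))" if "n\<le>M + T" for n
  using that
 proof (induction n)
  case 0
  thus ?case using tm[of 0] by simp
 next
  case (Suc n)
  thus ?case using add[OF Suc.IH tm[of "Suc n"]] by simp
 qed
 from this[OF order_refl] show ?thesis unfolding binomial_ring .
qed

text \<open>Provides forms and points of \<open>hyp a\<close> in duality, as
  \<open>graded_dimension\<close> requires them.\<close>

lemma dual_vectors: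
 fixes B :: "'a::euclidean_space set"
 assumes "independent (insert a B)" "a\<notin>B" "card B\<ge>q" "finite B"
 shows "\<exists>y w. (\<forall>i<q. y i\<in>B \<and> w i\<in>hyp a) \<and> (\<forall>i<q. \<forall>j<q. y i\<cdot>w j=(if i=j then 1 else (0::real)))"
proof -
 obtain C where C: "C\<subseteq>B" "card C=q" "finite C" using obtain_subset_with_card_n[OF assms(3)] by metis
 obtain y where y: "bij_betw y {..<q} C" using ex_bij_betw_nat_finite[OF C(3)] C(2) by (auto simp: atLeast0LessThan)
 have yC: "y i\<in>B" if "i < q" for i using y C(1) that by (auto simp: bij_betw_def)
 have "\<exists>w. (\<forall>b\<in>insert a B - {y i}. b\<cdot>w=0) \<and> y i\<cdot>w=1" if i: "i < q" for i
 proof -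
  have "y i\<notin>span (insert a B - {y i})" using assms(1) yC[OF i] unfolding dependent_def by auto
  from ortho_witness[OF this] obtain x where x: "\<forall>b\<in>insert a B - {y i}. b\<cdot>x=0" "y i\<cdot>x~=0" by blast
  thus ?thesis by (intro exI[of _ "(1 / (y i\<cdot>x))*\<^sub>Rx"]) auto
 qed
 then obtain w where w: "\<And>i. i < q ==> (\<forall>b\<in>insert a B - {y i}. b\<cdot>w i=0) \<and> y i\<cdot>w i=1" by metis
 have "w i\<in>hyp a" if "i < q" for i using w[OF that] yC[OF that] assms(2) by (auto simp: hyp_def)
 moreover have "y i\<cdot>w j=(if i=j then 1 else 0)" if "i < q" "j < q" for i j
 proof (cases "i=j")
  case False
  hence "y i~=y j" using y that by (auto simp: bij_betw_def inj_on_def)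
  thus ?thesis using w[OF that(2)] yC[OF that(1)] False by auto
 qed (use w that in auto)
 ultimately show ?thesis using yC by (intro exI[of _ y] exI[of _ w]) auto
qed

text \<open>The ideal of functions \<open>f\<close> on \<open>hyp a\<close> with \<open>f B\<close> of the form \<open>a \<cdot> t\<close>, where \<open>B\<close> is the common
 divisor of all \<open>a \<cdot> t\<close>, contains by the local hypotheses enough products of linear forms to
 be primary to the intersection of all hyperplanes. If no basis element of the critical degree were
 transversal to \<open>hyp a\<close>, it would be generated by too few elements of positive degree.\<close>

lemma add_step:
 assumes np: "npar (insert a N)" "a\<notin>N" and fb: "fbas E N r e F" and E: "subspace E"
  and loc: "\<And>x. x\<in>hyp a ==> \<exists>v\<in>N. v\<cdot>x~=0 ==> step_ok E {v\<in>N. v\<cdot>x=0} a"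
  and dim: "q + 1\<le>dim (insert a N)"
  and few: "card {i. i < r \<and> dd N a < e i} < q"
 shows "step_ok E N a"
proof (rule ccontr)
 assume nok: "\<not> step_ok E N a"
 let ?d = "dd N a"
 define J where "J={i. i < r \<and> ?d < e i}"
 have finJ: "finite J" by (simp add: J_def)
 note Fi = fbasD(1-3)[OF fb]
 have finN: "finite N" using np by (auto simp: npar_def)
 obtain R where R: "trv a N R" using trv_exists by blast
 have RN: "R\<subseteq>N" using R by (simp add: trv_def)
 have finR: "finite R" using RN finN finite_subset by blast
 have cR: "card (N - R)=?d" using trv_card[OF R finN] .
 define B where "B x=(\<Prod>v\<in>N - R. v\<cdot>x)" for x
 have hB: "hp ?d B" using hp_prod_lin[of "N - R"] cR by (simp add: B_def[abs_def])
 have Nnz: "\<exists>x\<in>hyp a. v\<cdot>x~=0" if "v\<in>N" for v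
  using ortho_witness[OF npar_notin[OF np that]] by (auto simp: hyp_def)
 have Bnz: "\<exists>x\<in>hyp a. B x~=0" unfolding B_def using finN Nnz by (intro hp_prod_lin_nonzero subspace_hyp) auto
 \<comment> \<open>Under the assumption that no transversal field of degree \<open>?d\<close>
   exists, only the basis fields of degree above \<open>?d\<close>, indexed by \<open>J\<close>,
   contribute on \<open>hyp a\<close>.\<close>
 have zero: "a\<cdot>F i x=0" if "i < r" "i\<notin>J" "x\<in>hyp a" for i x
 proof (cases "e i < ?d")
  case True
  thus ?thesis using tang_div_zero[OF np Fi(1)[OF that(1)] Fi(3)[OF that(1)] _ that(3)] by blast
 next
  case False
  hence "e i=?d" using that by (auto simp: J_def)
  thus ?thesis using nok Fi[OF that(1)] that(3) unfolding step_ok_def by (metis image_subset_iff)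
 qed
 have "\<exists>g. hp (e i - ?d) g \<and> (\<forall>x\<in>hyp a. a\<cdot>F i x=B x * g x)" if "i < r" for i
  using tang_div[OF np R Fi(1)[OF that] Fi(3)[OF that]] cR by (simp add: B_def)
 then obtain g where g: "\<And>i. i < r ==> hp (e i - ?d) (g i)"
  "\<And>i x. i < r ==> x\<in>hyp a ==> a\<cdot>F i x=B x * g i x" by metis
 \<comment> \<open>The ideal generated on \<open>hyp a\<close> by the cofactors \<open>g i\<close>
   with \<open>i\<close> in \<open>J\<close>, degree by degree. All these generators have positive
   degree \<open>e i - ?d\<close>.\<close>
 define inI where "inI m f \<longleftrightarrow> (\<exists>c. (\<forall>i\<in>J. hq m (e i - ?d) (c i)) \<and>
   (\<forall>x\<in>hyp a. f x=(\<Sum>i\<in>J. c i x * g i x)))" for m f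
 have inI_add: "inI m (%x. f x + f' x)" if ff: "inI m f" "inI m f'" for m f f'
 proof -
  obtain c where c: "\<forall>i\<in>J. hq m (e i - ?d) (c i)"
   "\<forall>x\<in>hyp a. f x=(\<Sum>i\<in>J. c i x * g i x)" using ff(1) unfolding inI_def by blast
  obtain c' where c': "\<forall>i\<in>J. hq m (e i - ?d) (c' i)"
   "\<forall>x\<in>hyp a. f' x=(\<Sum>i\<in>J. c' i x * g i x)" using ff(2) unfolding inI_def by blast
  show ?thesis unfolding inI_def
  proof (intro exI[of _ "%i x. c i x + c' i x"] conjI ballI)
   fix i assume "i\<in>J"
   thus "hq m (e i - ?d) (%x. c i x + c' i x)"
    using c(1)[rule_format, of i] c'(1)[rule_format, of i] hp_add[of "m - (e i - ?d)" "c i" "c' i"]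
    by (cases "e i - ?d\<le>m") simp_all
  next
   fix x assume "x\<in>hyp a"
   thus "f x + f' x=(\<Sum>i\<in>J. (c i x + c' i x) * g i x)"
    using c(2) c'(2) by (simp add: distrib_right sum.distrib)
  qed
 qed
 have inI_mult: "inI (k + m) (%x. h x * f x)" if f: "inI m f" and h: "hp k h" for k m f h
 proof -
  obtain c where c: "\<forall>i\<in>J. hq m (e i - ?d) (c i)"
   "\<forall>x\<in>hyp a. f x=(\<Sum>i\<in>J. c i x * g i x)" using f unfolding inI_def by blast
  show ?thesis unfolding inI_def
  proof (intro exI[of _ "%i x. h x * c i x"] conjI ballI)
   fix i assume i: "i\<in>J"
   show "hq (k + m) (e i - ?d) (%x. h x * c i x)"
   proof (cases "e i - ?d\<le>m")
    case True
    hence "hp (k + (m - (e i - ?d))) (%x. h x * c i x)" using c(1) i by (intro hp_mult[OF h]) auto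
    thus ?thesis using True by simp
   next
    case False
    hence "c i=(%_. 0)" using c(1) i by auto
    thus ?thesis by (auto intro: hp_zero)
   qed
  next
   fix x assume "x\<in>hyp a"
   thus "h x * f x=(\<Sum>i\<in>J. (h x * c i x) * g i x)" using c(2) by (simp add: sum_distrib_left mult.assoc)
  qed
 qed
 have inI_cong: "inI m f'" if "inI m f" "\<And>x. x\<in>hyp a ==> f' x=f x" for m f f'
  using that unfolding inI_def by simp
 \<comment> \<open>Membership is read off from tangent fields: expand \<open>I\<close> in the basis,
   take the component along \<open>a\<close> and cancel the divisor \<open>B\<close>.\<close>
 have inI_field: "inI k f" if th: "hf (?d + k) I" "range I\<subseteq>E" "tang N I" "hp k f" "\<And>x. x\<in>hyp a ==> a\<cdot>I x=B x * f x" for k I f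
 proof -
  obtain c where c: "\<And>i. i < r ==> hq (?d + k) (e i) (c i)"
   "\<And>x. I x=(\<Sum>i<r. c i x*\<^sub>RF i x)" using fbasD(4)[OF fb th(1-3)] by blast
  have ch: "hq k (e i - ?d) (c i)" if "i\<in>J" for i
   using c(1)[of i] that by (auto simp: J_def add.commute split: if_splits)
  have hs: "hp k (%x. \<Sum>i\<in>J. c i x * g i x)"
  proof (rule hp_sum)
   fix i assume i: "i\<in>J"
   show "hp k (%x. c i x * g i x)"
   proof (cases "e i - ?d\<le>k")
    case True
    hence "hp (k - (e i - ?d) + (e i - ?d)) (%x. c i x * g i x)"
     using ch[OF i] g(1)[of i] i by (intro hp_mult) (auto simp: J_def)
    thus ?thesis using True by simp
   next
    case False
    thus ?thesis using ch[OF i] by (auto intro: hp_zero)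
   qed
  qed
  have "f x=(\<Sum>i\<in>J. c i x * g i x)" if "x\<in>hyp a" for x
  proof (rule hp_cancel[OF th(4) hs hB subspace_hyp Bnz _ that])
   fix x assume x: "x\<in>hyp a"
   have "B x * f x=(\<Sum>i<r. c i x * (a\<cdot>F i x))" using th(5)[OF x] c(2) by (simp add: inner_sum_right)
   also have "\<dots>=(\<Sum>i\<in>J. c i x * (a\<cdot>F i x))"
    using zero[OF _ _ x] by (intro sum.mono_neutral_right) (auto simp: J_def)
   also have "\<dots>=(\<Sum>i\<in>J. c i x * (B x * g i x))" using g(2)[OF _ x] by (intro sum.cong) (auto simp: J_def)
   finally show "B x * f x=B x * (\<Sum>i\<in>J. c i x * g i x)" by (simp add: sum_distrib_left mult_ac)
  qed
  thus ?thesis unfolding inI_def using ch by blast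
 qed
 \<comment> \<open>The transversal field of the localization at \<open>x0\<close> becomes tangent to
   all of \<open>N\<close> after multiplication by the forms not vanishing at \<open>x0\<close>. Of
   these forms, the ones outside \<open>R\<close> complete the local divisor to \<open>B\<close>,
   and the ones in \<open>R\<close> give the stated product.\<close>
 have local: "inI (card {b\<in>R. b\<cdot>x0~=0}) (%x. \<Prod>b\<in>{b\<in>R. b\<cdot>x0~=0}. b\<cdot>x)"
  if x0: "x0\<in>hyp a" "\<exists>v\<in>N. v\<cdot>x0~=0" for x0
 proof -
  define M where "M={v\<in>N. v\<cdot>x0=0}"
  have MN: "M\<subseteq>N" by (auto simp: M_def)
  have finM: "finite M" using MN finN finite_subset by blast
  have npM: "npar (insert a M)" "a\<notin>M" using npar_subset[OF np(1), of "insert a M"] MN np(2) by auto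
  obtain I w where t: "hf (dd M a) I" "range I\<subseteq>E" "tang M I" "w\<in>hyp a" "a\<cdot>I w~=0"
   using loc[OF x0] unfolding step_ok_def M_def by blast
  have cls: "v\<cdot>x0=0 \<longleftrightarrow> b\<cdot>x0=0" if "v\<in>N" "b\<in>N" "span {a, v}=span {a, b}" for v b
  proof -
   have 1: "v\<in>span {a, b}" using that(3) span_base[of v "{a, v}"] by auto
   have 2: "v\<notin>span {a}" by (rule npar_notin[OF np that(1)])
   from span2_eqI(2)[OF 1 2] obtain s t where "t~=0" "v=s*\<^sub>Ra + t*\<^sub>Rb" by blast
   thus ?thesis using x0(1) by (simp add: hyp_def inner_add_left)
  qed
  have trM: "trv a M (R\<inter>M)" unfolding trv_def
  proof (intro conjI)
   show "inj_on (%v. span {a, v}) (R\<inter>M)" using R unfolding trv_def by (meson inf_le1 inj_on_subset)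
   show "(%v. span {a, v}) ` (R\<inter>M)=(%v. span {a, v}) ` M"
   proof (intro subset_antisym subsetI)
    fix X assume "X\<in>(%v. span {a, v}) ` M"
    then obtain v where v: "v\<in>M" "X=span {a, v}" by blast
    hence "X\<in>(%v. span {a, v}) ` R" using R MN unfolding trv_def by auto
    then obtain b where b: "b\<in>R" "X=span {a, b}" by blast
    hence "b\<in>M" using cls[of v b] v MN RN by (auto simp: M_def)
    thus "X\<in>(%v. span {a, v}) ` (R\<inter>M)" using b by blast
   qed auto
  qed auto
  have cM: "card (M - R)=dd M a" using trv_card[OF trM finM] by (simp add: Diff_Int_distrib2 Diff_Int)
  obtain g0 where g0: "hp (dd M a - card (M - R\<inter>M)) g0" "\<And>x. x\<in>hyp a ==> a\<cdot>I x=(\<Prod>v\<in>M - R\<inter>M. v\<cdot>x) * g0 x"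
   using tang_div[OF npM trM t(1,3)] by blast
  have MR: "M - R\<inter>M=M - R" by auto
  obtain c where c: "g0=(%_. c)" using hp_0D g0(1) cM MR by auto
  have c0: "c~=0" using t(5) g0(2)[OF t(4)] c by auto
  let ?P = "{b\<in>R. b\<cdot>x0~=0}"
  define H where "H x=(\<Prod>v\<in>N - M. v\<cdot>x)*\<^sub>RI x" for x
  have NM: "N - M=(N - R - M)\<union>?P" "(N - R - M)\<inter>?P={}" using RN by (auto simp: M_def)
  have NR: "N - R=(N - R - M)\<union>(M - R)" "(N - R - M)\<inter>(M - R)={}" using MN by auto
  have fins: "finite (N - R - M)" "finite ?P" "finite (M - R)" using finN finR finM by auto
  have card1: "card (N - M)=card (N - R - M) + card ?P" using card_Un_disjoint[OF fins(1,2) NM(2)] NM(1) by simp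
  have card2: "?d=card (N - R - M) + dd M a" using card_Un_disjoint[OF fins(1,3) NR(2)] NR(1) cR cM by simp
  have "hf (card (N - M) + dd M a) H" unfolding H_def[abs_def] by (rule hf_scale[OF hp_prod_lin t(1)])
  hence 1: "hf (?d + card ?P) H" using card1 card2 by (simp add: add_ac)
  have 2: "range H\<subseteq>E" using t(2) E by (auto simp: H_def intro!: subspace_scale)
  have 3: "tang N H" unfolding tang_def
  proof (intro ballI)
   fix v x assume v: "v\<in>N" "x\<in>hyp v"
   show "v\<cdot>H x=0"
   proof (cases "v\<in>M")
    case True
    thus ?thesis using t(3) v(2) by (simp add: H_def tang_def)
   next
    case False
    have "(\<Prod>v\<in>N - M. v\<cdot>x)=0" using False v finN by (intro prod_zero bexI[of _ v]) (auto simp: hyp_def)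
    thus ?thesis by (simp add: H_def)
   qed
  qed
  have 4: "hp (card ?P) (%x. c * (\<Prod>b\<in>?P. b\<cdot>x))" by (rule hp_cmult[OF hp_prod_lin])
  have 5: "a\<cdot>H x=B x * (c * (\<Prod>b\<in>?P. b\<cdot>x))" if x: "x\<in>hyp a" for x
  proof -
   have "a\<cdot>H x=(\<Prod>v\<in>N - M. v\<cdot>x) * ((\<Prod>v\<in>M - R. v\<cdot>x) * c)" using g0(2)[OF x] c MR by (simp add: H_def)
   also have "(\<Prod>v\<in>N - M. v\<cdot>x)=(\<Prod>v\<in>N - R - M. v\<cdot>x) * (\<Prod>b\<in>?P. b\<cdot>x)"
    unfolding NM(1) by (rule prod.union_disjoint[OF fins(1,2) NM(2)])
   also have "(\<Prod>v\<in>N - R - M. v\<cdot>x) * (\<Prod>b\<in>?P. b\<cdot>x) * ((\<Prod>v\<in>M - R. v\<cdot>x) * c) =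
     ((\<Prod>v\<in>N - R - M. v\<cdot>x) * (\<Prod>v\<in>M - R. v\<cdot>x)) * (c * (\<Prod>b\<in>?P. b\<cdot>x))" by (simp add: mult_ac)
   also have "(\<Prod>v\<in>N - R - M. v\<cdot>x) * (\<Prod>v\<in>M - R. v\<cdot>x)=B x"
   by (metis B_def prod.union_disjoint fins NR arg_cong)
   finally show ?thesis .
  qed
  from inI_mult[OF inI_field[OF 1 2 3 4 5] hp_const[of "1/c"]] show ?thesis using c0 by simp
 qed
 \<comment> \<open>Induction from large \<open>C\<close> to small. If some \<open>x0\<close> kills
   \<open>R - C\<close> but not all of \<open>R\<close>, then \<open>local\<close> supplies a factor
   of the product over \<open>C\<close>. Otherwise each form in \<open>C\<close> is, on
   \<open>hyp a\<close>, a combination of the forms in \<open>R - C\<close>, for which the induction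
   hypothesis is available. Singletons \<open>C\<close> give the powers of single forms.\<close>
 have rad: "\<exists>t\<ge>1. inI (t * card C) (%x. \<Prod>b\<in>C. (b\<cdot>x) ^ t)" if "C\<subseteq>R" "C~={}" for C using that
 proof (induction "card (R - C)" arbitrary: C rule: less_induct)
  case less
  have finC: "finite C" using less(2) finR finite_subset by blast
  show ?case
  proof (cases "\<exists>x0\<in>hyp a. (\<forall>b\<in>R - C. b\<cdot>x0=0) \<and> (\<exists>b\<in>R. b\<cdot>x0~=0)")
   case True
   then obtain x0 where x0: "x0\<in>hyp a" "\<forall>b\<in>R - C. b\<cdot>x0=0" "\<exists>b\<in>R. b\<cdot>x0~=0" by blast
   let ?P = "{b\<in>R. b\<cdot>x0~=0}"
   have PC: "?P\<subseteq>C" using x0(2) by blast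
   have "inI (card (C - ?P) + card ?P) (%x. (\<Prod>b\<in>C - ?P. b\<cdot>x) * (\<Prod>b\<in>?P. b\<cdot>x))"
    using x0 RN by (intro inI_mult local hp_prod_lin) auto
   moreover have "card (C - ?P) + card ?P=card C"
    using PC finC by (metis (no_types, lifting) add.commute card_Diff_subset card_mono finite_subset le_add_diff_inverse)
   moreover have "(\<Prod>b\<in>C - ?P. b\<cdot>x) * (\<Prod>b\<in>?P. b\<cdot>x)=(\<Prod>b\<in>C. b\<cdot>x)" for x
    by (rule prod.subset_diff[OF PC finC, symmetric])
   ultimately show ?thesis by (intro exI[of _ 1]) simp
  next
   case False
   obtain G where G: "G\<in>C" using less(3) by blast
   have "G\<in>span (insert a (R - C))"
   proof (rule ccontr)
    assume "G\<notin>span (insert a (R - C))"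
    from ortho_witness[OF this] obtain x where "\<forall>y\<in>insert a (R - C). y\<cdot>x=0" "G\<cdot>x~=0" by blast
    thus False using False G less(2) by (auto simp: hyp_def)
   qed
   then obtain k where "G - k*\<^sub>Ra\<in>span (R - C)" by (auto simp: span_insert)
   then obtain u where u: "G - k*\<^sub>Ra=(\<Sum>b\<in>R - C. u b*\<^sub>Rb)" using span_finite[of "R - C"] finR by auto
   have Gx: "G\<cdot>x=(\<Sum>b\<in>R - C. u b * (b\<cdot>x))" if "x\<in>hyp a" for x
   proof -
    have "(G - k*\<^sub>Ra)\<cdot>x=G\<cdot>x" using that by (simp add: hyp_def inner_diff_left)
    thus ?thesis unfolding u by (simp add: inner_sum_left)
   qed
   have "\<exists>t\<ge>1. inI (t * card (insert b C)) (%x. \<Prod>l\<in>insert b C. (l\<cdot>x) ^ t)" if b: "b\<in>R - C" for b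
   proof (rule less(1))
    have "R - insert b C \<subset> R - C" using b by auto
    thus "card (R - insert b C) < card (R - C)" using finR by (intro psubset_card_mono) auto
   qed (use b less(2) in auto)
   then obtain \<tau> where \<tau>: "\<And>b. b\<in>R - C ==> \<tau> b\<ge>1 \<and> inI (\<tau> b * card (insert b C)) (%x. \<Prod>l\<in>insert b C. (l\<cdot>x) ^ \<tau> b)"
    by metis
   define T where "T=Suc (\<Sum>b\<in>R - C. \<tau> b)"
   have T\<tau>: "\<tau> b\<le>T" if "b\<in>R - C" for b using member_le_sum[OF that, of \<tau>] finR by (simp add: T_def)
   \<comment> \<open>The ideal quotient by the \<open>T\<close>-th power of the product over
     \<open>C\<close>. By induction it contains a power of each \<open>b\<close> in
     \<open>R - C\<close>, hence by \<open>binomial_closure\<close> a power of their combination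
     \<open>G\<close>.\<close>
   define K where "K m f \<longleftrightarrow> inI (T * card C + m) (%x. (\<Prod>l\<in>C. (l\<cdot>x) ^ T) * f x)" for m f
   have K_add: "K m (%x. f x + f' x)" if "K m f" "K m f'" for m f f'
    using inI_add that unfolding K_def distrib_left by blast
   have K_mult: "K (k + m) (%x. h x * f x)" if "K m f" "hp k h" for m k f h
    using inI_mult[OF that(1)[unfolded K_def] that(2)] unfolding K_def by (simp add: add_ac mult_ac)
   have hC: "hp (n * card D) (%x. \<Prod>l\<in>D. (l\<cdot>x) ^ n)" if "finite D" for n and D :: "'a set"
   proof -
    have "hp (\<Sum>l\<in>D. n) (%x. \<Prod>l\<in>D. (l\<cdot>x) ^ n)"
     by (rule hp_prod[OF that]) (use hp_power[OF hp_linear, of n] in simp)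
    thus ?thesis by (simp add: mult.commute)
   qed
   have Kb: "K T (%x. (b\<cdot>x) ^ T)" if b: "b\<in>R - C" for b
   proof -
    let ?D = "insert b C" and ?n = "T - \<tau> b"
    have fD: "finite ?D" "b\<notin>C" using finC b by auto
    have "inI (?n * card ?D + \<tau> b * card ?D) (%x. (\<Prod>l\<in>?D. (l\<cdot>x) ^ ?n) * (\<Prod>l\<in>?D. (l\<cdot>x) ^ \<tau> b))"
     using \<tau>[OF b] by (intro inI_mult hC fD) auto
    moreover have "?n * card ?D + \<tau> b * card ?D=T * card C + T"
     using T\<tau>[OF b] fD finC by (simp flip: add_mult_distrib)
    moreover have "(\<Prod>l\<in>?D. (l\<cdot>x) ^ ?n) * (\<Prod>l\<in>?D. (l\<cdot>x) ^ \<tau> b)=(\<Prod>l\<in>C. (l\<cdot>x) ^ T) * (b\<cdot>x) ^ T" for x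
    proof -
     have "(\<Prod>l\<in>?D. (l\<cdot>x) ^ ?n) * (\<Prod>l\<in>?D. (l\<cdot>x) ^ \<tau> b)=(\<Prod>l\<in>?D. (l\<cdot>x) ^ T)"
      using T\<tau>[OF b] by (simp flip: prod.distrib power_add)
     thus ?thesis using fD finC by simp
    qed
    ultimately show ?thesis unfolding K_def by simp
   qed
   have Kpow: "\<exists>M. K M (%x. (\<Sum>b\<in>Q. u b * (b\<cdot>x)) ^ M)" if "finite Q" "Q\<subseteq>R - C" for Q using that
   proof (induction Q rule: finite_induct)
    case empty
    have "inI (T * card C + 1) (%x. 0)" unfolding inI_def by (intro exI[of _ "%_ _. 0"]) (auto intro: hp_zero)
    thus ?case by (intro exI[of _ 1]) (simp add: K_def)
   next
    case (insert b Q)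
    then obtain M where M: "K M (%x. (\<Sum>b\<in>Q. u b * (b\<cdot>x)) ^ M)" by blast
    have h1: "hp 1 (%x. \<Sum>b\<in>Q. u b * (b\<cdot>x))" using hp_linear by (intro hp_sum hp_cmult) simp
    have h2: "hp 1 (%x. u b * (b\<cdot>x))" using hp_linear by (intro hp_cmult) simp
    have "K (0 + T) (%x. u b ^ T * (b\<cdot>x) ^ T)" using insert(4) by (intro K_mult Kb hp_const) auto
    hence "K T (%x. (u b * (b\<cdot>x)) ^ T)" by (simp add: power_mult_distrib)
    moreover have T1: "T\<ge>1" by (simp add: T_def)
    ultimately have K1: "K (M + T) (%x. ((\<Sum>b\<in>Q. u b * (b\<cdot>x)) + u b * (b\<cdot>x)) ^ (M + T))"
     using binomial_closure[of K, OF K_add K_mult h1 M h2] by blast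
    have eq: "(\<Sum>l\<in>Q. u l * (l\<cdot>x)) + u b * (b\<cdot>x)=(\<Sum>l\<in>insert b Q. u l * (l\<cdot>x))" for x
     unfolding sum.insert[OF insert(1,2)] by (rule add.commute)
    show ?case by (rule exI[of _ "M + T"], rule K1[unfolded eq])
   qed
   obtain M where M: "K M (%x. (\<Sum>b\<in>R - C. u b * (b\<cdot>x)) ^ M)"
    using Kpow[OF finite_Diff[OF finR] order_refl] by blast
   have A: "inI (M * card (C - {G}) + (T * card C + M)) (%x. (\<Prod>l\<in>C - {G}. (l\<cdot>x) ^ M) * ((\<Prod>l\<in>C. (l\<cdot>x) ^ T) * (\<Sum>b\<in>R - C. u b * (b\<cdot>x)) ^ M))"
    by (rule inI_mult[OF M[unfolded K_def] hC]) (use finC in simp)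
   have "card C=Suc (card (C - {G}))" by (rule card.remove[OF finC G])
   hence E: "M * card (C - {G}) + (T * card C + M)=(T + M) * card C" by (simp add: algebra_simps)
   have "(\<Prod>l\<in>C. (l\<cdot>x) ^ (T + M))=(\<Prod>l\<in>C - {G}. (l\<cdot>x) ^ M) * ((\<Prod>l\<in>C. (l\<cdot>x) ^ T) * (\<Sum>b\<in>R - C. u b * (b\<cdot>x)) ^ M)"
    if x: "x\<in>hyp a" for x
   proof -
    have 1: "(\<Prod>l\<in>C. (l\<cdot>x) ^ (T + M))=(\<Prod>l\<in>C. (l\<cdot>x) ^ T) * (\<Prod>l\<in>C. (l\<cdot>x) ^ M)"
     by (simp only: power_add prod.distrib)
    have 2: "(\<Prod>l\<in>C. (l\<cdot>x) ^ M)=(G\<cdot>x) ^ M * (\<Prod>l\<in>C - {G}. (l\<cdot>x) ^ M)" by (rule prod.remove[OF finC G])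
    show ?thesis unfolding 1 2 Gx[OF x] by (simp only: mult_ac)
   qed
   from inI_cong[OF A[unfolded E] this]
   have "inI ((T + M) * card C) (%x. \<Prod>l\<in>C. (l\<cdot>x) ^ (T + M))" .
   thus ?thesis by (intro exI[of _ "T + M"]) (simp add: T_def)
  qed
 qed
 have "\<exists>t\<ge>1. inI t (%x. (b\<cdot>x) ^ t)" if "b\<in>R" for b using rad[of "{b}"] that by simp
 then obtain \<tau> where \<tau>: "\<And>b. b\<in>R ==> inI (\<tau> b) (%x. (b\<cdot>x) ^ \<tau> b)" by metis
 define s where "s=(\<Sum>b\<in>R. \<tau> b)"
 have pow: "inI s (%x. (b\<cdot>x) ^ s)" if "b\<in>R" for b
 proof -
  have le: "\<tau> b\<le>s" using member_le_sum[OF that, of \<tau>] finR by (simp add: s_def)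
  have "inI (Suc 0 * (s - \<tau> b) + \<tau> b) (%x. (b\<cdot>x) ^ (s - \<tau> b) * (b\<cdot>x) ^ \<tau> b)"
   by (intro inI_mult \<tau> that hp_power hp_linear)
  thus ?thesis using le by (simp flip: power_add)
 qed
 have a0: "a~=0" using np by (auto simp: npar_def)
 \<comment> \<open>A basis of the span of all normals consisting of \<open>a\<close> and members of
   \<open>R\<close>. The latter are independent on \<open>hyp a\<close>, and powers of them are in
   the ideal.\<close>
 obtain B' where B': "{a}\<subseteq>B'" "B'\<subseteq>insert a R" "independent B'" "insert a R\<subseteq>span B'"
  using maximal_independent_subset_extend[of "{a}" "insert a R"] a0 by auto
 have "N\<subseteq>span (insert a R)"
 proof
  fix v assume "v\<in>N"
  hence "span {a, v}\<in>(%v. span {a, v}) ` R" using R by (auto simp: trv_def)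
  then obtain b where b: "b\<in>R" "span {a, v}=span {a, b}" by blast
  hence "v\<in>span {a, b}" using span_base[of v "{a, v}"] by auto
  thus "v\<in>span (insert a R)" using span_mono[of "{a, b}" "insert a R"] b(1) by auto
 qed
 hence "insert a N\<subseteq>span B'" using B'(4) by (metis insert_subset order_trans span_minimal subspace_span)
 hence "dim (insert a N)\<le>card B'"
  using dim_le_card[of "insert a N" B'] B'(3) independent_imp_finite by blast
 hence qle: "q\<le>card (B' - {a})" using dim B'(1) by simp
 have ins: "insert a (B' - {a})=B'" using B'(1) by auto
 have "finite (B' - {a})" using independent_imp_finite[OF B'(3)] by simp
 note dv = dual_vectors[of a "B' - {a}" q, unfolded ins, OF B'(3) _ qle this]
 obtain y w where yw: "\<And>i. i < q ==> y i\<in>B' - {a} \<and> w i\<in>hyp a"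
  "\<And>i j. i < q ==> j < q ==> y i\<cdot>w j=(if i=j then 1 else 0)" using dv by blast
 have wH: "span (w ` {..<q})\<subseteq>hyp a" using yw(1) by (intro span_minimal subspace_hyp) auto
 have "q\<le>card J"
 proof (rule graded_dimension[where y = y and w = w and g = g and \<delta> = "%i. e i - ?d" and s = s, OF yw(2) finJ])
  fix i assume i: "i < q"
  have "y i\<in>R" using yw(1)[OF i] B'(2) by auto
  from pow[OF this] show "\<exists>f. (\<forall>j\<in>J. hq s (e j - ?d) (f j)) \<and>
    (\<forall>x\<in>span (w ` {..<q}). (y i\<cdot>x) ^ s=(\<Sum>j\<in>J. f j x * g j x))" unfolding inI_def using wH by blast
 qed (use g(1) in \<open>auto simp: J_def\<close>)
 thus False using few unfolding J_def by simp
qed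

section \<open>Root systems and heights\<close>

definition cn :: "'v::euclidean_space => 'v => real" where
 "cn b a=2 * (b\<cdot>a) / (a\<cdot>a)"

text \<open>In contrast to \<open>root_system\<close>, the roots may span a proper subspace, so that
  subsystems cut out by subspaces or congruences are again instances in the same space.\<close>

definition rs :: "'v::euclidean_space set => bool" where
 "rs R \<longleftrightarrow> finite R \<and> 0\<notin>R \<and> (\<forall>a\<in>R. R\<inter>span {a}={a, - a}) \<and>
   (\<forall>a\<in>R. \<forall>b\<in>R. refl_along a b\<in>R) \<and> (\<forall>a\<in>R. \<forall>b\<in>R. cn b a\<in>\<int>)"

definition pos :: "'v::euclidean_space set => 'v => 'v set" where
 "pos R g={a\<in>R. a\<cdot>g > 0}"

definition smp :: "'v::euclidean_space set => 'v => 'v set" where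
 "smp R g={a\<in>pos R g. \<not> (\<exists>b\<in>pos R g. \<exists>c\<in>pos R g. a=b + c)}"

text \<open>Half the sum of the positive coroots, so that \<open>b \<cdot> rho R g\<close> is the height of \<open>b\<close>.\<close>

definition rho :: "'v::euclidean_space set => 'v => 'v" where
 "rho R g=(\<Sum>c\<in>pos R g. (1 / (c\<cdot>c))*\<^sub>Rc)"

lemma refl_cn: "refl_along a b=b - cn b a*\<^sub>Ra" by (simp add: refl_along_def cn_def)

lemma refl_inner: "refl_along a x\<cdot>refl_along a y=x\<cdot>y"
by (auto simp: refl_along_def inner_diff_left inner_diff_right inner_commute field_simps)

lemma linear_refl: "linear (refl_along a)" unfolding refl_along_def
 by (rule linearI) (auto simp: algebra_simps inner_add_left add_divide_distrib)

lemma refl_refl: "refl_along a (refl_along a x)=x"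
 by (cases "a=0") (simp_all add: refl_along_def inner_diff_left)

lemma refl_adj: "refl_along a x\<cdot>y=x\<cdot>refl_along a y"
 using refl_inner[of a x "refl_along a y"] by (simp add: refl_refl)

text \<open>Separate the positive coefficients of a relation from the others: the vector common to
  both sides has non-positive square, so it is 0, and pairing with \<open>g\<close> then kills every
  coefficient.\<close>

lemma obtuse_independent:
 fixes S :: "'v::euclidean_space set"
 assumes "finite S" "\<And>a b. a\<in>S ==> b\<in>S ==> a~=b ==> a\<cdot>b\<le>0" "\<And>a. a\<in>S ==> a\<cdot>g > 0"
 shows "independent S"
proof (rule independent_if_scalars_zero[OF assms(1)])
 fix u a assume u: "(\<Sum>a\<in>S. u a*\<^sub>Ra)=0" and a: "a\<in>S"
 let ?P = "{a\<in>S. u a > 0}" and ?N = "{a\<in>S. \<not> u a > 0}"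
 let ?x = "\<Sum>a\<in>?P. u a*\<^sub>Ra"
 have fin: "finite ?P" "finite ?N" using assms(1) by auto
 have "(\<Sum>a\<in>S. u a*\<^sub>Ra)=?x + (\<Sum>a\<in>?N. u a*\<^sub>Ra)"
  using assms(1) by (subst sum.union_disjoint[symmetric]) (auto intro!: sum.cong)
 hence x2: "?x=(\<Sum>b\<in>?N. (- u b)*\<^sub>Rb)" using u by (simp add: sum_negf eq_neg_iff_add_eq_0)
 have "?x\<cdot>?x=(\<Sum>a\<in>?P. u a*\<^sub>Ra)\<cdot>(\<Sum>b\<in>?N. (- u b)*\<^sub>Rb)" using x2 by metis
 also have "\<dots>=(\<Sum>b\<in>?N. \<Sum>a\<in>?P. (- u b) * (u a * (a\<cdot>b)))"
  by (simp only: inner_sum_left inner_sum_right inner_scaleR_left inner_scaleR_right sum_distrib_left)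
 also have "\<dots>\<le>0"
 proof (intro sum_nonpos)
  fix b a assume "b\<in>?N" "a\<in>?P"
  hence "a\<cdot>b\<le>0" "u a\<ge>0" "- u b\<ge>0" using assms(2)[of a b] by auto
  thus "(- u b) * (u a * (a\<cdot>b))\<le>0" by (intro mult_nonneg_nonpos)
 qed
 finally have "?x\<cdot>?x\<le>0" .
 hence x0: "?x=0" using inner_gt_zero_iff[of ?x] by linarith
 have ug: "u a * (a\<cdot>g)=0" if "a\<in>?P" for a
 proof -
  have "(\<Sum>a\<in>?P. u a * (a\<cdot>g))=?x\<cdot>g" by (simp only: inner_sum_left inner_scaleR_left)
  also have "\<dots>=0" unfolding x0 by simp
  finally show ?thesis using sum_nonneg_eq_0_iff[OF fin(1), of "%a. u a * (a\<cdot>g)"] assms(3) that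
   by (simp add: less_imp_le)
 qed
 have un: "(- u b) * (b\<cdot>g)=0" if "b\<in>?N" for b
 proof -
  have "(\<Sum>b\<in>?N. (- u b) * (b\<cdot>g))=(\<Sum>b\<in>?N. (- u b)*\<^sub>Rb)\<cdot>g" by (simp only: inner_sum_left inner_scaleR_left)
  also have "\<dots>=0" unfolding x2[symmetric] x0 by simp
  finally show ?thesis using sum_nonneg_eq_0_iff[OF fin(2), of "%b. (- u b) * (b\<cdot>g)"] assms(3) that
   by (simp add: mult_nonpos_nonneg less_imp_le)
 qed
 have P: "\<forall>a\<in>?P. u a * (a\<cdot>g)=0" using ug by blast
 have N: "\<forall>b\<in>?N. (- u b) * (b\<cdot>g)=0" using un by blast
 show "u a=0" using P N a assms(3)[OF a] by force
qed

lemma rsD: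
 assumes "rs R"
 shows "finite R" "0\<notin>R" "\<And>a b. a\<in>R ==> b\<in>R ==> refl_along a b\<in>R"
  "\<And>a b. a\<in>R ==> b\<in>R ==> cn b a\<in>\<int>"
  "\<And>a b. a\<in>R ==> b\<in>R ==> b\<in>span {a} ==> b=a \<or> b=- a"
  "\<And>a. a\<in>R ==> - a\<in>R"
proof -
 show "finite R" "0\<notin>R" "\<And>a b. a\<in>R ==> b\<in>R ==> refl_along a b\<in>R"
  "\<And>a b. a\<in>R ==> b\<in>R ==> cn b a\<in>\<int>" using assms unfolding rs_def by simp_all
 have *: "R\<inter>span {a}={a, - a}" if "a\<in>R" for a using assms that unfolding rs_def by simp
 show "b=a \<or> b=- a" if "a\<in>R" "b\<in>R" "b\<in>span {a}" for a b using *[OF that(1)] that(2,3) by blast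
 show "- a\<in>R" if "a\<in>R" for a using *[OF that] by blast
qed

lemma rs_subset:
 assumes "rs R" "R'\<subseteq>R" "\<And>u. u\<in>R' ==> - u\<in>R'"
  "\<And>u c. u\<in>R' ==> c\<in>R' ==> refl_along u c\<in>R'"
 shows "rs R'" unfolding rs_def
proof (intro conjI ballI)
 show "finite R'" using rsD(1)[OF assms(1)] assms(2) finite_subset by blast
 show "0\<notin>R'" using rsD(2)[OF assms(1)] assms(2) by blast
 fix u assume a: "u\<in>R'"
 show "R'\<inter>span {u}={u, - u}"
 proof
  show "R'\<inter>span {u}\<subseteq>{u, - u}" using rsD(5)[OF assms(1)] assms(2) a by auto
  show "{u, - u}\<subseteq>R'\<inter>span {u}" using a assms(3) by (auto intro: span_base span_neg)
 qed
 fix c assume b: "c\<in>R'"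
 show "refl_along u c\<in>R'" using assms(4) a b by blast
 show "cn c u\<in>\<int>" using rsD(4)[OF assms(1)] a b assms(2) by blast
qed

lemma rs_Int_subspace:
 assumes "rs R" "subspace S"
 shows "rs (R\<inter>S)" using assms rsD(3,6)[OF assms(1)]
 by (intro rs_subset[OF assms(1)]) (auto simp: refl_cn subspace_diff subspace_scale subspace_neg)

text \<open>These are the gradients of the affine roots that vanish at \<open>p\<close> (up to sign
  of \<open>p\<close>, which does not change integrality).\<close>

lemma rs_congruence:
 assumes "rs R"
 shows "rs {c\<in>R. c\<cdot>p\<in>\<int>}"
proof (rule rs_subset[OF assms])
 fix a b assume "a\<in>{c\<in>R. c\<cdot>p\<in>\<int>}" "b\<in>{c\<in>R. c\<cdot>p\<in>\<int>}"
 thus "refl_along a b\<in>{c\<in>R. c\<cdot>p\<in>\<int>}"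
  using rsD(3,4)[OF assms, of a b] by (auto simp: refl_cn inner_diff_left)
qed (use rsD(6)[OF assms] in auto)

text \<open>By strict Cauchy-Schwarz the product of the two positive Cartan integers is less than 4,
  so one of them is 1, and the corresponding reflection produces the difference up to sign.\<close>

lemma root_sub:
 assumes "rs R" "a\<in>R" "b\<in>R" "a\<cdot>b > 0" "a~=b"
 shows "a - b\<in>R"
proof -
 have nz: "a\<cdot>a > 0" "b\<cdot>b > 0" using rsD(2)[OF assms(1)] assms(2,3) by auto
 have "b\<notin>span {a}"
 proof
  assume "b\<in>span {a}"
  hence "b=a \<or> b=- a" using rsD(5)[OF assms(1-3)] by blast
  thus False using assms(4,5) nz by auto
 qed
 hence "(a\<cdot>a)*\<^sub>Rb - (a\<cdot>b)*\<^sub>Ra~=0"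
 proof (rule contrapos_nn)
  assume "(a\<cdot>a)*\<^sub>Rb - (a\<cdot>b)*\<^sub>Ra=0"
  hence e: "(a\<cdot>a)*\<^sub>Rb=(a\<cdot>b)*\<^sub>Ra" by simp
  have "b=(1 / (a\<cdot>a))*\<^sub>R((a\<cdot>a)*\<^sub>Rb)" using nz by simp
  also have "\<dots>=((a\<cdot>b) / (a\<cdot>a))*\<^sub>Ra" unfolding e by simp
  finally have "b=((a\<cdot>b) / (a\<cdot>a))*\<^sub>Ra" .
  thus "b\<in>span {a}" using in_span1 by blast
 qed
 hence "((a\<cdot>a)*\<^sub>Rb - (a\<cdot>b)*\<^sub>Ra)\<cdot>((a\<cdot>a)*\<^sub>Rb - (a\<cdot>b)*\<^sub>Ra) > 0" by (rule inner_gt_zero_iff[THEN iffD2])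
 moreover have "((a\<cdot>a)*\<^sub>Rb - (a\<cdot>b)*\<^sub>Ra)\<cdot>((a\<cdot>a)*\<^sub>Rb - (a\<cdot>b)*\<^sub>Ra)
   = (a\<cdot>a) * ((a\<cdot>a) * (b\<cdot>b) - (a\<cdot>b) * (a\<cdot>b))"
  by (simp add: inner_diff_left inner_diff_right inner_commute[of b a] right_diff_distrib mult_ac)
 ultimately have lt: "(a\<cdot>b) * (a\<cdot>b) < (a\<cdot>a) * (b\<cdot>b)" using nz by (simp add: zero_less_mult_iff)
 have prod: "cn a b * cn b a < 4"
 proof -
  have "cn a b * cn b a=4 * ((a\<cdot>b) * (a\<cdot>b)) / ((a\<cdot>a) * (b\<cdot>b))" by (simp add: cn_def inner_commute)
  thus ?thesis using lt nz by (simp add: divide_less_eq)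
 qed
 obtain m n :: int where mn: "cn a b = of_int m" "cn b a = of_int n"
  using rsD(4)[OF assms(1)] assms(2,3) by (metis Ints_cases)
 have "cn a b > 0" "cn b a > 0" using assms(4) nz by (simp_all add: cn_def inner_commute)
 hence mn0: "m\<ge>1" "n\<ge>1" using mn by auto
 have "m * n < 4" using prod mn by (metis of_int_less_iff of_int_mult of_int_numeral)
 hence "m=1 \<or> n=1"
 proof -
  have "\<not> (2\<le>m \<and> 2\<le>n)"
  proof
   assume "2\<le>m \<and> 2\<le>n"
   hence "2 * 2\<le>m * n" by (intro mult_mono) auto
   thus False using \<open>m * n < 4\<close> by simp
  qed
  thus ?thesis using mn0 by linarith
 qed
 thus ?thesis
 proof
  assume "m=1"
  hence "refl_along b a=a - b" by (simp add: refl_cn mn)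
  thus ?thesis using rsD(3)[OF assms(1,3,2)] by simp
 next
  assume "n=1"
  hence "refl_along a b=- (a - b)" by (simp add: refl_cn mn)
  thus ?thesis using rsD(3)[OF assms(1,2,3)] rsD(6)[OF assms(1), of "- (a - b)"] by simp
 qed
qed

lemma root_add:
 assumes "rs R" "a\<in>R" "b\<in>R" "a\<cdot>b < 0" "a~=- b"
 shows "a + b\<in>R" using root_sub[OF assms(1,2) rsD(6)[OF assms(1,3)]] assms(4,5) by simp

section \<open>Positive roots, simple roots and heights for a generic direction\<close>

locale rsys =
 fixes R :: "'v::euclidean_space set" and g :: 'v
 assumes rs: "rs R" and g: "\<And>a. a\<in>R ==> a\<cdot>g~=0"
begin

abbreviation "Pos \<equiv> pos R g"
abbreviation "Smp \<equiv> smp R g"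
abbreviation "ht b \<equiv> b\<cdot>rho R g"

lemma finP: "finite (Pos)" using rsD(1)[OF rs] by (simp add: pos_def)
lemma posD: "b\<in>Pos ==> b\<in>R" "b\<in>Pos ==> b\<cdot>g > 0" by (auto simp: pos_def)
lemma smpD: "b\<in>Smp ==> b\<in>Pos" by (auto simp: smp_def)
lemma finS: "finite (Smp)" by (rule finite_subset[OF _ finP]) (auto simp: smp_def)
lemma pos_neg: "b\<in>R ==> b\<notin>Pos ==> - b\<in>Pos" using g[of b] rsD(6)[OF rs] by (auto simp: pos_def)
lemma nz: "b\<in>R ==> b~=0" "b\<in>R ==> b\<cdot>b > 0" using rsD(2)[OF rs] by auto

lemma pos_coeffs: "b\<in>Pos ==> \<exists>f::'v => nat. b=(\<Sum>a\<in>Smp. of_nat (f a)*\<^sub>Ra)"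
proof (induction "card {c\<in>Pos. c\<cdot>g < b\<cdot>g}" arbitrary: b rule: less_induct)
 case less
 show ?case
 proof (cases "b\<in>Smp")
  case True
  have "(\<Sum>a\<in>Smp. of_nat (if a=b then 1 else 0)*\<^sub>Ra)=(\<Sum>a\<in>Smp. if a=b then b else 0)"
   by (intro sum.cong) auto
  also have "\<dots>=b" using True finS by simp
  finally have "b=(\<Sum>a\<in>Smp. of_nat (if a=b then 1 else 0)*\<^sub>Ra)" by (rule sym)
  thus ?thesis by (rule exI[where x = "%a. if a=b then 1 else 0"])
 next
  case False
  then obtain c d where cd: "c\<in>Pos" "d\<in>Pos" "b=c + d" using less(2) by (auto simp: smp_def)
  have sm: "card {x\<in>Pos. x\<cdot>g < e\<cdot>g} < card {x\<in>Pos. x\<cdot>g < b\<cdot>g}"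
   if "e\<in>Pos" "e\<cdot>g < b\<cdot>g" for e using that finP by (intro psubset_card_mono) auto
  have "c\<cdot>g < b\<cdot>g" "d\<cdot>g < b\<cdot>g" using cd posD(2) by (simp_all add: inner_add_left)
  then obtain f f' :: "'v => nat" where "c=(\<Sum>a\<in>Smp. of_nat (f a)*\<^sub>Ra)" "d=(\<Sum>a\<in>Smp. of_nat (f' a)*\<^sub>Ra)"
   using less(1)[OF sm[OF cd(1)] cd(1)] less(1)[OF sm[OF cd(2)] cd(2)] by metis
  hence "b=(\<Sum>a\<in>Smp. of_nat (f a + f' a)*\<^sub>Ra)" using cd(3) by (simp add: scaleR_add_left sum.distrib)
  thus ?thesis by (intro exI[of _ "%a. f a + f' a"])
 qed
qed

lemma smp_obtuse:
 assumes "a\<in>Smp" "b\<in>Smp" "a~=b"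
 shows "a\<cdot>b\<le>0"
proof (rule ccontr)
 assume "\<not> a\<cdot>b\<le>0"
 hence ab: "a - b\<in>R" using root_sub[OF rs] assms smpD posD by (meson not_le)
 show False
 proof (cases "a - b\<in>Pos")
  case True
  have "a=(a - b) + b" by simp
  thus False using True assms(1,2) smpD unfolding smp_def by blast
 next
  case False
  have "b - a\<in>Pos" using pos_neg[OF ab False] by simp
  moreover have "b=(b - a) + a" by simp
  ultimately show False using assms(1,2) smpD unfolding smp_def by blast
 qed
qed

lemma smp_indep: "independent (Smp)"
 by (rule obtuse_independent[OF finS smp_obtuse]) (auto dest: smpD posD)

lemma smp_coeff_unique:
 assumes "(\<Sum>a\<in>Smp. u a*\<^sub>Ra)=(\<Sum>a\<in>Smp. v a*\<^sub>Ra)" "a\<in>Smp"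
 shows "u a=v a"
proof -
 have "(\<Sum>a\<in>Smp. (u a - v a)*\<^sub>Ra)=0" using assms(1) by (simp add: scaleR_diff_left sum_subtractf)
 from independentD[OF smp_indep finS order_refl this assms(2)] have "u a - v a=0" .
 thus ?thesis by simp
qed

lemma smp_span: "span (Smp)=span R"
proof
 show "span (Smp)\<subseteq>span R" using smpD posD by (intro span_mono) auto
 have "b\<in>span (Smp)" if b: "b\<in>Pos" for b
 proof -
  obtain f :: "'v => nat" where "b=(\<Sum>a\<in>Smp. of_nat (f a)*\<^sub>Ra)" using pos_coeffs[OF b] by blast
  thus ?thesis by (auto intro: span_sum span_scale span_base)
 qed
 hence P: "b\<in>span (Smp)" if "b\<in>Pos" for b using that by simp
 have "b\<in>span (Smp)" if b: "b\<in>R" for b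
 proof (cases "b\<in>Pos")
  case False
  from span_neg[OF P[OF pos_neg[OF b False]]] show ?thesis by simp
 qed (rule P)
 hence "R\<subseteq>span (Smp)" by (rule subsetI)
 thus "span R\<subseteq>span (Smp)" by (rule span_minimal[OF _ subspace_span])
qed

lemma card_smp: "card (Smp)=dim R" using dim_eq_card[OF smp_span smp_indep] by simp

lemma refl_smp:
 assumes "a\<in>Smp" "b\<in>Pos" "b~=a"
 shows "refl_along a b\<in>Pos" "refl_along a b~=a"
proof -
 have a: "a\<in>R" "a\<cdot>g > 0" using smpD[OF assms(1)] posD by auto
 have b: "b\<in>R" "b\<cdot>g > 0" using assms(2) posD by auto
 have rR: "refl_along a b\<in>R" using rsD(3)[OF rs a(1) b(1)] .
 obtain f :: "'v => nat" where f: "b=(\<Sum>c\<in>Smp. of_nat (f c)*\<^sub>Rc)" using pos_coeffs[OF assms(2)] by blast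
 have "\<exists>c\<in>Smp. c~=a \<and> f c~=0"
 proof (rule ccontr)
  assume "\<not> ?thesis"
  hence "b=(\<Sum>c\<in>Smp. if c=a then real (f a)*\<^sub>Ra else 0)" unfolding f by (intro sum.cong) auto
  hence "b=real (f a)*\<^sub>Ra" using assms(1) finS by simp
  hence "b\<in>span {a}" using in_span1 by blast
  hence "b=- a" using rsD(5)[OF rs a(1) b(1)] assms(3) by blast
  thus False using a(2) b(2) by simp
 qed
 then obtain c where c: "c\<in>Smp" "c~=a" "f c~=0" by blast
 let ?u = "%d. real (f d) - (if d=a then cn b a else 0)"
 have ru: "refl_along a b=(\<Sum>d\<in>Smp. ?u d*\<^sub>Rd)"
 proof -
  have "(\<Sum>d\<in>Smp. ?u d*\<^sub>Rd)=b - (\<Sum>d\<in>Smp. (if d=a then cn b a else 0)*\<^sub>Rd)"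
   unfolding f by (simp add: scaleR_diff_left sum_subtractf)
  also have "(\<Sum>d\<in>Smp. (if d=a then cn b a else 0)*\<^sub>Rd)=(\<Sum>d\<in>Smp. if d=a then cn b a*\<^sub>Ra else 0)"
   by (intro sum.cong) auto
  also have "\<dots>=cn b a*\<^sub>Ra" using assms(1) finS by simp
  finally show ?thesis by (simp add: refl_cn)
 qed
 show "refl_along a b\<in>Pos"
 proof (rule ccontr)
  assume "refl_along a b\<notin>Pos"
  hence "- refl_along a b\<in>Pos" using pos_neg[OF rR] by blast
  then obtain k :: "'v => nat" where "- refl_along a b=(\<Sum>d\<in>Smp. of_nat (k d)*\<^sub>Rd)"
   using pos_coeffs by blast
  hence "(\<Sum>d\<in>Smp. ?u d*\<^sub>Rd)=(\<Sum>d\<in>Smp. (- real (k d))*\<^sub>Rd)"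
   unfolding ru by (simp add: sum_negf minus_equation_iff)
  from smp_coeff_unique[OF this c(1)] show False using c(2,3) by simp
 qed
 show "refl_along a b~=a"
 proof
  assume "refl_along a b=a"
  hence "b=refl_along a a" by (metis refl_refl)
  hence "b=- a" using nz(2)[OF a(1)] by (simp add: refl_along_def scaleR_2)
  thus False using a(2) b(2) by simp
 qed
qed

text \<open>The reflection along a simple root permutes the other positive roots and negates their
  contributions, so these sum to 0.\<close>

lemma rho_smp:
 assumes "a\<in>Smp"
 shows "(\<Sum>c\<in>Pos - {a}. (a\<cdot>c) / (c\<cdot>c))=0" "ht a=1"
proof -
 let ?A = "Pos - {a}"
 have a: "a\<cdot>a > 0" using nz(2) smpD[OF assms] posD by blast
 have bij: "bij_betw (refl_along a) ?A ?A"
  by (rule bij_betwI[where g = "refl_along a"]) (use refl_smp[OF assms] in \<open>auto simp: refl_refl\<close>)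
 have "(\<Sum>c\<in>?A. (a\<cdot>c) / (c\<cdot>c))=(\<Sum>c\<in>?A. (a\<cdot>refl_along a c) / (refl_along a c\<cdot>refl_along a c))"
  by (rule sum.reindex_bij_betw[OF bij, symmetric])
 also have "\<dots>=(\<Sum>c\<in>?A. - ((a\<cdot>c) / (c\<cdot>c)))"
 proof (intro sum.cong refl)
  fix c
  have "a\<cdot>refl_along a c=- (a\<cdot>c)" using a by (simp add: refl_along_def inner_diff_right inner_commute)
  thus "(a\<cdot>refl_along a c) / (refl_along a c\<cdot>refl_along a c)=- ((a\<cdot>c) / (c\<cdot>c))" by (simp add: refl_inner)
 qed
 finally show 0: "(\<Sum>c\<in>?A. (a\<cdot>c) / (c\<cdot>c))=0" by (simp add: sum_negf)
 have "ht a=(\<Sum>c\<in>Pos. (a\<cdot>c) / (c\<cdot>c))" by (simp add: rho_def inner_sum_right)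
 also have "\<dots>=(a\<cdot>a) / (a\<cdot>a) + (\<Sum>c\<in>?A. (a\<cdot>c) / (c\<cdot>c))" by (rule sum.remove[OF finP smpD[OF assms]])
 finally show "ht a=1" using 0 a by simp
qed

lemma ht_nat: "b\<in>Pos ==> \<exists>n::nat. n\<ge>1 \<and> ht b=real n"
proof -
 assume b: "b\<in>Pos"
 obtain f :: "'v => nat" where f: "b=(\<Sum>a\<in>Smp. of_nat (f a)*\<^sub>Ra)" using pos_coeffs[OF b] by blast
 have "ht b=(\<Sum>a\<in>Smp. real (f a))" unfolding f inner_sum_left by (intro sum.cong) (auto simp: rho_smp)
 hence h: "ht b=real (\<Sum>a\<in>Smp. f a)" by simp
 have "(\<Sum>a\<in>Smp. f a)~=0"
 proof
  assume "(\<Sum>a\<in>Smp. f a)=0"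
  hence "b=0" unfolding f using finS by (intro sum.neutral) auto
  thus False using nz(1) posD(1)[OF b] by blast
 qed
 thus ?thesis using h by (intro exI[of _ "\<Sum>a\<in>Smp. f a"]) auto
qed

lemma ht_ge1: "b\<in>Pos ==> ht b\<ge>1" using ht_nat by force

lemma ht_pos_iff: "b\<in>R ==> ht b > 0 \<longleftrightarrow> b\<in>Pos"
using pos_neg ht_ge1 by fastforce

lemma ht_ne0: "b\<in>R ==> ht b~=0"
 using ht_pos_iff pos_neg ht_ge1 by (metis inner_minus_left neg_0_equal_iff_equal not_one_le_zero)

lemma nonsimple_descend:
 assumes "b\<in>Pos" "b\<notin>Smp"
 shows "\<exists>a\<in>Smp. b - a\<in>Pos"
proof -
 obtain f :: "'v => nat" where f: "b=(\<Sum>a\<in>Smp. of_nat (f a)*\<^sub>Ra)" using pos_coeffs[OF assms(1)] by blast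
 have "\<exists>a\<in>Smp. b\<cdot>a > 0"
 proof (rule ccontr)
  assume "\<not> ?thesis"
  hence "(\<Sum>a\<in>Smp. real (f a) * (a\<cdot>b))\<le>0"
   by (intro sum_nonpos mult_nonneg_nonpos) (auto simp: inner_commute not_less)
  moreover have "b\<cdot>b=(\<Sum>a\<in>Smp. real (f a) * (a\<cdot>b))" by (subst (1) f) (simp add: inner_sum_left)
  ultimately show False using nz(2) posD(1)[OF assms(1)] by fastforce
 qed
 then obtain a where a: "a\<in>Smp" "b\<cdot>a > 0" by blast
 have "b~=a" using assms(2) a(1) by blast
 hence r: "b - a\<in>R" using root_sub[OF rs _ _ a(2)] posD assms(1) smpD a(1) by blast
 have "b - a\<in>Pos"
 proof (rule ccontr)
  assume "b - a\<notin>Pos"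
  hence "a - b\<in>Pos" using pos_neg[OF r] by simp
  moreover have "a=b + (a - b)" by simp
  ultimately show False using assms(1) a(1) unfolding smp_def by blast
 qed
 thus ?thesis using a(1) by blast
qed

lemma ht_1_smp: "b\<in>Pos ==> ht b < 2 ==> b\<in>Smp"
using nonsimple_descend ht_ge1 rho_smp inner_diff_left by (fastforce simp: inner_diff_left)

text \<open>Otherwise the difference would be a root of height 0, and there is none.\<close>

lemma same_ht_obtuse:
 assumes "b\<in>R" "c\<in>R" "ht b=ht c" "b~=c"
 shows "b\<cdot>c\<le>0"
proof (rule ccontr)
 assume "\<not> b\<cdot>c\<le>0"
 hence "b - c\<in>R" using root_sub[OF rs assms(1,2)] assms(4) by simp
 from ht_ne0[OF this] assms(3) show False by (simp add: inner_diff_left)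
qed

lemma same_ht_indep: "independent {b\<in>Pos. ht b=m}"
 by (rule obtuse_independent[of _ g]) (use finP same_ht_obtuse posD in auto)

text \<open>The sum of the normalized vectors has positive square, namely \<open>card S\<close> plus
  the off-diagonal cosines. Each ordered adjacent pair contributes at most -1/2, since the product
  of its two Cartan integers is at least 1.\<close>

lemma card_edges:
 assumes "S\<subseteq>R" "S~={}" "independent S" "\<And>a b. a\<in>S ==> b\<in>S ==> a~=b ==> a\<cdot>b\<le>0"
 shows "card {(a, b). a\<in>S \<and> b\<in>S \<and> a~=b \<and> a\<cdot>b~=0} < 2 * card S"
proof -
 have finS: "finite S" using assms(1) rsD(1)[OF rs] finite_subset by blast
 let ?E = "{(a, b). a\<in>S \<and> b\<in>S \<and> a~=b \<and> a\<cdot>b~=0}"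
 have finE: "finite ?E" by (rule finite_subset[of _ "S \<times> S"]) (use finS in auto)
 define x where "x=(\<Sum>a\<in>S. (1 / norm a)*\<^sub>Ra)"
 have nza: "norm a > 0" if "a\<in>S" for a using that assms(1) nz(1) by auto
 have "x~=0"
 proof
  assume "x=0"
  obtain a where a: "a\<in>S" using assms(2) by blast
  have "1 / norm a=0" using independentD[OF assms(3) finS order_refl \<open>x = 0\<close>[unfolded x_def] a] .
  thus False using nza[OF a] by simp
 qed
 hence "0 < x\<cdot>x" by simp
 also have "x\<cdot>x=(\<Sum>a\<in>S. \<Sum>b\<in>S. (a\<cdot>b) / (norm a * norm b))"
  unfolding x_def inner_sum_left inner_sum_right inner_scaleR_left inner_scaleR_right
  by (subst sum.swap) (simp add: sum_divide_distrib mult.commute)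
 also have "\<dots>=(\<Sum>z\<in>S \<times> S. (fst z\<cdot>snd z) / (norm (fst z) * norm (snd z)))"
  by (simp add: sum.cartesian_product case_prod_beta)
 also have "\<dots>\<le>(\<Sum>z\<in>S \<times> S. (if fst z=snd z then 1 else 0) + (if z\<in>?E then - 1 / 2 else 0))"
 proof (rule sum_mono)
  fix z assume z: "z\<in>S \<times> S"
  obtain a b where ab: "z=(a, b)" by (cases z)
  hence abS: "a\<in>S" "b\<in>S" using z by auto
  show "(fst z\<cdot>snd z) / (norm (fst z) * norm (snd z))\<le>(if fst z=snd z then 1 else 0) + (if z\<in>?E then - 1 / 2 else 0)"
  proof (cases "a=b")
   case True
   thus ?thesis using ab nza[OF abS(1)] by (simp add: dot_square_norm power2_eq_square)
  next
   case False
   have le: "a\<cdot>b\<le>0" using assms(4)[OF abS False] .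
   show ?thesis
   proof (cases "a\<cdot>b=0")
    case True
    thus ?thesis using ab False by simp
   next
    case nz0: False
    have inR: "a\<in>R" "b\<in>R" using abS assms(1) by auto
    obtain m n :: int where mn: "cn a b = of_int m" "cn b a = of_int n"
     using rsD(4)[OF rs] inR by (metis Ints_cases)
    have "cn a b < 0" "cn b a < 0" using le nz0 nz(2)[OF inR(1)] nz(2)[OF inR(2)]
     by (auto simp: cn_def inner_commute divide_less_0_iff)
    hence "m\<le>-1" "n\<le>-1" using mn by auto
    hence "1\<le>(- m) * (- n)" using mult_mono[of 1 "-m" 1 "-n"] by simp
    hence "1\<le>m * n" by simp
    hence "1\<le>cn a b * cn b a" unfolding mn by (metis of_int_1_le_iff of_int_mult)
    also have "cn a b * cn b a=(2 * (a\<cdot>b) / (norm a * norm b))\<^sup>2"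
     by (simp add: cn_def inner_commute dot_square_norm power2_eq_square)
    finally have "1\<le>\<bar>2 * (a\<cdot>b) / (norm a * norm b)\<bar>" by (metis abs_one abs_le_square_iff one_power2)
    moreover have "2 * (a\<cdot>b) / (norm a * norm b)\<le>0" using le by (simp add: divide_nonpos_nonneg)
    ultimately have "(a\<cdot>b) / (norm a * norm b)\<le>- 1 / 2" by simp
    thus ?thesis using ab False nz0 abS by simp
   qed
  qed
 qed
 also have "\<dots>=(\<Sum>z\<in>S \<times> S. if fst z=snd z then 1 else 0) + (\<Sum>z\<in>S \<times> S. if z\<in>?E then - 1 / 2 else 0)"
  by (rule sum.distrib)
 also have "(\<Sum>z\<in>S \<times> S. if fst z=snd z then 1 else 0)=real (card S)"
 proof -
  have "(\<Sum>z\<in>S \<times> S. if fst z=snd z then 1 else 0)=(\<Sum>a\<in>S. \<Sum>b\<in>S. if a=b then 1 else (0::real))"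
   by (simp add: sum.cartesian_product case_prod_beta)
  also have "\<dots>=(\<Sum>a\<in>S. 1)" using finS by (intro sum.cong) auto
  finally show ?thesis by simp
 qed
 also have "(\<Sum>z\<in>S \<times> S. if z\<in>?E then - 1 / 2 else 0)=(\<Sum>z\<in>?E. - 1 / (2::real))"
  using finS by (intro sum.mono_neutral_cong_right) auto
 finally have "real (card ?E) < 2 * real (card S)" by simp
 thus ?thesis by linarith
qed

text \<open>If the roots of height \<open>m\<close> were as many as the rank, they would be the
  simple roots of the subsystem of roots whose height is divisible by \<open>m\<close>. Comparing
  the two vectors \<open>rho\<close> leaves only \<open>m = 2\<close>, and there the Dynkin diagram
  has too few edges.\<close>

lemma card_ht_less:
 assumes m: "m\<ge>2" and ne: "{b\<in>Pos. ht b=real m}~={}"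
 shows "card {b\<in>Pos. ht b=real m} < dim R"
proof (rule ccontr)
 let ?B = "{b\<in>Pos. ht b=real m}"
 assume "\<not> card ?B < dim R"
 hence cB: "dim R\<le>card ?B" by simp
 have finB: "finite ?B" using finP by simp
 have BR: "?B\<subseteq>span R" using posD span_base by blast
 have spB: "span R\<subseteq>span ?B" using card_ge_dim_independent[OF BR same_ht_indep] cB by (simp add: dim_span)
 define Rm where "Rm={c\<in>R. c\<cdot>((1 / real m)*\<^sub>Rrho R g)\<in>\<int>}"
 have "rs Rm" unfolding Rm_def by (rule rs_congruence[OF rs])
 then interpret M: rsys Rm g by unfold_locales (use g in \<open>auto simp: Rm_def\<close>)
 have m0: "real m > 0" using m by simp
 have htm: "ht c\<ge>real m" if cp: "c\<in>pos Rm g" for c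
 proof -
  have "c\<in>Pos" using cp by (auto simp: pos_def Rm_def)
  hence "ht c > 0" using ht_ge1 by force
  moreover obtain k :: int where k: "ht c / real m = of_int k"
   using cp by (auto simp: pos_def Rm_def elim!: Ints_cases)
  ultimately have "of_int k > (0::real)" using m0 by (metis divide_pos_pos)
  hence "(1::real)\<le>of_int k" by simp
  thus ?thesis using k m0 by (metis le_divide_eq_1_pos)
 qed
 have Bs: "?B\<subseteq>smp Rm g"
 proof
  fix b assume b: "b\<in>?B"
  hence "b\<in>pos Rm g" using m0 by (auto simp: pos_def Rm_def)
  moreover have False if cd: "c\<in>pos Rm g" "d\<in>pos Rm g" "b=c + d" for c d
  proof -
   have "real m=ht c + ht d" using b cd(3) by (simp add: inner_add_left)
   thus False using htm[OF cd(1)] htm[OF cd(2)] m0 by linarith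
  qed
  ultimately show "b\<in>smp Rm g" by (auto simp: smp_def)
 qed
 have "card (smp Rm g)\<le>card ?B"
 proof -
  have "card (smp Rm g)=dim Rm" by (rule M.card_smp)
  also have "\<dots>\<le>dim R" by (rule dim_subset) (auto simp: Rm_def)
  finally show ?thesis using cB by simp
 qed
 hence eq: "?B=smp Rm g" using card_seteq[OF M.finS Bs] by blast
 \<comment> \<open>\<open>y\<close> is orthogonal to \<open>?B\<close> and lies in its span, so it
   vanishes: \<open>rho R g\<close> is \<open>m\<close> times \<open>rho Rm g\<close>.\<close>
 define y where "y=rho R g - real m*\<^sub>Rrho Rm g"
 have by0: "b\<cdot>y=0" if "b\<in>?B" for b
 proof -
  have "b\<cdot>rho Rm g=1" using M.rho_smp(2) that eq by blast
  thus ?thesis using that by (simp add: y_def inner_diff_right)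
 qed
 have r1: "rho R g\<in>span R" unfolding rho_def by (intro span_sum span_scale span_base posD(1))
 have pm: "c\<in>R" if "c\<in>pos Rm g" for c using that by (simp add: pos_def Rm_def)
 have r2: "rho Rm g\<in>span R" unfolding rho_def by (intro span_sum span_scale span_base pm)
 have yB: "y\<in>span ?B" using subsetD[OF spB r1] subsetD[OF spB r2] unfolding y_def by (intro span_diff span_scale)
 have "span ?B\<subseteq>hyp y" using by0 by (intro span_minimal subspace_hyp) (auto simp: hyp_def inner_commute)
 hence "y\<cdot>y=0" using yB by (auto simp: hyp_def)
 hence yz: "rho R g=real m*\<^sub>Rrho Rm g" by (simp add: y_def)
 have "Smp~={}"
 using pos_coeffs nz posD ne by fastforce
 then obtain u where u: "u\<in>Smp" by blast
 have uR: "u\<in>R" using u smpD posD by blast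
 \<comment> \<open>Twice the pairing of a root with \<open>rho\<close> is a sum of Cartan integers.
   For a simple root \<open>u\<close> of \<open>R\<close> this integer equals
   \<open>2 / m\<close>.\<close>
 have "2 * (u\<cdot>rho Rm g)=(\<Sum>c\<in>pos Rm g. cn u c)"
  by (simp add: rho_def inner_sum_right cn_def sum_distrib_left)
 also have "\<dots>\<in>\<int>" using rsD(4)[OF rs _ uR] by (intro Ints_sum) (auto simp: pos_def Rm_def)
 finally have "2 / real m\<in>\<int>"
 proof -
  assume i: "2 * (u\<cdot>rho Rm g)\<in>\<int>"
  have "1=real m * (u\<cdot>rho Rm g)" using rho_smp(2)[OF u] yz by simp
  hence "2 * (u\<cdot>rho Rm g)=2 / real m" using m0 by (simp add: field_simps)
  thus ?thesis using i by simp
 qed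
 then obtain k :: int where k: "2 / real m = of_int k" by (auto elim: Ints_cases)
 have "of_int k > (0::real)" using m0 unfolding k[symmetric] by simp
 hence "1\<le>2 / real m" unfolding k by simp
 hence m2: "m=2" using m by (simp add: le_divide_eq)
 \<comment> \<open>A root of height 2 is the sum of two adjacent simple roots. At least
   \<open>dim R\<close> such roots would give \<open>2 * dim R\<close> ordered edges, contradicting
   \<open>card_edges\<close>.\<close>
 let ?E = "{(a, b). a\<in>Smp \<and> b\<in>Smp \<and> a~=b \<and> a\<cdot>b~=0}"
 have E: "card ?E < 2 * card (Smp)"
  by (rule card_edges[OF _ \<open>Smp \<noteq> {}\<close> smp_indep smp_obtuse]) (use smpD posD in auto)
 have finE: "finite ?E" by (rule finite_subset[of _ "Smp \<times> Smp"]) (use finS in auto)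
 have ex: "\<exists>z. z\<in>?E \<and> (snd z, fst z)\<in>?E \<and> b=fst z + snd z" if b: "b\<in>?B" for b
 proof -
  have b2: "b\<in>Pos" "ht b=2" using b m2 by auto
  have "b\<notin>Smp" using rho_smp(2)[of b] b2(2) by auto
  then obtain u where u: "u\<in>Smp" "b - u\<in>Pos" using nonsimple_descend[OF b2(1)] by blast
  have s: "b - u\<in>Smp" using ht_1_smp[OF u(2)] b2(2) rho_smp(2)[OF u(1)] by (simp add: inner_diff_left)
  have inR: "b\<in>R" "u\<in>R" "b - u\<in>R" using b2(1) u smpD posD by auto
  have ne1: "b - u~=u"
  proof
   assume "b - u=u"
   hence bu: "b=2*\<^sub>Ru" by (simp add: scaleR_2 diff_eq_eq)
   hence "b\<in>span {u}" using in_span1 by blast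
   hence "b=u \<or> b=- u" using rsD(5)[OF rs inR(2,1)] by blast
   thus False using b2(2) rho_smp(2)[OF u(1)] by auto
  qed
  have "(b - u)\<cdot>u~=0"
  proof
   assume o: "(b - u)\<cdot>u=0"
   hence "refl_along u b=(b - u) - u" using nz(2)[OF inR(2)]
    by (simp add: refl_along_def inner_diff_left scaleR_2)
   moreover have "refl_along u b\<in>Pos" using refl_smp(1)[OF u(1) b2(1)] ne1 \<open>b \<notin> Smp\<close> u(1) by blast
   ultimately have "((b - u) - u)\<cdot>rho R g\<ge>1" using ht_ge1 by metis
   thus False using rho_smp(2)[OF u(1)] rho_smp(2)[OF s] by (simp add: inner_diff_left)
  qed
  thus ?thesis using u(1) s ne1 by (intro exI[of _ "(u, b - u)"]) (auto simp: inner_commute)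
 qed
 have "\<exists>F. \<forall>b\<in>?B. F b\<in>?E \<and> (snd (F b), fst (F b))\<in>?E \<and> b=fst (F b) + snd (F b)"
  by (rule bchoice) (rule ballI, rule ex)
 then obtain F where F: "\<forall>b\<in>?B. F b\<in>?E \<and> (snd (F b), fst (F b))\<in>?E \<and> b=fst (F b) + snd (F b)" ..
 define p q where "p b=fst (F b)" and "q b=snd (F b)" for b
 have pq: "(p b, q b)\<in>?E \<and> (q b, p b)\<in>?E \<and> b=p b + q b" if "b\<in>?B" for b
  using bspec[OF F that] unfolding p_def q_def prod.collapse .
 let ?f = "%b. (p b, q b)" and ?f' = "%b. (q b, p b)"
 have rec: "b=b'" if "b\<in>?B" "b'\<in>?B" "{p b, q b}={p b', q b'}" for b b'
 proof -
  have "p b + q b=p b' + q b'" using that(3) by (auto simp: doubleton_eq_iff add.commute)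
  moreover have "b=p b + q b" using pq[OF that(1)] by blast
  moreover have "b'=p b' + q b'" using pq[OF that(2)] by blast
  ultimately show ?thesis by simp
 qed
 have inj: "inj_on ?f ?B" by (rule inj_onI, rule rec) auto
 have inj': "inj_on ?f' ?B" by (rule inj_onI, rule rec) auto
 have disj: "?f ` ?B\<inter>?f' ` ?B={}"
 proof (rule ccontr)
  assume "?f ` ?B\<inter>?f' ` ?B~={}"
  then obtain b b' where bb: "b\<in>?B" "b'\<in>?B" "p b=q b'" "q b=p b'" by auto
  hence "b=b'" using rec[of b b'] by auto
  thus False using bb pq[OF bb(1)] by auto
 qed
 have "2 * card ?B=card (?f ` ?B\<union>?f' ` ?B)"
  using card_Un_disjoint[OF _ _ disj] finB card_image[OF inj] card_image[OF inj'] by simp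
 also have "\<dots>\<le>card ?E" using pq finE by (intro card_mono) auto
 finally show False using E cB card_smp by simp
qed

end

section \<open>Heights counted plane by plane, and the Coxeter number\<close>

lemma dd_sum:
 assumes "finite N"
 shows "real (dd N a)=(\<Sum>X\<in>(%v. span {a, v}) ` N. real (card {v\<in>N. span {a, v}=X}) - 1)"
proof -
 let ?pl = "%v. span {a, v}"
 have "(\<Sum>v\<in>N. 1)=(\<Sum>X\<in>?pl ` N. \<Sum>v\<in>{v\<in>N. ?pl v=X}. (1::nat))" by (rule sum.image_gen[OF assms])
 hence "card N=(\<Sum>X\<in>?pl ` N. card {v\<in>N. ?pl v=X})" by simp
 hence "real (card N)=(\<Sum>X\<in>?pl ` N. real (card {v\<in>N. ?pl v=X}))" by simp
 moreover have "real (dd N a)=real (card N) - real (card (?pl ` N))"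
  unfolding dd_def using card_image_le[OF assms, of ?pl] by (simp add: of_nat_diff)
 ultimately show ?thesis by (simp add: sum_subtractf)
qed

context rsys
begin

lemma ht_chain:
 assumes "b\<in>Pos" "ht b=real n" "1\<le>j" "j\<le>n"
 shows "\<exists>c\<in>Pos. ht c=real j" using assms
proof (induction n arbitrary: b)
 case 0
 thus ?case by simp
next
 case (Suc n)
 show ?case
 proof (cases "j=Suc n")
  case True
  thus ?thesis using Suc(2,3) by blast
 next
  case False
  hence jn: "j\<le>n" "1\<le>n" using Suc(4,5) by auto
  have "b\<notin>Smp" using rho_smp(2)[of b] Suc(3) jn by auto
  then obtain a where a: "a\<in>Smp" "b - a\<in>Pos" using nonsimple_descend[OF Suc(2)] by blast
  have "(b - a)\<cdot>rho R g=real n" using Suc(3) rho_smp(2)[OF a(1)] by (simp add: inner_diff_left)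
  from Suc.IH[OF a(2) this Suc(4) jn(1)] show ?thesis .
 qed
qed

lemma smp_multiple:
 assumes "b\<in>Pos" "a\<in>Smp" "b\<in>span {a}"
 shows "b=a"
proof -
 have "a\<in>Pos" using smpD[OF assms(2)] .
 moreover have "b=a \<or> b=- a"
  by (rule rsD(5)[OF rs _ _ assms(3)]) (use posD(1) assms(1) smpD[OF assms(2)] in auto)
 ultimately show ?thesis using posD(2)[OF assms(1)] posD(2)[of a] by auto
qed

text \<open>In rank two \<open>card_ht_less\<close> leaves at most one root of each height from 2
  on, and \<open>ht_chain\<close> shows that no height is skipped. So below a root of height
  \<open>n \<ge> 2\<close> lie exactly the two simple roots and one root of each height from 2 to
  \<open>n - 1\<close>, whatever the generic direction is.\<close>

lemma rank2_count:
 assumes dim2: "dim R=2" and u: "u\<in>Pos" and inj: "inj_on (%c. c\<cdot>g) R"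
 shows "{c\<in>Pos. c\<cdot>g < u\<cdot>g}~={} ==> real (card {c\<in>Pos. c\<cdot>g < u\<cdot>g})=ht u"
  and "{c\<in>Pos. c\<cdot>g < u\<cdot>g}={} ==> ht u=1"
proof -
 let ?low = "{c\<in>Pos. c\<cdot>g < u\<cdot>g}"
 have card2: "card (Smp)=2" using card_smp dim2 by simp
 have uniq: "b=c" if bc: "b\<in>Pos" "c\<in>Pos" "ht b=real m" "ht c=real m" "m\<ge>2" for b c m
 proof -
  let ?B = "{b\<in>Pos. ht b=real m}"
  have "card ?B\<le>Suc 0" using card_ht_less[OF bc(5)] bc(1,3) dim2 by force
  moreover have "finite ?B" using finP by simp
  ultimately have "\<forall>x\<in>?B. \<forall>y\<in>?B. x=y" using card_le_Suc0_iff_eq by blast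
  thus ?thesis using bc by simp
 qed
 have ns2: "ht b\<ge>2" if "b\<in>Pos" "b\<notin>Smp" for b using ht_1_smp[OF that(1)] that(2) by force
 have simple_lt: "a\<cdot>g < b\<cdot>g" if a: "a\<in>Smp" and b: "b\<in>Pos" "b\<notin>Smp" for a b
 proof -
  obtain a' where a': "Smp={a, a'}" "a'~=a"
   using card2 a by (metis card_2_iff doubleton_eq_iff insertE singletonD)
  obtain f :: "'v => nat" where f: "b=(\<Sum>a\<in>Smp. of_nat (f a)*\<^sub>Ra)" using pos_coeffs[OF b(1)] by blast
  hence bf: "b=real (f a)*\<^sub>Ra + real (f a')*\<^sub>Ra'" using a' by simp
  have "f a~=0"
  proof
   assume "f a=0"
   hence "b=real (f a')*\<^sub>Ra'" using bf by simp
   hence "b\<in>span {a'}" using in_span1 by blast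
   thus False using smp_multiple[OF b(1), of a'] b(2) a' by auto
  qed
  moreover have "f a'~=0"
  proof
   assume "f a'=0"
   hence "b=real (f a)*\<^sub>Ra" using bf by simp
   hence "b\<in>span {a}" using in_span1 by blast
   thus False using smp_multiple[OF b(1) a] b(2) a by auto
  qed
  moreover have "a\<cdot>g > 0" "a'\<cdot>g > 0" using a' smpD posD(2) by auto
  ultimately have "real (f a) * (a\<cdot>g)\<ge>a\<cdot>g" "real (f a') * (a'\<cdot>g) > 0" by auto
  thus ?thesis unfolding bf by (simp add: inner_add_left)
 qed
 have val_mono: "c\<cdot>g < b\<cdot>g" if "b\<in>Pos" "c\<in>Pos" "c\<notin>Smp" "ht b=real n" "ht c < real n" for b c n
  using that
 proof (induction n arbitrary: b)
  case 0
  thus ?case using ht_ge1[of c] by simp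
 next
  case (Suc n)
  have c2: "2\<le>ht c" using ns2 Suc(3,4) by blast
  hence "2 < real (Suc n)" using Suc(6) by linarith
  hence n2: "n\<ge>2" by simp
  hence "b\<notin>Smp" using rho_smp(2)[of b] Suc(5) by auto
  then obtain a where a: "a\<in>Smp" "b - a\<in>Pos" using nonsimple_descend[OF Suc(2)] by blast
  have hn: "(b - a)\<cdot>rho R g=real n" using Suc(5) rho_smp(2)[OF a(1)] by (simp add: inner_diff_left)
  have "a\<cdot>g > 0" using a(1) smpD posD(2) by blast
  hence lt: "(b - a)\<cdot>g < b\<cdot>g" by (simp add: inner_diff_left)
  obtain k :: nat where k: "ht c=real k" using ht_nat[OF Suc(3)] by blast
  hence "k\<le>n" using Suc(6) by simp
  show ?case
  proof (cases "k=n")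
   case True
   hence "c=b - a" using uniq[OF Suc(3) a(2) _ hn n2] k by blast
   thus ?thesis using lt by simp
  next
   case False
   hence "ht c < real n" using k \<open>k \<le> n\<close> by simp
   from Suc.IH[OF a(2) Suc(3,4) hn this] show ?thesis using lt by simp
  qed
 qed
 obtain n :: nat where n: "n\<ge>1" "ht u=real n" using ht_nat[OF u] by blast
 have nsc: "u\<notin>Smp ==> ?low~={} \<and> real (card ?low)=ht u"
 proof -
  assume ns: "u\<notin>Smp"
  have n2: "n\<ge>2" using ns2[OF u ns] n(2) by simp
  let ?M = "{c\<in>Pos. 2\<le>ht c \<and> ht c < real n}"
  have low: "?low=Smp\<union>?M"
  proof (intro subset_antisym subsetI)
   fix c assume c: "c\<in>?low"
   show "c\<in>Smp\<union>?M"
   proof (cases "c\<in>Smp")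
    case False
    have cp: "c\<in>Pos" using c by simp
    obtain k :: nat where k: "ht c=real k" using ht_nat[OF cp] by blast
    have "\<not> n < k"
    proof
     assume "n < k"
     hence "u\<cdot>g < c\<cdot>g" using val_mono[OF cp u ns k] n(2) by simp
     thus False using c by simp
    qed
    moreover have "k~=n"
    proof
     assume "k=n"
     hence "c=u" using uniq[OF cp u k _ ] n(2) n2 by simp
     thus False using c by simp
    qed
    ultimately show ?thesis using ns2[OF cp False] k cp by simp
   qed simp
  next
   fix c assume "c\<in>Smp\<union>?M"
   thus "c\<in>?low"
   proof
    assume c: "c\<in>Smp"
    thus ?thesis using simple_lt[OF c u ns] smpD[OF c] by simp
   next
    assume c: "c\<in>?M"
    hence "c\<notin>Smp" using rho_smp(2)[of c] by auto
    thus ?thesis using val_mono[OF u _ _ n(2), of c] c by simp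
   qed
  qed
  have disj: "Smp\<inter>?M={}" using rho_smp(2) by force
  have "bij_betw (%c. nat \<lfloor>ht c\<rfloor>) ?M {2..<n}" unfolding bij_betw_def
  proof
   show "inj_on (%c. nat \<lfloor>ht c\<rfloor>) ?M"
   proof (rule inj_onI)
    fix c d assume cd: "c\<in>?M" "d\<in>?M" "nat \<lfloor>ht c\<rfloor>=nat \<lfloor>ht d\<rfloor>"
    have cp: "c\<in>Pos" "d\<in>Pos" using cd by auto
    obtain k :: nat where k: "ht c=real k" using ht_nat[OF cp(1)] by blast
    obtain l :: nat where l: "ht d=real l" using ht_nat[OF cp(2)] by blast
    have "k=l" using cd(3) k l by simp
    moreover have "k\<ge>2" using cd(1) k by simp
    ultimately show "c=d" using uniq[OF cp k] l by simp
   qed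
   show "(%c. nat \<lfloor>ht c\<rfloor>) ` ?M={2..<n}"
   proof (intro subset_antisym subsetI)
    fix j assume "j\<in>(%c. nat \<lfloor>ht c\<rfloor>) ` ?M"
    then obtain c where c: "c\<in>?M" "j=nat \<lfloor>ht c\<rfloor>" by blast
    hence cp: "c\<in>Pos" by simp
    obtain k :: nat where k: "ht c=real k" using ht_nat[OF cp] by blast
    show "j\<in>{2..<n}" using c k by simp
   next
    fix j assume j: "j\<in>{2..<n}"
    then obtain c where "c\<in>Pos" "ht c=real j" using ht_chain[OF u n(2), of j] by auto
    thus "j\<in>(%c. nat \<lfloor>ht c\<rfloor>) ` ?M" using j by (intro image_eqI[of _ _ c]) auto
   qed
  qed
  hence "card ?M=n - 2" using bij_betw_same_card by fastforce
  hence "card ?low=n" unfolding low using card_Un_disjoint[OF finS _ disj] finP card2 n2 by simp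
  thus ?thesis using n(2) n2 by (metis card.empty not_numeral_le_zero)
 qed
 have sc: "u\<in>Smp ==> ?low\<subseteq>Smp - {u}"
 proof
  fix c assume us: "u\<in>Smp" and c: "c\<in>?low"
  have "c\<in>Smp"
  proof (rule ccontr)
   assume "c\<notin>Smp"
   hence "u\<cdot>g < c\<cdot>g" using simple_lt[OF us] c by simp
   thus False using c by simp
  qed
  thus "c\<in>Smp - {u}" using c by auto
 qed
 show "?low~={} ==> real (card ?low)=ht u"
 proof (cases "u\<in>Smp")
  case True
  assume ne: "?low~={}"
  have "card (Smp - {u})=1" using card2 True finS by simp
  hence "card ?low\<le>1" using card_mono[OF _ sc[OF True]] finS by simp
  moreover have "card ?low~=0" using ne finP by simp
  ultimately have "card ?low=1" by simp
  thus ?thesis using rho_smp(2)[OF True] by simp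
 qed (use nsc in blast)
 show "?low={} ==> ht u=1" using nsc rho_smp(2) by blast
qed

lemma rho_minus_one:
 assumes "b\<in>Pos"
 shows "ht b - 1=(\<Sum>c\<in>Pos - {b}. (b\<cdot>c) / (c\<cdot>c))"
proof -
 have "ht b=(\<Sum>c\<in>Pos. (b\<cdot>c) / (c\<cdot>c))" by (simp add: rho_def inner_sum_right)
 also have "\<dots>=(b\<cdot>b) / (b\<cdot>b) + (\<Sum>c\<in>Pos - {b}. (b\<cdot>c) / (c\<cdot>c))" by (rule sum.remove[OF finP assms])
 finally show ?thesis using nz(2)[OF posD(1)[OF assms]] by simp
qed

lemma pos_not_par:
 assumes "b\<in>Pos" "c\<in>Pos" "c~=b"
 shows "c\<notin>span {b}"
proof
 assume "c\<in>span {b}"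
 hence "c=b \<or> c=- b" using rsD(5)[OF rs posD(1)[OF assms(1)] posD(1)[OF assms(2)]] by blast
 thus False using posD(2)[OF assms(1)] posD(2)[OF assms(2)] assms(3) by auto
qed

lemma plane_dim:
 assumes "b\<in>Pos" "c\<in>Pos" "c~=b"
 shows "dim (R\<inter>span {b, c})=2"
proof -
 have "independent {b}" using nz(1)[OF posD(1)[OF assms(1)]] by (simp add: dependent_single)
 hence "independent (insert c {b})" by (rule independent_insertI[OF pos_not_par[OF assms]])
 hence "independent {b, c}" by (simp add: insert_commute)
 hence d2: "dim {b, c}=2" using assms(3) by (simp add: dim_eq_card_independent)
 have "dim {b, c}\<le>dim (R\<inter>span {b, c})"
  using posD(1)[OF assms(1)] posD(1)[OF assms(2)] by (intro dim_subset) (auto intro: span_base)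
 moreover have "dim (R\<inter>span {b, c})\<le>dim (span {b, c})" by (rule dim_subset) auto
 ultimately show ?thesis using d2 by (simp add: dim_span)
qed

lemma plane_count:
 assumes b: "b\<in>Pos" and inj: "inj_on (%c. c\<cdot>g) R" and c: "c\<in>Pos" "c~=b"
 defines "X \<equiv> span {b, c}"
 shows "(\<Sum>d\<in>{d\<in>Pos - {b}. d\<in>X}. (b\<cdot>d) / (d\<cdot>d)) =
   (if {d\<in>Pos. d\<in>X \<and> d\<cdot>g < b\<cdot>g}={} then 0 else real (card {d\<in>Pos. d\<in>X \<and> d\<cdot>g < b\<cdot>g}) - 1)"
proof -
 interpret X: rsys "R\<inter>X" g using rs_Int_subspace[OF rs, of X] g by unfold_locales (auto simp: X_def)
 have eq: "pos (R\<inter>X) g={d\<in>Pos. d\<in>X}" by (auto simp: pos_def)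
 have bX: "b\<in>pos (R\<inter>X) g" using b by (auto simp: pos_def X_def intro: span_base)
 have inj': "inj_on (%c. c\<cdot>g) (R\<inter>X)" using inj by (rule inj_on_subset) auto
 have d2: "dim (R\<inter>X)=2" unfolding X_def by (rule plane_dim[OF b c])
 have s1: "{d\<in>Pos - {b}. d\<in>X}=pos (R\<inter>X) g - {b}" unfolding eq by auto
 have s2: "{d\<in>Pos. d\<in>X \<and> d\<cdot>g < b\<cdot>g}={d\<in>pos (R\<inter>X) g. d\<cdot>g < b\<cdot>g}" unfolding eq by auto
 show ?thesis unfolding s1 s2 X.rho_minus_one[OF bX, symmetric] using X.rank2_count[OF d2 bX inj'] by auto
qed

text \<open>Both sides split over the planes through \<open>b\<close>: \<open>dd\<close> by
  \<open>dd_sum\<close>, the height minus one by \<open>rho_minus_one\<close>. Inside one plane they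
  agree by \<open>rank2_count\<close>.\<close>

lemma fin_dd:
 assumes b: "b\<in>Pos" and inj: "inj_on (%c. c\<cdot>g) R"
 shows "real (dd {c\<in>Pos. c\<cdot>g < b\<cdot>g} b)=ht b - 1"
proof -
 let ?I = "{c\<in>Pos. c\<cdot>g < b\<cdot>g}" and ?P = "Pos - {b}" and ?pl = "%v. span {b, v}"
 have finI: "finite ?I" "finite ?P" using finP by auto
 have cls: "{d\<in>Pos - {b}. ?pl d=?pl c}={d\<in>Pos - {b}. d\<in>?pl c}" if c: "c\<in>?P" for c
 proof (intro Collect_cong conj_cong refl iffI)
  fix d assume d: "d\<in>Pos - {b}"
  show "?pl d=?pl c ==> d\<in>?pl c" using span_base[of d "{b, d}"] by auto
  assume dc: "d\<in>?pl c"
  have "d\<notin>span {b}" using pos_not_par[OF b] d by blast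
  from span2_eqI(1)[OF dc this] show "?pl d=?pl c" .
 qed
 have clsI: "{d\<in>?I. ?pl d=?pl c}={d\<in>Pos. d\<in>?pl c \<and> d\<cdot>g < b\<cdot>g}" if c: "c\<in>?P" for c
 proof -
  have "{d\<in>?I. ?pl d=?pl c}={d\<in>{d\<in>Pos - {b}. ?pl d=?pl c}. d\<cdot>g < b\<cdot>g}" by auto
  also have "\<dots>={d\<in>Pos. d\<in>?pl c \<and> d\<cdot>g < b\<cdot>g}" unfolding cls[OF c] by auto
  finally show ?thesis .
 qed
 let ?f = "%X. (if {d\<in>?I. ?pl d=X}={} then 0 else real (card {d\<in>?I. ?pl d=X}) - 1)"
 have "ht b - 1=(\<Sum>c\<in>?P. (b\<cdot>c) / (c\<cdot>c))" by (rule rho_minus_one[OF b])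
 also have "\<dots>=(\<Sum>X\<in>?pl ` ?P. \<Sum>c\<in>{c\<in>?P. ?pl c=X}. (b\<cdot>c) / (c\<cdot>c))" by (rule sum.image_gen[OF finI(2)])
 also have "\<dots>=(\<Sum>X\<in>?pl ` ?P. ?f X)"
 proof (rule sum.cong[OF refl])
  fix X assume "X\<in>?pl ` ?P"
  then obtain c where c: "c\<in>?P" "X=?pl c" by blast
  have c': "c\<in>Pos" "c~=b" using c(1) by auto
  show "(\<Sum>c\<in>{c\<in>?P. ?pl c=X}. (b\<cdot>c) / (c\<cdot>c))=?f X"
   unfolding c(2) cls[OF c(1)] clsI[OF c(1)] by (rule plane_count[OF b inj c'])
 qed
 also have "\<dots>=(\<Sum>X\<in>?pl ` ?I. ?f X)"
 proof (rule sum.mono_neutral_right)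
  show "finite (?pl ` ?P)" using finI by simp
  show "?pl ` ?I\<subseteq>?pl ` ?P" by (rule image_mono) auto
  show "\<forall>X\<in>?pl ` ?P - ?pl ` ?I. ?f X=0"
  by auto
 qed
 also have "\<dots>=(\<Sum>X\<in>?pl ` ?I. real (card {d\<in>?I. ?pl d=X}) - 1)" by (rule sum.cong[OF refl]) auto
 also have "\<dots>=real (dd ?I b)" by (rule dd_sum[OF finI(1), symmetric])
 finally show ?thesis by simp
qed

lemma sum_pos2:
 assumes "\<And>c. F (- c)=F c"
 shows "(\<Sum>c\<in>R. F c)=2 * (\<Sum>c\<in>Pos. (F c::real))"
proof -
 have U: "R=Pos\<union>uminus ` Pos"
 proof (intro subset_antisym subsetI)
  fix c assume c: "c\<in>R"
  show "c\<in>Pos\<union>uminus ` Pos"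
  proof (cases "c\<in>Pos")
   case False
   have "c=- (- c)" by simp
   thus ?thesis using pos_neg[OF c False] by blast
  qed simp
 next
  fix c assume "c\<in>Pos\<union>uminus ` Pos"
  thus "c\<in>R" using posD(1) rsD(6)[OF rs] by auto
 qed
 have disj: "Pos\<inter>uminus ` Pos={}" by (auto dest!: posD(2))
 have "(\<Sum>c\<in>R. F c)=(\<Sum>c\<in>Pos. F c) + (\<Sum>c\<in>uminus ` Pos. F c)"
  by (subst U) (rule sum.union_disjoint[OF finP finite_imageI[OF finP] disj])
 also have "(\<Sum>c\<in>uminus ` Pos. F c)=(\<Sum>c\<in>Pos. F (- c))" by (subst sum.reindex) (auto simp: inj_on_def)
 finally show ?thesis using assms by simp
qed

lemma card_pos: "card R=2 * card (Pos)" using sum_pos2[of "%_. 1"] by simp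

lemma irr_connected:
 assumes irr: "irreducible_roots R" and b0: "b0\<in>R" "P b0"
  and conn: "\<And>b c. b\<in>R ==> c\<in>R ==> P b ==> b\<cdot>c~=0 ==> P c" and c: "c\<in>R"
 shows "P c"
proof (rule ccontr)
 assume "\<not> P c"
 let ?A = "{b\<in>R. P b}" and ?B = "{b\<in>R. \<not> P b}"
 have "?A~={}" "?B~={}" using b0 c \<open>\<not> P c\<close> by auto
 moreover have "R=?A\<union>?B" "?A\<inter>?B={}" by auto
 moreover have "\<forall>a\<in>?A. \<forall>u\<in>?B. a\<cdot>u=0" using conn by blast
 ultimately have "\<exists>\<Phi>1 \<Phi>2. \<Phi>1~={} \<and> \<Phi>2~={} \<and> R=\<Phi>1\<union>\<Phi>2 \<and> \<Phi>1\<inter>\<Phi>2={} \<and>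
   (\<forall>a\<in>\<Phi>1. \<forall>u\<in>\<Phi>2. a\<cdot>u=0)" by (intro exI[of _ ?A] exI[of _ ?B] conjI)
 thus False using irr unfolding irreducible_roots_def by (rule notE[OF conjunct2, rotated])
qed

text \<open>Each root \<open>b\<close> is an eigenvector of the invariant operator \<open>\<Sum>c. cn _ c *\<^sub>R c\<close>, since that
 operator commutes with the reflection along \<open>b\<close>.\<close>

lemma coxeter_number:
 assumes irr: "irreducible_roots R" and b: "b\<in>R"
 shows "(\<Sum>c\<in>R. cn b c * cn c b)=4 * (real (card R) / real (dim R))"
proof -
 define K where "K x=(\<Sum>c\<in>R. cn x c*\<^sub>Rc)" for x
 have Kl: "K (x + y)=K x + K y" "K (t*\<^sub>Rx)=t*\<^sub>RK x" for x y t
  by (auto simp: K_def cn_def inner_add_left add_divide_distrib distrib_left scaleR_add_left sum.distrib scaleR_sum_right mult.left_commute)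
 have Ksym: "K x\<cdot>y=x\<cdot>K y" for x y
  by (simp add: K_def inner_sum_left inner_sum_right cn_def inner_commute mult_ac)
 have eig: "K b=(cn (K b) b / 2)*\<^sub>Rb" if b: "b\<in>R" for b
 proof -
  have bij: "bij_betw (refl_along b) R R"
   by (rule bij_betwI[where g = "refl_along b"]) (use rsD(3)[OF rs b] in \<open>auto simp: refl_refl\<close>)
  have "K (refl_along b b)=(\<Sum>c\<in>R. cn (refl_along b b) (refl_along b c)*\<^sub>Rrefl_along b c)"
   unfolding K_def by (rule sum.reindex_bij_betw[OF bij, symmetric])
  also have "\<dots>=(\<Sum>c\<in>R. refl_along b (cn b c*\<^sub>Rc))"
   by (simp add: cn_def refl_inner linear_cmul[OF linear_refl])
  also have "\<dots>=refl_along b (K b)" unfolding K_def by (rule linear_sum[OF linear_refl, symmetric])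
  finally have "K (refl_along b b)=refl_along b (K b)" .
  moreover have "refl_along b b=(-1)*\<^sub>Rb" using nz(2)[OF b] by (simp add: refl_along_def scaleR_2)
  ultimately have "(-1)*\<^sub>RK b=refl_along b (K b)" using Kl(2)[of "-1" b] by simp
  hence "2*\<^sub>RK b=cn (K b) b*\<^sub>Rb" by (simp add: refl_cn scaleR_2 algebra_simps)
  hence "(1/2)*\<^sub>R(2*\<^sub>RK b)=(1/2)*\<^sub>R(cn (K b) b*\<^sub>Rb)" by simp
  thus ?thesis by simp
 qed
 define l where "l b=cn (K b) b / 2" for b
 have lc: "l b=l c" if "b\<in>R" "c\<in>R" "b\<cdot>c~=0" for b c
 proof -
  have "l b * (b\<cdot>c)=K b\<cdot>c" using eig[OF that(1)] by (metis inner_scaleR_left l_def)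
  also have "\<dots>=b\<cdot>K c" by (rule Ksym)
  also have "\<dots>=l c * (b\<cdot>c)" using eig[OF that(2)] by (metis inner_scaleR_right l_def)
  finally show ?thesis using that(3) by simp
 qed
 have lb: "l c=l b" if "c\<in>R" for c
  by (rule irr_connected[OF irr b, of "%c. l c=l b"]) (use lc that in auto)
 have Kx: "K x=l b*\<^sub>Rx" if "x\<in>span R" for x using that
 proof (induction rule: span_induct_alt)
  case base
  thus ?case by (simp add: K_def cn_def)
 next
  case (step t c y)
  thus ?case using eig[OF step(1)] lb[OF step(1)] by (simp add: Kl l_def scaleR_add_right)
 qed
 \<comment> \<open>The trace of \<open>K\<close> over an orthonormal basis is twice the number of
   roots. As \<open>K\<close> acts on \<open>span R\<close> as the scalar \<open>l b\<close>, this
   determines that scalar.\<close>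
 obtain B where B: "B\<subseteq>span R" "pairwise orthogonal B" "\<And>x. x\<in>B ==> norm x=1"
  "independent B" "card B=dim (span R)" "span B=span R"
  using orthonormal_basis_subspace[OF subspace_span[of R]] by metis
 have finB: "finite B" using B(4) independent_imp_finite by blast
 have pars: "(\<Sum>e\<in>B. (c\<cdot>e) * (c\<cdot>e))=c\<cdot>c" if c: "c\<in>R" for c
 proof -
  have "(\<Sum>e\<in>B. (c\<cdot>e)*\<^sub>Re)=c"
   by (rule orthonormal_basis_expand[OF B(2,3) _ finB]) (use c B(6) span_base in auto)
  hence "c\<cdot>c=c\<cdot>(\<Sum>e\<in>B. (c\<cdot>e)*\<^sub>Re)" by simp
  thus ?thesis by (simp add: inner_sum_right)
 qed
 have "(\<Sum>e\<in>B. K e\<cdot>e)=(\<Sum>e\<in>B. \<Sum>c\<in>R. 2 / (c\<cdot>c) * ((c\<cdot>e) * (c\<cdot>e)))"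
  unfolding K_def inner_sum_left inner_scaleR_left cn_def
  by (intro sum.cong refl) (simp add: inner_commute mult_ac)
 also have "\<dots>=(\<Sum>c\<in>R. 2 / (c\<cdot>c) * (\<Sum>e\<in>B. (c\<cdot>e) * (c\<cdot>e)))"
  by (subst sum.swap) (simp add: sum_distrib_left)
 also have "\<dots>=(\<Sum>c\<in>R. 2)" using pars nz(1) by (intro sum.cong) auto
 finally have tr: "(\<Sum>e\<in>B. K e\<cdot>e)=2 * real (card R)" by simp
 have "(\<Sum>e\<in>B. K e\<cdot>e)=(\<Sum>e\<in>B. l b)"
 proof (rule sum.cong[OF refl])
  fix e assume e: "e\<in>B"
  have "e\<cdot>e=1" using B(3)[OF e] by (simp add: dot_square_norm)
  thus "K e\<cdot>e=l b" using Kx[of e] e B(1) by auto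
 qed
 hence lh: "l b * real (dim R)=2 * real (card R)" using tr B(5) by (simp add: dim_span mult.commute)
 have "dim R~=0" using nz(1)[OF b] b dim_eq_0[of R] by auto
 hence l2: "l b=2 * (real (card R) / real (dim R))" using lh by (simp add: field_simps)
 have "(\<Sum>c\<in>R. cn b c * cn c b)=2 / (b\<cdot>b) * (K b\<cdot>b)"
  by (simp add: K_def inner_sum_left sum_distrib_left cn_def[of _ b] mult_ac)
 also have "K b\<cdot>b=l b * (b\<cdot>b)" using eig[OF b] by (metis inner_scaleR_left l_def)
 finally show ?thesis using l2 nz(2)[OF b] by simp
qed

text \<open>Evaluate \<open>coxeter_number\<close> at a root \<open>u\<close> of maximal height. Its
  Cartan integers with positive roots are nonnegative, since otherwise a higher root would exist;
  where nonzero, \<open>cn c u\<close> is at least 1. So the sum of products dominates the sum of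
  the \<open>cn u c\<close>, which is twice \<open>ht u - 1\<close>.\<close>

lemma ht_le:
 assumes irr: "irreducible_roots R" and b: "b\<in>Pos"
 shows "ht b\<le>real (card R) / real (dim R) - 1"
proof -
 let ?h = "real (card R) / real (dim R)"
 have "Pos~={}" using b by blast
 hence "Max ((%b. ht b) ` Pos)\<in>(%b. ht b) ` Pos" using finP by (intro Max_in) auto
 then obtain u where u1: "u\<in>Pos" "ht u=Max ((%b. ht b) ` Pos)" by auto
 have u2: "ht c\<le>ht u" if "c\<in>Pos" for c
  unfolding u1(2) using that finP by (intro Max_ge) auto
 note u = u1(1) u2
 have uR: "u\<in>R" using posD(1)[OF u(1)] .
 have dom: "u\<cdot>c\<ge>0" if c: "c\<in>Pos" for c
 proof (rule ccontr)
  assume "\<not> 0\<le>u\<cdot>c"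
  moreover have "u~=- c" using posD(2)[OF c] posD(2)[OF u(1)] by auto
  ultimately have "u + c\<in>R" using root_add[OF rs uR posD(1)[OF c]] by simp
  moreover have "(u + c)\<cdot>g > 0" using posD(2)[OF c] posD(2)[OF u(1)] by (simp add: inner_add_left)
  ultimately have "u + c\<in>Pos" by (simp add: pos_def)
  from u(2)[OF this] ht_ge1[OF c] show False by (simp add: inner_add_left)
 qed
 have "4 * ?h=(\<Sum>c\<in>R. cn u c * cn c u)" by (rule coxeter_number[OF irr uR, symmetric])
 also have "\<dots>=2 * (\<Sum>c\<in>Pos. cn u c * cn c u)" by (rule sum_pos2) (simp add: cn_def)
 finally have "2 * ?h=(\<Sum>c\<in>Pos. cn u c * cn c u)" by simp
 also have "\<dots>=cn u u * cn u u + (\<Sum>c\<in>Pos - {u}. cn u c * cn c u)" by (rule sum.remove[OF finP u(1)])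
 finally have A: "2 * ?h=4 + (\<Sum>c\<in>Pos - {u}. cn u c * cn c u)"
  using nz(2)[OF uR] by (simp add: cn_def[of u u])
 have B: "(\<Sum>c\<in>Pos - {u}. cn u c * cn c u)\<ge>(\<Sum>c\<in>Pos - {u}. cn u c)"
 proof (rule sum_mono)
  fix c assume c: "c\<in>Pos - {u}"
  hence cR: "c\<in>R" using posD(1) by blast
  have nn: "cn u c\<ge>0" using dom[of c] c nz(2)[OF cR] by (simp add: cn_def)
  show "cn u c\<le>cn u c * cn c u"
  proof (cases "u\<cdot>c=0")
   case True
   thus ?thesis by (simp add: cn_def)
  next
   case False
   hence "cn c u > 0" using dom[of c] c nz(2)[OF uR] by (simp add: cn_def inner_commute)
   moreover obtain k :: int where "cn c u = of_int k" using rsD(4)[OF rs uR cR] by (auto elim: Ints_cases)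
   ultimately have "cn c u\<ge>1" by simp
   thus ?thesis using nn by (simp add: mult_le_cancel_left1)
  qed
 qed
 have C: "(\<Sum>c\<in>Pos - {u}. cn u c)=2 * (ht u - 1)"
  unfolding rho_minus_one[OF u(1)] by (simp add: cn_def sum_distrib_left)
 have "ht u\<le>?h - 1" 
 proof -
  have "r\<le>h - 1" if "2 * h=4 + s" "t\<le>s" "t=2 * (r - 1)" for h s t r :: real using that by (simp add: algebra_simps)
  from this[OF A B C] show ?thesis .
 qed
 thus ?thesis using u(2)[OF b] by simp
qed

end

section \<open>Localizations and initial segments of positive roots\<close>

lemma step_ok_mono: "step_ok E N a ==> E\<subseteq>E' ==> step_ok E' N a" unfolding step_ok_def by (meson subset_trans)

lemma hf_const: "hf 0 (%_. v)" unfolding hf_def by (simp add: hp_const)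

text \<open>The start of the chains of additions. \<open>N0\<close> will be empty, or consist of the
  hyperplane at infinity, whose normal is orthogonal to \<open>E\<close>.\<close>

lemma fbas_const:
 assumes E: "subspace E" and N0: "\<And>v x. v\<in>N0 ==> x\<in>E ==> v\<cdot>x=0"
 shows "\<exists>F. fbas E N0 (dim E) (%_. 0) F"
proof -
 obtain B where B: "B\<subseteq>E" "pairwise orthogonal B" "\<And>x. x\<in>B ==> norm x=1"
  "independent B" "card B=dim E" "span B=E" using orthonormal_basis_subspace[OF E] by metis
 have finB: "finite B" using B(4) independent_imp_finite by blast
 obtain b where b: "bij_betw b {..<dim E} B"
  using ex_bij_betw_nat_finite[OF finB] B(5) by (auto simp: atLeast0LessThan)
 have bB: "b i\<in>B" if "i < dim E" for i using b that by (auto simp: bij_betw_def)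
 have expand: "x=(\<Sum>i<dim E. (b i\<cdot>x)*\<^sub>Rb i)" if "x\<in>E" for x
 proof -
  have "(\<Sum>e\<in>B. (x\<cdot>e)*\<^sub>Re)=x"
   by (rule orthonormal_basis_expand[OF B(2,3) _ finB]) (use that B(6) in auto)
  thus ?thesis using sum.reindex_bij_betw[OF b, of "%e. (x\<cdot>e)*\<^sub>Re"] by (simp add: inner_commute)
 qed
 have on: "b i\<cdot>b j=(if i=j then 1 else 0)" if "i < dim E" "j < dim E" for i j
 proof (cases "i=j")
  case True
  thus ?thesis using B(3)[OF bB[OF that(1)]] by (simp add: dot_square_norm)
 next
  case False
  hence "b i~=b j" using b that by (auto simp: bij_betw_def inj_on_def)
  thus ?thesis using B(2) bB[OF that(1)] bB[OF that(2)] False by (auto simp: pairwise_def orthogonal_def)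
 qed
 have "fbas E N0 (dim E) (%_. 0) (%i _. b i)" unfolding fbas_def
 proof (intro conjI allI impI)
  fix i assume i: "i < dim E"
  show "hf 0 (%_. b i)" by (rule hf_const)
  show "range (%_. b i)\<subseteq>E" using bB[OF i] B(1) by auto
  show "tang N0 (%_. b i)" unfolding tang_def using N0 bB[OF i] B(1) by blast
 next
  fix d and G :: "'a => 'a" assume G: "hf d G" "range G\<subseteq>E"
  show "\<exists>f. (\<forall>i<dim E. hq d 0 (f i)) \<and>
    (\<forall>x. G x=(\<Sum>i<dim E. f i x*\<^sub>Rb i))"
   by (rule exI[of _ "%i x. b i\<cdot>G x"]) (use G expand in \<open>auto simp: hf_def\<close>)
 next
  fix f :: "nat => 'a => real" and j x
  assume f: "\<forall>x. (\<Sum>i<dim E. f i x*\<^sub>Rb i)=0" and j: "j < dim E"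
  have "0=b j\<cdot>(\<Sum>i<dim E. f i x*\<^sub>Rb i)" using f by simp
  also have "\<dots>=(\<Sum>i<dim E. f i x * (b j\<cdot>b i))" by (simp add: inner_sum_right)
  also have "\<dots>=(\<Sum>i<dim E. if j=i then f i x else 0)" by (intro sum.cong refl) (use on j in auto)
  finally show "f j x=0" using j by simp
 qed
 thus ?thesis by blast
qed

text \<open>Adding \<open>v\<close> raises one exponent from the current \<open>dd\<close> to its
  successor, so the number of exponents above \<open>t\<close> grows exactly when \<open>dd\<close>
  equals \<open>t\<close>.\<close>

lemma fbas_chain:
 fixes val :: "'a::euclidean_space => real"
 assumes "finite P" "inj_on val P" "npar (N0\<union>P)" "N0\<inter>P={}" "fbas E N0 r (%_. 0) F0" "subspace E"
  "\<And>b. b\<in>P ==> step_ok E (N0\<union>{c\<in>P. val c < val b}) b"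
 shows "\<exists>e F. fbas E (N0\<union>P) r e F \<and>
  (\<forall>t. card {i. i < r \<and> t < e i}=card {v\<in>P. dd (N0\<union>{c\<in>P. val c < val v}) v=t})" using assms(1-4,7)
proof (induction "card P" arbitrary: P)
 case 0
 hence "P={}" by simp
 thus ?case using assms(5) by auto
next
 case (Suc n)
 have ne: "P~={}" using Suc(2) by auto
 have "Max (val ` P)\<in>val ` P" using Suc(3) ne by (intro Max_in) auto
 then obtain a where a: "a\<in>P" "val a=Max (val ` P)" by auto
 have amax: "val c\<le>val a" if "c\<in>P" for c unfolding a(2) using that Suc(3) by (intro Max_ge) auto
 define Q where "Q=P - {a}"
 have PQ: "P=insert a Q" "a\<notin>Q" using a(1) by (auto simp: Q_def)
 have less: "val c < val a" if "c\<in>Q" for c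
 proof -
  have "val c~=val a" using Suc(4) that a(1) unfolding Q_def by (auto dest: inj_onD)
  thus ?thesis using amax[of c] that by (auto simp: Q_def)
 qed
 have low: "{c\<in>P. val c < val b}={c\<in>Q. val c < val b}" if "b\<in>P" for b using amax[OF that] PQ by auto
 have lowa: "{c\<in>P. val c < val a}=Q" using less PQ by auto
 have np: "npar (N0\<union>Q)" by (rule npar_subset[OF Suc(5)]) (auto simp: Q_def)
 have "\<exists>e F. fbas E (N0\<union>Q) r e F \<and>
  (\<forall>t. card {i. i < r \<and> t < e i}=card {v\<in>Q. dd (N0\<union>{c\<in>Q. val c < val v}) v=t})"
 proof (rule Suc(1))
  show "n=card Q" using Suc(2,3) a(1) by (simp add: Q_def)
  show "finite Q" "inj_on val Q" "N0\<inter>Q={}" using Suc(3,4,6) by (auto simp: Q_def inj_on_diff)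
  show "npar (N0\<union>Q)" by (rule np)
  show "step_ok E (N0\<union>{c\<in>Q. val c < val b}) b" if "b\<in>Q" for b
   using Suc(7)[of b] low[of b] that by (auto simp: Q_def)
 qed
 then obtain e F where eF: "fbas E (N0\<union>Q) r e F"
  "\<And>t. card {i. i < r \<and> t < e i}=card {v\<in>Q. dd (N0\<union>{c\<in>Q. val c < val v}) v=t}" by blast
 have ins: "N0\<union>P=insert a (N0\<union>Q)" using PQ by auto
 have aN: "a\<notin>N0\<union>Q" using Suc(6) a(1) PQ by auto
 have ok: "step_ok E (N0\<union>Q) a" using Suc(7)[OF a(1)] lowa by simp
 obtain i0 F' where i0: "i0 < r" "e i0=dd (N0\<union>Q) a"
  "fbas E (insert a (N0\<union>Q)) r (e(i0 := Suc (dd (N0\<union>Q) a))) F'"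
  using step_fbas[OF Suc(5)[unfolded ins] aN eF(1) ok assms(6)] by blast
 let ?d = "dd (N0\<union>Q) a"
 have cnt: "card {i. i < r \<and> t < (e(i0 := Suc ?d)) i}=card {v\<in>P. dd (N0\<union>{c\<in>P. val c < val v}) v=t}" for t
 proof -
  have S: "{v\<in>P. dd (N0\<union>{c\<in>P. val c < val v}) v=t} =
    {v\<in>Q. dd (N0\<union>{c\<in>Q. val c < val v}) v=t}\<union>(if ?d=t then {a} else {})" using low lowa PQ(1) by auto
  have L: "{i. i < r \<and> t < (e(i0 := Suc ?d)) i}={i. i < r \<and> t < e i}\<union>(if ?d=t then {i0} else {})"
   using i0(1,2) by (auto simp: less_Suc_eq)
  have nS: "a\<notin>{v\<in>Q. dd (N0\<union>{c\<in>Q. val c < val v}) v=t}" using PQ by auto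
  have finQ: "finite Q" using Suc(3) by (simp add: Q_def)
  show ?thesis
  proof (cases "?d=t")
   case True
   hence "i0\<notin>{i. i < r \<and> t < e i}" using i0(2) by simp
   thus ?thesis unfolding S L using True nS finQ eF(2)[of t] by (simp del: Un_insert_right add: Un_commute)
  next
   case False
   thus ?thesis unfolding S L using eF(2)[of t] by simp
  qed
 qed
 show ?case
 using ins i0 cnt by auto
qed

lemma ortho_witness_in:
 fixes u :: "'a::euclidean_space"
 assumes "u\<notin>span S" "subspace E" "insert u S\<subseteq>E"
 shows "\<exists>x\<in>E. (\<forall>y\<in>S. y\<cdot>x=0) \<and> u\<cdot>x~=0"
proof -
 obtain x where x: "\<forall>y\<in>S. y\<cdot>x=0" "u\<cdot>x~=0" using ortho_witness[OF assms(1)] by blast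
 obtain y z where yz: "y\<in>span E" "\<And>w. w\<in>span E ==> orthogonal z w" "x=y + z"
  using orthogonal_subspace_decomp_exists[of E x] by metis
 have eq: "w\<cdot>x=w\<cdot>y" if "w\<in>E" for w
 proof -
  have "z\<cdot>w=0" using yz(2)[OF span_base[OF that]] by (simp add: orthogonal_def)
  thus ?thesis unfolding yz(3) by (simp add: inner_add_right inner_commute)
 qed
 show ?thesis
 proof (rule bexI[of _ y], intro conjI ballI)
  show "w\<cdot>y=0" if "w\<in>S" for w using eq[of w] x(1) that assms(3) by auto
  show "u\<cdot>y~=0" using eq[of u] x(2) assms(3) by auto
  show "y\<in>E" using yz(1) assms(2) by (simp add: span_eq_iff[THEN iffD2])
 qed
qed

context rsys
begin

lemma npar_pos: "npar (Pos)" unfolding npar_def using finP pos_not_par posD(1) nz(1) by blast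

lemma pos_coeff_bound:
 assumes b: "b\<in>Pos"
 shows "\<exists>f::'v => nat. b=(\<Sum>a\<in>Smp. of_nat (f a)*\<^sub>Ra) \<and> (\<forall>a\<in>Smp. b\<cdot>g < a\<cdot>g --> f a=0)"
proof -
 obtain f :: "'v => nat" where f: "b=(\<Sum>a\<in>Smp. of_nat (f a)*\<^sub>Ra)" using pos_coeffs[OF b] by blast
 have "f a=0" if a: "a\<in>Smp" "b\<cdot>g < a\<cdot>g" for a
 proof (rule ccontr)
  assume "f a~=0"
  hence f1: "1\<le>real (f a)" by simp
  have ps: "c\<cdot>g > 0" if "c\<in>Smp" for c using posD(2)[OF smpD[OF that]] .
  have "a\<cdot>g\<le>real (f a) * (a\<cdot>g)" using f1 ps[OF a(1)] by simp
  also have "\<dots>\<le>(\<Sum>c\<in>Smp. real (f c) * (c\<cdot>g))"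
   by (rule member_le_sum[OF a(1) _ finS]) (auto intro!: mult_nonneg_nonneg less_imp_le[OF ps])
  also have "\<dots>=b\<cdot>g" unfolding f by (simp add: inner_sum_left)
  finally show False using a(2) by simp
 qed
 thus ?thesis using f by blast
qed

text \<open>A simple root occurring in \<open>b\<close> has value at most that of \<open>b\<close>.
  Hence an initial segment lies in the span of the simple roots it has reached, and has smaller rank
  as long as one is missing.\<close>

lemma pos_coeff_le:
 assumes b: "b\<in>Pos" and J: "\<And>a. a\<in>Smp ==> a\<cdot>g\<le>b\<cdot>g ==> a\<in>J"
 shows "b\<in>span J"
proof -
 obtain f :: "'v => nat" where f: "b=(\<Sum>a\<in>Smp. of_nat (f a)*\<^sub>Ra)"
  "\<forall>a\<in>Smp. b\<cdot>g < a\<cdot>g --> f a=0" using pos_coeff_bound[OF b] by blast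
 have "(\<Sum>a\<in>Smp. of_nat (f a)*\<^sub>Ra)\<in>span J"
 proof (rule span_sum)
  fix a assume a: "a\<in>Smp"
  show "of_nat (f a)*\<^sub>Ra\<in>span J"
  proof (cases "a\<cdot>g\<le>b\<cdot>g")
   case True
   thus ?thesis using J[OF a] by (intro span_scale span_base)
  next
   case False
   thus ?thesis using f(2) a by (simp add: span_zero)
  qed
 qed
 thus ?thesis using f(1) by simp
qed

end

text \<open>Induction on the system and on the segment. While a simple root is missing below a
  non-simple \<open>u\<close>, the segment belongs to a smaller system. Once all are present,
  \<open>add_step\<close> applies with \<open>q\<close> one less than the rank, the bound being
  \<open>card_ht_less\<close>.\<close>

lemma fin_step:
 assumes "rs R" "inj_on (%c. c\<cdot>g) R" "\<And>c. c\<in>R ==> c\<cdot>g~=0" "u\<in>pos R g"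
 shows "step_ok (span R) {c\<in>pos R g. c\<cdot>g < u\<cdot>g} u" using assms
proof (induction "card R" arbitrary: R u rule: less_induct)
 case (less R)
 note IH = less(1)
 interpret rsys R g using less(2,4) by unfold_locales auto
 note inj = less(3)
 show ?case using less(5)
 proof (induction "card {c\<in>pos R g. c\<cdot>g < u\<cdot>g}" arbitrary: u rule: less_induct)
  case (less u)
  note u = less(2)
  let ?I = "{c\<in>pos R g. c\<cdot>g < u\<cdot>g}"
  have finI: "finite ?I" using finP by simp
  have uR: "u\<in>R" using posD(1)[OF u] .
  have dd: "real (dd ?I u)=u\<cdot>rho R g - 1" by (rule fin_dd[OF u inj])
  \<comment> \<open>Intersecting the segment with a subspace gives the segment of a smaller root
    system. This serves both for segments of small rank and for localizations.\<close>
  have sub: "step_ok (span R) {c\<in>?I. c\<in>X} u"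
   if X: "subspace X" "u\<in>X" and h: "h\<in>R" "h\<notin>X" for X h
  proof -
   have c: "card (R\<inter>X) < card R" using h rsD(1)[OF rs] by (intro psubset_card_mono) auto
   have eq: "{c\<in>?I. c\<in>X}={c\<in>pos (R\<inter>X) g. c\<cdot>g < u\<cdot>g}" by (auto simp: pos_def)
   have "step_ok (span (R\<inter>X)) {c\<in>pos (R\<inter>X) g. c\<cdot>g < u\<cdot>g} u"
    by (rule IH[OF c rs_Int_subspace[OF rs X(1)]])
     (use inj g u X(2) in \<open>auto simp: pos_def intro: inj_on_subset\<close>)
   thus ?thesis unfolding eq by (rule step_ok_mono) (simp add: span_mono)
  qed
  show ?case
  proof (cases "u\<in>smp R g")
   case True
   \<comment> \<open>For simple \<open>u\<close> the degree is 0: the roots below \<open>u\<close>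
     do not involve \<open>u\<close>, so a constant field dual to \<open>u\<close> among the simple
     roots works.\<close>
   let ?J = "smp R g - {u}"
   have ni: "u\<notin>span ?J" using smp_indep True unfolding dependent_def by blast
   have "insert u ?J\<subseteq>span R" using smpD posD(1) True by (auto intro: span_base)
   from ortho_witness_in[OF ni subspace_span this] obtain v where
    v: "v\<in>span R" "\<forall>y\<in>?J. y\<cdot>v=0" "u\<cdot>v~=0" by blast
   have cv: "c\<cdot>v=0" if "c\<in>?I" for c
   proof -
    have "c\<in>span ?J" by (rule pos_coeff_le) (use that in auto)
    thus ?thesis
    proof (induction rule: span_induct_alt)
     case (step t a y)
     thus ?case using v(2) by (simp add: inner_add_left)
    qed simp
   qed
   have "dd ?I u=0" using dd rho_smp(2)[OF True] by simp
   thus ?thesis unfolding step_ok_def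
    using v cv by (intro exI[of _ "%_. v"]) (auto simp: hf_const tang_def hyp_def intro!: exI[of _ 0])
  next
   case ns: False
   show ?thesis
   proof (cases "\<exists>h\<in>smp R g. u\<cdot>g\<le>h\<cdot>g")
    case True
    then obtain h where h: "h\<in>smp R g" "u\<cdot>g\<le>h\<cdot>g" by blast
    let ?J = "{h\<in>smp R g. h\<cdot>g < u\<cdot>g}"
    have lt: "w\<cdot>g < u\<cdot>g" if "w\<in>smp R g" "w\<cdot>g\<le>u\<cdot>g" for w
    proof -
     have "w~=u" using that(1) ns by auto
     hence "w\<cdot>g~=u\<cdot>g" using inj_onD[OF inj _ posD(1)[OF smpD[OF that(1)]] uR] by auto
     thus ?thesis using that(2) by simp
    qed
    have n: "h\<notin>span ?J"
    proof
     assume "h\<in>span ?J"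
     hence "h\<in>span (smp R g - {h})" by (rule set_rev_mp) (use h(2) in \<open>auto intro!: span_mono\<close>)
     thus False using smp_indep h(1) unfolding dependent_def by blast
    qed
    have b: "u\<in>span ?J" by (rule pos_coeff_le[OF u]) (use lt in auto)
    have "step_ok (span R) {c\<in>?I. c\<in>span ?J} u"
     by (rule sub[OF subspace_span b posD(1)[OF smpD[OF h(1)]] n])
    moreover have "{c\<in>?I. c\<in>span ?J}=?I"
    using pos_coeff_le by auto
    ultimately show ?thesis by simp
   next
    case False
    hence SI: "smp R g\<subseteq>?I" using smpD by force
    have "\<exists>F. fbas (span R) {} (dim (span R)) (%_. 0) F" by (rule fbas_const) auto
    then obtain F0 where F0: "fbas (span R) {} (dim R) (%_. 0) F0" by (auto simp: dim_span)
    have low: "{c\<in>?I. c\<cdot>g < w\<cdot>g}={c\<in>pos R g. c\<cdot>g < w\<cdot>g}" if "w\<in>?I" for w using that by auto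
    have st: "step_ok (span R) ({}\<union>{c\<in>?I. c\<cdot>g < w\<cdot>g}) w" if w: "w\<in>?I" for w
    proof -
     have "{c\<in>pos R g. c\<cdot>g < w\<cdot>g} \<subset> ?I" using w by auto
     hence "card {c\<in>pos R g. c\<cdot>g < w\<cdot>g} < card ?I" using finI by (rule psubset_card_mono[rotated])
     from less(1)[OF this] w have "step_ok (span R) {c\<in>pos R g. c\<cdot>g < w\<cdot>g} w" by simp
     thus ?thesis unfolding low[OF w] by simp
    qed
    have npI: "npar (insert u ?I)" by (rule npar_subset[OF npar_pos]) (use u in auto)
    have "\<exists>e F. fbas (span R) ({}\<union>?I) (dim R) e F \<and>
      (\<forall>t. card {i. i < dim R \<and> t < e i}=card {w\<in>?I. dd ({}\<union>{c\<in>?I. c\<cdot>g < w\<cdot>g}) w=t})"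
    proof (rule fbas_chain[OF finI _ _ _ F0 subspace_span st])
     show "inj_on (%c. c\<cdot>g) ?I" using inj by (rule inj_on_subset) (auto simp: pos_def)
     show "npar ({}\<union>?I)" by (rule npar_subset[OF npI]) auto
    qed auto
    then obtain e F where eF: "fbas (span R) ?I (dim R) e F"
     "\<And>t. card {i. i < dim R \<and> t < e i}=card {w\<in>?I. dd ({}\<union>{c\<in>?I. c\<cdot>g < w\<cdot>g}) w=t}" by auto
    obtain m :: nat where m: "m\<ge>1" "u\<cdot>rho R g=real m" using ht_nat[OF u] by blast
    have m2: "m\<ge>2"
    proof (rule ccontr)
     assume "\<not> m\<ge>2"
     thus False using ht_1_smp[OF u] m ns by simp
    qed
    have d: "dd ?I u=m - 1" using dd m by simp
    \<comment> \<open>Exponents above \<open>m - 1\<close> are counted by the roots of height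
      \<open>m\<close> already added. Since \<open>u\<close> is a further root of that height, at
      most \<open>dim R - 2\<close> of them exist.\<close>
    have "{w\<in>?I. dd ({}\<union>{c\<in>?I. c\<cdot>g < w\<cdot>g}) w=m - 1}\<subseteq>{b\<in>pos R g. b\<cdot>rho R g=real m} - {u}"
    proof
     fix w assume w: "w\<in>{w\<in>?I. dd ({}\<union>{c\<in>?I. c\<cdot>g < w\<cdot>g}) w=m - 1}"
     hence wI: "w\<in>?I" by blast
     have "dd {c\<in>pos R g. c\<cdot>g < w\<cdot>g} w=m - 1" using w low[OF wI] by simp
     hence "w\<cdot>rho R g - 1=real (m - 1)" using fin_dd[OF _ inj, of w] wI by simp
     thus "w\<in>{b\<in>pos R g. b\<cdot>rho R g=real m} - {u}" using wI m(1) by (auto simp: of_nat_diff)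
    qed
    hence "card {w\<in>?I. dd ({}\<union>{c\<in>?I. c\<cdot>g < w\<cdot>g}) w=m - 1}\<le>card ({b\<in>pos R g. b\<cdot>rho R g=real m} - {u})"
     using finP by (intro card_mono) auto
    also have "\<dots> < card {b\<in>pos R g. b\<cdot>rho R g=real m}" using finP u m by (intro card_Diff1_less) auto
    finally have lt: "card {i. i < dim R \<and> m - 1 < e i} < card {b\<in>pos R g. b\<cdot>rho R g=real m}"
     unfolding eF(2) .
    have "card {b\<in>pos R g. b\<cdot>rho R g=real m} < dim R" by (rule card_ht_less[OF m2]) (use u m in auto)
    hence few: "card {i. i < dim R \<and> dd ?I u < e i} < dim R - 1" unfolding d using lt by simp
    show ?thesis
    proof (rule add_step[OF npI _ eF(1) subspace_span _ _ few])
     show "u\<notin>?I" by simp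
     have "dim (smp R g)\<le>dim (insert u ?I)" using SI by (intro dim_subset) auto
     moreover have "dim (smp R g)=dim R" using smp_span dim_span by metis
     ultimately show "dim R - 1 + 1\<le>dim (insert u ?I)" using few by simp
     fix x assume x: "x\<in>hyp u" "\<exists>j\<in>?I. j\<cdot>x~=0"
     then obtain j where j: "j\<in>?I" "j\<cdot>x~=0" by blast
     have "step_ok (span R) {c\<in>?I. c\<in>hyp x} u"
      by (rule sub[OF subspace_hyp, where h = j]) (use x(1) j posD(1) in \<open>auto simp: hyp_def inner_commute\<close>)
     moreover have "{c\<in>?I. c\<in>hyp x}={j\<in>?I. j\<cdot>x=0}" by (auto simp: hyp_def inner_commute)
     ultimately show "step_ok (span R) {j\<in>?I. j\<cdot>x=0} u" by simp
    qed
   qed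
  qed
 qed
qed

context rsys
begin

text \<open>The exponents of the reflection arrangement form the partition dual to the numbers of
  roots of each height.\<close>

lemma fin_basis:
 assumes inj: "inj_on (%c. c\<cdot>g) R"
 shows "\<exists>e F. fbas (span R) (Pos) (dim R) e F \<and>
  (\<forall>t. card {i. i < dim R \<and> t < e i}=card {d\<in>Pos. ht d=real (Suc t)})"
proof -
 have "\<exists>F. fbas (span R) {} (dim (span R)) (%_. 0) F" by (rule fbas_const) auto
 then obtain F0 where F0: "fbas (span R) {} (dim R) (%_. 0) F0" by (auto simp: dim_span)
 have "\<exists>e F. fbas (span R) ({}\<union>Pos) (dim R) e F \<and>
   (\<forall>t. card {i. i < dim R \<and> t < e i}=card {d\<in>Pos. dd ({}\<union>{c\<in>Pos. c\<cdot>g < d\<cdot>g}) d=t})"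
 proof (rule fbas_chain[OF finP _ _ _ F0 subspace_span])
  show "inj_on (%c. c\<cdot>g) (Pos)" using inj by (rule inj_on_subset) (auto simp: pos_def)
  show "npar ({}\<union>Pos)" using npar_pos by simp
  show "step_ok (span R) ({}\<union>{c\<in>Pos. c\<cdot>g < d\<cdot>g}) d" if "d\<in>Pos" for d
   using fin_step[OF rs inj g that] by simp
 qed auto
 moreover have "{d\<in>Pos. dd ({}\<union>{c\<in>Pos. c\<cdot>g < d\<cdot>g}) d=t}={d\<in>Pos. ht d=real (Suc t)}" for t
 using fin_dd inj Collect_cong conj_cong by fastforce
 ultimately show ?thesis by simp
qed

end

section \<open>Duality of exponents\<close>

text \<open>The value at \<open>x + \<i> y\<close> of the complexification of a polynomial function.\<close>

definition cx :: "('a::euclidean_space => real) => 'a => 'a => complex" where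
 "cx f x y=poly (map_poly of_real (SOME p. \<forall>t. f (x + t*\<^sub>Ry)=poly p t)) \<i>"

lemma cxI:
 assumes "\<And>t. f (x + t*\<^sub>Ry)=poly p t"
 shows "cx f x y=poly (map_poly of_real p) \<i>"
proof -
 define q where "q=(SOME p. \<forall>t. f (x + t*\<^sub>Ry)=poly p t)"
 have q: "\<forall>t. f (x + t*\<^sub>Ry)=poly q t"
  unfolding q_def by (rule someI_ex, rule exI[of _ p]) (simp add: assms)
 have "poly q t=poly p t" for t using q[rule_format, of t] assms[of t] by (rule trans[OF sym])
 hence "q=p" by (simp add: poly_eq_poly_eq_iff[symmetric] fun_eq_iff)
 thus ?thesis by (simp add: cx_def q_def[symmetric])
qed

lemma evi_pCons: "poly (map_poly of_real (pCons a p)) (z::complex) = of_real a + z * poly (map_poly of_real p) z"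
 by (simp add: map_poly_pCons)

lemma evi_add: "poly (map_poly of_real (p + q)) (z::complex)=poly (map_poly of_real p) z + poly (map_poly of_real q) z"
proof (induction p q rule: poly_induct2)
 case (pCons a p b q)
 thus ?case by (simp only: add_pCons evi_pCons) (simp add: algebra_simps)
qed simp

lemma evi_smult: "poly (map_poly of_real (smult c p)) (z::complex) = of_real c * poly (map_poly of_real p) z"
proof (induction p)
 case (pCons a p)
 thus ?case by (simp only: smult_pCons evi_pCons) (simp add: algebra_simps)
qed simp

lemma evi_mult: "poly (map_poly of_real (p * q)) (z::complex)=poly (map_poly of_real p) z * poly (map_poly of_real q) z"
proof (induction p)
 case (pCons a p)
 thus ?case by (simp only: mult_pCons_left evi_add evi_smult evi_pCons) (simp add: algebra_simps)
qed simp

lemma cx_add: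
 assumes "hp d f" "hp e g"
 shows "cx (%x. f x + g x) x y=cx f x y + cx g x y"
proof -
 obtain p where p: "\<And>t. f (x + t*\<^sub>Ry)=poly p t" using hp_line[OF assms(1)] by blast
 obtain q where q: "\<And>t. g (x + t*\<^sub>Ry)=poly q t" using hp_line[OF assms(2)] by blast
 have "cx (%x. f x + g x) x y=poly (map_poly of_real (p + q)) \<i>" by (rule cxI) (simp add: p q)
 thus ?thesis by (simp add: evi_add cxI[OF p] cxI[OF q])
qed

lemma cx_mult:
 assumes "hp d f" "hp e g"
 shows "cx (%x. f x * g x) x y=cx f x y * cx g x y"
proof -
 obtain p where p: "\<And>t. f (x + t*\<^sub>Ry)=poly p t" using hp_line[OF assms(1)] by blast
 obtain q where q: "\<And>t. g (x + t*\<^sub>Ry)=poly q t" using hp_line[OF assms(2)] by blast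
 have "cx (%x. f x * g x) x y=poly (map_poly of_real (p * q)) \<i>" by (rule cxI) (simp add: p q)
 thus ?thesis by (simp add: evi_mult cxI[OF p] cxI[OF q])
qed

lemma cx_const: "cx (%_. c) x y = of_real c" using cxI[of "%_. c" x y "[:c:]"] by (simp add: evi_pCons)

lemma cx_linear: "cx (%x. a\<cdot>x) x y=Complex (a\<cdot>x) (a\<cdot>y)"
 using cxI[of "%x. a\<cdot>x" x y "[:a\<cdot>x, a\<cdot>y:]"] by (simp add: evi_pCons inner_add_right complex_eq_iff)

lemma cx_cmult: "hp d f ==> cx (%x. c * f x) x y = of_real c * cx f x y"
 using cx_mult[OF hp_const[of c], of d f x y] by (simp add: cx_const)

lemma cx_sum:
 assumes "finite I" "\<And>i. i\<in>I ==> hp d (f i)"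
 shows "cx (%x. \<Sum>i\<in>I. f i x) x y=(\<Sum>i\<in>I. cx (f i) x y)" using assms
proof (induction I rule: finite_induct)
 case (insert i I)
 have "hp d (%x. \<Sum>i\<in>I. f i x)" using insert(4) by (intro hp_sum) auto
 with insert show ?case by (simp add: cx_add[where d = d and e = d])
qed (simp add: cx_const)

lemma cx_prod_lin:
 assumes "finite I"
 shows "cx (%x. \<Prod>b\<in>I. b\<cdot>x) x y=(\<Prod>b\<in>I. Complex (b\<cdot>x) (b\<cdot>y))" using assms
proof (induction I rule: finite_induct)
 case (insert i I)
 thus ?case using cx_mult[OF hp_linear[of i] hp_prod_lin[of I]] by (simp add: cx_linear)
qed (simp add: cx_const)

text \<open>The two arguments on the left are the real and imaginary part of
  \<open>z * (x + \<i> y)\<close>.\<close>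

lemma cx_scale:
 assumes "hp d f"
 shows "cx f (Re z*\<^sub>Rx - Im z*\<^sub>Ry) (Im z*\<^sub>Rx + Re z*\<^sub>Ry)=z ^ d * cx f x y" using assms
proof (induction rule: hp.induct)
 case (hp_const c)
 thus ?case by (simp add: cx_const)
next
 case (hp_add d f g)
 show ?case using hp_add(3,4) by (simp add: cx_add[OF hp_add(1,2)] distrib_left)
next
 case (hp_lin d f a)
 have "Complex (a\<cdot>(Re z*\<^sub>Rx - Im z*\<^sub>Ry)) (a\<cdot>(Im z*\<^sub>Rx + Re z*\<^sub>Ry))=z * Complex (a\<cdot>x) (a\<cdot>y)"
  by (simp add: complex_eq_iff inner_diff_right inner_add_right)
 thus ?case unfolding cx_mult[OF hp_linear hp_lin(1)] cx_linear hp_lin(2) by simp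
qed

lemma cx_compose:
 assumes "hp d f" "linear T"
 shows "cx (%x. f (T x)) x y=cx f (T x) (T y)"
proof -
 obtain p where p: "\<And>t. f (T x + t*\<^sub>RT y)=poly p t" using hp_line[OF assms(1)] by blast
 have "f (T (x + t*\<^sub>Ry))=poly p t" for t
  using p by (simp add: linear_add[OF assms(2)] linear_scale[OF assms(2)])
 from cxI[of "%x. f (T x)", OF this] show ?thesis using cxI[of f, OF p] by simp
qed

section \<open>Tangent fields modulo the irrelevant ideal, and the action of reflections on
  them\<close>

definition dz :: "'v::euclidean_space set => nat => ('v => 'v) => bool" where
 "dz R d t \<longleftrightarrow> hf d t \<and> range t\<subseteq>span R \<and> tang R t"

text \<open>The degree \<open>d\<close> part of the irrelevant ideal times the module of tangent
  fields: the polynomial factor in \<open>mD_mult\<close> has degree \<open>Suc k\<close>, hence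
  positive.\<close>

inductive mD :: "'v::euclidean_space set => nat => ('v => 'v) => bool" for R d where
 mD_zero: "mD R d (%_. 0)"
| mD_add: "mD R d h ==> mD R d t ==> mD R d (%x. h x + t x)"
| mD_mult: "hp (Suc k) p ==> dz R j t ==> d=Suc k + j ==> mD R d (%x. p x*\<^sub>Rt x)"

lemma mD_scale: "mD R d h ==> mD R d (%x. c*\<^sub>Rh x)"
proof (induction rule: mD.induct)
 case (mD_add h t)
 thus ?case using mD.mD_add[OF mD_add(3,4)] by (simp add: scaleR_add_right)
next
 case (mD_mult k p j t)
 show ?case using mD.mD_mult[OF hp_cmult[OF mD_mult(1), of c] mD_mult(2,3)] by simp
qed (simp add: mD_zero)

lemma mD_sum: "finite I ==> (\<And>i. i\<in>I ==> mD R d (h i)) ==> mD R d (%x. \<Sum>i\<in>I. h i x)"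
proof (induction I rule: finite_induct)
 case (insert i I)
 thus ?case using mD_add[of R d "h i" "%x. \<Sum>i\<in>I. h i x"] by simp
qed (simp add: mD_zero)

lemma dz_add: "dz R d h ==> dz R d t ==> dz R d (%x. h x + t x)" unfolding dz_def hf_def tang_def inner_add_right
 by (intro conjI allI hp_add subsetI) (auto simp: image_subset_iff intro!: span_add)

lemma dz_scale: "dz R d h ==> dz R d (%x. c*\<^sub>Rh x)" unfolding dz_def hf_def tang_def inner_scaleR_right
 by (intro conjI allI hp_cmult subsetI) (auto simp: image_subset_iff intro!: span_scale)

lemma dz_zero: "dz R d (%_. 0)" unfolding dz_def hf_def tang_def by (auto simp: hp_zero span_zero)

lemma dz_sum: "finite I ==> (\<And>i. i\<in>I ==> dz R d (h i)) ==> dz R d (%x. \<Sum>i\<in>I. h i x)"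
proof (induction I rule: finite_induct)
 case (insert i I)
 thus ?case using dz_add[of R d "h i" "%x. \<Sum>i\<in>I. h i x"] by simp
qed (simp add: dz_zero)

lemma hp_vanish:
 assumes "hp d f" "\<And>x. x\<in>hyp b ==> f x=0"
 shows "\<exists>g. (if d=0 then g=(%_. 0) else hp (d - 1) g) \<and> (\<forall>x. f x=(b\<cdot>x) * g x) \<and> continuous_on UNIV g"
proof -
 obtain g where g: "if d=0 then g=(%_. 0) else hp (d - 1) g" "\<And>x. f x=f (proj b x) + (b\<cdot>x) * g x"
  using hp_taylor[OF assms(1), of b] by blast
 have "continuous_on UNIV g"
 proof (cases "d=0")
  case True
  thus ?thesis using g(1) by simp
 next
  case False
  thus ?thesis using g(1) hp_cont by auto
 qed
 thus ?thesis using g assms(2)[OF proj_in] by (intro exI[of _ g]) simp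
qed

lemma hf_vanish:
 fixes h :: "'a::euclidean_space => 'a"
 assumes "hf d h" "\<And>x. x\<in>hyp b ==> h x=0"
 shows "\<exists>t. (if d=0 then t=(%_. 0) else hf (d - 1) t) \<and> (\<forall>x. h x=(b\<cdot>x)*\<^sub>Rt x)"
proof -
 have "\<forall>w\<in>Basis. \<exists>g. (if d=0 then g=(%_. 0) else hp (d - 1) g) \<and> (\<forall>x. w\<cdot>h x=(b\<cdot>x) * g x)"
 proof
  fix w :: 'a
  have "hp d (%x. w\<cdot>h x)" using assms(1) by (simp add: hf_def)
  from hp_vanish[OF this, of b] assms(2)
  show "\<exists>g. (if d=0 then g=(%_. 0) else hp (d - 1) g) \<and> (\<forall>x. w\<cdot>h x=(b\<cdot>x) * g x)" by auto
 qed
 from bchoice[OF this] obtain g where g: "\<And>w. w\<in>Basis ==> if d=0 then g w=(%_. 0) else hp (d - 1) (g w)"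
  "\<And>w x. w\<in>Basis ==> w\<cdot>h x=(b\<cdot>x) * g w x" by blast
 define t where "t x=(\<Sum>w\<in>Basis. g w x*\<^sub>Rw)" for x
 have "h x=(b\<cdot>x)*\<^sub>Rt x" for x
 proof -
  have "h x=(\<Sum>w\<in>Basis. (h x\<cdot>w)*\<^sub>Rw)" by (simp add: euclidean_representation)
  also have "\<dots>=(\<Sum>w\<in>Basis. (b\<cdot>x)*\<^sub>Rg w x*\<^sub>Rw)"
  proof (rule sum.cong[OF refl])
   fix w :: 'a assume "w\<in>Basis"
   from g(2)[OF this, of x] show "(h x\<cdot>w)*\<^sub>Rw=(b\<cdot>x)*\<^sub>Rg w x*\<^sub>Rw" by (simp add: inner_commute)
  qed
  finally show ?thesis by (simp add: t_def scaleR_right.sum)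
 qed
 moreover have "if d=0 then t=(%_. 0) else hf (d - 1) t"
 proof (cases "d=0")
  case True
  hence "g w x=0" if "w\<in>Basis" for w x using g(1)[OF that] by simp
  hence "t=(%_. 0)" by (intro ext) (simp add: t_def)
  thus ?thesis using True by simp
 next
  case False
  have "hp (d - 1) (%x. v\<cdot>t x)" for v
  proof -
   have "hp (d - 1) (%x. (v\<cdot>w) * g w x)" if "w\<in>Basis" for w
    using g(1)[OF that] False by (intro hp_cmult) simp
   hence "hp (d - 1) (%x. \<Sum>w\<in>Basis. (v\<cdot>w) * g w x)" by (rule hp_sum)
   thus ?thesis by (simp add: t_def inner_sum_right mult.commute)
  qed
  thus ?thesis using False by (simp add: hf_def)
 qed
 ultimately show ?thesis by blast
qed

lemma hf_conj:
 assumes "hf d u" "linear s" "\<And>x y. x\<cdot>t y=t' x\<cdot>y"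
 shows "hf d (%x. t (u (s x)))" unfolding hf_def assms(3)
proof
 fix v
 have "hp d (%x. t' v\<cdot>u x)" using assms(1) by (simp add: hf_def)
 thus "hp d (%x. t' v\<cdot>u (s x))" by (rule hp_compose[OF assms(2)])
qed

lemma in_spanI:
 assumes "\<And>w. \<forall>y\<in>S. y\<cdot>w=0 ==> w\<cdot>x=0"
 shows "x\<in>span (S :: 'a::euclidean_space set)"
proof (rule ccontr)
 assume "x\<notin>span S"
 from ortho_witness[OF this] assms show False by (auto simp: inner_commute)
qed

lemma refl_fix: "x\<in>hyp b ==> refl_along b x=x" by (simp add: refl_along_def hyp_def inner_commute)

lemma refl_self: "b~=0 ==> refl_along b b=- b" by (simp add: refl_along_def scaleR_2)

lemma refl_conj:
 assumes rs: "rs R" and b: "b\<in>R" and t: "dz R d t"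
 shows "dz R d (%x. refl_along b (t (refl_along b x)))" unfolding dz_def
proof (intro conjI subsetI)
 let ?s = "refl_along b"
 note t' = t[unfolded dz_def]
 show "hf d (%x. ?s (t (?s x)))" by (rule hf_conj[OF conjunct1[OF t'] linear_refl refl_adj[symmetric]])
 show "tang R (%x. ?s (t (?s x)))" unfolding tang_def
 proof (intro ballI)
  fix c x assume c: "c\<in>R" "x\<in>hyp c"
  have "?s x\<in>hyp (?s c)" using c(2) by (simp add: hyp_def refl_inner)
  moreover have "?s c\<in>R" using rsD(3)[OF rs b c(1)] .
  ultimately have "?s c\<cdot>t (?s x)=0" using t' by (simp add: tang_def)
  thus "c\<cdot>?s (t (?s x))=0" by (simp add: refl_adj)
 qed
 fix y assume "y\<in>range (%x. ?s (t (?s x)))"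
 then obtain x where y: "y=?s (t (?s x))" by blast
 have "t (?s x)\<in>span R" using t' by blast
 thus "y\<in>span R" unfolding y refl_cn by (intro span_diff span_scale span_base[OF b])
qed

text \<open>The difference vanishes on \<open>hyp b\<close>, so it is the form \<open>b\<close>
  times a field, and that field is again tangent. Thus reflections act trivially modulo
  \<open>mD\<close>.\<close>

lemma refl_diff:
 assumes rs: "rs R" and b: "b\<in>R" and u: "dz R d u"
 shows "mD R d (%x. refl_along b (u (refl_along b x)) - u x)"
proof -
 let ?s = "refl_along b"
 define h where "h x=?s (u (?s x)) - u x" for x
 note u' = u[unfolded dz_def] and su' = refl_conj[OF assms, unfolded dz_def]
 have b0: "b~=0" using rsD(2)[OF rs] b by auto
 have hfh: "hf d h" unfolding h_def using u' su' by (intro hf_diff) auto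
 have bu: "b\<cdot>u x=0" if "x\<in>hyp b" for x using u' b that by (simp add: tang_def)
 have "h x=0" if "x\<in>hyp b" for x
 proof -
  have "u x\<in>hyp b" using bu[OF that] by (simp add: hyp_def)
  from refl_fix[OF this] show ?thesis by (simp add: h_def refl_fix[OF that])
 qed
 from hf_vanish[OF hfh this] obtain j where j: "if d=0 then j=(%_. 0) else hf (d - 1) j"
  "\<And>x. h x=(b\<cdot>x)*\<^sub>Rj x" by blast
 show ?thesis
 proof (cases "d=0")
  case True
  hence "(%x. ?s (u (?s x)) - u x)=(%_. 0)" using j by (intro ext) (simp add: h_def[symmetric])
  thus ?thesis by (simp add: mD_zero)
 next
  case False
  hence hfj: "hf (d - 1) j" using j(1) by simp
  hence cont: "continuous_on UNIV (%x. w\<cdot>j x)" for w using hp_cont by (auto simp: hf_def)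
  have rng: "j x\<in>span R" for x
  proof (rule in_spanI)
   fix w assume w: "\<forall>y\<in>R. y\<cdot>w=0"
   have wE: "w\<cdot>y=0" if "y\<in>span R" for y using that
   proof (induction rule: span_induct_alt)
    case (step t c y)
    thus ?case using w by (simp add: inner_add_right inner_commute)
   qed simp
   have "(b\<cdot>y) * (w\<cdot>j y)=0" for y
   proof -
    have "w\<cdot>h y=0" using wE u' su' by (simp add: h_def inner_diff_right image_subset_iff)
    thus ?thesis unfolding j(2) by simp
   qed
   from hyp_dense[OF b0 cont this] show "w\<cdot>j x=0" .
  qed
  have tb: "b\<cdot>j x=0" if x: "x\<in>hyp b" for x
  proof -
   \<comment> \<open>If \<open>b \<cdot> u\<close> is the form \<open>b\<close> times
     \<open>k\<close>, then \<open>b \<cdot> j\<close> is the value of \<open>k\<close> at the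
     reflected point minus \<open>k\<close>, which is 0 on the mirror.\<close>
   have "hp d (%x. b\<cdot>u x)" using u' by (simp add: hf_def)
   from hp_vanish[OF this bu] obtain k where k: "\<And>x. b\<cdot>u x=(b\<cdot>x) * k x" "continuous_on UNIV k" by blast
   have cs: "continuous_on UNIV ?s" by (rule linear_continuous_on[OF linear_conv_bounded_linear[THEN iffD1, OF linear_refl]])
   have "continuous_on UNIV (%x. k (?s x))"
    using continuous_on_compose[OF cs, of k] k(2) continuous_on_subset by (auto simp: o_def)
   hence c: "continuous_on UNIV (%x. b\<cdot>j x - (k (?s x) - k x))" using cont[of b] k(2) by (intro continuous_on_diff)
   have "(b\<cdot>y) * (b\<cdot>j y - (k (?s y) - k y))=0" for y
   proof -
    have "(b\<cdot>y) * (b\<cdot>j y)=b\<cdot>h y" by (simp add: j(2))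
    also have "\<dots>=?s b\<cdot>u (?s y) - b\<cdot>u y" by (simp add: h_def inner_diff_right refl_adj)
    also have "\<dots>=- (b\<cdot>?s y) * k (?s y) - (b\<cdot>y) * k y" by (simp add: refl_self[OF b0] k(1))
    also have "b\<cdot>?s y=- (b\<cdot>y)" by (simp add: refl_adj[symmetric] refl_self[OF b0])
    finally show ?thesis by (simp add: algebra_simps)
   qed
   from hyp_dense[OF b0 c this, of x] show ?thesis by (simp add: refl_fix[OF x])
  qed
  have "tang R j" unfolding tang_def
  proof (intro ballI)
   fix c x assume c: "c\<in>R" "x\<in>hyp c"
   show "c\<cdot>j x=0"
   proof (cases "b\<in>span {c}")
    case True
    hence "b=c \<or> b=- c" using rsD(5)[OF rs c(1) b] by simp
    thus ?thesis using tb[of x] c(2) by (auto simp: hyp_def)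
   next
    case False
    obtain y where y: "c\<cdot>y=0" "b\<cdot>y~=0" using ortho_witness[OF False] by auto
    have "(\<forall>x\<in>hyp c. b\<cdot>x=0) \<or> (\<forall>x\<in>hyp c. c\<cdot>j x=0)"
    proof (rule hp_domain[OF hp_linear _ subspace_hyp])
     show "hp (d - 1) (%x. c\<cdot>j x)" using hfj by (simp add: hf_def)
     fix z assume z: "z\<in>hyp c"
     have "c\<cdot>h z=0" using u' su' c(1) z by (simp add: h_def inner_diff_right tang_def)
     thus "b\<cdot>z * (c\<cdot>j z)=0" unfolding j(2) by simp
    qed
    thus ?thesis using y c(2) by (auto simp: hyp_def)
   qed
  qed
  hence "dz R (d - 1) j" unfolding dz_def using hfj rng by auto
  from mD_mult[OF hp_linear[of b] this, of d] False
  have "mD R d (%x. (b\<cdot>x)*\<^sub>Rj x)" by simp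
  thus ?thesis unfolding h_def[symmetric] j(2) .
 qed
qed

text \<open>Orthogonal maps with inverse \<open>w'\<close> that preserve \<open>R\<close> and act
  trivially on tangent fields modulo \<open>mD\<close>. Reflections are such maps, and so are
  products; with the inverse kept explicit, powers and averages are formed directly.\<close>

definition gd :: "'v::euclidean_space set => ('v => 'v) => ('v => 'v) => bool" where
 "gd R w w' \<longleftrightarrow> linear w \<and> linear w' \<and> (\<forall>x. w (w' x)=x) \<and> (\<forall>x. w' (w x)=x) \<and>
   (\<forall>x y. w x\<cdot>y=x\<cdot>w' y) \<and> w ` R\<subseteq>R \<and> w' ` R\<subseteq>R \<and>
   (\<forall>d t. dz R d t --> dz R d (%x. w (t (w' x))) \<and> mD R d (%x. w (t (w' x)) - t x))"

lemma gdD: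
 assumes "gd R w w'"
 shows "linear w" "linear w'" "\<And>x. w (w' x)=x" "\<And>x. w' (w x)=x" "\<And>x y. w x\<cdot>y=x\<cdot>w' y"
  "\<And>b. b\<in>R ==> w b\<in>R" "\<And>b. b\<in>R ==> w' b\<in>R"
  "\<And>d t. dz R d t ==> dz R d (%x. w (t (w' x)))"
  "\<And>d t. dz R d t ==> mD R d (%x. w (t (w' x)) - t x)"
 using assms unfolding gd_def by (simp_all add: image_subset_iff)

lemma gd_id: "gd R (%x. x) (%x. x)" unfolding gd_def by (simp add: mD_zero linear_iff)

lemma gd_refl: "rs R ==> b\<in>R ==> gd R (refl_along b) (refl_along b)"
 unfolding gd_def using refl_conj[of R b] refl_diff[of R b] rsD(3)[of R b]
 by (simp add: linear_refl refl_refl refl_adj image_subset_iff)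

lemma gd_comp:
 assumes "gd R w w'" "gd R v v'"
 shows "gd R (%x. w (v x)) (%x. v' (w' x))" unfolding gd_def
proof (intro conjI allI impI)
 show "linear (%x. w (v x))" "linear (%x. v' (w' x))"
  using linear_compose[OF gdD(1)[OF assms(2)] gdD(1)[OF assms(1)]]
   linear_compose[OF gdD(2)[OF assms(1)] gdD(2)[OF assms(2)]] by (simp_all add: o_def)
 show "(%x. w (v x)) ` R\<subseteq>R" "(%x. v' (w' x)) ` R\<subseteq>R"
  using gdD(6,7)[OF assms(1)] gdD(6,7)[OF assms(2)] by auto
 show "w (v (v' (w' x)))=x" "v' (w' (w (v x)))=x" "w (v x)\<cdot>y=x\<cdot>v' (w' y)" for x y
  using gdD(3-5)[OF assms(1)] gdD(3-5)[OF assms(2)] by simp_all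
 fix d t assume t: "dz R d t"
 note vt = gdD(8,9)[OF assms(2) t]
 note wvt = gdD(8,9)[OF assms(1) vt(1)]
 show "dz R d (%x. w (v (t (v' (w' x)))))" by (rule wvt(1))
 show "mD R d (%x. w (v (t (v' (w' x)))) - t x)" using mD_add[OF wvt(2) vt(2)] by simp
qed

lemma gd_pow: "gd R w w' ==> gd R (w ^^ j) (w' ^^ j)"
proof (induction j)
 case 0
 thus ?case using gd_id[of R] by (simp add: id_def)
next
 case (Suc j)
 from gd_comp[OF Suc(2) Suc(1)[OF Suc(2)]]
 show ?case by (simp only: funpow_Suc_right[of j w'] funpow.simps(2)[of j w] o_def)
qed

text \<open>Average the conjugates of \<open>t\<close> over the powers of \<open>c\<close>. Each
  conjugate differs from \<open>t\<close> only by an element of \<open>mD\<close>, hence so does the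
  average.\<close>

lemma average:
 assumes gd: "gd R c c'" and k: "k > 0" "\<And>x. (c ^^ k) x=x" and t: "dz R d t"
 shows "\<exists>h. dz R d h \<and> mD R d (%x. h x - t x) \<and> (\<forall>x. h (c x)=c (h x))"
proof -
 define T where "T j x=(c ^^ j) (t ((c' ^^ j) x))" for j x
 define h where "h x=(1 / real k)*\<^sub>R(\<Sum>j<k. T j x)" for x
 note g = gdD[OF gd_pow[OF gd]]
 have k': "(c' ^^ k) x=x" for x using k(2)[of "(c' ^^ k) x"] g(3)[of k x] by simp
 have dzT: "dz R d (T j)" for j using g(8)[OF t, of j] by (simp add: T_def[abs_def])
 have mDT: "mD R d (%x. T j x - t x)" for j using g(9)[OF t, of j] by (simp add: T_def)
 have "dz R d h" unfolding h_def[abs_def] by (intro dz_scale dz_sum) (use dzT in auto)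
 moreover have "mD R d (%x. h x - t x)"
 proof -
  have "mD R d (%x. (1 / real k)*\<^sub>R(\<Sum>j<k. T j x - t x))" by (intro mD_scale mD_sum) (use mDT in auto)
  moreover have "(%x. (1 / real k)*\<^sub>R(\<Sum>j<k. T j x - t x))=(%x. h x - t x)"
   using k(1) by (intro ext) (simp add: h_def sum_subtractf sum_constant_scaleR scaleR_diff_right)
  ultimately show ?thesis by simp
 qed
 moreover have "h (c x)=c (h x)" for x
 proof -
  have "T (Suc j) (c x)=c (T j x)" for j
   by (simp only: T_def funpow_Suc_right[of j c'] funpow.simps(2)[of j c] o_def gdD(4)[OF gd])
  hence "c (\<Sum>j<k. T j x)=(\<Sum>j<k. T (Suc j) (c x))" by (simp add: linear_sum[OF gdD(1)[OF gd]])
  also have "\<dots>=(\<Sum>j<k. T j (c x))"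
  proof -
   have "(\<Sum>j<Suc k. T j (c x))=T 0 (c x) + (\<Sum>j<k. T (Suc j) (c x))" by (rule sum.lessThan_Suc_shift)
   moreover have "T k (c x)=T 0 (c x)" by (simp add: T_def k(2) k')
   ultimately show ?thesis by simp
  qed
  finally show ?thesis by (simp add: h_def linear_scale[OF gdD(1)[OF gd]])
 qed
 ultimately show ?thesis by blast
qed

text \<open>Some positive degree is spent on the factor from the irrelevant ideal, so only basis
  fields of degree strictly below \<open>d\<close> occur. This strictness makes the induction in
  \<open>eigenvalue_symmetry\<close> triangular.\<close>

lemma mD_expand:
 assumes "mD R d h" and fb: "fbas (span R) R r e F"
 shows "\<exists>f. (\<forall>i<r. if e i < d then hp (d - e i) (f i) else f i=(%_. 0)) \<and> (\<forall>x. h x=(\<Sum>i<r. f i x*\<^sub>RF i x))"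
 using assms(1)
proof (induction rule: mD.induct)
 case mD_zero
 show ?case by (rule exI[of _ "%_ _. 0"]) (simp add: hp_zero)
next
 case (mD_add h t)
 from mD_add(3) obtain f where f: "\<forall>i<r. if e i < d then hp (d - e i) (f i) else f i=(%_. 0)"
  "\<forall>x. h x=(\<Sum>i<r. f i x*\<^sub>RF i x)" by blast
 from mD_add(4) obtain f' where f': "\<forall>i<r. if e i < d then hp (d - e i) (f' i) else f' i=(%_. 0)"
  "\<forall>x. t x=(\<Sum>i<r. f' i x*\<^sub>RF i x)" by blast
 show ?case
 proof (rule exI[of _ "%i x. f i x + f' i x"], intro conjI allI impI)
  fix i assume i: "i < r"
  show "if e i < d then hp (d - e i) (%x. f i x + f' i x) else (%x. f i x + f' i x)=(%_. 0)"
   using f(1)[rule_format, OF i] f'(1)[rule_format, OF i] hp_add[of "d - e i" "f i" "f' i"]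
   by (cases "e i < d") simp_all
 next
  show "h x + t x=(\<Sum>i<r. (f i x + f' i x)*\<^sub>RF i x)" for x
   using f(2) f'(2) by (simp add: scaleR_add_left sum.distrib)
 qed
next
 case (mD_mult k p j t)
 from mD_mult(2) have "hf j t" "range t\<subseteq>span R" "tang R t" by (auto simp: dz_def)
 from fbasD(4)[OF fb this] obtain f where
  f: "\<forall>i<r. hq j (e i) (f i)" "\<forall>x. t x=(\<Sum>i<r. f i x*\<^sub>RF i x)" by blast
 show ?case
 proof (rule exI[of _ "%i x. p x * f i x"], intro conjI allI impI)
  fix i assume i: "i < r"
  show "if e i < d then hp (d - e i) (%x. p x * f i x) else (%x. p x * f i x)=(%_. 0)"
  proof (cases "e i\<le>j")
   case True
   hence "hp (Suc k + (j - e i)) (%x. p x * f i x)" using f(1) i mD_mult(1) by (intro hp_mult) auto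
   moreover have "Suc k + (j - e i)=d - e i" "e i < d" using True mD_mult(3) by auto
   ultimately show ?thesis by simp
  next
   case False
   hence "f i=(%_. 0)" using f(1) i by auto
   thus ?thesis by (simp add: hp_zero)
  qed
 next
  show "p x*\<^sub>Rt x=(\<Sum>i<r. (p x * f i x)*\<^sub>RF i x)" for x using f(2) by (simp add: scaleR_right.sum)
 qed
qed

section \<open>A bipartite Coxeter element and its Perron vector\<close>

lemma span_orth:
 assumes "\<And>a b. a\<in>A ==> b\<in>B ==> a\<cdot>b=0" "x\<in>span A" "y\<in>span B"
 shows "x\<cdot>(y::'a::euclidean_space)=0"
proof -
 have a: "a\<cdot>y=0" if "a\<in>A" for a using assms(3)
 proof (induction rule: span_induct_alt)
  case (step t b z)
  thus ?case using assms(1)[OF that] by (simp add: inner_add_right)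
 qed simp
 show ?thesis using assms(2)
 proof (induction rule: span_induct_alt)
  case (step t b z)
  thus ?case using a by (simp add: inner_add_left)
 qed simp
qed

text \<open>The average degree is below 2, so some vertex has at most one neighbour. Colour the
  others and put this vertex on the side without that neighbour.\<close>

lemma forest_coloring:
 fixes S :: "'a::euclidean_space set"
 assumes "finite S" "\<And>T. T\<subseteq>S ==> T~={} ==> card {(a, b). a\<in>T \<and> b\<in>T \<and> a~=b \<and> a\<cdot>b~=0} < 2 * card T"
 shows "\<exists>J\<subseteq>S. (\<forall>a\<in>J. \<forall>b\<in>J. a~=b --> a\<cdot>b=0) \<and> (\<forall>a\<in>S - J. \<forall>b\<in>S - J. a~=b --> a\<cdot>b=0)" using assms
proof (induction "card S" arbitrary: S)
 case 0
 thus ?case by auto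
next
 case (Suc n)
 let ?N = "%v. {b\<in>S. v~=b \<and> v\<cdot>b~=0}"
 have ne: "S~={}" using Suc(2) by auto
 have "\<exists>v\<in>S. card (?N v) < 2"
 proof (rule ccontr)
  assume "\<not> ?thesis"
  hence "(\<Sum>v\<in>S. 2)\<le>(\<Sum>v\<in>S. card (?N v))" by (intro sum_mono) (simp add: not_less)
  also have "\<dots>=card (SIGMA v:S. ?N v)" using Suc(3) by (simp add: card_SigmaI)
  also have "(SIGMA v:S. ?N v)={(a, b). a\<in>S \<and> b\<in>S \<and> a~=b \<and> a\<cdot>b~=0}" by auto
  finally show False using Suc(4)[OF order_refl ne] by simp
 qed
 then obtain v where v: "v\<in>S" "card (?N v) < 2" by blast
 have N1: "b=b'" if "b\<in>?N v" "b'\<in>?N v" for b b'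
 proof -
  have "card (?N v)\<le>Suc 0" using v(2) by simp
  thus ?thesis using that Suc(3) card_le_Suc0_iff_eq[of "?N v"] by simp
 qed
 have "\<exists>J\<subseteq>S - {v}. (\<forall>a\<in>J. \<forall>b\<in>J. a~=b --> a\<cdot>b=0) \<and>
   (\<forall>a\<in>(S - {v}) - J. \<forall>b\<in>(S - {v}) - J. a~=b --> a\<cdot>b=0)"
 proof (rule Suc(1))
  show "n=card (S - {v})" "finite (S - {v})" using Suc(2,3) v(1) by auto
  show "card {(a, b). a\<in>T \<and> b\<in>T \<and> a~=b \<and> a\<cdot>b~=0} < 2 * card T"
   if "T\<subseteq>S - {v}" "T~={}" for T by (rule Suc(4)) (use that in auto)
 qed
 then obtain J where J': "J\<subseteq>S - {v}" "\<forall>a\<in>J. \<forall>b\<in>J. a~=b --> a\<cdot>b=0"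
  "\<forall>a\<in>(S - {v}) - J. \<forall>b\<in>(S - {v}) - J. a~=b --> a\<cdot>b=0" by (elim exE conjE)
 have J: "J\<subseteq>S - {v}" "\<And>a b. a\<in>J ==> b\<in>J ==> a~=b ==> a\<cdot>b=0"
  "\<And>a b. a\<in>S - {v} - J ==> b\<in>S - {v} - J ==> a~=b ==> a\<cdot>b=0" using J' by simp_all
 show ?case
 proof (cases "?N v\<inter>J={}")
  case True
  have vJ: "v\<cdot>b=0" "b\<cdot>v=0" if "b\<in>J" for b
  proof -
   have "b\<notin>?N v" "b\<in>S" "b~=v" using True that J(1) by blast+
   thus "v\<cdot>b=0" by auto
   thus "b\<cdot>v=0" by (simp add: inner_commute)
  qed
  show ?thesis
  proof (rule exI[of _ "insert v J"], intro conjI ballI impI)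
   show "insert v J\<subseteq>S" using v(1) J(1) by blast
   fix a b
   show "a\<cdot>b=0" if "a\<in>insert v J" "b\<in>insert v J" "a~=b" using that vJ J(2) by blast
   show "a\<cdot>b=0" if "a\<in>S - insert v J" "b\<in>S - insert v J" "a~=b" using that J(3)[of a b] by blast
  qed
 next
  case False
  then obtain b0 where b0: "b0\<in>?N v" "b0\<in>J" by blast
  have vJ: "v\<cdot>b=0" "b\<cdot>v=0" if "b\<in>S - J" "b~=v" for b
  proof -
   have "b\<notin>?N v" using N1[OF b0(1), of b] b0(2) that(1) by blast
   thus "v\<cdot>b=0" using that by auto
   thus "b\<cdot>v=0" by (simp add: inner_commute)
  qed
  show ?thesis
  proof (rule exI[of _ J], intro conjI ballI impI)
   show "J\<subseteq>S" using J(1) by blast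
   fix a b
   show "a\<cdot>b=0" if "a\<in>J" "b\<in>J" "a~=b" using that J(2) by blast
   show "a\<cdot>b=0" if "a\<in>S - J" "b\<in>S - J" "a~=b"
   proof (cases "a=v \<or> b=v")
    case True
    thus ?thesis using that vJ by blast
   next
    case False
    thus ?thesis using that J(3)[of a b] by blast
   qed
  qed
 qed
qed

text \<open>Compactness of the unit sphere of coefficient vectors. The orthonormal family
  \<open>f\<close> only gives these vectors a Euclidean space to live in.\<close>

lemma rayleigh_min:
 fixes S :: "'a::euclidean_space set" and e :: "'a => 'a"
 assumes S: "finite S" "S~={}" "card S\<le>DIM('a)"
 shows "\<exists>y::'a => real. (\<Sum>a\<in>S. y a ^ 2)=1 \<and> (\<forall>z. norm (\<Sum>a\<in>S. y a*\<^sub>Re a) ^ 2 * (\<Sum>a\<in>S. z a ^ 2)\<le>norm (\<Sum>a\<in>S. z a*\<^sub>Re a) ^ 2)"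
proof -
 obtain f :: "'a => 'a" where f: "f ` S\<subseteq>Basis" "inj_on f S"
  using card_le_inj[OF S(1) finite_Basis] S(3) by blast
 define Zv where "Zv z=(\<Sum>a\<in>S. z a*\<^sub>Rf a)" for z :: "'a => real"
 have on: "f a\<cdot>f u=(if a=u then 1 else 0)" if "a\<in>S" "u\<in>S" for a u
 proof -
  have "f a\<in>Basis" "f u\<in>Basis" "f a=f u \<longleftrightarrow> a=u" using f that by (auto dest: inj_onD)
  thus ?thesis by (simp add: inner_Basis)
 qed
 have co: "Zv z\<cdot>f a=z a" if "a\<in>S" for z a
 proof -
  have "Zv z\<cdot>f a=(\<Sum>u\<in>S. if u=a then z u else 0)"
   unfolding Zv_def inner_sum_left by (intro sum.cong refl) (use on that in auto)
  thus ?thesis using S(1) that by simp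
 qed
 have nrm: "norm (Zv z) ^ 2=(\<Sum>a\<in>S. z a ^ 2)" for z
 proof -
  have "norm (Zv z) ^ 2=Zv z\<cdot>Zv z" by (simp add: power2_norm_eq_inner)
  also have "\<dots>=(\<Sum>a\<in>S. z a * (Zv z\<cdot>f a))" by (subst (2) Zv_def) (simp add: inner_sum_right)
  also have "\<dots>=(\<Sum>a\<in>S. z a ^ 2)" by (intro sum.cong refl) (simp add: co power2_eq_square)
  finally show ?thesis .
 qed
 define q where "q Y=norm (\<Sum>a\<in>S. (Y\<cdot>f a)*\<^sub>Re a) ^ 2" for Y
 have qZ: "q (Zv z)=norm (\<Sum>a\<in>S. z a*\<^sub>Re a) ^ 2" for z unfolding q_def by (simp add: co cong: sum.cong)
 let ?K = "sphere 0 1\<inter>span (f ` S)"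
 have ZvE: "Zv z\<in>span (f ` S)" for z unfolding Zv_def by (intro span_sum span_scale span_base) auto
 have "compact ?K" by (intro compact_Int_closed compact_sphere closed_subspace subspace_span)
 moreover have "?K~={}"
 proof -
  obtain a where "a\<in>S" using S(2) by blast
  hence "f a\<in>?K" using f(1) by (auto intro: span_base)
  thus ?thesis by blast
 qed
 moreover have "continuous_on ?K q" unfolding q_def by (intro continuous_intros)
 ultimately obtain Y where Y: "Y\<in>?K" "\<And>Z. Z\<in>?K ==> q Y\<le>q Z" using continuous_attains_inf[of ?K q] by blast
 define y where "y a=Y\<cdot>f a" for a
 have YZ: "Y=Zv y"
 proof -
  have "x=Zv (%a. x\<cdot>f a)" if "x\<in>span (f ` S)" for x using that
  proof (induction rule: span_induct_alt)
   case base
   thus ?case by (simp add: Zv_def)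
  next
   case (step c b x)
   then obtain u where u: "u\<in>S" "b=f u" by blast
   have "Zv (%a. b\<cdot>f a)=(\<Sum>a\<in>S. if a=u then f a else 0)"
    unfolding Zv_def u(2) by (intro sum.cong refl) (use on u(1) in auto)
   hence b: "Zv (%a. b\<cdot>f a)=b" using u S(1) by simp
   have "Zv (%a. (c*\<^sub>Rb + x)\<cdot>f a)=c*\<^sub>RZv (%a. b\<cdot>f a) + Zv (%a. x\<cdot>f a)"
    unfolding Zv_def by (simp add: inner_add_left scaleR_add_left sum.distrib scaleR_right.sum)
   thus ?case using b step(2) by simp
  qed
  thus ?thesis unfolding y_def using Y(1) by blast
 qed
 have "norm Y=1" using Y(1) by simp
 hence y1: "(\<Sum>a\<in>S. y a ^ 2)=1" using nrm[of y] YZ by simp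
 have "q Y * (\<Sum>a\<in>S. z a ^ 2)\<le>norm (\<Sum>a\<in>S. z a*\<^sub>Re a) ^ 2" for z
 proof (cases "norm (Zv z)=0")
  case True
  thus ?thesis using nrm[of z] by simp
 next
  case False
  let ?n = "norm (Zv z)"
  have "(1 / ?n)*\<^sub>RZv z\<in>?K" using False ZvE by (auto intro: span_scale)
  from Y(2)[OF this] have "q Y\<le>q ((1 / ?n)*\<^sub>RZv z)" .
  also have "\<dots>=(1 / ?n) ^ 2 * q (Zv z)"
  proof -
   have "(\<Sum>a\<in>S. (((1 / ?n)*\<^sub>RZv z)\<cdot>f a)*\<^sub>Re a)=(1 / ?n)*\<^sub>R(\<Sum>a\<in>S. (Zv z\<cdot>f a)*\<^sub>Re a)"
    by (simp add: scaleR_right.sum)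
   thus ?thesis unfolding q_def by (simp add: power_mult_distrib power_divide)
  qed
  finally have "q Y * ?n ^ 2\<le>q (Zv z)" using False by (simp add: field_simps)
  thus ?thesis unfolding nrm qZ .
 qed
 moreover have "q Y=norm (\<Sum>a\<in>S. y a*\<^sub>Re a) ^ 2" by (simp add: q_def y_def)
 ultimately show ?thesis using y1 by (intro exI[of _ y]) simp
qed

lemma quadratic_nonneg:
 assumes "\<And>t::real. 0\<le>2 * t * a + t ^ 2 * b"
 shows "a=0"
proof (rule ccontr)
 assume a: "a~=0"
 define B where "B=1 + \<bar>b\<bar>"
 have B: "B > 0" "b\<le>B" by (auto simp: B_def)
 have "0\<le>2 * (- a / B) * a + (- a / B) ^ 2 * b" by (rule assms)
 also have "\<dots>\<le>2 * (- a / B) * a + (- a / B) ^ 2 * B" using B by (intro add_left_mono mult_left_mono) auto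
 also have "\<dots>=- (a ^ 2 / B)" using B by (simp add: power2_eq_square field_simps)
 finally have "a ^ 2 / B\<le>0" by simp
 thus False using a B by (simp add: divide_le_0_iff)
qed

text \<open>For pairwise orthogonal \<open>J\<close> this is the product of the commuting
  reflections along \<open>J\<close>, in a form independent of an ordering.\<close>

definition sJ :: "'v::euclidean_space set => 'v => 'v" where
 "sJ J x=x - (\<Sum>a\<in>J. cn x a*\<^sub>Ra)"

context rsys
begin

text \<open>An orthogonal splitting of the simple roots would split all roots, by induction on the
  height. If \<open>b - a\<close> lies in the part orthogonal to the simple root \<open>a\<close>,
  then reflecting \<open>b\<close> along \<open>a\<close> gives the root \<open>b - 2 a\<close>; if
  positive it contradicts the splitting, if negative it decomposes \<open>a\<close>.\<close>

lemma smp_connected: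
 assumes irr: "irreducible_roots R" and Z: "Z\<subseteq>Smp" "Z~={}"
  and orth: "\<And>a u. a\<in>Z ==> u\<in>Smp - Z ==> a\<cdot>u=0"
 shows "Z=Smp"
proof -
 let ?C = "Smp - Z"
 have ZC: "x\<cdot>y=0" if "x\<in>span Z" "y\<in>span ?C" for x y by (rule span_orth[OF orth that])
 have split: "b\<in>span Z \<or> b\<in>span ?C" if "b\<in>Pos" "ht b=real n" for b n using that
 proof (induction n arbitrary: b rule: less_induct)
  case (less n)
  have step: "b\<in>span A \<or> b\<in>span B"
   if AB: "A\<union>B=Smp" "A\<inter>B={}" "\<And>x y. x\<in>span A ==> y\<in>span B ==> x\<cdot>y=0"
    and a: "a\<in>Smp" "b - a\<in>Pos" "b - a\<in>span A"
    and IH: "\<And>d m. d\<in>Pos ==> ht d=real m ==> m < n ==> d\<in>span A \<or> d\<in>span B" for A B a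
  proof (cases "a\<in>A")
   case True
   hence "(b - a) + a\<in>span A" by (intro span_add a(3) span_base)
   thus ?thesis by simp
  next
   case False
   hence aB: "a\<in>span B" using AB(1) a(1) by (auto intro: span_base)
   have o: "(b - a)\<cdot>a=0" by (rule AB(3)[OF a(3) aB])
   have aR: "a\<in>R" using posD(1)[OF smpD[OF a(1)]] .
   have "cn b a=2" using o nz(2)[OF aR] by (simp add: cn_def inner_diff_left)
   hence "refl_along a b=(b - a) - a" by (simp add: refl_cn scaleR_2)
   hence d: "(b - a) - a\<in>R" using rsD(3)[OF rs aR posD(1)[OF less(2)]] by simp
   show ?thesis
   proof (cases "(b - a) - a\<in>Pos")
    case True
    obtain m where m: "(b - a - a)\<cdot>rho R g=real m" using ht_nat[OF True] by blast
    hence "m < n" using less(3) rho_smp(2)[OF a(1)] by (simp add: inner_diff_left)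
    from IH[OF True m this] show ?thesis
    proof
     assume "b - a - a\<in>span A"
     hence "(b - a) - (b - a - a)\<in>span A" by (rule span_diff[OF a(3)])
     hence "a\<cdot>a=0" using AB(3)[OF _ aB] by simp
     thus ?thesis using nz(2)[OF aR] by simp
    next
     assume "b - a - a\<in>span B"
     hence "(b - a - a) + a\<in>span B" by (intro span_add aB)
     hence "(b - a)\<cdot>(b - a)=0" using AB(3)[OF a(3)] by simp
     thus ?thesis using nz(2)[OF posD(1)[OF a(2)]] by simp
    qed
   next
    case False
    from pos_neg[OF d this] have "- (b - a - a)\<in>Pos" .
    moreover have "a=- (b - a - a) + (b - a)" by simp
    ultimately show ?thesis using a(1,2) unfolding smp_def by blast
   qed
  qed
  show ?case
  proof (cases "b\<in>Smp")
   case True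
   thus ?thesis by (auto intro: span_base)
  next
   case False
   obtain a where a: "a\<in>Smp" "b - a\<in>Pos" using nonsimple_descend[OF less(2) False] by blast
   obtain m where m: "(b - a)\<cdot>rho R g=real m" using ht_nat[OF a(2)] by blast
   hence "m < n" using less(3) rho_smp(2)[OF a(1)] by (simp add: inner_diff_left)
   from less(1)[OF this a(2) m] show ?thesis
   proof
    assume A: "b - a\<in>span Z"
    show ?thesis by (rule step[OF _ _ ZC a A]) (use Z(1) less(1) in auto)
   next
    assume A: "b - a\<in>span ?C"
    have "b\<in>span ?C \<or> b\<in>span Z"
    proof (rule step[OF _ _ _ a A])
     show "x\<cdot>y=0" if "x\<in>span ?C" "y\<in>span Z" for x y using ZC[OF that(2,1)] by (simp add: inner_commute)
     show "d\<in>span ?C \<or> d\<in>span Z" if "d\<in>Pos" "ht d=real m" "m < n" for d m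
      using less(1)[OF that(3,1,2)] by blast
    qed (use Z(1) in auto)
    thus ?thesis by blast
   qed
  qed
 qed
 have splitR: "b\<in>span Z \<or> b\<in>span ?C" if b: "b\<in>R" for b
 proof (cases "b\<in>Pos")
  case True
  thus ?thesis using split[OF True] ht_nat[OF True] by blast
 next
  case False
  from pos_neg[OF b False] have n: "- b\<in>Pos" .
  hence "- b\<in>span Z \<or> - b\<in>span ?C" using split[OF n] ht_nat[OF n] by blast
  thus ?thesis using span_neg[of "- b" Z] span_neg[of "- b" ?C] by auto
 qed
 obtain b0 where b0: "b0\<in>Z" using Z(2) by blast
 have all: "c\<in>span Z" if "c\<in>R" for c
 proof (rule irr_connected[OF irr, where ?b0.0 = b0 and P = "%c. c\<in>span Z"])
  show "c\<in>R" by (rule that)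
  show "b0\<in>span Z" by (rule span_base[OF b0])
  show "b0\<in>R" using b0 Z(1) smpD posD(1) by blast
  fix b c assume "b\<in>R" "c\<in>R" "b\<in>span Z" "b\<cdot>c~=0"
  thus "c\<in>span Z" using splitR[of c] ZC[of b c] by auto
 qed
 have "?C={}"
 proof (rule ccontr)
  assume "?C~={}"
  then obtain a where a: "a\<in>?C" by blast
  hence "a\<in>R" using smpD posD(1) by blast
  moreover from this have "a\<cdot>a=0" using ZC[OF all span_base[OF a]] by simp
  ultimately show False using nz(1)[of a] by simp
 qed
 thus ?thesis using Z(1) by blast
qed

text \<open>Perron-Frobenius for the Gram matrix of the normalized simple roots. Its off-diagonal
  entries are non-positive, so the absolute values \<open>w\<close> of a minimizer \<open>y\<close>
  minimize as well, and connectedness makes them positive. The minimum \<open>m\<close> is the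
  lowest eigenvalue, and \<open>l = 1 - m\<close>.\<close>

lemma perron:
 assumes irr: "irreducible_roots R" and dim2: "dim R\<ge>2"
 shows "\<exists>u l. (\<forall>a\<in>Smp. a\<cdot>u > 0) \<and> 0 < l \<and> l < 1 \<and>
  2*\<^sub>Ru - (\<Sum>a\<in>Smp. cn u a*\<^sub>Ra)=(2 * l)*\<^sub>Ru"
proof -
 let ?S = "Smp"
 define E where "E a=(1 / norm a)*\<^sub>Ra" for a :: 'v
 have nS: "norm a > 0" "a~=0" if "a\<in>?S" for a using nz(1)[OF posD(1)[OF smpD[OF that]]] by auto
 have E1: "E a\<cdot>E a=1" if "a\<in>?S" for a using nS[OF that] by (simp add: E_def dot_square_norm power2_eq_square)
 have En: "E a\<cdot>E b\<le>0" if "a\<in>?S" "b\<in>?S" "a~=b" for a b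
  using smp_obtuse[OF that] by (simp add: E_def divide_le_0_iff mult_nonneg_nonneg)
 have E0: "a\<cdot>b=0" if "E a\<cdot>E b=0" "a\<in>?S" "b\<in>?S" for a b using that nS by (simp add: E_def)
 have Sne: "?S~={}" 
 proof
  assume "?S={}"
  hence "card ?S=0" by simp
  thus False unfolding card_smp using dim2 by linarith
 qed
 have "card ?S\<le>DIM('v)" using card_smp dim_subset_UNIV[of R] by simp
 from rayleigh_min[OF finS Sne this, of E] obtain y where y: "(\<Sum>a\<in>?S. y a ^ 2)=1"
  "\<And>z. norm (\<Sum>a\<in>?S. y a*\<^sub>RE a) ^ 2 * (\<Sum>a\<in>?S. z a ^ 2)\<le>norm (\<Sum>a\<in>?S. z a*\<^sub>RE a) ^ 2" by blast
 define m where "m=norm (\<Sum>a\<in>?S. y a*\<^sub>RE a) ^ 2"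
 define w where "w a=\<bar>y a\<bar>" for a
 define u where "u=(\<Sum>a\<in>?S. w a*\<^sub>RE a)"
 have w0: "w a\<ge>0" for a by (simp add: w_def)
 have w1: "(\<Sum>a\<in>?S. w a ^ 2)=1" using y(1) by (simp add: w_def)
 have sq: "norm (\<Sum>a\<in>?S. z a*\<^sub>RE a) ^ 2=(\<Sum>a\<in>?S. \<Sum>b\<in>?S. (z a * z b) * (E a\<cdot>E b))" for z
  unfolding power2_norm_eq_inner inner_sum_left unfolding inner_sum_right
  by (intro sum.cong refl) (simp add: mult_ac)
 have "u\<cdot>u\<le>m"
 proof -
  have "norm u ^ 2\<le>m" unfolding u_def m_def sq
  proof (intro sum_mono)
   fix a b assume a: "a\<in>?S" "b\<in>?S"
   show "w a * w b * (E a\<cdot>E b)\<le>y a * y b * (E a\<cdot>E b)"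
   proof (cases "a=b")
    case True
    thus ?thesis by (simp add: w_def power2_eq_square[symmetric])
   next
    case False
    have "y a * y b\<le>w a * w b" unfolding w_def by (metis abs_ge_self abs_mult)
    thus ?thesis using En[OF a False] by (rule mult_right_mono_neg)
   qed
  qed
  thus ?thesis by (simp add: power2_norm_eq_inner)
 qed
 moreover have "m\<le>u\<cdot>u" using y(2)[of w] unfolding m_def[symmetric] u_def[symmetric] w1 by (simp add: power2_norm_eq_inner)
 ultimately have um: "u\<cdot>u=m" by simp
 \<comment> \<open>Stationarity under a change of the single coordinate \<open>a\<close> is the
   eigenvector equation.\<close>
 have stat: "u\<cdot>E a=m * w a" if a: "a\<in>?S" for a
 proof -
  have "0\<le>2 * t * (u\<cdot>E a - m * w a) + t ^ 2 * (1 - m)" for t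
  proof -
   let ?z = "w(a := w a + t)"
   have e1: "(\<Sum>b\<in>?S. ?z b*\<^sub>RE b)=u + t*\<^sub>RE a"
    unfolding u_def sum.remove[OF finS a] by (simp add: scaleR_add_left)
   have e2: "(\<Sum>b\<in>?S. ?z b ^ 2)=1 + 2 * t * w a + t ^ 2"
   proof -
    have "(\<Sum>b\<in>?S. ?z b ^ 2)=(w a + t) ^ 2 + (\<Sum>b\<in>?S - {a}. w b ^ 2)" unfolding sum.remove[OF finS a] by simp
    also have "(\<Sum>b\<in>?S - {a}. w b ^ 2)=1 - w a ^ 2" using w1 sum.remove[OF finS a, of "%b. w b ^ 2"] by simp
    finally show ?thesis by (simp add: power2_sum)
   qed
   have "m * (1 + 2 * t * w a + t ^ 2)\<le>(u + t*\<^sub>RE a)\<cdot>(u + t*\<^sub>RE a)"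
    using y(2)[of ?z] unfolding m_def[symmetric] e1 e2 unfolding power2_norm_eq_inner .
   also have "\<dots>=m + 2 * t * (u\<cdot>E a) + t ^ 2"
    using um E1[OF a] by (simp add: inner_add_left inner_add_right inner_commute power2_eq_square)
   finally show ?thesis by (simp add: algebra_simps)
  qed
  from quadratic_nonneg[OF this] show ?thesis by simp
 qed
 have m0: "m > 0"
 proof -
  have "u~=0"
  using independentD smp_indep finS order_refl nS w1 by (force simp: u_def E_def)
  thus ?thesis using um by (simp add: inner_gt_zero_iff flip: um)
 qed
 have offdiag: "w b * (E b\<cdot>E a)=0"
  if a: "a\<in>?S" "m * w a=w a" and b: "b\<in>?S - {a}" for a b
 proof -
  have "u\<cdot>E a=w a * (E a\<cdot>E a) + (\<Sum>b\<in>?S - {a}. w b * (E b\<cdot>E a))"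
   unfolding u_def inner_sum_left by (subst sum.remove[OF finS a(1)]) simp
  hence s0: "(\<Sum>b\<in>?S - {a}. - (w b * (E b\<cdot>E a)))=0"
   using stat[OF a(1)] a(2) E1[OF a(1)] by (simp add: sum_negf)
  have "\<forall>b\<in>?S - {a}. - (w b * (E b\<cdot>E a))=0"
  proof (subst sum_nonneg_eq_0_iff[symmetric])
   show "finite (?S - {a})" using finS by simp
   show "0\<le>- (w b * (E b\<cdot>E a))" if "b\<in>?S - {a}" for b
    using that w0 En[of b a] a(1) by (simp add: mult_nonneg_nonpos)
  qed (rule s0)
  thus ?thesis using b by simp
 qed
 \<comment> \<open>At a zero of \<open>w\<close> stationarity says that a sum of terms of one sign
   vanishes. So the zero set of \<open>w\<close> is orthogonal to the other simple roots, and it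
   cannot be everything because \<open>w\<close> has norm 1.\<close>
 have wpos: "w a > 0" if "a\<in>?S" for a
 proof (rule ccontr)
  assume "\<not> w a > 0"
  hence "w a=0" using w0[of a] by simp
  let ?Z = "{a\<in>?S. w a=0}"
  have "?Z=?S"
  proof (rule smp_connected[OF irr])
   show "?Z~={}" using that \<open>w a = 0\<close> by blast
   fix c b assume c: "c\<in>?Z" and b: "b\<in>?S - ?Z"
   have "w b * (E b\<cdot>E c)=0" by (rule offdiag) (use c b in auto)
   hence "E b\<cdot>E c=0" using b by auto
   thus "c\<cdot>b=0" using E0[of b c] c b by (auto simp: inner_commute)
  qed auto
  hence "(\<Sum>a\<in>?S. w a ^ 2)=0" by (intro sum.neutral) auto
  thus False using w1 by simp
 qed
 obtain a0 where a0: "a0\<in>?S" using Sne by blast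
 have "m\<le>1"
 proof -
  let ?z = "%b. if b=a0 then 1 else 0 :: real"
  have "(\<Sum>b\<in>?S. ?z b*\<^sub>RE b)=E a0" "(\<Sum>b\<in>?S. ?z b ^ 2)=1" unfolding sum.remove[OF finS a0] by simp_all
  thus ?thesis using y(2)[of ?z] E1[OF a0] unfolding m_def[symmetric] by (simp add: power2_norm_eq_inner)
 qed
 moreover have "m~=1"
 proof
  assume m1: "m=1"
  have "{a0}=?S"
  proof (rule smp_connected[OF irr])
   fix c b assume c: "c\<in>{a0}" and b: "b\<in>?S - {a0}"
   have "w b * (E b\<cdot>E c)=0" by (rule offdiag) (use c b m1 a0 in auto)
   hence "E b\<cdot>E c=0" using b wpos[of b] by auto
   thus "c\<cdot>b=0" using E0[of b c] c b a0 by (auto simp: inner_commute)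
  qed (use a0 in auto)
  hence "card ?S=1" by (metis card_1_singleton_iff One_nat_def)
  thus False unfolding card_smp using dim2 by linarith
 qed
 ultimately have m1: "m < 1" by simp
 show ?thesis
 proof (rule exI[of _ u], rule exI[of _ "1 - m"], intro conjI ballI)
  fix a assume a: "a\<in>?S"
  have "a\<cdot>u=norm a * (u\<cdot>E a)" using nS[OF a] by (simp add: E_def inner_commute)
  thus "a\<cdot>u > 0" using stat[OF a] nS[OF a] m0 wpos[OF a] by simp
 next
  have "cn u a*\<^sub>Ra=(2 * m)*\<^sub>R(w a*\<^sub>RE a)" if a: "a\<in>?S" for a
  proof -
   have "cn u a*\<^sub>Ra=(2 * (u\<cdot>E a))*\<^sub>RE a"
    using nS[OF a] by (simp add: cn_def E_def dot_square_norm power2_eq_square)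
   thus ?thesis using stat[OF a] by simp
  qed
  hence "(\<Sum>a\<in>?S. cn u a*\<^sub>Ra)=(2 * m)*\<^sub>Ru" unfolding u_def scaleR_right.sum by (intro sum.cong) auto
  thus "2*\<^sub>Ru - (\<Sum>a\<in>?S. cn u a*\<^sub>Ra)=(2 * (1 - m))*\<^sub>Ru" by (simp add: algebra_simps)
 qed (use m0 m1 in auto)
qed

lemma sJ_gd:
 assumes "finite J" "J\<subseteq>Smp" "\<And>a b. a\<in>J ==> b\<in>J ==> a~=b ==> a\<cdot>b=0"
 shows "gd R (sJ J) (sJ J) \<and> (\<forall>c\<in>Pos - J. sJ J c\<in>Pos - J)" using assms
proof (induction J rule: finite_induct)
 case empty
 have e: "sJ {}=(%x. x)" by (intro ext) (simp add: sJ_def)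
 show ?case unfolding e using gd_id[of R] by blast
next
 case (insert a J)
 have o: "a\<cdot>b=0" "b\<cdot>a=0" if "b\<in>J" for b
  using insert(5)[of a b] insert(5)[of b a] that insert(2) by auto
 have ih: "gd R (sJ J) (sJ J)" "\<And>c. c\<in>Pos - J ==> sJ J c\<in>Pos - J"
  using insert(3) insert(4,5) by auto
 have a: "a\<in>Smp" "a\<in>R" using insert(4) smpD posD(1) by auto
 have cJ: "cn (sJ J x) a=cn x a" for x using o by (simp add: sJ_def cn_def inner_diff_left inner_sum_left)
 have cr: "cn (refl_along a x) b=cn x b" if "b\<in>J" for x b
  using o[OF that] by (simp add: refl_cn cn_def inner_diff_left)
 have e1: "sJ (insert a J)=(%x. refl_along a (sJ J x))"
  using insert(1,2) by (intro ext) (simp add: refl_cn cJ, simp add: sJ_def)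
 have e2: "sJ (insert a J)=(%x. sJ J (refl_along a x))"
 proof
  fix x
  have "sJ J (refl_along a x)=refl_along a x - (\<Sum>b\<in>J. cn x b*\<^sub>Rb)"
   unfolding sJ_def by (simp add: cr cong: sum.cong)
  thus "sJ (insert a J) x=sJ J (refl_along a x)" using insert(1,2) by (simp add: sJ_def refl_cn)
 qed
 have "gd R (%x. refl_along a (sJ J x)) (%x. sJ J (refl_along a x))"
  by (rule gd_comp[OF gd_refl[OF rs a(2)] ih(1)])
 hence gd: "gd R (sJ (insert a J)) (sJ (insert a J))" unfolding e1[symmetric] e2[symmetric] .
 have "sJ (insert a J) c\<in>Pos - insert a J" if c: "c\<in>Pos - insert a J" for c
 proof -
  have s: "refl_along a c\<in>Pos" "refl_along a c~=a" using refl_smp[OF a(1)] c by auto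
  have nJ: "refl_along a c\<notin>J"
  proof
   assume J: "refl_along a c\<in>J"
   have "c=refl_along a (refl_along a c)" by (simp add: refl_refl)
   also have "\<dots>=refl_along a c" using o(1)[OF J] by (intro refl_fix) (simp add: hyp_def)
   finally show False using J c by simp
  qed
  have m: "sJ J (refl_along a c)\<in>Pos - J" by (rule ih(2)) (use s nJ in auto)
  moreover have "sJ J (refl_along a c)~=a"
  proof
   assume "sJ J (refl_along a c)=a"
   hence "refl_along a (sJ J c)=a" using e1 e2 by metis
   hence "sJ J c=refl_along a a" by (metis refl_refl)
   hence "sJ J c=- a" using refl_self nz(1)[OF a(2)] by simp
   moreover have "sJ J c\<in>Pos" using ih(2) c by auto
   ultimately show False using posD(2)[OF smpD[OF a(1)]] posD(2)[of "- a"] by simp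
  qed
  ultimately show ?thesis unfolding e2 by simp
 qed
 thus ?case using gd by blast
qed

text \<open>\<open>c\<close> is the product of \<open>p\<close> and \<open>q\<close>, the
  reflections over the two colour classes. From \<open>p u + q u = 2 l u\<close> the double angle
  formula gives \<open>C = 2 l^2 - 1\<close>. A positive root that \<open>c'\<close> makes negative
  lies in one class or in the \<open>p\<close>-image of the other, so there are at most rank
  many.\<close>

lemma coxeter_element:
 assumes irr: "irreducible_roots R" and dim2: "dim R\<ge>2"
 shows "\<exists>c c' u C. gd R c c' \<and> card {d\<in>Pos. c' d\<notin>Pos}\<le>dim R \<and>
  (\<forall>b\<in>Pos. b\<cdot>u > 0) \<and> - 1 < C \<and> C < 1 \<and> c u + c' u=(2 * C)*\<^sub>Ru \<and>
  (\<forall>x. (\<forall>b\<in>R. b\<cdot>x=0) --> c x=x)"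
proof -
 let ?S = "Smp"
 obtain J where J: "J\<subseteq>?S" "\<forall>a\<in>J. \<forall>b\<in>J. a~=b --> a\<cdot>b=0"
  "\<forall>a\<in>?S - J. \<forall>b\<in>?S - J. a~=b --> a\<cdot>b=0"
 proof -
  have "card {(a, b). a\<in>T \<and> b\<in>T \<and> a~=b \<and> a\<cdot>b~=0} < 2 * card T" if T: "T\<subseteq>?S" "T~={}" for T
  proof (rule card_edges[OF _ T(2) independent_mono[OF smp_indep T(1)]])
   show "T\<subseteq>R" using T(1) smpD posD(1) by blast
   show "a\<cdot>b\<le>0" if "a\<in>T" "b\<in>T" "a~=b" for a b by (rule smp_obtuse) (use that T(1) in auto)
  qed
  from forest_coloring[OF finS this] show ?thesis using that by blast
 qed
 define p where "p=sJ J"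
 define q where "q=sJ (?S - J)"
 have finJ: "finite J" using J(1) finS finite_subset by blast
 have gp: "gd R p p" "\<And>d. d\<in>Pos - J ==> p d\<in>Pos - J"
  unfolding p_def using sJ_gd[OF finJ J(1)] J(2) by blast+
 have gq: "gd R q q" "\<And>d. d\<in>Pos - (?S - J) ==> q d\<in>Pos - (?S - J)"
  unfolding q_def using sJ_gd[of "?S - J"] finS J(3) by blast+
 obtain u l where u: "\<forall>v\<in>?S. v\<cdot>u > 0" "0 < l" "l < 1"
  "2*\<^sub>Ru - (\<Sum>v\<in>?S. cn u v *\<^sub>R v)=(2 * l)*\<^sub>Ru" using perron[OF irr dim2] by blast
 have "p u + q u=2*\<^sub>Ru - ((\<Sum>v\<in>J. cn u v *\<^sub>R v) + (\<Sum>v\<in>?S - J. cn u v *\<^sub>R v))"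
  by (simp add: p_def q_def sJ_def scaleR_2)
 also have "(\<Sum>v\<in>J. cn u v *\<^sub>R v) + (\<Sum>v\<in>?S - J. cn u v *\<^sub>R v)=(\<Sum>v\<in>?S. cn u v *\<^sub>R v)"
  using sum.subset_diff[OF J(1) finS, of "%v. cn u v *\<^sub>R v"] by simp
 finally have pq: "p u + q u=(2 * l)*\<^sub>Ru" using u(4) by simp
 have lin: "linear p" "linear q" using gdD(1)[OF gp(1)] gdD(1)[OF gq(1)] by auto
 have "p (p u + q u)=(2 * l)*\<^sub>Rp u" unfolding pq by (rule linear_scale[OF lin(1)])
 hence A: "u + p (q u)=(2 * l)*\<^sub>Rp u" using linear_add[OF lin(1)] gdD(3)[OF gp(1)] by simp
 have "q (p u + q u)=(2 * l)*\<^sub>Rq u" unfolding pq by (rule linear_scale[OF lin(2)])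
 hence B: "q (p u) + u=(2 * l)*\<^sub>Rq u" using linear_add[OF lin(2)] gdD(3)[OF gq(1)] by simp
 have "p (q u) + q (p u)=(2 * l)*\<^sub>R(p u + q u) - 2*\<^sub>Ru"
  unfolding scaleR_add_right A[symmetric] B[symmetric] by (simp add: scaleR_2)
 hence cc: "p (q u) + q (p u)=(2 * (2 * l\<^sup>2 - 1))*\<^sub>Ru"
  unfolding pq by (simp add: algebra_simps power2_eq_square)
 show ?thesis
 proof (rule exI[of _ "%x. p (q x)"], rule exI[of _ "%x. q (p x)"], rule exI[of _ u],
   rule exI[of _ "2 * l\<^sup>2 - 1"], intro conjI ballI allI impI)
  show "gd R (%x. p (q x)) (%x. q (p x))" by (rule gd_comp[OF gp(1) gq(1)])
  have "{d\<in>Pos. q (p d)\<notin>Pos}\<subseteq>J\<union>p ` (?S - J)"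
  proof
   fix d assume d: "d\<in>{d\<in>Pos. q (p d)\<notin>Pos}"
   show "d\<in>J\<union>p ` (?S - J)"
   proof (cases "d\<in>J")
    case False
    hence "p d\<in>Pos" using gp(2)[of d] d by auto
    moreover have "q (p d)\<notin>Pos" using d by simp
    ultimately have "p d\<in>?S - J" using gq(2)[of "p d"] by blast
    hence "p (p d)\<in>p ` (?S - J)" by (rule imageI)
    thus ?thesis using gdD(3)[OF gp(1)] by simp
   qed simp
  qed
  hence "card {d\<in>Pos. q (p d)\<notin>Pos}\<le>card (J\<union>p ` (?S - J))"
   using finJ finS by (intro card_mono) auto
  also have "\<dots>\<le>card J + card (p ` (?S - J))" by (rule card_Un_le)
  also have "\<dots>\<le>card J + card (?S - J)" using finS by (intro add_left_mono card_image_le) auto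
  also have "\<dots>=card ?S" using J(1) finS finJ by (simp add: card_Diff_subset card_mono)
  finally show "card {d\<in>Pos. q (p d)\<notin>Pos}\<le>dim R" unfolding card_smp .
  show "b\<cdot>u > 0" if b: "b\<in>Pos" for b
  proof -
   obtain f :: "'v => nat" where f: "b=(\<Sum>v\<in>?S. of_nat (f v)*\<^sub>Rv)" using pos_coeffs[OF b] by blast
   have "\<exists>v\<in>?S. f v~=0"
   proof (rule ccontr)
    assume "\<not> ?thesis"
    hence "b=0" unfolding f by (intro sum.neutral) auto
    thus False using nz(1)[OF posD(1)[OF b]] by simp
   qed
   then obtain v where v: "v\<in>?S" "f v~=0" by blast
   have "0 < real (f v) * (v\<cdot>u)" using v u(1) by simp
   also have "\<dots>\<le>(\<Sum>c\<in>?S. real (f c) * (c\<cdot>u))"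
    by (rule member_le_sum[OF v(1) _ finS]) (auto intro!: mult_nonneg_nonneg less_imp_le[OF u(1)[rule_format]])
   also have "\<dots>=b\<cdot>u" unfolding f by (simp add: inner_sum_left)
   finally show ?thesis .
  qed
  show "- 1 < 2 * l\<^sup>2 - 1" using u(2) by simp
  have "l\<^sup>2 < 1\<^sup>2" using u(2,3) by (intro power_strict_mono) auto
  thus "2 * l\<^sup>2 - 1 < 1" by simp
  show "p (q u) + q (p u)=(2 * (2 * l\<^sup>2 - 1))*\<^sub>Ru" by (rule cc)
  show "p (q x)=x" if x: "\<forall>b\<in>R. b\<cdot>x=0" for x
  proof -
   have "cn x v=0" if "v\<in>?S" for v using x smpD[OF that] posD(1) by (simp add: cn_def inner_commute)
   hence "q x=x" "p x=x" using J(1) by (auto simp: p_def q_def sJ_def subset_eq intro!: sum.neutral)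
   thus ?thesis by simp
  qed
 qed
qed

end

section \<open>Roots of unity, linear dependence and conjugate eigenvalues\<close>

lemma cycle_sign:
 fixes s :: "nat => real"
 assumes "s N=s 0" "(\<Sum>j<N. s j)=0" "\<And>j. s j~=0" "N > 0"
 shows "\<exists>j<N. s j > 0 \<and> s (Suc j) < 0"
proof (rule ccontr)
 assume n: "\<not> ?thesis"
 have step: "s (Suc j) > 0" if "j < N" "s j > 0" for j
  using n that assms(3)[of "Suc j"] by (meson linorder_neqE_linordered_idom)
 have up: "s (j + i) > 0" if "s j > 0" "j + i\<le>N" for i j using that(2)
 proof (induction i)
  case (Suc i)
  thus ?case using step[of "j + i"] by simp
 qed (use that(1) in simp)
 have ne: "{..<N}~={}" using assms(4) by auto
 show False
 proof (cases "s 0 > 0")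
  case True
  hence "0 < (\<Sum>j<N. s j)" using up[of 0] ne by (intro sum_pos) auto
  thus False using assms(2) by simp
 next
  case False
  have "s j < 0" if "j < N" for j
  proof (rule ccontr)
   assume "\<not> s j < 0"
   hence "s j > 0" using assms(3)[of j] by simp
   hence "s (j + (N - j)) > 0" by (rule up) (use that in simp)
   thus False using False assms(1) that by simp
  qed
  hence "0 < (\<Sum>j<N. - s j)" using ne by (intro sum_pos) auto
  thus False using assms(2) by (simp add: sum_negf)
 qed
qed

lemma root_of_unity_order:
 fixes z :: complex
 assumes "z ^ k=1" "k > 0" "z~=1"
 shows "\<exists>N>0. z ^ N=1 \<and> (\<forall>a<N. \<forall>b<N. z ^ a=z ^ b --> a=b) \<and> (\<Sum>j<N. z ^ j)=0"
proof -
 define N where "N=(LEAST N. N > 0 \<and> z ^ N=1)"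
 have N: "N > 0" "z ^ N=1" unfolding N_def using LeastI[of "%N. N > 0 \<and> z ^ N=1" k] assms by blast+
 have least: "N\<le>M" if "M > 0" "z ^ M=1" for M unfolding N_def by (rule Least_le) (use that in simp)
 have z0: "z~=0" using N by (auto simp: power_0_left)
 have *: "False" if "a < b" "b < N" "z ^ a=z ^ b" for a b
 proof -
  have "z ^ b=z ^ a * z ^ (b - a)" using that(1) by (simp add: power_add[symmetric])
  hence "z ^ a * z ^ (b - a)=z ^ a * 1" using that(3) by simp
  hence "z ^ (b - a)=1" using z0 by simp
  thus False using least[of "b - a"] that by simp
 qed
 have "(1 - z) * (\<Sum>j<N. z ^ j)=1 - z ^ N" by (rule one_diff_power_eq[symmetric])
 hence "(\<Sum>j<N. z ^ j)=0" using N(2) assms(3) by simp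
 moreover have "a=b" if "a < N" "b < N" "z ^ a=z ^ b" for a b
  using *[of a b] *[of b a] that by (metis linorder_neqE_nat)
 ultimately show ?thesis using N by blast
qed

lemma lin_dep:
 fixes A :: "'i => 'j => 'k::field"
 assumes "finite J" "finite I" "card J < card I"
 shows "\<exists>x. (\<exists>i\<in>I. x i~=0) \<and> (\<forall>j\<in>J. (\<Sum>i\<in>I. x i * A i j)=0)" using assms
proof (induction J arbitrary: I A rule: finite_induct)
 case empty
 hence "I~={}" by auto
 thus ?case by (intro exI[of _ "%_. 1"]) auto
next
 case (insert j J)
 show ?case
 proof (cases "\<forall>i\<in>I. A i j=0")
  case True
  from insert(1,2,4,5) have "card J < card I" by simp
  from insert(3)[OF insert(4) this, of A] obtain x where
   x: "\<exists>i\<in>I. x i~=0" "\<forall>j\<in>J. (\<Sum>i\<in>I. x i * A i j)=0" by blast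
  have "(\<Sum>i\<in>I. x i * A i j)=0" using True by (intro sum.neutral) simp
  thus ?thesis using x by (intro exI[of _ x]) simp
 next
  case False
  then obtain i0 where i0: "i0\<in>I" "A i0 j~=0" by blast
  have c: "card J < card (I - {i0})" using insert(1,2,4,5) i0(1) by simp
  let ?A = "%i j'. A i j' - (A i j / A i0 j) * A i0 j'"
  from insert(3)[OF _ c, of ?A] insert(4) obtain x where
   x: "\<exists>i\<in>I - {i0}. x i~=0" "\<forall>j'\<in>J. (\<Sum>i\<in>I - {i0}. x i * ?A i j')=0" by blast
  define y where "y=x(i0 := - (\<Sum>i\<in>I - {i0}. x i * (A i j / A i0 j)))"
  have sum: "(\<Sum>i\<in>I. y i * A i j')=(\<Sum>i\<in>I - {i0}. x i * ?A i j')" for j'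
  proof -
   have "(\<Sum>i\<in>I. y i * A i j')=y i0 * A i0 j' + (\<Sum>i\<in>I - {i0}. y i * A i j')"
    by (rule sum.remove[OF insert(4) i0(1)])
   also have "(\<Sum>i\<in>I - {i0}. y i * A i j')=(\<Sum>i\<in>I - {i0}. x i * A i j')"
    by (intro sum.cong) (auto simp: y_def)
   also have "y i0 * A i0 j'=- (\<Sum>i\<in>I - {i0}. x i * (A i j / A i0 j) * A i0 j')"
    by (simp add: y_def sum_distrib_right)
   finally show ?thesis by (simp add: sum_subtractf right_diff_distrib mult.assoc)
  qed
  have "\<exists>i\<in>I. y i~=0" using x(1) by (auto simp: y_def)
  moreover have "(\<Sum>i\<in>I. y i * A i j')=0" if "j'\<in>insert j J" for j'
  proof (cases "j'=j")
   case True
   thus ?thesis unfolding sum using i0(2) by (intro sum.neutral) simp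
  next
   case False
   thus ?thesis unfolding sum using x(2) that by simp
  qed
  ultimately show ?thesis by blast
 qed
qed

definition lc :: "nat => (nat => 'v => complex) => ('v => complex) => bool" where
 "lc r P h \<longleftrightarrow> (\<exists>a. \<forall>w. h w=(\<Sum>j<r. a j * P j w))"

lemma lc_add: "lc r P h ==> lc r P h' ==> lc r P (%w. h w + h' w)"
proof -
 assume "lc r P h" "lc r P h'"
 then obtain a a' where "\<forall>w. h w=(\<Sum>j<r. a j * P j w)" "\<forall>w. h' w=(\<Sum>j<r. a' j * P j w)" unfolding lc_def by blast
 thus ?thesis unfolding lc_def by (intro exI[of _ "%j. a j + a' j"]) (simp add: sum.distrib distrib_right)
qed

lemma lc_scale: "lc r P h ==> lc r P (%w. c * h w)"
proof -
 assume "lc r P h"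
 then obtain a where "\<forall>w. h w=(\<Sum>j<r. a j * P j w)" unfolding lc_def by blast
 thus ?thesis unfolding lc_def by (intro exI[of _ "%j. c * a j"]) (simp add: sum_distrib_left mult.assoc)
qed

lemma lc_zero: "lc r P (%w. 0)" unfolding lc_def by (intro exI[of _ "%_. 0"]) simp

lemma lc_base: "i < r ==> lc r P (P i)" unfolding lc_def
proof (rule exI[of _ "%j. if j=i then 1 else 0"], rule allI)
 fix w assume "i < r"
 have "(\<Sum>j<r. (if j=i then 1 else 0) * P j w)=(\<Sum>j<r. if j=i then P j w else 0)" by (intro sum.cong) auto
 thus "P i w=(\<Sum>j<r. (if j=i then 1 else 0) * P j w)" using \<open>i < r\<close> by simp
qed

lemma lc_sum: "finite I ==> (\<And>i. i\<in>I ==> lc r P (h i)) ==> lc r P (%w. \<Sum>i\<in>I. h i w)"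
proof (induction I rule: finite_induct)
 case (insert i I)
 thus ?case using lc_add[of r P "h i" "%w. \<Sum>i\<in>I. h i w"] by simp
qed (simp add: lc_zero)

text \<open>The span of the \<open>P i\<close> contains \<open>r\<close> independent functions. A
  nontrivial relation would allow one \<open>P i\<close> to be eliminated, leaving
  \<open>r - 1\<close> functions to span them.\<close>

lemma dual_basis_indep:
 fixes P :: "nat => 'v => complex"
 assumes L: "\<And>k. k < r ==> lc r P (L k)" and B: "\<And>k m. k < r ==> m < r ==> L k (B m)=(if k=m then 1 else 0)"
  and a: "\<And>w. (\<Sum>i<r. a i * P i w)=0" and i0: "i0 < r"
 shows "a i0=0"
proof (rule ccontr)
 assume a0: "a i0~=0"
 have "\<forall>k\<in>{..<r}. \<exists>f. \<forall>w. L k w=(\<Sum>j<r. f j * P j w)" using L by (simp add: lc_def)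
 from bchoice[OF this] obtain f where f: "\<And>k w. k < r ==> L k w=(\<Sum>j<r. f k j * P j w)" by auto
 have fin: "finite {..<r}" by simp
 have c: "card ({..<r} - {i0}) < card {..<r}" using i0 by (intro psubset_card_mono) auto
 obtain x where x: "\<exists>k\<in>{..<r}. x k~=0"
  "\<forall>j\<in>{..<r} - {i0}. (\<Sum>k<r. x k * (f k j - f k i0 / a i0 * a j))=0"
  using lin_dep[OF _ fin c, of "%k j. f k j - f k i0 / a i0 * a j"] by auto
 have g: "L k w=(\<Sum>j<r. (f k j - f k i0 / a i0 * a j) * P j w)" if "k < r" for k w
 proof -
  have "(\<Sum>j<r. (f k i0 / a i0) * (a j * P j w))=0" using a[of w] by (simp only: sum_distrib_left[symmetric] mult_zero_right)
  thus ?thesis unfolding f[OF that] by (simp add: left_diff_distrib sum_subtractf mult.assoc)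
 qed
 have "(\<Sum>k<r. x k * L k w)=0" for w
 proof -
  have "(\<Sum>k<r. x k * L k w)=(\<Sum>k<r. \<Sum>j<r. x k * (f k j - f k i0 / a i0 * a j) * P j w)"
   by (intro sum.cong refl) (simp add: g sum_distrib_left mult.assoc)
  also have "\<dots>=(\<Sum>j<r. (\<Sum>k<r. x k * (f k j - f k i0 / a i0 * a j)) * P j w)"
   by (subst sum.swap) (simp add: sum_distrib_right)
  also have "\<dots>=0"
  proof (rule sum.neutral, rule ballI)
   fix j assume j: "j\<in>{..<r}"
   show "(\<Sum>k<r. x k * (f k j - f k i0 / a i0 * a j)) * P j w=0"
   proof (cases "j=i0")
    case True
    thus ?thesis using a0 by simp
   next
    case False
    thus ?thesis using x(2) j by simp
   qed
  qed
  finally show ?thesis .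
 qed
 moreover obtain m where m: "m < r" "x m~=0" using x(1) by blast
 moreover have "(\<Sum>k<r. x k * L k (B m))=(\<Sum>k<r. if k=m then x k else 0)"
  by (intro sum.cong refl) (use B m(1) in auto)
 ultimately show False by simp
qed

text \<open>Conjugating an eigenfunction for \<open>\<omega>\<close> gives an eigenfunction for the
  conjugate eigenvalue, since \<open>T\<close> acts on the argument. Conjugation preserves
  independence, which compares the multiplicities.\<close>

lemma eigen_conj:
 fixes P :: "nat => 'v => complex" and T :: "'v => 'v"
 assumes indep: "\<And>a i. (\<And>w. (\<Sum>i<r. a i * P i w)=0) ==> i < r ==> a i=0"
  and eig: "\<And>i w. i < r ==> P i (T w)=\<epsilon> i * P i w"
  and cj: "\<And>i. i < r ==> lc r P (%w. cnj (P i w))"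
 shows "card {i. i < r \<and> \<epsilon> i=\<omega>}\<le>card {i. i < r \<and> \<epsilon> i=cnj \<omega>}"
proof (rule ccontr)
 let ?X = "{i. i < r \<and> \<epsilon> i=\<omega>}" and ?Y = "{i. i < r \<and> \<epsilon> i=cnj \<omega>}"
 assume "\<not> ?thesis"
 hence c: "card ?Y < card ?X" by simp
 have "\<forall>i\<in>{..<r}. \<exists>f. \<forall>w. cnj (P i w)=(\<Sum>j<r. f j * P j w)" using cj by (simp add: lc_def)
 from bchoice[OF this] obtain f where f: "\<And>i w. i < r ==> cnj (P i w)=(\<Sum>j<r. f i j * P j w)" by auto
 have supp: "f i j=0" if i: "i\<in>?X" and j: "j < r" "j\<notin>?Y" for i j
 proof -
  have "(\<Sum>j<r. (f i j * (\<epsilon> j - cnj \<omega>)) * P j w)=0" for w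
  proof -
   have "(\<Sum>j<r. f i j * P j (T w))=cnj (P i (T w))" using f i by simp
   also have "\<dots>=cnj \<omega> * cnj (P i w)" using eig[of i w] i by simp
   also have "\<dots>=(\<Sum>j<r. cnj \<omega> * (f i j * P j w))" using f i by (simp add: sum_distrib_left)
   finally have "(\<Sum>j<r. f i j * P j (T w)) - (\<Sum>j<r. cnj \<omega> * (f i j * P j w))=0" by simp
   moreover have "(\<Sum>j<r. f i j * P j (T w))=(\<Sum>j<r. f i j * (\<epsilon> j * P j w))"
    by (intro sum.cong refl) (simp add: eig)
   ultimately show ?thesis by (simp add: sum_subtractf[symmetric] algebra_simps)
  qed
  from indep[of "%j. f i j * (\<epsilon> j - cnj \<omega>)", OF this j(1)] show ?thesis using j by auto
 qed
 have fin: "finite ?X" "finite ?Y" by auto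
 obtain x where x: "\<exists>i\<in>?X. x i~=0" "\<forall>j\<in>?Y. (\<Sum>i\<in>?X. x i * f i j)=0"
  using lin_dep[OF fin(2,1) c, of f] by blast
 define a where "a i=(if i\<in>?X then cnj (x i) else 0)" for i
 have "(\<Sum>i<r. a i * P i w)=0" for w
 proof -
  have "(\<Sum>i\<in>?X. x i * cnj (P i w))=(\<Sum>i\<in>?X. \<Sum>j<r. x i * f i j * P j w)"
   by (intro sum.cong refl) (simp add: f sum_distrib_left mult.assoc)
  also have "\<dots>=(\<Sum>j<r. (\<Sum>i\<in>?X. x i * f i j) * P j w)" by (subst sum.swap) (simp add: sum_distrib_right)
  also have "\<dots>=0"
  proof (rule sum.neutral, rule ballI)
   fix j assume j: "j\<in>{..<r}"
   show "(\<Sum>i\<in>?X. x i * f i j) * P j w=0"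
   proof (cases "j\<in>?Y")
    case True
    thus ?thesis using x(2) by simp
   next
    case False
    have "(\<Sum>i\<in>?X. x i * f i j)=0" by (intro sum.neutral ballI) (use supp[OF _ _ False] j in simp)
    thus ?thesis by simp
   qed
  qed
  finally have "cnj (\<Sum>i\<in>?X. x i * cnj (P i w))=0" by simp
  hence "(\<Sum>i\<in>?X. cnj (x i) * P i w)=0" by simp
  moreover have "(\<Sum>i<r. a i * P i w)=(\<Sum>i\<in>?X. cnj (x i) * P i w)"
   by (rule sum.mono_neutral_cong_right) (auto simp: a_def)
  ultimately show ?thesis by simp
 qed
 note a0 = indep[OF this]
 obtain i where i: "i\<in>?X" "x i~=0" using x(1) by blast
 hence "a i=0" using a0[of i] by simp
 thus False using i by (simp add: a_def)
qed

text \<open>Two powers agree on the finite set \<open>R\<close>, hence on its span; the orthogonal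
  complement is fixed by assumption.\<close>

lemma gd_finite_order:
 assumes rs: "rs R" and gd: "gd R c c'" and fixed: "\<And>x. (\<forall>b\<in>R. b\<cdot>x=0) ==> c x=x"
 shows "\<exists>k>0. \<forall>x. (c ^^ k) x=x"
proof -
 note g = gdD[OF gd_pow[OF gd]]
 have "finite (R \<rightarrow>\<^sub>E R)" using rsD(1)[OF rs] by (intro finite_PiE)
 moreover have "range (%j. restrict (c ^^ j) R)\<subseteq>R \<rightarrow>\<^sub>E R" using g(6) by auto
 ultimately have "finite (range (%j. restrict (c ^^ j) R))" by (rule finite_subset[rotated])
 hence "\<not> inj (%j. restrict (c ^^ j) R)" using finite_imageD infinite_UNIV_nat by blast
 then obtain i j where ij: "i~=j" "restrict (c ^^ i) R=restrict (c ^^ j) R" by (auto simp: inj_on_def)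
 have "\<exists>i j. i < j \<and> restrict (c ^^ i) R=restrict (c ^^ j) R"
 proof (cases "i < j")
  case True
  thus ?thesis using ij by blast
 next
  case False
  thus ?thesis using ij by (intro exI[of _ j] exI[of _ i]) auto
 qed
 then obtain i j where ij: "i < j" "restrict (c ^^ i) R=restrict (c ^^ j) R" by blast
 define k where "k=j - i"
 have b: "(c ^^ k) b=b" if "b\<in>R" for b
 proof -
  have "(c ^^ i) b=(c ^^ j) b" using fun_cong[OF ij(2), of b] that by simp
  also have "j=i + k" using ij(1) by (simp add: k_def)
  finally have "(c' ^^ i) ((c ^^ i) b)=(c' ^^ i) ((c ^^ i) ((c ^^ k) b))" by (simp add: funpow_add)
  thus ?thesis using g(4)[of i] by simp
 qed
 have sp: "(c ^^ k) x=x" if "x\<in>span R" for x using that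
 proof (induction rule: span_induct_alt)
  case base
  thus ?case using linear_0[OF g(1)[of k]] .
 next
  case (step t a y)
  thus ?case using b linear_add[OF g(1)[of k]] linear_scale[OF g(1)[of k]] by simp
 qed
 have "(c ^^ k) x=x" for x
 proof -
  obtain y z where yz: "y\<in>span R" "\<And>w. w\<in>span R ==> orthogonal z w" "x=y + z"
   using orthogonal_subspace_decomp_exists[of R x] by metis
  have "b\<cdot>z=0" if "b\<in>R" for b using yz(2)[OF span_base[OF that]] by (simp add: orthogonal_def inner_commute)
  hence cz: "c z=z" using fixed by blast
  have "(c ^^ n) z=z" for n using cz by (induction n) auto
  thus ?thesis unfolding yz(3) linear_add[OF g(1)[of k]] using sp[OF yz(1)] by simp
 qed
 thus ?thesis using ij(1) by (intro exI[of _ k]) (simp add: k_def)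
qed

lemma cx_comb:
 fixes r :: nat
 assumes F: "\<And>i. i < r ==> hf (e i) (F i)"
  and f: "\<And>i. i < r ==> hq d (e i) (f i)"
  and G: "\<And>x. G x=(\<Sum>i<r. f i x*\<^sub>RF i x)"
 shows "cx (%x. w\<cdot>G x) x y=(\<Sum>i<r. cx (f i) x y * cx (%x. w\<cdot>F i x) x y)"
proof -
 have hpF: "hp (e i) (%x. w\<cdot>F i x)" if "i < r" for i using F[OF that] by (simp add: hf_def)
 have t: "hp d (%x. f i x * (w\<cdot>F i x)) \<and>
   cx (%x. f i x * (w\<cdot>F i x)) x y=cx (f i) x y * cx (%x. w\<cdot>F i x) x y" if i: "i < r" for i
 proof (cases "e i\<le>d")
  case True
  hence fi: "hp (d - e i) (f i)" using f[OF i] by simp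
  show ?thesis using hp_mult[OF fi hpF[OF i]] cx_mult[OF fi hpF[OF i]] True by simp
 next
  case False
  hence "f i=(%_. 0)" using f[OF i] by simp
  thus ?thesis by (simp add: hp_zero cx_const)
 qed
 have "cx (%x. w\<cdot>G x) x y=cx (%x. \<Sum>i<r. f i x * (w\<cdot>F i x)) x y" by (simp add: G inner_sum_right)
 also have "\<dots>=(\<Sum>i<r. cx (%x. f i x * (w\<cdot>F i x)) x y)" by (rule cx_sum[where d = d]) (use t in auto)
 also have "\<dots>=(\<Sum>i<r. cx (f i) x y * cx (%x. w\<cdot>F i x) x y)" by (intro sum.cong refl) (use t in auto)
 finally show ?thesis .
qed

lemma sum_fibres:
 fixes F :: "nat => real" and r :: nat
 assumes "finite M" "\<And>i. i < r ==> e i\<in>M"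
 shows "(\<Sum>i<r. F (e i))=(\<Sum>m\<in>M. F m * real (card {i. i < r \<and> e i=m}))"
proof -
 have "(\<Sum>i<r. F (e i))=(\<Sum>m\<in>M. \<Sum>i\<in>{i. i\<in>{..<r} \<and> e i=m}. F (e i))"
  by (rule sum.group[symmetric]) (use assms in auto)
 also have "\<dots>=(\<Sum>m\<in>M. F m * real (card {i. i < r \<and> e i=m}))"
 proof (intro sum.cong refl)
  fix m assume "m\<in>M"
  have "(\<Sum>i\<in>{i. i\<in>{..<r} \<and> e i=m}. F (e i))=(\<Sum>i\<in>{i. i < r \<and> e i=m}. F m)" by (rule sum.cong) auto
  thus "(\<Sum>i\<in>{i. i\<in>{..<r} \<and> e i=m}. F (e i))=F m * real (card {i. i < r \<and> e i=m})" by simp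
 qed
 finally show ?thesis .
qed

lemma sum_symmetric:
 fixes F :: "nat => real" and r :: nat
 assumes b: "\<And>i. i < r ==> 1\<le>e i \<and> e i < N"
  and sym: "\<And>m. 1\<le>m ==> m < N ==> card {i. i < r \<and> e i=m}=card {i. i < r \<and> e i=N - m}"
 shows "(\<Sum>i<r. F (e i))=(\<Sum>i<r. F (N - e i))"
proof -
 have M: "e i\<in>{1..<N}" if "i < r" for i using b[OF that] by simp
 have "(\<Sum>i<r. F (e i))=(\<Sum>m\<in>{1..<N}. F m * real (card {i. i < r \<and> e i=m}))"
  by (rule sum_fibres) (use M in auto)
 also have "\<dots>=(\<Sum>m\<in>{1..<N}. F m * real (card {i. i < r \<and> e i=N - m}))"
  by (intro sum.cong refl) (use sym in auto)
 also have "\<dots>=(\<Sum>m\<in>{1..<N}. F (N - m) * real (card {i. i < r \<and> e i=m}))"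
  by (rule sum.reindex_bij_witness[of _ "%m. N - m" "%m. N - m"]) auto
 also have "\<dots>=(\<Sum>i<r. F (N - e i))" using sum_fibres[of "{1..<N}" r e "%m. F (N - m)"] M by simp
 finally show ?thesis .
qed

section \<open>The regular eigenvector of the Coxeter element and the symmetry of the
  exponents\<close>

context rsys
begin

lemma tang_pos: "tang (Pos) F \<longleftrightarrow> tang R F"
proof
 assume t: "tang (Pos) F"
 show "tang R F" unfolding tang_def
 proof (intro ballI)
  fix c x assume c: "c\<in>R" "x\<in>hyp c"
  show "c\<cdot>F x=0"
  proof (cases "c\<in>Pos")
   case True
   thus ?thesis using t c(2) by (simp add: tang_def)
  next
   case False
   have "x\<in>hyp (- c)" using c(2) by (simp add: hyp_def)
   hence "(- c)\<cdot>F x=0" using t pos_neg[OF c(1) False] unfolding tang_def by blast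
   thus ?thesis by simp
  qed
 qed
qed (auto intro: tang_subset simp: pos_def)

text \<open>Along the orbit of a root \<open>b\<close> under \<open>c'\<close> the values of
  \<open>v\<close> are \<open>Z ^ j * v b\<close>. Their imaginary parts are never 0 and sum to 0
  over \<open>N\<close> steps, so somewhere a positive root is sent to a negative one. Hence
  \<open>N\<close> translates of the inversion set cover \<open>R\<close>.\<close>

lemma coxeter_order:
 assumes ev: "\<And>b j. v ((c' ^^ j) b)=Z ^ j * (v b :: complex)" and gd: "gd R c c'"
  and im: "\<And>b. Im (v b)=S * (b\<cdot>u)" and S: "S > 0" and u: "\<forall>b\<in>Pos. b\<cdot>u > 0"
  and N: "Z ^ N=1" "(\<Sum>j<N. Z ^ j)=0" "N > 0"
 shows "card R\<le>card {d\<in>Pos. c' d\<notin>Pos} * N"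
proof -
 note g' = gdD[OF gd_pow[OF gd]]
 let ?I = "{d\<in>Pos. c' d\<notin>Pos}"
 have upos: "b\<in>Pos \<longleftrightarrow> b\<cdot>u > 0" if b: "b\<in>R" for b
 proof
  assume "b\<cdot>u > 0"
  show "b\<in>Pos"
  proof (rule ccontr)
   assume "b\<notin>Pos"
   hence "(- b)\<cdot>u > 0" using pos_neg[OF b] u by blast
   thus False using \<open>b \<cdot> u > 0\<close> by simp
  qed
 qed (use u in blast)
 have une: "b\<cdot>u~=0" if b: "b\<in>R" for b
 proof (cases "b\<in>Pos")
  case False
  hence "(- b)\<cdot>u > 0" using pos_neg[OF b] u by blast
  thus ?thesis by simp
 qed (use u in force)
 have "R\<subseteq>(%(d, j). (c ^^ j) d) ` (?I \<times> {..<N})"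
 proof
  fix b assume b: "b\<in>R"
  define s where "s j=Im (Z ^ j * v b)" for j
  have s: "s j=S * ((c' ^^ j) b\<cdot>u)" for j by (simp only: s_def ev[symmetric] im)
  have inR: "(c' ^^ j) b\<in>R" for j using g'(7)[OF b] .
  have "\<exists>j<N. s j > 0 \<and> s (Suc j) < 0"
  proof (rule cycle_sign)
   show "s N=s 0" by (simp add: s_def N(1))
   have "(\<Sum>j<N. s j)=Im ((\<Sum>j<N. Z ^ j) * v b)" by (simp add: s_def sum_distrib_right Im_sum)
   thus "(\<Sum>j<N. s j)=0" by (simp add: N(2))
   show "s j~=0" for j using s[of j] S une[OF inR[of j]] by simp
  qed (rule N(3))
  then obtain j where j: "j < N" "s j > 0" "s (Suc j) < 0" by blast
  define d where "d=(c' ^^ j) b"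
  have "d\<cdot>u > 0" using j(2) s[of j] S by (simp add: d_def zero_less_mult_iff)
  hence 1: "d\<in>Pos" using upos[OF inR[of j]] by (simp add: d_def)
  have "c' d=(c' ^^ Suc j) b" by (simp add: d_def)
  moreover have "(c' ^^ Suc j) b\<cdot>u < 0" using j(3) s[of "Suc j"] S by (simp add: mult_less_0_iff)
  ultimately have 2: "c' d\<notin>Pos" using u by fastforce
  have "b=(c ^^ j) d" unfolding d_def using g'(3)[of j b] by simp
  thus "b\<in>(%(d, j). (c ^^ j) d) ` (?I \<times> {..<N})" using 1 2 j(1) by (intro image_eqI[of _ _ "(d, j)"]) auto
 qed
 hence "card R\<le>card ((%(d, j). (c ^^ j) d) ` (?I \<times> {..<N}))" using finP by (intro card_mono) auto
 also have "\<dots>\<le>card (?I \<times> {..<N})" using finP by (intro card_image_le) auto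
 finally show ?thesis by (simp add: card_cartesian_product)
qed

text \<open>Evaluating \<open>c\<close>-equivariant generators at the eigenvector
  \<open>x0 + \<i> y0\<close> of \<open>c\<close> gives eigenfunctions of \<open>c'\<close> with
  eigenvalues \<open>Z ^ e i\<close>. They are independent because the eigenvector lies on no
  mirror, and the eigenvalues come in conjugate pairs because \<open>c'\<close> is real.\<close>

lemma eigenvalue_symmetry:
 assumes fb: "fbas (span R) R r e F" and r: "r=dim R" and gd: "gd R c c'"
  and k: "k > 0" "\<And>x. (c ^^ k) x=x"
  and v: "c x0=Re Z*\<^sub>Rx0 - Im Z*\<^sub>Ry0" "c y0=Im Z*\<^sub>Rx0 + Re Z*\<^sub>Ry0"
  and reg: "\<And>b. b\<in>Pos ==> Complex (b\<cdot>x0) (b\<cdot>y0)~=0"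
 shows "card {i. i < r \<and> Z ^ e i=\<omega>}\<le>card {i. i < r \<and> Z ^ e i=cnj \<omega>}"
proof -
 note Fi = fbasD(1-3)[OF fb]
 have "\<forall>i\<in>{..<r}. \<exists>h. dz R (e i) h \<and> mD R (e i) (%x. h x - F i x) \<and> (\<forall>x. h (c x)=c (h x))"
 proof
  fix i assume "i\<in>{..<r}"
  hence "dz R (e i) (F i)" using Fi[of i] by (auto simp: dz_def)
  from average[OF gd k this]
  show "\<exists>h. dz R (e i) h \<and> mD R (e i) (%x. h x - F i x) \<and> (\<forall>x. h (c x)=c (h x))" .
 qed
 from bchoice[OF this] obtain G where G: "\<And>i. i < r ==> dz R (e i) (G i)"
  "\<And>i. i < r ==> mD R (e i) (%x. G i x - F i x)" "\<And>i x. i < r ==> G i (c x)=c (G i x)" by auto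
 define P where "P i w=cx (%x. w\<cdot>G i x) x0 y0" for i w
 define PF where "PF i w=cx (%x. w\<cdot>F i x) x0 y0" for i w
 have hpG: "hp (e i) (%x. w\<cdot>G i x)" if "i < r" for i w using G(1)[OF that] by (simp add: dz_def hf_def)
 have hpF: "hp (e i) (%x. w\<cdot>F i x)" if "i < r" for i w using Fi(1)[OF that] by (simp add: hf_def)
 \<comment> \<open>\<open>G i\<close> and \<open>F i\<close> differ by a combination of basis fields
   of smaller degree, so induction on the degree expresses the values of \<open>F\<close> through
   those of \<open>G\<close>.\<close>
 have PF: "lc r P (PF i)" if "i < r" for i using that
 proof (induction "e i" arbitrary: i rule: less_induct)
  case (less i)
  from mD_expand[OF G(2)[OF less(2)] fb] obtain f where
   f: "\<forall>j<r. if e j < e i then hp (e i - e j) (f j) else f j=(%_. 0)"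
     "\<forall>x. G i x - F i x=(\<Sum>j<r. f j x*\<^sub>RF j x)" by blast
  have eq: "PF i w=P i w + (- 1) * (\<Sum>j<r. cx (f j) x0 y0 * PF j w)" for w
  proof -
   have "cx (%x. w\<cdot>(G i x - F i x)) x0 y0=(\<Sum>j<r. cx (f j) x0 y0 * PF j w)" unfolding PF_def
   proof (rule cx_comb[OF Fi(1)])
    fix j assume j: "j < r"
    show "hq (e i) (e j) (f j)"
     using f(1)[rule_format, OF j] by (cases "e j < e i") (auto simp: hp_zero)
   qed (use f(2) in auto)
   moreover have "P i w=PF i w + cx (%x. w\<cdot>(G i x - F i x)) x0 y0"
   proof -
    have "hp (e i) (%x. w\<cdot>(G i x - F i x))"
     using hp_diff[OF hpG[OF less(2)] hpF[OF less(2)]] by (simp add: inner_diff_right)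
    from cx_add[OF hpF[OF less(2), of w] this, of x0 y0]
    show ?thesis by (simp add: P_def PF_def inner_diff_right)
   qed
   ultimately show ?thesis by simp
  qed
  have "lc r P (%w. cx (f j) x0 y0 * PF j w)" if j: "j\<in>{..<r}" for j
  proof (cases "e j < e i")
   case True
   thus ?thesis using less(1)[OF True] j by (intro lc_scale) simp
  next
   case False
   hence "f j=(%_. 0)" using f(1) j by auto
   thus ?thesis by (simp add: cx_const lc_zero)
  qed
  hence "lc r P (%w. \<Sum>j<r. cx (f j) x0 y0 * PF j w)" by (rule lc_sum[OF finite_lessThan])
  from lc_add[OF lc_base[OF less(2)] lc_scale[OF this, of "- 1"]]
  have "lc r P (%w. P i w + (- 1) * (\<Sum>j<r. cx (f j) x0 y0 * PF j w))" .
  thus ?case unfolding eq[symmetric] .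
 qed
 obtain B where B: "B\<subseteq>span R" "pairwise orthogonal B" "\<And>x. x\<in>B ==> norm x=1"
  "independent B" "card B=dim (span R)" "span B=span R"
  using orthonormal_basis_subspace[OF subspace_span[of R]] by metis
 have finB: "finite B" by (rule independent_imp_finite[OF B(4)])
 obtain b where b: "bij_betw b {..<r} B"
  using ex_bij_betw_nat_finite[OF finB] B(5) r by (auto simp: atLeast0LessThan dim_span)
 have bB: "b i\<in>B" if "i < r" for i using b that by (auto simp: bij_betw_def)
 have on: "b i\<cdot>b j=(if i=j then 1 else 0)" if "i < r" "j < r" for i j
 proof (cases "i=j")
  case True
  thus ?thesis using B(3)[OF bB[OF that(1)]] by (simp add: dot_square_norm)
 next
  case False
  hence "b i~=b j" using b that by (auto simp: bij_betw_def inj_on_def)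
  thus ?thesis using B(2) bB[OF that(1)] bB[OF that(2)] False by (auto simp: pairwise_def orthogonal_def)
 qed
 have expand: "x=(\<Sum>i<r. (b i\<cdot>x)*\<^sub>Rb i)" if "x\<in>span R" for x
 proof -
  have "(\<Sum>e\<in>B. (x\<cdot>e)*\<^sub>Re)=x"
   by (rule orthonormal_basis_expand[OF B(2,3) _ finB]) (use that B(6) in auto)
  thus ?thesis using sum.reindex_bij_betw[OF b, of "%e. (x\<cdot>e)*\<^sub>Re"] by (simp add: inner_commute)
 qed
 define L where "L k w=complex_of_real (w\<cdot>b k)" for k w
 let ?Q = "%x. \<Prod>b\<in>Pos. b\<cdot>x"
 define q where "q=cx ?Q x0 y0"
 have q0: "q~=0" unfolding q_def cx_prod_lin[OF finP] using reg finP by simp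
 \<comment> \<open>A constant field times the product of all positive roots is tangent, so it
   expands in the basis. At the eigenvector that product is the nonzero number \<open>q\<close>;
   dividing by it puts the coordinate functions into the span of the \<open>P i\<close>.\<close>
 have L: "lc r P (L k)" if k: "k < r" for k
 proof -
  have hfQ: "hf (card (Pos) + 0) (%x. ?Q x*\<^sub>Rb k)" by (rule hf_scale[OF hp_prod_lin hf_const])
  have rng: "range (%x. ?Q x*\<^sub>Rb k)\<subseteq>span R" using bB[OF k] B(1) by (auto intro: span_scale)
  have tg: "tang R (%x. ?Q x*\<^sub>Rb k)"
  proof (subst tang_pos[symmetric], unfold tang_def, intro ballI)
   fix c x assume "c\<in>Pos" "x\<in>hyp c"
   hence "?Q x=0" using finP by (auto simp: hyp_def)
   thus "c\<cdot>(?Q x*\<^sub>Rb k)=0" by simp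
  qed
  from fbasD(4)[OF fb hfQ rng tg] obtain f where
   f: "\<forall>i<r. hq (card (Pos) + 0) (e i) (f i)"
     "\<forall>x. ?Q x*\<^sub>Rb k=(\<Sum>i<r. f i x*\<^sub>RF i x)" by blast
  have qL: "q * L k w=(\<Sum>i<r. cx (f i) x0 y0 * PF i w)" for w
  proof -
   have "cx (%x. w\<cdot>(?Q x*\<^sub>Rb k)) x0 y0=(\<Sum>i<r. cx (f i) x0 y0 * PF i w)" unfolding PF_def
    by (rule cx_comb[where e = e and d = "card (Pos)", OF Fi(1)]) (use f in auto)
   moreover have "cx (%x. w\<cdot>(?Q x*\<^sub>Rb k)) x0 y0=q * L k w"
    using cx_cmult[OF hp_prod_lin[of "Pos"], of "w\<cdot>b k" x0 y0] by (simp add: q_def L_def mult.commute)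
   ultimately show ?thesis by simp
  qed
  have "L k w=(1 / q) * (\<Sum>i<r. cx (f i) x0 y0 * PF i w)" for w using q0 by (simp add: qL[symmetric])
  hence Lk: "L k=(%w. (1 / q) * (\<Sum>i<r. cx (f i) x0 y0 * PF i w))" by (rule ext)
  show ?thesis unfolding Lk by (intro lc_scale lc_sum PF) auto
 qed
 have LB: "L k (b m)=(if k=m then 1 else 0)" if "k < r" "m < r" for k m
  using on[OF that(2,1)] by (auto simp: L_def)
 have cj: "lc r P (%w. cnj (P i w))" if i: "i < r" for i
 proof -
  have "cnj (P i w)=(\<Sum>k<r. cnj (P i (b k)) * L k w)" for w
  proof -
   have "P i w=cx (%x. \<Sum>k<r. (w\<cdot>b k) * (b k\<cdot>G i x)) x0 y0"
   proof -
    have "w\<cdot>G i x=(\<Sum>k<r. (w\<cdot>b k) * (b k\<cdot>G i x))" for x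
    proof -
     have "G i x\<in>span R" using G(1)[OF i] by (auto simp: dz_def)
     hence "w\<cdot>G i x=w\<cdot>(\<Sum>k<r. (b k\<cdot>G i x)*\<^sub>Rb k)" using expand[of "G i x"] by simp
     thus ?thesis by (simp add: inner_sum_right mult.commute)
    qed
    thus ?thesis by (simp add: P_def)
   qed
   also have "\<dots>=(\<Sum>k<r. cx (%x. (w\<cdot>b k) * (b k\<cdot>G i x)) x0 y0)"
    by (rule cx_sum[where d = "e i"]) (use hpG[OF i] in \<open>auto intro: hp_cmult\<close>)
   also have "\<dots>=(\<Sum>k<r. L k w * P i (b k))"
    by (intro sum.cong refl) (simp add: cx_cmult[OF hpG[OF i]] L_def P_def)
   finally show ?thesis by (simp add: L_def mult.commute)
  qed
  hence e: "(%w. cnj (P i w))=(%w. \<Sum>k<r. cnj (P i (b k)) * L k w)" by (rule ext)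
  show ?thesis unfolding e by (intro lc_sum lc_scale L) auto
 qed
 have eig: "P i (c' w)=Z ^ e i * P i w" if i: "i < r" for i w
 proof -
  have "c' w\<cdot>G i x=w\<cdot>G i (c x)" for x
   using gdD(5)[OF gd, of "G i x" w] G(3)[OF i, of x] by (simp add: inner_commute)
  hence "P i (c' w)=cx (%x. w\<cdot>G i (c x)) x0 y0" by (simp add: P_def)
  also have "\<dots>=cx (%x. w\<cdot>G i x) (c x0) (c y0)" by (rule cx_compose[OF hpG[OF i] gdD(1)[OF gd]])
  also have "\<dots>=Z ^ e i * P i w" unfolding v P_def by (rule cx_scale[OF hpG[OF i]])
  finally show ?thesis .
 qed
 show ?thesis
 proof (rule eigen_conj[where P = P and T = c' and \<epsilon> = "%i. Z ^ e i", OF _ eig cj])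
  show "a i=0" if "\<And>w. (\<Sum>i<r. a i * P i w)=0" "i < r" for a i by (rule dual_basis_indep[OF L LB that])
 qed
qed

lemma smp_ht: "Smp={c\<in>Pos. ht c=1}"
using rho_smp smpD ht_1_smp subset_antisym subsetI by auto

lemma duality_rank1:
 assumes "dim R=1"
 shows "card R=2" "Pos=Smp" "card (Pos)=1"
proof -
 have "card (Smp)=1" using card_smp assms by simp
 then obtain a where a: "Smp={a}" using card_1_singletonE by blast
 have "b=a" if "b\<in>Pos" for b
 proof (rule smp_multiple[OF that])
  show "a\<in>Smp" using a by simp
  show "b\<in>span {a}" using smp_span a posD(1)[OF that] by (metis span_base)
 qed
 hence "Pos={a}" using a smpD by blast
 thus "Pos=Smp" "card (Pos)=1" using a by simp_all
 thus "card R=2" using card_pos by simp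
qed

text \<open>In rank at least two \<open>h\<close> is the order \<open>N\<close> of the eigenvalue
  \<open>Z\<close> of a Coxeter element. By \<open>coxeter_order\<close> and \<open>ht_le\<close>
  the exponents lie between 1 and \<open>N - 1\<close>, and \<open>eigenvalue_symmetry\<close> makes
  them symmetric under subtraction from \<open>N\<close>. Their sum is the number of positive roots,
  which identifies \<open>N\<close> with the number of roots divided by the rank.\<close>

lemma duality:
 assumes irr: "irreducible_roots R" and inj: "inj_on (%c. c\<cdot>g) R"
 shows "\<exists>h\<ge>2. card R=h * dim R \<and> (\<forall>m. 1\<le>m --> m\<le>h -->
  card {d\<in>Pos. ht d=real m} + card {d\<in>Pos. ht d=real (h + 1 - m)}\<le>dim R)"
proof -
 define r where "r=dim R"
 let ?n = "%m. card {d\<in>Pos. ht d=real m}"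
 obtain a0 where a0: "a0\<in>R" using irr unfolding irreducible_roots_def by blast
 have r0: "r > 0"
 proof (rule ccontr)
  assume "\<not> r > 0"
  hence "dim R=0" by (simp add: r_def)
  hence "a0=0" using a0 by (auto simp: dim_eq_0)
  thus False using nz(1)[OF a0] by simp
 qed
 show ?thesis
 proof (cases "r=1")
  case True
  note d1 = duality_rank1[OF True[unfolded r_def]]
  have n: "?n m=(if m=1 then 1 else 0)" for m
  proof -
   have "{d\<in>Pos. ht d=real m}=(if m=1 then Pos else {})"
    unfolding d1(2) using rho_smp(2) by auto
   thus ?thesis using d1(3) by simp
  qed
  show ?thesis
  proof (rule exI[of _ 2], intro conjI allI impI)
   show "card R=2 * dim R" using d1(1) True by (simp add: r_def)
   fix m :: nat assume "1\<le>m" "m\<le>2"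
   hence "m=1 \<or> m=2" by auto
   thus "?n m + ?n (2 + 1 - m)\<le>dim R" using True by (auto simp: n r_def)
  qed simp
 next
  case False
  hence r2: "dim R\<ge>2" using r0 by (simp add: r_def)
  obtain e F where eF: "fbas (span R) (Pos) r e F" "\<And>t. card {i. i < r \<and> t < e i}=?n (Suc t)"
   using fin_basis[OF inj] unfolding r_def by blast
  have fb: "fbas (span R) R r e F" using eF(1) unfolding fbas_def tang_pos .
  obtain c c' u C where cox: "gd R c c'" "card {d\<in>Pos. c' d\<notin>Pos}\<le>dim R"
   "\<forall>b\<in>Pos. b\<cdot>u > 0" "- 1 < C" "C < 1" "c u + c' u=(2 * C)*\<^sub>Ru"
   "\<forall>x. (\<forall>b\<in>R. b\<cdot>x=0) --> c x=x" using coxeter_element[OF irr r2] by (elim exE conjE)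
  have "\<exists>k>0. \<forall>x. (c ^^ k) x=x" by (rule gd_finite_order[OF rs cox(1)]) (use cox(7) in simp)
  then obtain k where k: "k > 0" "\<And>x. (c ^^ k) x=x" by (elim exE conjE) simp
  define S where "S=sqrt (1 - C\<^sup>2)"
  have "C\<^sup>2 < 1" using cox(4,5) by (simp add: abs_square_less_1)
  hence S: "S > 0" "S\<^sup>2=1 - C\<^sup>2" by (simp_all add: S_def)
  define Z where "Z=Complex C S"
  have Z1: "norm Z=1" using S(2) by (simp add: Z_def complex_norm)
  have Zn: "Z~=1" using S(1) by (auto simp: Z_def complex_eq_iff)
  \<comment> \<open>\<open>x0 + \<i> y0\<close> is \<open>c u - cnj Z * u\<close>. On the plane of
    \<open>u\<close> and \<open>c u\<close> the operator satisfies \<open>c^2 = 2 C c - 1\<close>,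
    with roots \<open>Z\<close> and its conjugate, so this is an eigenvector for \<open>Z\<close>.
    Its imaginary part is a positive multiple of \<open>u\<close>, so it lies on no mirror.\<close>
  define x0 where "x0=c u - C*\<^sub>Ru"
  define y0 where "y0=S*\<^sub>Ru"
  have lin: "linear c" using gdD(1)[OF cox(1)] .
  have "c (c u + c' u)=(2 * C)*\<^sub>Rc u" unfolding cox(6) by (rule linear_scale[OF lin])
  hence ccu: "c (c u)=(2 * C)*\<^sub>Rc u - u"
   using linear_add[OF lin] gdD(3)[OF cox(1)] by (simp add: algebra_simps)
  have v: "c x0=Re Z*\<^sub>Rx0 - Im Z*\<^sub>Ry0" "c y0=Im Z*\<^sub>Rx0 + Re Z*\<^sub>Ry0"
  proof -
   have "c x0=C*\<^sub>Rc u - u"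
   proof -
    have "(2 * C)*\<^sub>Rc u=C*\<^sub>Rc u + C*\<^sub>Rc u" by (simp add: scaleR_add_left[symmetric])
    thus ?thesis unfolding x0_def linear_diff[OF lin] linear_scale[OF lin] ccu by simp
   qed
   also have "\<dots>=C*\<^sub>Rx0 - S*\<^sub>Ry0"
   proof -
    have "(C * C + S * S)*\<^sub>Ru=u" using S(2) by (simp add: power2_eq_square)
    thus ?thesis by (simp add: x0_def y0_def algebra_simps)
   qed
   finally show "c x0=Re Z*\<^sub>Rx0 - Im Z*\<^sub>Ry0" by (simp add: Z_def)
   show "c y0=Im Z*\<^sub>Rx0 + Re Z*\<^sub>Ry0"
    unfolding y0_def linear_scale[OF lin] by (simp add: Z_def x0_def algebra_simps)
  qed
  define l where "l b=Complex (b\<cdot>x0) (b\<cdot>y0)" for b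
  have im: "Im (l b)=S * (b\<cdot>u)" for b by (simp add: l_def y0_def)
  have "l (c' b)=Z * l b" for b
  proof -
   have "c' b\<cdot>x=b\<cdot>c x" for x using gdD(5)[OF cox(1), of x b] by (simp add: inner_commute)
   thus ?thesis unfolding l_def by (simp add: v complex_eq_iff inner_diff_right inner_add_right)
  qed
  hence ev: "l ((c' ^^ j) b)=Z ^ j * l b" for b j by (induction j) simp_all
  have reg: "l b~=0" if "b\<in>Pos" for b
  proof -
   have "Im (l b) > 0" using im[of b] S(1) cox(3) that by simp
   thus ?thesis by auto
  qed
  obtain a1 where a1: "a1\<in>Pos" using a0 pos_neg by blast
  have "Z ^ k=1"
  proof -
   have "(c' ^^ k) a1=a1" using k(2)[of "(c' ^^ k) a1"] gdD(3)[OF gd_pow[OF cox(1)], of k a1] by simp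
   hence "Z ^ k * l a1=1 * l a1" using ev[of k a1] by simp
   thus ?thesis using reg[OF a1] mult_cancel_right by blast
  qed
  from root_of_unity_order[OF this k(1) Zn] obtain N where N: "N > 0" "Z ^ N=1"
   "\<And>a b. a < N ==> b < N ==> Z ^ a=Z ^ b ==> a=b" "(\<Sum>j<N. Z ^ j)=0" by blast
  have "card R\<le>card {d\<in>Pos. c' d\<notin>Pos} * N"
   by (rule coxeter_order[OF ev cox(1) im S(1) cox(3) N(2,4,1)])
  also have "\<dots>\<le>r * N" using cox(2) by (simp add: r_def)
  finally have hN: "real (card R) / real (dim R)\<le>real N"
   using r0 by (simp add: r_def divide_le_eq mult.commute flip: of_nat_mult)
  have htN: "ht d\<le>real N - 1" if "d\<in>Pos" for d using ht_le[OF irr that] hN by simp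
  have n1: "?n 1=r" using card_smp smp_ht by (simp add: r_def)
  have eb: "1\<le>e i \<and> e i < N" if i: "i < r" for i
  proof
   have c: "card {i. i < r \<and> 0 < e i}=r" by (simp only: eF(2) One_nat_def[symmetric] n1)
   have "{i. i < r \<and> 0 < e i}={..<r}"
   proof (rule card_subset_eq)
    show "card {i. i < r \<and> 0 < e i}=card {..<r}" unfolding c by simp
   qed auto
   hence "i\<in>{i. i < r \<and> 0 < e i}" using i by blast
   thus 1: "1\<le>e i" by simp
   obtain t where t: "e i=Suc t" using 1 by (cases "e i") auto
   have "i\<in>{i. i < r \<and> t < e i}" using i t by simp
   hence "card {i. i < r \<and> t < e i}~=0" by (subst card_0_eq) auto
   hence "{d\<in>Pos. ht d=real (Suc t)}~={}" unfolding eF(2) using card.empty by metis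
   then obtain d where "d\<in>Pos" "ht d=real (Suc t)" by blast
   thus "e i < N" using htN[of d] t by simp
  qed
  have sym1: "card {i. i < r \<and> e i=m}\<le>card {i. i < r \<and> e i=N - m}" if m: "1\<le>m" "m < N" for m
  proof -
   have "Z ^ (N - m) * Z ^ m=1" using m N(2) by (simp flip: power_add)
   moreover have "cnj (Z ^ m) * Z ^ m=1"
    using complex_norm_square[of "Z ^ m"] Z1 by (simp add: norm_power mult.commute)
   ultimately have cm: "cnj (Z ^ m)=Z ^ (N - m)" by (metis mult_cancel_right mult_zero_left zero_neq_one mult_zero_right)
   have *: "{i. i < r \<and> Z ^ e i=Z ^ m'}={i. i < r \<and> e i=m'}" if "m' < N" for m'
   proof (intro Collect_cong conj_cong refl)
    fix i assume "i < r"
    hence "e i < N" using eb by blast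
    from N(3)[OF this that] show "Z ^ e i=Z ^ m' \<longleftrightarrow> e i=m'" by auto
   qed
   note 1 = *[OF m(2)]
   have "N - m < N" using m by simp
   hence 2: "{i. i < r \<and> Z ^ e i=cnj (Z ^ m)}={i. i < r \<and> e i=N - m}" unfolding cm by (rule *)
   show ?thesis unfolding 1[symmetric] 2[symmetric]
    by (rule eigenvalue_symmetry[OF fb r_def cox(1) k v]) (use reg in \<open>auto simp: l_def\<close>)
  qed
  have sym: "card {i. i < r \<and> e i=m}=card {i. i < r \<and> e i=N - m}" if m: "1\<le>m" "m < N" for m
   using sym1[OF m] sym1[of "N - m"] m by simp
  have bal: "(\<Sum>i<r. H (e i))=(\<Sum>i<r. H (N - e i))" for H :: "nat => real" by (rule sum_symmetric[OF eb sym])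
  have n_alt: "real (?n m)=(\<Sum>i<r. if m\<le>e i then 1 else 0)" if "1\<le>m" for m
  proof -
   have "?n m=card {i. i < r \<and> m - 1 < e i}" using eF(2)[of "m - 1"] that by simp
   also have "{i. i < r \<and> m - 1 < e i}={i\<in>{..<r}. m\<le>e i}" using that by auto
   finally show ?thesis by (simp add: sum.If_cases Int_def)
  qed
  \<comment> \<open>By \<open>n_alt\<close> the roots of height \<open>m\<close> count the exponents
    that are at least \<open>m\<close>. The symmetry turns the condition for
    \<open>N + 1 - m\<close> into the complement of the one for \<open>m\<close>.\<close>
  have dual: "?n m + ?n (N + 1 - m)=r" if m: "1\<le>m" "m\<le>N" for m
  proof -
   have "real (?n (N + 1 - m))=(\<Sum>i<r. if N + 1 - m\<le>e i then 1 else 0)" by (rule n_alt) (use m in simp)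
   also have "\<dots>=(\<Sum>i<r. if N + 1 - m\<le>N - e i then 1 else 0)" by (rule bal)
   also have "\<dots>=(\<Sum>i<r. if m\<le>e i then 0 else 1)"
   proof (intro sum.cong refl)
    fix i assume "i\<in>{..<r}"
    hence "1\<le>e i" "e i < N" using eb[of i] by auto
    hence "N + 1 - m\<le>N - e i \<longleftrightarrow> \<not> m\<le>e i" using m by auto
    thus "(if N + 1 - m\<le>N - e i then 1 else 0)=(if m\<le>e i then 0 else 1 :: real)" by simp
   qed
   finally have "real (?n m) + real (?n (N + 1 - m))=(\<Sum>i<r. 1)"
    unfolding n_alt[OF m(1)] by (simp only: sum.distrib[symmetric]) (intro sum.cong, auto)
   thus ?thesis by simp
  qed
  have "real (card R)=real N * real r"
  proof -
   have "(\<Sum>i<r. real (e i))=real (card (Pos))"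
   proof -
    have "(\<Sum>i<r. real (e i))=(\<Sum>i<r. \<Sum>m\<in>{1..<N}. if m\<le>e i then 1 else 0)"
    proof (intro sum.cong refl)
     fix i assume "i\<in>{..<r}"
     hence "1\<le>e i" "e i < N" using eb[of i] by auto
     hence "{1..<N}\<inter>{m. m\<le>e i}={1..e i}" by auto
     thus "real (e i)=(\<Sum>m\<in>{1..<N}. if m\<le>e i then 1 else 0)" by (simp add: sum.If_cases)
    qed
    also have "\<dots>=(\<Sum>m\<in>{1..<N}. real (?n m))" by (subst sum.swap) (intro sum.cong refl, simp add: n_alt)
    also have "\<dots>=real (\<Sum>m\<in>{1..<N}. ?n m)" by simp
    also have "(\<Sum>m\<in>{1..<N}. ?n m)=card (\<Union>m\<in>{1..<N}. {d\<in>Pos. ht d=real m})"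
     by (rule card_UN_disjoint[symmetric]) (use finP in auto)
    also have "(\<Union>m\<in>{1..<N}. {d\<in>Pos. ht d=real m})=Pos"
    using ht_nat htN subset_antisym subsetI by fastforce
    finally show ?thesis .
   qed
   moreover have "(\<Sum>i<r. real (e i))=real N * real r - (\<Sum>i<r. real (e i))"
   proof -
    have "(\<Sum>i<r. real (e i))=(\<Sum>i<r. real (N - e i))" by (rule bal)
    also have "\<dots>=(\<Sum>i<r. real N - real (e i))"
     by (intro sum.cong refl) (use eb in \<open>auto simp: of_nat_diff less_imp_le\<close>)
    finally show ?thesis by (simp add: sum_subtractf mult.commute)
   qed
   ultimately show ?thesis using card_pos by simp
  qed
  hence cN: "card R=N * dim R" by (simp add: r_def flip: of_nat_mult)
  have N2: "N\<ge>2" using eb[OF r0] by simp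
  show ?thesis by (rule exI[of _ N]) (use N2 cN dual in \<open>auto simp: r_def\<close>)
 qed
qed

end

section \<open>Affine roots\<close>

lemma dd_image:
 assumes "linear f" "inj f"
 shows "dd (f ` N) (f a)=dd N a"
proof -
 have c: "card (f ` M)=card M" for M using assms(2) by (simp add: card_image inj_on_subset)
 have "(%v. span {f a, v}) ` f ` N=(`) f ` (%v. span {a, v}) ` N" unfolding image_image
 proof (rule image_cong[OF refl])
  fix v show "span {f a, f v}=f ` span {a, v}" using linear_span_image[OF assms(1), of "{a, v}"] by simp
 qed
 moreover have "inj ((`) f)" using assms(2) by (intro injI) (simp add: inj_image_eq_iff)
 hence "card ((`) f ` (%v. span {a, v}) ` N)=card ((%v. span {a, v}) ` N)"
  by (intro card_image) (auto intro: inj_on_subset)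
 ultimately show ?thesis unfolding dd_def c by simp
qed

text \<open>A vector alone in its class adds one to both terms of the difference that defines
  \<open>dd\<close>.\<close>

lemma dd_singles:
 assumes "finite N" "finite M" "N\<inter>M={}"
  "\<And>u v. u\<in>M ==> v\<in>N\<union>M ==> span {a, u}=span {a, v} ==> u=v"
 shows "dd (N\<union>M) a=dd N a"
proof -
 let ?pl = "%v. span {a, v}"
 have "card (?pl ` (N\<union>M))=card (?pl ` N) + card (?pl ` M)" unfolding image_Un
 proof (rule card_Un_disjoint)
  show "?pl ` N\<inter>?pl ` M={}"
  proof (rule ccontr)
   assume "\<not> ?thesis"
   then obtain v u where *: "v\<in>N" "u\<in>M" "?pl v=?pl u" by auto
   have "u=v" by (rule assms(4)) (use * in auto)
   thus False using * assms(3) by blast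
  qed
 qed (use assms in auto)
 moreover have "card (?pl ` M)=card M" by (intro card_image inj_onI) (use assms(4) in blast)
 moreover have "card (N\<union>M)=card N + card M" by (rule card_Un_disjoint[OF assms(1-3)])
 moreover have "card (?pl ` N)\<le>card N" by (rule card_image_le[OF assms(1)])
 ultimately show ?thesis unfolding dd_def by simp
qed

lemma cn_sign:
 assumes "b~=0"
 shows "cn c b > 0 \<longleftrightarrow> c\<cdot>b > 0" "cn c b < 0 \<longleftrightarrow> c\<cdot>b < 0"
proof -
 have "2 * x / d > 0 \<longleftrightarrow> x > 0" "2 * x / d < 0 \<longleftrightarrow> x < 0" if "d > 0" for x d :: real
  using that by (simp_all add: zero_less_divide_iff divide_less_0_iff)
 moreover have "b\<cdot>b > 0" using assms by simp
 ultimately show "cn c b > 0 \<longleftrightarrow> c\<cdot>b > 0" "cn c b < 0 \<longleftrightarrow> c\<cdot>b < 0" unfolding cn_def by blast+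
qed

lemma two_values:
 fixes b c :: "'a::euclidean_space"
 assumes "b\<notin>span {c}" "c\<notin>span {b}"
 shows "\<exists>q. b\<cdot>q=s \<and> c\<cdot>q=(t::real)"
proof -
 obtain x where x: "c\<cdot>x=0" "b\<cdot>x~=0" using ortho_witness[OF assms(1)] by auto
 obtain y where y: "b\<cdot>y=0" "c\<cdot>y~=0" using ortho_witness[OF assms(2)] by auto
 show ?thesis
  by (rule exI[of _ "(s / (b\<cdot>x))*\<^sub>Rx + (t / (c\<cdot>y))*\<^sub>Ry"]) (use x y in \<open>simp add: inner_add_right\<close>)
qed

context rsys
begin

text \<open>In \<open>rho_minus_one\<close> the positive roots that stay positive under the
  reflection along \<open>b\<close> are permuted by it and cancel. What remains is a sum over
  inversions, a form that still makes sense for affine roots, whose inversion sets are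
  finite.\<close>

lemma rho_inversions:
 assumes b: "b\<in>Pos"
 shows "ht b - 1=(\<Sum>c\<in>{c\<in>Pos - {b}. refl_along b c\<notin>Pos}. cn b c) / 2"
proof -
 let ?s = "refl_along b" and ?P = "Pos - {b}"
 let ?K = "{c\<in>?P. ?s c\<in>Pos}"
 have bR: "b\<in>R" using posD(1)[OF b] .
 have sb: "?s b=- b" by (rule refl_self[OF nz(1)[OF bR]])
 have sK: "?s c\<in>?K" if c: "c\<in>?K" for c
 proof -
  have "?s c~=b"
  proof
   assume "?s c=b"
   hence "c=- b" using sb refl_refl by metis
   thus False using posD(2)[of c] posD(2)[OF b] c by auto
  qed
  thus ?thesis using c by (simp add: refl_refl)
 qed
 have "(\<Sum>c\<in>?K. cn b c)=(\<Sum>c\<in>?K. cn b (?s c))"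
  by (rule sum.reindex_bij_witness[of _ ?s ?s]) (use sK in \<open>auto simp: refl_refl\<close>)
 also have "\<dots>=(\<Sum>c\<in>?K. - cn b c)"
 proof (rule sum.cong[OF refl])
  fix c
  have "b\<cdot>?s c=- (b\<cdot>c)" using refl_adj[of b b c] sb by simp
  thus "cn b (?s c)=- cn b c" by (simp add: cn_def refl_inner)
 qed
 finally have K0: "(\<Sum>c\<in>?K. cn b c)=0" by (simp add: sum_negf)
 have "ht b - 1=(\<Sum>c\<in>?P. cn b c) / 2"
  unfolding rho_minus_one[OF b] by (simp add: cn_def sum_divide_distrib)
 also have "(\<Sum>c\<in>?P. cn b c)=(\<Sum>c\<in>?K. cn b c) + (\<Sum>c\<in>{c\<in>?P. ?s c\<notin>Pos}. cn b c)"
 proof (subst sum.union_disjoint[symmetric])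
  show "sum (cn b) ?P=sum (cn b) (?K\<union>{c\<in>?P. ?s c\<notin>Pos})" by (rule sum.cong) auto
 qed (use finP in auto)
 finally show ?thesis using K0 by simp
qed

end

text \<open>A pair \<open>(c, j)\<close> stands for the affine root \<open>c + j\<close>; its value
  at \<open>p\<close> is the inner product with \<open>(p, 1)\<close>.\<close>

definition af :: "'v::euclidean_space set => 'v => real => ('v \<times> real) set" where
 "af R p v={c. fst c\<in>R \<and> snd c\<in>\<int> \<and> 0 < c\<cdot>(p, 1) \<and> c\<cdot>(p, 1) < v}"

text \<open>The affine function with gradient \<open>c\<close> that vanishes at
  \<open>q\<close>.\<close>

definition phi :: "'v::euclidean_space => 'v => 'v \<times> real" where
 "phi q c=(c, - (c\<cdot>q))"

lemma phi_linear: "linear (phi q)" and phi_inj: "inj (phi q)"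
 by (auto simp: phi_def linear_iff inner_add_left inj_def)

lemma phi_val: "phi q c\<cdot>(p, 1)=c\<cdot>(p - q)" by (simp add: phi_def inner_diff_right)

lemma pair_eq_phi: "c\<cdot>(q, 1)=0 ==> c=phi q (fst c)" by (cases c) (simp add: phi_def)

text \<open>\<open>p\<close> is generic and so close to the origin that the values of two roots
  differ by less than 1. Hence an affine root is determined by its value at
  \<open>p\<close>.\<close>

locale asys =
 fixes R :: "'v::euclidean_space set" and p :: 'v
 assumes rs: "rs R" and inj: "inj_on (%c. c\<cdot>p) R" and small: "\<And>c. c\<in>R ==> c\<cdot>p~=0 \<and> \<bar>c\<cdot>p\<bar> < 1 / 2"

sublocale asys \<subseteq> rsys R p using rs small by unfold_locales auto

context asys
begin

lemma int_val: "s\<in>\<int> ==> t\<in>\<int> ==> c\<in>R ==> d\<in>R ==> c\<cdot>p + s=d\<cdot>p + t ==> c=d \<and> s=t"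
proof -
 assume st: "s\<in>\<int>" "t\<in>\<int>" and cd: "c\<in>R" "d\<in>R" and e: "c\<cdot>p + s=d\<cdot>p + t"
 obtain i j where ij: "s = of_int i" "t = of_int j" using st by (auto elim!: Ints_cases)
 have "\<bar>real_of_int (i - j)\<bar> < 1" using small[OF cd(1)] small[OF cd(2)] e ij by simp linarith
 hence "i=j" by linarith
 hence "c\<cdot>p=d\<cdot>p" using e ij by simp
 thus ?thesis using inj_onD[OF inj _ cd] \<open>i = j\<close> ij by simp
qed

lemma val_inj:
 fixes c d :: "'v \<times> real"
 assumes "fst c\<in>R" "snd c\<in>\<int>" "fst d\<in>R" "snd d\<in>\<int>" "c\<cdot>(p, 1)=d\<cdot>(p, 1)"
 shows "c=d" using int_val[OF assms(2,4,1,3)] assms(5) by (cases c, cases d) simp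

lemma af_finite: "finite (af R p v)"
proof (rule finite_subset)
 show "af R p v\<subseteq>R \<times> real_of_int ` {-1..\<lceil>v\<rceil> + 1}"
 proof
  fix d assume d: "d\<in>af R p v"
  obtain c s where cs: "d=(c, s)" by (cases d)
  hence c: "c\<in>R" "s\<in>\<int>" "0 < c\<cdot>p + s" "c\<cdot>p + s < v" using d by (auto simp: af_def)
  then obtain i where i: "s = of_int i" by (auto elim: Ints_cases)
  have "-1\<le>i" "i\<le>\<lceil>v\<rceil> + 1" using small[OF c(1)] c(3,4) unfolding i by linarith+
  thus "d\<in>R \<times> real_of_int ` {-1..\<lceil>v\<rceil> + 1}" unfolding cs i using c(1) by auto
 qed
 show "finite (R \<times> real_of_int ` {-1..\<lceil>v\<rceil> + 1})" using rsD(1)[OF rs] by simp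
qed

lemma par_fst: "b\<in>R ==> c\<in>R ==> c\<in>span {b} \<longleftrightarrow> c=b \<or> c=- b"
 using rsD(5)[OF rs, of b c] by (auto intro: span_base span_neg)

text \<open>The affine roots vanishing at \<open>(q, 1)\<close> form a finite root system, with positivity given by \<open>p - q\<close>.\<close>

lemma slice_rsys:
 fixes q :: 'v
 assumes "subspace X"
 defines "R' \<equiv> {c\<in>R\<inter>X. c\<cdot>q\<in>\<int>}"
 shows "rsys R' (p - q)" "inj_on (%c. c\<cdot>(p - q)) R'"
proof -
 have rs': "rs R'" unfolding R'_def using rs_congruence[OF rs_Int_subspace[OF rs assms(1)]] by simp
 show "rsys R' (p - q)"
 proof
  show "rs R'" by (rule rs')
  fix c assume c: "c\<in>R'"
  then obtain i where i: "c\<cdot>q = of_int i" by (auto simp: R'_def elim: Ints_cases)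
  show "c\<cdot>(p - q)~=0"
  proof
   assume "c\<cdot>(p - q)=0"
   hence e: "c\<cdot>p = of_int i" using i by (simp add: inner_diff_right)
   have "c\<cdot>p~=0 \<and> \<bar>c\<cdot>p\<bar> < 1 / 2" using small c by (simp add: R'_def)
   hence "i~=0" "\<bar>real_of_int i\<bar> < 1" unfolding e by auto
   thus False by linarith
  qed
 qed
 show "inj_on (%c. c\<cdot>(p - q)) R'"
 proof (rule inj_onI)
  fix c d assume cd: "c\<in>R'" "d\<in>R'" and e: "c\<cdot>(p - q)=d\<cdot>(p - q)"
  have "c\<cdot>p + - (c\<cdot>q)=d\<cdot>p + - (d\<cdot>q)" using e by (simp add: inner_diff_right)
  thus "c=d" using int_val[of "- (c\<cdot>q)" "- (d\<cdot>q)" c d] cd by (simp add: R'_def)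
 qed
qed

text \<open>The localization at \<open>(q, 1)\<close> is an initial segment of a finite system,
  because the value at \<open>p\<close> of an affine root through \<open>q\<close> is the pairing of
  its gradient with \<open>p - q\<close>.\<close>

lemma slice_eq:
 fixes u :: "'v \<times> real"
 assumes u: "fst u\<in>R" "snd u\<in>\<int>" "u\<cdot>(q, 1)=0"
 shows "{d\<in>af R p (u\<cdot>(p, 1)). d\<cdot>(q, 1)=0} =
  phi q ` {c\<in>pos {c\<in>R. c\<cdot>q\<in>\<int>} (p - q). c\<cdot>(p - q) < fst u\<cdot>(p - q)}"
proof (intro subset_antisym subsetI)
 have b: "u\<cdot>(p, 1)=fst u\<cdot>(p - q)" using phi_val[of q "fst u" p] pair_eq_phi[OF u(3)] by simp
 fix d assume d: "d\<in>{d\<in>af R p (u\<cdot>(p, 1)). d\<cdot>(q, 1)=0}"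
 have e: "d=phi q (fst d)" using d pair_eq_phi by blast
 have v: "d\<cdot>(p, 1)=fst d\<cdot>(p - q)" by (subst e) (rule phi_val)
 have "snd d=- (fst d\<cdot>q)" by (subst e) (simp add: phi_def)
 moreover have "snd d\<in>\<int>" using d by (simp add: af_def)
 ultimately have "- (fst d\<cdot>q)\<in>\<int>" by simp
 hence "fst d\<cdot>q\<in>\<int>" by simp
 hence "fst d\<in>{c\<in>pos {c\<in>R. c\<cdot>q\<in>\<int>} (p - q). c\<cdot>(p - q) < fst u\<cdot>(p - q)}"
  using d v b by (simp add: af_def pos_def)
 thus "d\<in>phi q ` {c\<in>pos {c\<in>R. c\<cdot>q\<in>\<int>} (p - q). c\<cdot>(p - q) < fst u\<cdot>(p - q)}" using e by blast
next
 have b: "u\<cdot>(p, 1)=fst u\<cdot>(p - q)" using phi_val[of q "fst u" p] pair_eq_phi[OF u(3)] by simp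
 fix d assume "d\<in>phi q ` {c\<in>pos {c\<in>R. c\<cdot>q\<in>\<int>} (p - q). c\<cdot>(p - q) < fst u\<cdot>(p - q)}"
 then obtain c where c: "d=phi q c" "c\<in>R" "c\<cdot>q\<in>\<int>" "0 < c\<cdot>(p - q)" "c\<cdot>(p - q) < fst u\<cdot>(p - q)"
  by (auto simp: pos_def)
 have "d\<cdot>(p, 1)=c\<cdot>(p - q)" unfolding c(1) by (rule phi_val)
 thus "d\<in>{d\<in>af R p (u\<cdot>(p, 1)). d\<cdot>(q, 1)=0}" using c b by (simp add: af_def) (simp add: phi_def)
qed

text \<open>The positive affine roots not parallel to \<open>b\<close> that the affine reflection
  along \<open>b\<close> makes negative: this reflection subtracts \<open>cn (fst c) (fst b)\<close>
  times \<open>b\<close>.\<close>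

definition ainv :: "'v \<times> real => ('v \<times> real) set" where
 "ainv b={c. fst c\<in>R \<and> snd c\<in>\<int> \<and> fst c~=fst b \<and> fst c~=- fst b \<and>
   0 < c\<cdot>(p, 1) \<and> c\<cdot>(p, 1) < cn (fst c) (fst b) * (b\<cdot>(p, 1))}"

text \<open>Two non-parallel affine roots vanish at a common \<open>q\<close>, so the affine roots
  in their span are the image of a finite system of rank two. There the number of smaller roots and
  the sum over inversions are both determined by the height of \<open>fst u\<close>.\<close>

lemma affine_plane_count:
 fixes u d0 :: "'v \<times> real"
 assumes u: "fst u\<in>R" "snd u\<in>\<int>" "0 < u\<cdot>(p, 1)"
  and d0: "fst d0\<in>R" "snd d0\<in>\<int>" "fst d0~=fst u" "fst d0~=- fst u"
 defines "A' \<equiv> {d\<in>af R p (u\<cdot>(p, 1)). fst d~=fst u \<and> fst d~=- fst u}" and "X \<equiv> span {u, d0}"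
 shows "(\<Sum>d\<in>{d\<in>ainv u. span {u, d}=X}. cn (fst u) (fst d)) / 2 =
  (if {d\<in>A'. span {u, d}=X}={} then 0 else real (card {d\<in>A'. span {u, d}=X}) - 1)"
proof -
 define b where "b=fst u"
 define c0 where "c0=fst d0"
 have bc: "b\<in>R" "c0\<in>R" using u d0 by (auto simp: b_def c0_def)
 have c0b: "c0\<notin>span {b}" using par_fst[OF bc] d0 by (simp add: b_def c0_def)
 have bc0: "b\<notin>span {c0}" using par_fst[OF bc(2,1)] d0 by (auto simp: b_def c0_def)
 obtain q where q: "b\<cdot>q=- snd u" "c0\<cdot>q=- snd d0" using two_values[OF bc0 c0b] by blast
 have uq: "u\<cdot>(q, 1)=0" using q(1) by (cases u) (simp add: b_def)
 have dq: "d0\<cdot>(q, 1)=0" using q(2) by (cases d0) (simp add: c0_def)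
 have ue: "u=phi q b" using pair_eq_phi[OF uq] by (simp add: b_def)
 have de: "d0=phi q c0" using pair_eq_phi[OF dq] by (simp add: c0_def)
 let ?Y = "span {b, c0}"
 define R' where "R'={c\<in>R\<inter>?Y. c\<cdot>q\<in>\<int>}"
 let ?g = "p - q"
 interpret R: rsys R' ?g unfolding R'_def by (rule slice_rsys(1)[OF subspace_span])
 have injR: "inj_on (%c. c\<cdot>?g) R'" unfolding R'_def by (rule slice_rsys(2)[OF subspace_span])
 have XY: "X=phi q ` ?Y" unfolding X_def ue de using linear_span_image[OF phi_linear, of q "{b, c0}"] by simp
 have bv: "u\<cdot>(p, 1)=b\<cdot>?g" unfolding ue by (rule phi_val)
 have b': "b\<in>R'" using bc(1) q(1) u(2) by (auto simp: R'_def intro: span_base)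
 have c0': "c0\<in>R'" using bc(2) q(2) d0(2) by (auto simp: R'_def intro: span_base)
 have bpos: "b\<in>pos R' ?g" using b' u(3) bv by (simp add: pos_def)
 have d2: "dim R'=2"
 proof -
  have "independent {b}" using nz(1)[OF bc(1)] by (simp add: dependent_single)
  hence "independent (insert c0 {b})" by (rule independent_insertI[OF c0b])
  hence "independent {b, c0}" by (simp add: insert_commute)
  moreover have "b~=c0" using d0(3) by (auto simp: b_def c0_def)
  ultimately have d2: "dim {b, c0}=2" by (simp add: dim_eq_card_independent)
  have "dim {b, c0}\<le>dim R'" by (intro dim_subset) (use b' c0' in auto)
  moreover have "dim R'\<le>dim ?Y" by (rule dim_subset) (auto simp: R'_def)
  ultimately show ?thesis using d2 by (simp add: dim_span)
 qed
 have plX: "span {u, phi q c}=X \<longleftrightarrow> c\<in>?Y" if c: "c\<in>R" "c~=b" "c~=- b" for c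
 proof
  assume "span {u, phi q c}=X"
  hence "phi q c\<in>phi q ` ?Y" unfolding XY[symmetric] using span_base[of "phi q c" "{u, phi q c}"] by simp
  thus "c\<in>?Y" using phi_inj[of q] by (auto dest: injD)
 next
  assume "c\<in>?Y"
  moreover have "c\<notin>span {b}" using par_fst[OF bc(1) c(1)] c(2,3) by simp
  ultimately have "span {b, c}=span {b, c0}" by (rule span2_eqI(1))
  thus "span {u, phi q c}=X" unfolding X_def ue de
   using linear_span_image[OF phi_linear, of q "{b, c}"] linear_span_image[OF phi_linear, of q "{b, c0}"] by simp
 qed
 have inX: "d=phi q (fst d) \<and> fst d\<in>?Y" if "span {u, d}=X" for d
 proof -
  have "d\<in>phi q ` ?Y" unfolding XY[symmetric] that[symmetric] by (rule span_base) simp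
  thus ?thesis by (auto simp: phi_def)
 qed
 have gen: "{d. fst d\<in>R \<and> snd d\<in>\<int> \<and> fst d~=b \<and> fst d~=- b \<and> 0 < d\<cdot>(p, 1) \<and> d\<cdot>(p, 1) < W (fst d) \<and> span {u, d}=X}
   = phi q ` {c\<in>pos R' ?g - {b}. c\<cdot>?g < W c}" for W
 proof (intro subset_antisym subsetI)
  fix d assume d: "d\<in>{d. fst d\<in>R \<and> snd d\<in>\<int> \<and> fst d~=b \<and> fst d~=- b \<and> 0 < d\<cdot>(p, 1) \<and> d\<cdot>(p, 1) < W (fst d) \<and> span {u, d}=X}"
  hence X: "d=phi q (fst d)" "fst d\<in>?Y" using inX by blast+
  have v: "d\<cdot>(p, 1)=fst d\<cdot>?g" by (subst X(1)) (rule phi_val)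
  have "snd d=- (fst d\<cdot>q)" by (subst X(1)) (simp add: phi_def)
  hence "- (fst d\<cdot>q)\<in>\<int>" using d by simp
  hence "fst d\<cdot>q\<in>\<int>" by simp
  hence "fst d\<in>{c\<in>pos R' ?g - {b}. c\<cdot>?g < W c}" using d v X(2) by (simp add: pos_def R'_def)
  thus "d\<in>phi q ` {c\<in>pos R' ?g - {b}. c\<cdot>?g < W c}" using X(1) by blast
 next
  fix d assume "d\<in>phi q ` {c\<in>pos R' ?g - {b}. c\<cdot>?g < W c}"
  then obtain c where c: "d=phi q c" "c\<in>pos R' ?g" "c~=b" "c\<cdot>?g < W c" by blast
  have v: "d\<cdot>(p, 1)=c\<cdot>?g" unfolding c(1) by (rule phi_val)
  have c': "c\<in>R" "c\<in>?Y" "c\<cdot>q\<in>\<int>" "0 < c\<cdot>?g" using c(2) by (auto simp: pos_def R'_def)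
  have nb: "c~=- b" using c'(4) R.posD(2)[OF bpos] by auto
  have "span {u, d}=X" unfolding c(1) using plX[OF c'(1) c(3) nb] c'(2) by simp
  moreover have "fst d=c" "snd d\<in>\<int>" unfolding c(1) using c'(3) by (simp_all add: phi_def)
  ultimately show "d\<in>{d. fst d\<in>R \<and> snd d\<in>\<int> \<and> fst d~=b \<and> fst d~=- b \<and> 0 < d\<cdot>(p, 1) \<and> d\<cdot>(p, 1) < W (fst d) \<and> span {u, d}=X}"
   using c' c v nb by simp
 qed
 have s1: "{d\<in>A'. span {u, d}=X}=phi q ` {c\<in>pos R' ?g. c\<cdot>?g < b\<cdot>?g}"
 proof -
  have "{d\<in>A'. span {u, d}=X}=phi q ` {c\<in>pos R' ?g - {b}. c\<cdot>?g < b\<cdot>?g}"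
   unfolding gen[of "%_. b\<cdot>?g", symmetric] A'_def af_def bv b_def[symmetric] by (rule Collect_cong) auto
  moreover have "{c\<in>pos R' ?g - {b}. c\<cdot>?g < b\<cdot>?g}={c\<in>pos R' ?g. c\<cdot>?g < b\<cdot>?g}" by auto
  ultimately show ?thesis by simp
 qed
 have s2: "{d\<in>ainv u. span {u, d}=X}=phi q ` {c\<in>pos R' ?g - {b}. refl_along b c\<notin>pos R' ?g}"
 proof -
  have "{d\<in>ainv u. span {u, d}=X}=phi q ` {c\<in>pos R' ?g - {b}. c\<cdot>?g < cn c b * (b\<cdot>?g)}"
   unfolding gen[of "%c. cn c b * (b\<cdot>?g)", symmetric] ainv_def bv b_def[symmetric] by (rule Collect_cong) auto
  also have "{c\<in>pos R' ?g - {b}. c\<cdot>?g < cn c b * (b\<cdot>?g)}={c\<in>pos R' ?g - {b}. refl_along b c\<notin>pos R' ?g}"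
  proof (intro Collect_cong conj_cong refl)
   fix c assume "c\<in>pos R' ?g - {b}"
   hence c: "c\<in>R'" by (simp add: pos_def)
   have r: "refl_along b c\<in>R'" by (rule rsD(3)[OF R.rs b' c])
   have e: "refl_along b c\<cdot>?g=c\<cdot>?g - cn c b * (b\<cdot>?g)" by (simp add: refl_cn inner_diff_left)
   show "c\<cdot>?g < cn c b * (b\<cdot>?g) \<longleftrightarrow> refl_along b c\<notin>pos R' ?g"
    using R.g[OF r] r unfolding pos_def mem_Collect_eq e by auto
  qed
  finally show ?thesis .
 qed
 have "(\<Sum>d\<in>{d\<in>ainv u. span {u, d}=X}. cn (fst u) (fst d)) / 2 =
   (\<Sum>c\<in>{c\<in>pos R' ?g - {b}. refl_along b c\<notin>pos R' ?g}. cn b c) / 2"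
  unfolding s2 by (subst sum.reindex) (auto simp: phi_def inj_on_def b_def)
 also have "\<dots>=b\<cdot>rho R' ?g - 1" by (rule R.rho_inversions[OF bpos, symmetric])
 also have "\<dots>=(if {d\<in>A'. span {u, d}=X}={} then 0 else real (card {d\<in>A'. span {u, d}=X}) - 1)"
 proof (cases "{c\<in>pos R' ?g. c\<cdot>?g < b\<cdot>?g}={}")
  case True
  from R.rank2_count(2)[OF d2 bpos injR True] show ?thesis unfolding s1 using True by simp
 next
  case False
  have "card (phi q ` {c\<in>pos R' ?g. c\<cdot>?g < b\<cdot>?g})=card {c\<in>pos R' ?g. c\<cdot>?g < b\<cdot>?g}"
   by (rule card_image[OF inj_on_subset[OF phi_inj subset_UNIV]])
  moreover have "phi q ` {c\<in>pos R' ?g. c\<cdot>?g < b\<cdot>?g}~={}" unfolding image_is_empty by (rule False)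
  ultimately show ?thesis unfolding s1 using R.rank2_count(1)[OF d2 bpos injR False] by (simp only: if_False)
 qed
 finally show ?thesis .
qed

lemma finite_int_between: "finite {i. (x::real) < of_int i \<and> of_int i < (y::real)}"
proof (rule finite_subset)
 show "{i. x < of_int i \<and> of_int i < y}\<subseteq>{\<lfloor>x\<rfloor>..\<lceil>y\<rceil>}" by (auto; linarith)
qed simp

text \<open>Integers strictly between \<open>- (c \<cdot> p)\<close> and \<open>cn c b * j\<close>
  minus the value of the reflected root at \<open>p\<close>. Both values are small, so the count is
  \<open>cn c b * j\<close> with corrections recording their signs.\<close>

lemma affine_count:
 assumes b: "b\<in>R" and j: "0 < b\<cdot>p + real_of_int j" and c: "c\<in>R"
 shows "real (card {i. 0 < c\<cdot>p + of_int i \<and> c\<cdot>p + of_int i < cn c b * (b\<cdot>p + real_of_int j)}) =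
  (if cn c b > 0 then cn c b * real_of_int j + (if c\<in>Pos then 1 else 0) - (if refl_along b c\<in>Pos then 1 else 0) else 0)"
proof -
 let ?S = "{i. 0 < c\<cdot>p + of_int i \<and> c\<cdot>p + of_int i < cn c b * (b\<cdot>p + real_of_int j)}"
 obtain n where n: "cn c b = of_int n" using rsD(4)[OF rs b c] by (auto elim: Ints_cases)
 define t where "t=refl_along b c\<cdot>p"
 have sc: "refl_along b c\<in>R" by (rule rsD(3)[OF rs b c])
 have ts: "t~=0" "\<bar>t\<bar> < 1 / 2" using small[OF sc] by (auto simp: t_def)
 have cs: "c\<cdot>p~=0" "\<bar>c\<cdot>p\<bar> < 1 / 2" using small[OF c] by auto
 have te: "t=c\<cdot>p - of_int n * (b\<cdot>p)" unfolding t_def refl_cn n by (simp add: inner_diff_left)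
 have tp: "refl_along b c\<in>Pos \<longleftrightarrow> t > 0" using sc by (simp add: pos_def t_def)
 have cp: "c\<in>Pos \<longleftrightarrow> c\<cdot>p > 0" using c by (simp add: pos_def)
 show ?thesis
 proof (cases "n > 0")
  case False
  have S0: "?S={}"
  proof (rule ccontr)
   assume "?S~={}"
   then obtain i where "0 < c\<cdot>p + of_int i" "c\<cdot>p + of_int i < cn c b * (b\<cdot>p + real_of_int j)" by blast
   hence "0 < of_int n * (b\<cdot>p + real_of_int j)" unfolding n by linarith
   thus False using j False by (simp add: zero_less_mult_iff)
  qed
  show ?thesis unfolding S0 using False n by simp
 next
  case True
  define m where "m=n * j"
  define lo where "lo=(if c\<cdot>p > 0 then 0 else 1 :: int)"
  define hi where "hi=m - (if t > 0 then 1 else 0)"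
  have len: "0 < of_int n * (b\<cdot>p + real_of_int j)" using True j by simp
  have e: "of_int n * (b\<cdot>p + real_of_int j)=c\<cdot>p - t + of_int m" unfolding te m_def by (simp add: algebra_simps)
  have "?S={lo..hi}"
  proof (intro subset_antisym subsetI)
   fix i assume "i\<in>?S"
   hence i: "0 < c\<cdot>p + of_int i" "of_int i < of_int m - t" unfolding n mem_Collect_eq e by linarith+
   show "i\<in>{lo..hi}" using i cs ts unfolding lo_def hi_def by (auto split: if_splits; linarith)
  next
   fix i assume "i\<in>{lo..hi}"
   hence "lo\<le>i" "i\<le>hi" by auto
   hence "real_of_int lo\<le>of_int i" "real_of_int i\<le>of_int hi" by simp_all
   moreover have "- 1 < c\<cdot>p" "t < 1" using cs(2) ts(2) unfolding abs_less_iff by simp_all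
   hence "- (c\<cdot>p) < real_of_int lo" "real_of_int hi < of_int m - t"
    using cs(1) ts(1) unfolding lo_def hi_def by (auto split: if_split)
   ultimately have "0 < c\<cdot>p + of_int i" "of_int i < of_int m - t" by simp_all
   thus "i\<in>?S" unfolding n mem_Collect_eq e by linarith
  qed
  hence "card ?S=nat (hi - lo + 1)" by simp
  moreover have "hi - lo + 1\<ge>0"
  proof -
   have "0 < c\<cdot>p - t + of_int m" using len e by simp
   thus ?thesis using cs ts unfolding hi_def lo_def by (auto split: if_splits; linarith)
  qed
  ultimately have "real (card ?S)=real_of_int (hi - lo + 1)" by simp
  also have "\<dots> = of_int n * real_of_int j + (if c\<cdot>p > 0 then 1 else 0) - (if t > 0 then 1 else 0)"
   unfolding hi_def lo_def m_def by simp
  finally show ?thesis unfolding tp cp n using True by simp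
 qed
qed

lemma ainv_sum:
 assumes u: "b\<in>R" "0 < b\<cdot>p + real_of_int j"
 shows "finite (ainv (b, real_of_int j))"
  "(\<Sum>d\<in>ainv (b, real_of_int j). cn b (fst d))=(\<Sum>c\<in>{c\<in>R - {b, - b}. cn c b > 0}.
   cn b c * (cn c b * real_of_int j + (if c\<in>Pos then 1 else 0) - (if refl_along b c\<in>Pos then 1 else 0)))"
proof -
 let ?S = "%c. {i. 0 < c\<cdot>p + of_int i \<and> c\<cdot>p + of_int i < cn c b * (b\<cdot>p + real_of_int j)}"
 let ?C = "{c\<in>R - {b, - b}. cn c b > 0}"
 have fS: "finite (?S c)" for c
 proof -
  have "?S c={i. - (c\<cdot>p) < of_int i \<and> of_int i < cn c b * (b\<cdot>p + real_of_int j) - c\<cdot>p}" by auto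
  thus ?thesis using finite_int_between by simp
 qed
 have finC: "finite ?C" using rsD(1)[OF rs] by simp
 have eq: "ainv (b, real_of_int j)=(%(c, i). (c, real_of_int i)) ` (SIGMA c:?C. ?S c)"
 proof (intro subset_antisym subsetI)
  fix d assume d: "d\<in>ainv (b, real_of_int j)"
  obtain c s where cs: "d=(c, s)" by (cases d)
  hence *: "c\<in>R" "s\<in>\<int>" "c~=b" "c~=- b" "0 < c\<cdot>p + s" "c\<cdot>p + s < cn c b * (b\<cdot>p + real_of_int j)"
   using d by (auto simp: ainv_def)
  have "0 < cn c b * (b\<cdot>p + real_of_int j)" using *(5,6) by linarith
  hence "cn c b > 0" using u(2) by (simp add: zero_less_mult_iff)
  moreover obtain i where "s = of_int i" using *(2) by (auto elim: Ints_cases)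
  ultimately show "d\<in>(%(c, i). (c, real_of_int i)) ` (SIGMA c:?C. ?S c)"
   unfolding cs using * by (intro image_eqI[of _ _ "(c, i)"]) auto
 qed (auto simp: ainv_def)
 show "finite (ainv (b, real_of_int j))" unfolding eq using finC fS by (intro finite_imageI finite_SigmaI) auto
 have "(\<Sum>d\<in>ainv (b, real_of_int j). cn b (fst d))=(\<Sum>(c, i)\<in>(SIGMA c:?C. ?S c). cn b c)"
  unfolding eq by (subst sum.reindex) (auto simp: inj_on_def split_beta)
 also have "\<dots>=(\<Sum>c\<in>?C. \<Sum>i\<in>?S c. cn b c)" by (rule sum.Sigma[symmetric]) (use finC fS in auto)
 also have "\<dots>=(\<Sum>c\<in>?C. cn b c * (cn c b * real_of_int j + (if c\<in>Pos then 1 else 0) - (if refl_along b c\<in>Pos then 1 else 0)))"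
 proof (rule sum.cong[OF refl])
  fix c assume c: "c\<in>?C"
  have "(\<Sum>i\<in>?S c. cn b c)=cn b c * real (card (?S c))" by simp
  also have "real (card (?S c))=cn c b * real_of_int j + (if c\<in>Pos then 1 else 0) - (if refl_along b c\<in>Pos then 1 else 0)"
   using affine_count[OF u, of c] c by simp
  finally show "(\<Sum>i\<in>?S c. cn b c)=cn b c * (cn c b * real_of_int j + (if c\<in>Pos then 1 else 0) - (if refl_along b c\<in>Pos then 1 else 0))" .
 qed
 finally show "(\<Sum>d\<in>ainv (b, real_of_int j). cn b (fst d))=(\<Sum>c\<in>?C.
   cn b c * (cn c b * real_of_int j + (if c\<in>Pos then 1 else 0) - (if refl_along b c\<in>Pos then 1 else 0)))" .
qed

text \<open>The part linear in \<open>x\<close> is \<open>coxeter_number\<close> without the terms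
  of \<open>b\<close> and \<open>- b\<close>, halved by the symmetry under negation. In the
  corrections, reflecting along \<open>b\<close> turns the second indicator into the missing half of
  a sum over all positive roots, that is, into a pairing with \<open>rho\<close>.\<close>

lemma ainv_value:
 assumes irr: "irreducible_roots R" and h: "card R=h * dim R" and b: "b\<in>R"
 shows "(\<Sum>c\<in>{c\<in>R - {b, - b}. cn c b > 0}.
   cn b c * (cn c b * x + (if c\<in>Pos then 1 else 0) - (if refl_along b c\<in>Pos then 1 else 0))) / 2
  = x * (real h - 2) + ht b - (if b\<in>Pos then 1 else - 1)"
proof -
 let ?D = "R - {b, - b}" and ?s = "refl_along b"
 have finD: "finite ?D" using rsD(1)[OF rs] by simp
 have nb: "- b\<in>R" "- b~=b"
 proof -
  show "- b~=b"
  proof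
   assume "- b=b"
   hence "- (b\<cdot>b)=b\<cdot>b" by (metis inner_minus_left)
   thus False using nz(2)[OF b] by simp
  qed
 qed (rule rsD(6)[OF rs b])
 have dim0: "dim R~=0" using b nz(1)[OF b] dim_eq_0[of R] by auto
 have cnb: "cn b b=2" "cn b (- b)=- 2" "cn (- b) b=- 2" using nz(2)[OF b] by (auto simp: cn_def)
 have neg: "- c\<in>?D" if "c\<in>?D" for c using that rsD(6)[OF rs] by (auto simp: minus_equation_iff)
 have sD: "?s c\<in>?D" if c: "c\<in>?D" for c
 proof -
  have "?s c\<in>R" using rsD(3)[OF rs b] c by simp
  moreover have "?s c~=b" "?s c~=- b"
  proof -
   have sb: "?s b=- b" by (rule refl_self[OF nz(1)[OF b]])
   have snb: "?s (- b)=b" using sb refl_refl by metis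
   show "?s c~=b" using c snb sb refl_refl by (metis DiffE insertCI)
   show "?s c~=- b" using c snb sb refl_refl by (metis DiffE insertCI)
  qed
  ultimately show ?thesis by simp
 qed
 have cns: "cn b (?s c)=- cn b c" "cn (?s c) b=- cn c b" for c
 proof -
  have sb: "?s b=- b" by (rule refl_self[OF nz(1)[OF b]])
  have "b\<cdot>?s c=- (b\<cdot>c)" using refl_adj[of b b c] sb by simp
  thus "cn b (?s c)=- cn b c" "cn (?s c) b=- cn c b" by (simp_all add: cn_def refl_inner inner_commute)
 qed
 have sgn: "cn c b > 0 \<longleftrightarrow> cn b c > 0" if "c\<in>R" for c
  unfolding cn_sign(1)[OF nz(1)[OF that]] cn_sign(1)[OF nz(1)[OF b]] by (simp add: inner_commute)
 have sgn': "cn c b < 0 \<longleftrightarrow> cn b c < 0" if "c\<in>R" for c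
  unfolding cn_sign(2)[OF nz(1)[OF that]] cn_sign(2)[OF nz(1)[OF b]] by (simp add: inner_commute)
 have A: "(\<Sum>c\<in>{c\<in>?D. cn c b > 0}. cn b c * cn c b)=2 * (real h - 2)"
 proof -
  have "4 * real h=(\<Sum>c\<in>R. cn b c * cn c b)" using coxeter_number[OF irr b] h dim0 by simp
  also have "\<dots>=(\<Sum>c\<in>?D. cn b c * cn c b) + (\<Sum>c\<in>{b, - b}. cn b c * cn c b)"
   by (rule sum.subset_diff) (use b nb rsD(1)[OF rs] in auto)
  also have "(\<Sum>c\<in>{b, - b}. cn b c * cn c b)=8" using nb(2) cnb by simp
  also have "(\<Sum>c\<in>?D. cn b c * cn c b)=(\<Sum>c\<in>{c\<in>?D. cn c b > 0}. cn b c * cn c b) + (\<Sum>c\<in>{c\<in>?D. cn c b < 0}. cn b c * cn c b)"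
  proof (subst sum.union_disjoint[symmetric])
   show "(\<Sum>c\<in>?D. cn b c * cn c b)=(\<Sum>c\<in>{c\<in>?D. cn c b > 0}\<union>{c\<in>?D. cn c b < 0}. cn b c * cn c b)"
   proof (rule sum.mono_neutral_right)
    show "\<forall>c\<in>?D - ({c\<in>?D. cn c b > 0}\<union>{c\<in>?D. cn c b < 0}). cn b c * cn c b=0" by auto
   qed (use finD in auto)
  qed (use finD in auto)
  also have "(\<Sum>c\<in>{c\<in>?D. cn c b < 0}. cn b c * cn c b)=(\<Sum>c\<in>{c\<in>?D. cn c b > 0}. cn b c * cn c b)"
   by (rule sum.reindex_bij_witness[of _ uminus uminus]) (use neg in \<open>auto simp: cn_def\<close>)
  finally show ?thesis by simp
 qed
 have B: "(\<Sum>c\<in>{c\<in>?D. cn c b > 0}. cn b c * ((if c\<in>Pos then 1 else 0) - (if ?s c\<in>Pos then 1 else 0)))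
   = 2 * (ht b - (if b\<in>Pos then 1 else - 1))"
 proof -
  let ?u = "%c. if c\<in>Pos then 1 else 0 :: real"
  have "(\<Sum>c\<in>{c\<in>?D. cn c b > 0}. cn b c * (?u c - ?u (?s c))) =
    (\<Sum>c\<in>{c\<in>?D. cn c b > 0}. cn b c * ?u c) + (\<Sum>c\<in>{c\<in>?D. cn c b > 0}. - (cn b c * ?u (?s c)))"
   by (simp add: sum.distrib[symmetric] algebra_simps)
  also have "(\<Sum>c\<in>{c\<in>?D. cn c b > 0}. - (cn b c * ?u (?s c)))=(\<Sum>c\<in>{c\<in>?D. cn c b < 0}. cn b c * ?u c)"
   by (rule sum.reindex_bij_witness[of _ ?s ?s]) (use sD cns in \<open>auto simp: refl_refl\<close>)
  also have "(\<Sum>c\<in>{c\<in>?D. cn c b > 0}. cn b c * ?u c) + (\<Sum>c\<in>{c\<in>?D. cn c b < 0}. cn b c * ?u c)=(\<Sum>c\<in>?D. cn b c * ?u c)"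
  proof (subst sum.union_disjoint[symmetric])
   show "(\<Sum>c\<in>{c\<in>?D. cn c b > 0}\<union>{c\<in>?D. cn c b < 0}. cn b c * ?u c)=(\<Sum>c\<in>?D. cn b c * ?u c)"
   proof (rule sum.mono_neutral_left)
    show "\<forall>c\<in>?D - ({c\<in>?D. cn c b > 0}\<union>{c\<in>?D. cn c b < 0}). cn b c * ?u c=0"
    using sgn sgn' by auto
   qed (use finD in auto)
  qed (use finD in auto)
  also have "(\<Sum>c\<in>?D. cn b c * ?u c)=(\<Sum>c\<in>Pos. cn b c) - (if b\<in>Pos then 2 else - 2)"
  proof -
   have "(\<Sum>c\<in>R. cn b c * ?u c)=(\<Sum>c\<in>?D. cn b c * ?u c) + (\<Sum>c\<in>{b, - b}. cn b c * ?u c)"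
    by (rule sum.subset_diff) (use b nb rsD(1)[OF rs] in auto)
   moreover have "(\<Sum>c\<in>R. cn b c * ?u c)=(\<Sum>c\<in>Pos. cn b c)"
    by (rule sum.mono_neutral_cong_right) (use rsD(1)[OF rs] in \<open>auto simp: pos_def\<close>)
   moreover have "(\<Sum>c\<in>{b, - b}. cn b c * ?u c)=(if b\<in>Pos then 2 else - 2)"
   using nb cnb pos_neg by (fastforce simp: pos_def)
   ultimately show ?thesis by simp
  qed
  also have "(\<Sum>c\<in>Pos. cn b c)=2 * (ht b)"
   by (simp add: rho_def inner_sum_right cn_def sum_distrib_left)
  finally show ?thesis by simp
 qed
 have "(\<Sum>c\<in>{c\<in>?D. cn c b > 0}. cn b c * (cn c b * x + (if c\<in>Pos then 1 else 0) - (if ?s c\<in>Pos then 1 else 0)))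
  = (\<Sum>c\<in>{c\<in>?D. cn c b > 0}. x * (cn b c * cn c b) + cn b c * ((if c\<in>Pos then 1 else 0) - (if ?s c\<in>Pos then 1 else 0)))"
  by (intro sum.cong refl) (simp add: algebra_simps)
 also have "\<dots>=x * (2 * (real h - 2)) + 2 * (ht b - (if b\<in>Pos then 1 else - 1))"
  unfolding sum.distrib B sum_distrib_left[symmetric] A ..
 finally show ?thesis by (simp add: field_simps)
qed

end

section \<open>Bases for segments of affine roots\<close>

lemma step_ok_singles:
 assumes "step_ok E N a" "finite N" "finite M" "N\<inter>M={}"
  "\<And>u v. u\<in>M ==> v\<in>N\<union>M ==> span {a, u}=span {a, v} ==> u=v"
  and E: "\<And>u x. u\<in>M ==> x\<in>E ==> u\<cdot>x=0"
 shows "step_ok E (N\<union>M) a"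
proof -
 obtain t where t: "hf (dd N a) t" "range t\<subseteq>E" "tang N t" "\<exists>w\<in>hyp a. a\<cdot>t w~=0"
  using assms(1) unfolding step_ok_def by (elim exE conjE)
 have "tang (N\<union>M) t" unfolding tang_def
 proof (intro ballI)
  fix v x assume v: "v\<in>N\<union>M" "x\<in>hyp v"
  show "v\<cdot>t x=0"
  proof (cases "v\<in>N")
   case True
   thus ?thesis using t(3) v(2) by (simp add: tang_def)
  next
   case False
   thus ?thesis using E[of v "t x"] v(1) t(2) by auto
  qed
 qed
 have e: "dd (N\<union>M) a=dd N a" by (rule dd_singles[OF assms(2-4)]) (rule assms(5))
 have "hf (dd (N\<union>M) a) t" unfolding e by (rule t(1))
 with \<open>tang (N \<union> M) t\<close> show ?thesis unfolding step_ok_def using t(2,4) by blast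
qed

text \<open>\<open>T\<close> is adjoint to \<open>phi q\<close>, so a field pulled back along
  \<open>T\<close> and given last component 0 is tangent to the corresponding hyperplanes through
  \<open>(q, 1)\<close>.\<close>

lemma step_ok_phi:
 assumes "step_ok E M b" "E\<subseteq>E'"
 shows "step_ok (E' \<times> {0}) (phi q ` M) (phi q b)"
proof -
 obtain t w where t: "hf (dd M b) t" "range t\<subseteq>E" "tang M t" "w\<in>hyp b" "b\<cdot>t w~=0"
  using assms(1) unfolding step_ok_def by (elim exE conjE bexE)
 define T where "T y=fst y - snd y*\<^sub>Rq" for y :: "'a \<times> real"
 have T: "linear T" unfolding T_def by (auto simp: linear_iff algebra_simps)
 have pT: "phi q c\<cdot>y=c\<cdot>T y" for c y by (cases y) (simp add: phi_def T_def inner_diff_right)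
 let ?t = "%y. (t (T y), 0::real)"
 show ?thesis unfolding step_ok_def dd_image[OF phi_linear phi_inj]
 proof (intro exI[of _ ?t] conjI)
  show "hf (dd M b) ?t" unfolding hf_def
  proof
   fix v :: "'a \<times> real"
   have "hp (dd M b) (%x. fst v\<cdot>t x)" using t(1) by (simp add: hf_def)
   from hp_compose[OF T this] show "hp (dd M b) (%x. v\<cdot>(t (T x), 0))" by (cases v) simp
  qed
  show "range ?t\<subseteq>E' \<times> {0}" using t(2) assms(2) by auto
  show "tang (phi q ` M) ?t" unfolding tang_def
  proof (intro ballI)
   fix u y assume "u\<in>phi q ` M" "y\<in>hyp u"
   then obtain c where c: "c\<in>M" "u=phi q c" "c\<cdot>T y=0" by (auto simp: hyp_def pT)
   hence "c\<cdot>t (T y)=0" using t(3) by (simp add: tang_def hyp_def)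
   thus "u\<cdot>(t (T y), 0)=0" unfolding c(2) by (simp add: phi_def)
  qed
  have "(w, 0)\<in>hyp (phi q b)" using t(4) by (simp add: hyp_def phi_def)
  moreover have "phi q b\<cdot>?t (w, 0)~=0" using t(5) by (simp add: phi_def T_def)
  ultimately show "\<exists>w\<in>hyp (phi q b). phi q b\<cdot>?t w~=0" by blast
 qed
qed

context asys
begin

lemma npar_af: "npar (insert (0, 1) (af R p v))" unfolding npar_def
proof (intro conjI ballI impI)
 show "finite (insert (0, 1) (af R p v))" using af_finite by simp
 show "0\<notin>insert (0, 1) (af R p v)" using rsD(2)[OF rs] by (auto simp: af_def zero_prod_def)
 fix w u :: "'v \<times> real" assume w: "w\<in>insert (0, 1) (af R p v)" and u: "u\<in>insert (0, 1) (af R p v)" and ne: "w~=u"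
 show "w\<notin>span {u}"
 proof
  assume "w\<in>span {u}"
  then obtain t where t: "w=t*\<^sub>Ru" unfolding in_span1 by blast
  have a0: "fst c~=0" "c\<cdot>(p, 1) > 0" "fst c\<in>R" if "c\<in>af R p v" for c
   using that rsD(2)[OF rs] by (auto simp: af_def)
  show False
  proof (cases "u=(0, 1)")
   case True
   hence "w=(0, t)" using t by simp
   hence "w=(0, 1)" using w a0(1)[of w] by auto
   thus False using ne True by simp
  next
   case False
   hence uA: "u\<in>af R p v" using u by blast
   have wA: "w\<in>af R p v"
   proof (rule ccontr)
    assume "w\<notin>af R p v"
    hence "w=(0, 1)" using w by blast
    hence "t*\<^sub>Rfst u=0" "t*\<^sub>Rsnd u=1" using t by (metis fst_scaleR fst_conv, metis snd_scaleR snd_conv)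
    thus False using a0(1)[OF uA] by auto
   qed
   have "fst w=t*\<^sub>Rfst u" using t by simp
   hence "fst w\<in>span {fst u}" unfolding in_span1 by blast
   hence "fst w=fst u \<or> fst w=- fst u" using par_fst[OF a0(3)[OF uA] a0(3)[OF wA]] by simp
   hence "t*\<^sub>Rfst u=1*\<^sub>Rfst u \<or> t*\<^sub>Rfst u=(- 1)*\<^sub>Rfst u" using \<open>fst w = t *\<^sub>R fst u\<close> by simp
   hence "t=1 \<or> t=- 1" using a0(1)[OF uA] scaleR_cancel_right by metis
   moreover have "t~=1" using t ne by auto
   ultimately have "w\<cdot>(p, 1)=- (u\<cdot>(p, 1))" using t by simp
   thus False using a0(2)[OF wA] a0(2)[OF uA] by simp
  qed
 qed
qed

lemma par_card:
 assumes b: "b\<in>R" and j: "0 < b\<cdot>p + real_of_int j"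
 shows "real (card {d\<in>af R p (b\<cdot>p + real_of_int j). fst d=b \<or> fst d=- b}) =
  2 * real_of_int j - (if b\<in>Pos then 0 else 1)"
proof -
 let ?v = "b\<cdot>p + real_of_int j"
 have sb: "b\<cdot>p~=0" "- 1 < 2 * (b\<cdot>p)" "2 * (b\<cdot>p) < 1" using small[OF b] by (auto simp: abs_less_iff)
 have nb: "- b\<in>R" "- b~=b"
 proof -
  show "- b~=b"
  by (smt (verit) sb inner_minus_left)
 qed (rule rsD(6)[OF rs b])
 let ?S1 = "{i::int. 0 < b\<cdot>p + of_int i \<and> b\<cdot>p + of_int i < ?v}"
 let ?S2 = "{i::int. 0 < - (b\<cdot>p) + of_int i \<and> - (b\<cdot>p) + of_int i < ?v}"
 have eq: "{d\<in>af R p ?v. fst d=b \<or> fst d=- b}=(%i. (b, real_of_int i)) ` ?S1\<union>(%i. (- b, real_of_int i)) ` ?S2"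
 proof (intro subset_antisym subsetI)
  fix d assume d: "d\<in>{d\<in>af R p ?v. fst d=b \<or> fst d=- b}"
  obtain c s where cs: "d=(c, s)" by (cases d)
  hence *: "c=b \<or> c=- b" "s\<in>\<int>" "0 < c\<cdot>p + s" "c\<cdot>p + s < ?v" using d by (auto simp: af_def)
  then obtain i where i: "s = of_int i" by (auto elim: Ints_cases)
  show "d\<in>(%i. (b, real_of_int i)) ` ?S1\<union>(%i. (- b, real_of_int i)) ` ?S2" using *(1)
  proof
   assume "c=b"
   hence "d=(b, real_of_int i)" "i\<in>?S1" using * cs i by auto
   thus ?thesis by blast
  next
   assume "c=- b"
   hence "d=(- b, real_of_int i)" "i\<in>?S2" using * cs i by auto
   thus ?thesis by blast
  qed
 qed (use b nb(1) in \<open>auto simp: af_def\<close>)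
 have S1: "?S1={(if b\<cdot>p > 0 then 0 else 1)..j - 1}" using sb by (auto split: if_splits)
 have S2: "?S2={(if b\<cdot>p > 0 then 1 else 0)..(if b\<cdot>p > 0 then j else j - 1)}"
 using sb by auto
 have j0: "0\<le>j" using j sb by linarith
 have "card {d\<in>af R p ?v. fst d=b \<or> fst d=- b}=card ?S1 + card ?S2" unfolding eq
 proof (subst card_Un_disjoint)
  show "finite ((%i. (b, real_of_int i)) ` ?S1)" "finite ((%i. (- b, real_of_int i)) ` ?S2)"
   unfolding S1 S2 by simp_all
  show "(%i. (b, real_of_int i)) ` ?S1\<inter>(%i. (- b, real_of_int i)) ` ?S2={}" using nb(2) by auto
  show "card ((%i. (b, real_of_int i)) ` ?S1) + card ((%i. (- b, real_of_int i)) ` ?S2)=card ?S1 + card ?S2"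
   by (simp add: card_image inj_on_def)
 qed
 moreover have "b\<in>Pos \<longleftrightarrow> b\<cdot>p > 0" using b by (simp add: pos_def)
 moreover have "\<not> b\<cdot>p > 0 ==> j\<ge>1" using j by linarith
 ultimately show ?thesis unfolding S1 S2 using j0 by (cases "b\<cdot>p > 0") auto
qed

text \<open>The roots parallel to \<open>b\<close> have the same trace as the hyperplane at
  infinity, so each contributes 1, and \<open>par_card\<close> counts them. The other classes are
  converted into inversions by \<open>affine_plane_count\<close> and summed by
  \<open>ainv_value\<close>. The slope \<open>h\<close> in \<open>j\<close> is 2 from the parallel
  roots plus \<open>h - 2\<close> from the inversions.\<close>

lemma aff_dd:
 assumes irr: "irreducible_roots R" and h: "card R=h * dim R" and b: "b\<in>R"
  and j: "0 < b\<cdot>p + real_of_int j"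
 shows "real (dd (insert (0, 1) (af R p (b\<cdot>p + real_of_int j))) (b, real_of_int j)) =
  real h * real_of_int j + ht b - (if b\<in>Pos then 1 else 0)"
proof -
 define u where "u=(b, real_of_int j)"
 let ?v = "b\<cdot>p + real_of_int j"
 have v: "u\<cdot>(p, 1)=?v" by (simp add: u_def)
 define A where "A=af R p ?v"
 define A0 where "A0={d\<in>A. fst d=b \<or> fst d=- b}"
 define A' where "A'={d\<in>A. fst d~=b \<and> fst d~=- b}"
 let ?z = "(0, 1) :: 'v \<times> real" and ?pl = "%w. span {u, w}"
 have fin: "finite A" "finite A0" "finite A'" using af_finite by (auto simp: A_def A0_def A'_def)
 have NA: "insert ?z A=insert ?z A0\<union>A'" by (auto simp: A0_def A'_def)
 have zA: "?z\<notin>A" using rsD(2)[OF rs] by (auto simp: A_def af_def)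
 have cN: "card (insert ?z A)=1 + card A0 + card A'"
 proof -
  have "card (A0\<union>A')=card A0 + card A'" by (rule card_Un_disjoint) (use fin in \<open>auto simp: A0_def A'_def\<close>)
  moreover have "A0\<union>A'=A" by (auto simp: A0_def A'_def)
  ultimately show ?thesis using zA fin by simp
 qed
 have p0: "?pl d=?pl ?z" if d: "d\<in>A0" for d
 proof (rule span2_eqI(1))
  obtain c s where cs: "d=(c, s)" by (cases d)
  have c: "c=b \<or> c=- b" and val: "0 < c\<cdot>p + s" "c\<cdot>p + s < ?v" using d cs by (auto simp: A0_def A_def af_def)
  have "\<exists>x y. d=x*\<^sub>Ru + y*\<^sub>R?z" using c
  proof
   assume "c=b"
   thus ?thesis by (intro exI[of _ 1] exI[of _ "s - j"]) (simp add: cs u_def)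
  next
   assume "c=- b"
   thus ?thesis by (intro exI[of _ "- 1"] exI[of _ "s + j"]) (simp add: cs u_def)
  qed
  thus "d\<in>span {u, ?z}" unfolding in_span2 .
  show "d\<notin>span {u}"
  proof
   assume "d\<in>span {u}"
   then obtain t where t: "d=t*\<^sub>Ru" unfolding in_span1 by blast
   hence "c=t*\<^sub>Rb" "d\<cdot>(p, 1)=t * ?v" using cs v by (auto simp: u_def algebra_simps)
   hence "t*\<^sub>Rb=1*\<^sub>Rb \<or> t*\<^sub>Rb=(- 1)*\<^sub>Rb" using c by auto
   hence "t=1 \<or> t=- 1" using nz(1)[OF b] scaleR_cancel_right by metis
   moreover have "d\<cdot>(p, 1)=c\<cdot>p + s" using cs by simp
   ultimately show False using \<open>d \<cdot> (p, 1) = t * ?v\<close> val by auto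
  qed
 qed
 have p1: "?pl d~=?pl ?z" if d: "d\<in>A'" for d
 proof
  assume "?pl d=?pl ?z"
  hence "d\<in>?pl ?z" using span_base[of d "{u, d}"] by simp
  then obtain x y where "d=x*\<^sub>Ru + y*\<^sub>R?z" unfolding in_span2 by blast
  hence "fst d=x*\<^sub>Rb" by (simp add: u_def)
  hence "fst d\<in>span {b}" unfolding in_span1 by blast
  moreover have "fst d\<in>R" using d by (auto simp: A'_def A_def af_def)
  ultimately show False using par_fst[OF b] d by (auto simp: A'_def)
 qed
 have "?pl ` insert ?z A=insert (?pl ?z) (?pl ` A')" unfolding NA using p0 by auto
 moreover have "?pl ?z\<notin>?pl ` A'" using p1 by force
 ultimately have "card (?pl ` insert ?z A)=1 + card (?pl ` A')" using fin by simp
 hence dN: "dd (insert ?z A) u=card A0 + dd A' u"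
  unfolding dd_def cN using card_image_le[OF fin(3), of ?pl] by simp
 let ?Inv = "ainv u"
 have finI: "finite ?Inv" unfolding u_def by (rule ainv_sum(1)[OF b j])
 let ?T = "?pl ` A'\<union>?pl ` ?Inv"
 let ?f = "%X. (if {d\<in>A'. ?pl d=X}={} then 0 else real (card {d\<in>A'. ?pl d=X}) - 1)"
 have "real (dd A' u)=(\<Sum>X\<in>?pl ` A'. real (card {d\<in>A'. ?pl d=X}) - 1)" by (rule dd_sum[OF fin(3)])
 also have "\<dots>=(\<Sum>X\<in>?T. ?f X)"
 proof (rule sum.mono_neutral_cong_left)
  show "finite ?T" using fin finI by simp
  show "\<forall>X\<in>?T - ?pl ` A'. ?f X=0"
  by auto
  show "real (card {d\<in>A'. ?pl d=X}) - 1=?f X" if X: "X\<in>?pl ` A'" for X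
  proof -
   have "{d\<in>A'. ?pl d=X}~={}" using X by blast
   thus ?thesis by (simp only: if_False)
  qed
 qed auto
 also have "\<dots>=(\<Sum>X\<in>?T. (\<Sum>d\<in>{d\<in>?Inv. ?pl d=X}. cn b (fst d)) / 2)"
 proof (rule sum.cong[OF refl])
  fix X assume "X\<in>?T"
  then obtain d where d: "d\<in>A' \<or> d\<in>?Inv" "X=?pl d" by blast
  have g: "fst d\<in>R" "snd d\<in>\<int>" "fst d~=fst u" "fst d~=- fst u"
   using d(1) by (auto simp: A'_def A_def af_def ainv_def u_def)
  have u': "fst u\<in>R" "snd u\<in>\<int>" "0 < u\<cdot>(p, 1)" using b j v by (auto simp: u_def)
  have fb: "fst u=b" by (simp add: u_def)
  note * = affine_plane_count[OF u' g, unfolded fb v, folded A_def, folded A'_def d(2)]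
  show "?f X=(\<Sum>d\<in>{d\<in>?Inv. ?pl d=X}. cn b (fst d)) / 2" by (rule *[symmetric])
 qed
 also have "\<dots>=(\<Sum>X\<in>?T. \<Sum>d\<in>{d\<in>?Inv. ?pl d=X}. cn b (fst d)) / 2" by (simp add: sum_divide_distrib)
 also have "(\<Sum>X\<in>?T. \<Sum>d\<in>{d\<in>?Inv. ?pl d=X}. cn b (fst d))=(\<Sum>d\<in>?Inv. cn b (fst d))"
  by (rule sum.group) (use fin finI in auto)
 also have "(\<Sum>d\<in>?Inv. cn b (fst d)) / 2=real_of_int j * (real h - 2) + ht b - (if b\<in>Pos then 1 else - 1)"
  unfolding u_def ainv_sum(2)[OF b j] by (rule ainv_value[OF irr h b])
 finally have "real (dd A' u)=real_of_int j * (real h - 2) + ht b - (if b\<in>Pos then 1 else - 1)" .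
 moreover have "real (card A0)=2 * real_of_int j - (if b\<in>Pos then 0 else 1)"
  unfolding A0_def A_def by (rule par_card[OF b j])
 ultimately show ?thesis unfolding u_def[symmetric] A_def[symmetric] dN
  by (cases "b\<in>Pos") (simp_all add: algebra_simps)
qed

text \<open>Write the common value as \<open>h * q + s\<close>. By \<open>aff_dd\<close> it occurs
  only at level \<open>q\<close> for positive roots of height \<open>s + 1\<close>, and at level
  \<open>q + 1\<close> for negatives of roots of height \<open>h - s\<close>. These heights add up
  to \<open>h + 1\<close>, so \<open>duality\<close> bounds both kinds together by the rank, and
  \<open>(b, j)\<close> itself is one of them.\<close>

lemma aff_few:
 assumes irr: "irreducible_roots R" and b: "b\<in>R" and j: "0 < b\<cdot>p + real_of_int j"
 defines "D \<equiv> %d. dd (insert (0, 1) (af R p (d\<cdot>(p, 1)))) d"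
 shows "card {d\<in>af R p (b\<cdot>p + real_of_int j). D d=D (b, real_of_int j)} < dim R"
proof -
 obtain h where h: "h\<ge>2" "card R=h * dim R"
  "\<And>m. 1\<le>m ==> m\<le>h ==> card {d\<in>Pos. ht d=real m} +
   card {d\<in>Pos. ht d=real (h + 1 - m)}\<le>dim R"
  using duality[OF irr inj] by (elim exE conjE) simp
 let ?n = "%m. {d\<in>Pos. ht d=real m}"
 have dim0: "dim R~=0" using b nz(1)[OF b] dim_eq_0[of R] by auto
 have hth: "ht c\<le>real h - 1" if "c\<in>Pos" for c using ht_le[OF irr that] h(2) dim0 by simp
 define t where "t=D (b, real_of_int j)"
 define q where "q=t div h"
 define s where "s=t mod h"
 have s: "s < h" "t=h * q + s" using h(1) by (auto simp: q_def s_def)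
 let ?W = "{d\<in>af R p (b\<cdot>p + real_of_int j). D d=t}"
 let ?B = "(%c. (c, real q)) ` ?n (s + 1)\<union>(%c. (- c, real (q + 1))) ` ?n (h - s)"
 have mem: "(c, real_of_int i)\<in>?B" if c: "c\<in>R" "0 < c\<cdot>p + real_of_int i" "D (c, real_of_int i)=t" for c i
 proof -
  have "(c, real_of_int i)\<cdot>(p, 1)=c\<cdot>p + real_of_int i" by simp
  hence e: "real t=real h * real_of_int i + ht c - (if c\<in>Pos then 1 else 0)"
   using aff_dd[OF irr h(2) c(1,2)] c(3) unfolding D_def by simp
  show ?thesis
  proof (cases "c\<in>Pos")
   case True
   obtain m where m: "m\<ge>1" "ht c=real m" using ht_nat[OF True] by blast
   have mh: "m\<le>h - 1" using hth[OF True] m h(1) by simp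
   have "real_of_int (int t)=real_of_int (int h * i + int m - 1)" using e m True by simp
   hence e': "int t=int h * i + (int m - 1)" by (simp only: of_int_eq_iff)
   have "int t div int h=i" unfolding e' using m mh h(1) by (intro int_div_pos_eq) auto
   hence iq: "i=int q" by (simp add: q_def zdiv_int)
   hence "m=s + 1" using e' s(2) m(1) by (simp flip: of_nat_mult)
   thus ?thesis using True m(2) iq by auto
  next
   case False
   have n: "- c\<in>Pos" by (rule pos_neg[OF c(1) False])
   obtain m where m: "m\<ge>1" "(- c)\<cdot>rho R p=real m" using ht_nat[OF n] by blast
   have mh: "m\<le>h - 1" using hth[OF n] m h(1) by simp
   have "real_of_int (int t)=real_of_int (int h * i - int m)" using e m False by simp
   hence e': "int t=int h * i - int m" by (simp only: of_int_eq_iff)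
   have e'': "int t=int h * (i - 1) + (int h - int m)" unfolding e' by (simp add: algebra_simps)
   have "int t div int h=i - 1" unfolding e'' using m mh h(1) by (intro int_div_pos_eq) auto
   hence iq: "i=int (q + 1)" by (simp add: q_def zdiv_int)
   hence "int h - int m=int s" using e'' s(2) by simp
   hence "m=h - s" using s(1) by simp
   hence "- c\<in>?n (h - s)" using n m(2) by simp
   hence "(- (- c), real (q + 1))\<in>(%c. (- c, real (q + 1))) ` ?n (h - s)" by (rule imageI)
   thus ?thesis using iq by simp
  qed
 qed
 have fW: "finite ?W" using af_finite by simp
 have nW: "(b, real_of_int j)\<notin>?W" by (simp add: af_def)
 have "insert (b, real_of_int j) ?W\<subseteq>?B"
 proof
  fix d assume "d\<in>insert (b, real_of_int j) ?W"
  hence "d=(b, real_of_int j) \<or> d\<in>?W" by blast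
  thus "d\<in>?B"
  proof
   assume "d=(b, real_of_int j)"
   thus ?thesis using mem[OF b j] by (simp add: t_def)
  next
   assume d: "d\<in>?W"
   obtain c s where cs: "d=(c, s)" by (cases d)
   obtain i where i: "s=real_of_int i" using d cs by (auto simp: af_def elim: Ints_cases)
   show ?thesis unfolding cs i by (rule mem) (use d cs i in \<open>auto simp: af_def\<close>)
  qed
 qed
 hence "card (insert (b, real_of_int j) ?W)\<le>card ?B" using finP by (intro card_mono) auto
 also have "\<dots>\<le>card ((%c. (c, real q)) ` ?n (s + 1)) + card ((%c. (- c, real (q + 1))) ` ?n (h - s))" by (rule card_Un_le)
 also have "\<dots>\<le>card (?n (s + 1)) + card (?n (h - s))" using finP by (intro add_mono card_image_le) auto
 also have "\<dots>\<le>dim R" using h(3)[of "s + 1"] s(1) by simp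
 finally show ?thesis using fW nW by (simp add: t_def)
qed

end

lemma irreducible_cases:
 assumes rs: "rs R" and b: "b\<in>R" and red: "\<not> irreducible_roots R"
 shows "\<exists>R1 R2. b\<in>R1 \<and> R2~={} \<and> R=R1\<union>R2 \<and> R1\<inter>R2={} \<and>
  (\<forall>a\<in>R1. \<forall>c\<in>R2. a\<cdot>c=0) \<and> rs R1"
proof -
 have "\<exists>R1 R2. R1~={} \<and> R2~={} \<and> R=R1\<union>R2 \<and> R1\<inter>R2={} \<and> (\<forall>a\<in>R1. \<forall>c\<in>R2. a\<cdot>c=0)"
  using red b unfolding irreducible_roots_def by blast
 then obtain A B where AB: "A~={}" "B~={}" "R=A\<union>B" "A\<inter>B={}" "\<forall>a\<in>A. \<forall>c\<in>B. a\<cdot>c=0" by blast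
 have rsA: "rs C" if C: "C\<union>D=R" "C\<inter>D={}" "\<And>a c. a\<in>C ==> c\<in>D ==> a\<cdot>c=0" for C D
 proof (rule rs_subset[OF rs])
  have D0: "x\<cdot>x~=0" if "x\<in>D" for x using that C(1) rsD(2)[OF rs] by auto
  show "C\<subseteq>R" using C(1) by blast
  show "- a\<in>C" if a: "a\<in>C" for a
  proof -
   have "- a\<in>C\<union>D" using rsD(6)[OF rs, of a] a C(1) by blast
   moreover have "- a\<notin>D"
   proof
    assume d: "- a\<in>D"
    have "a\<cdot>(- a)=0" by (rule C(3)[OF a d])
    thus False using D0[OF d] by simp
   qed
   ultimately show ?thesis by blast
  qed
  show "refl_along a c\<in>C" if a: "a\<in>C" "c\<in>C" for a c
  proof -
   have "refl_along a c\<in>C\<union>D" using rsD(3)[OF rs, of a c] a C(1) by blast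
   moreover have "refl_along a c\<notin>D"
   proof
    assume d: "refl_along a c\<in>D"
    have "c\<cdot>refl_along a c=0" "a\<cdot>refl_along a c=0" by (rule C(3)[OF a(2) d], rule C(3)[OF a(1) d])
    hence "refl_along a c\<cdot>refl_along a c=0" by (subst (1) refl_cn) (simp add: inner_diff_left)
    thus False using D0[OF d] by simp
   qed
   ultimately show ?thesis by blast
  qed
 qed
 show ?thesis
 proof (cases "b\<in>A")
  case True
  have "rs A" by (rule rsA[OF AB(3)[symmetric] AB(4) AB(5)[rule_format]])
  thus ?thesis using True AB by (intro exI[of _ A] exI[of _ B] conjI)
 next
  case False
  have o: "a\<cdot>c=0" if "a\<in>B" "c\<in>A" for a c
   using AB(5)[rule_format, OF that(2,1)] by (simp only: inner_commute)
  have BA: "B\<union>A=R" "B\<inter>A={}" using AB(3,4) by auto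
  have "rs B" by (rule rsA[OF BA o])
  moreover have "b\<in>B" using False b AB(3) by blast
  ultimately show ?thesis using AB(1) BA o by (intro exI[of _ B] exI[of _ A] conjI ballI) auto
 qed
qed

text \<open>Induction on the system and on the segment, with \<open>add_step\<close> for
  \<open>q = dim R\<close>. At points whose last coordinate is 0 the localization is the affine
  segment of a proper subsystem; at the other points it is a finite segment, moved there by
  \<open>phi\<close>.\<close>

lemma aff_step:
 assumes "asys R p" "b\<in>R" "0 < b\<cdot>p + real_of_int j"
 shows "step_ok (span R \<times> {0}) (insert (0, 1) (af R p (b\<cdot>p + real_of_int j))) (b, real_of_int j)"
 using assms
proof (induction "card R" arbitrary: R b j rule: less_induct)
 case (less R)
 note IH = less(1)
 interpret asys R p by (rule less(2))
 let ?z = "(0, 1) :: 'a \<times> real" and ?E = "span R \<times> {0::real}"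
 have sE: "subspace ?E" by (intro subspace_Times subspace_span) (simp add: subspace_def)
 have dE: "dim ?E=dim R"
 proof -
  have "dim ?E=dim (span R) + dim {0::real}" by (rule dim_Times[OF subspace_span]) (simp add: subspace_def)
  thus ?thesis by (simp add: dim_span)
 qed
 have asub: "asys R' p" if "rs R'" "R'\<subseteq>R" for R'
  using that small inj by unfold_locales (auto intro: inj_on_subset)
 show ?case using less(3,4)
 proof (induction "card (af R p (b\<cdot>p + real_of_int j))" arbitrary: b j rule: less_induct)
  case (less b j)
  note b = less(2) and j = less(3)
  define u where "u=(b, real_of_int j)"
  let ?v = "b\<cdot>p + real_of_int j"
  have v: "u\<cdot>(p, 1)=?v" by (simp add: u_def)
  have sb: "b\<cdot>p~=0" "- 1 < 2 * (b\<cdot>p)" "2 * (b\<cdot>p) < 1" using small[OF b] by (auto simp: abs_less_iff)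
  have j0: "0\<le>j" using j sb by linarith
  show ?case
  proof (cases "j=0")
   case True
   \<comment> \<open>Below level 0 plus a small value only level 0 occurs, since values of roots at
     \<open>p\<close> are less than 1/2 in size. So the segment is a finite one, and infinity is
     alone in its class.\<close>
   have e: "af R p ?v=phi 0 ` {c\<in>pos R p. c\<cdot>p < b\<cdot>p}"
   proof (intro subset_antisym subsetI)
    fix h assume h: "h\<in>af R p ?v"
    obtain c s where cs: "h=(c, s)" by (cases h)
    have c: "c\<in>R" "s\<in>\<int>" "0 < c\<cdot>p + s" "c\<cdot>p + s < b\<cdot>p" using h cs True by (auto simp: af_def)
    obtain i where i: "s = of_int i" using c(2) by (auto elim: Ints_cases)
    have "- 1 < 2 * (c\<cdot>p)" "2 * (c\<cdot>p) < 1" using small[OF c(1)] by (auto simp: abs_less_iff)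
    hence "i=0" using c(3,4) sb unfolding i by linarith
    thus "h\<in>phi 0 ` {c\<in>pos R p. c\<cdot>p < b\<cdot>p}"
     using c cs i by (intro image_eqI[of _ _ c]) (auto simp: phi_def pos_def)
   next
    fix h assume "h\<in>phi 0 ` {c\<in>pos R p. c\<cdot>p < b\<cdot>p}"
    thus "h\<in>af R p ?v" using True by (auto simp: phi_def pos_def af_def)
   qed
   have bp: "b\<in>pos R p" using b j True by (simp add: pos_def)
   have "step_ok ?E (phi 0 ` {c\<in>pos R p. c\<cdot>p < b\<cdot>p}) (phi 0 b)"
    by (rule step_ok_phi[OF fin_step[OF rs inj _ bp] order_refl]) (use small in blast)
   moreover have "phi 0 b=u" using True by (simp add: phi_def u_def)
   ultimately have st: "step_ok ?E (af R p ?v) u" unfolding e by simp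
   have "step_ok ?E (af R p ?v\<union>{?z}) u"
   proof (rule step_ok_singles[OF st])
    show "af R p ?v\<inter>{?z}={}" using rsD(2)[OF rs] by (auto simp: af_def)
    fix l a assume l: "l\<in>{?z}" and a: "a\<in>af R p ?v\<union>{?z}" and sp: "span {u, l}=span {u, a}"
    show "l=a"
    proof (rule ccontr)
     assume "l~=a"
     hence "a\<in>af R p ?v" using l a by blast
     hence "snd a=0" unfolding e by (auto simp: phi_def)
     have "?z\<in>span {u, a}" unfolding sp[symmetric] using l by (intro span_base) simp
     then obtain x y where "?z=x*\<^sub>Ru + y*\<^sub>Ra" unfolding in_span2 by blast
     hence "snd ?z=x * snd u + y * snd a" by simp
     thus False using \<open>snd a = 0\<close> True by (simp add: u_def)
    qed
   qed (use af_finite in \<open>auto simp: inner_prod_def\<close>)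
   thus ?thesis unfolding u_def by simp
  next
   case jn: False
   show ?thesis
   proof (cases "irreducible_roots R")
    case False
    \<comment> \<open>The count in \<open>aff_few\<close> is for irreducible systems. Here the
      factor containing \<open>b\<close> supplies the transversal field, and each affine root of the
      orthogonal factor is alone in its class.\<close>
    obtain R1 R2 where P: "b\<in>R1" "R2~={}" "R=R1\<union>R2" "R1\<inter>R2={}"
     "\<forall>n\<in>R1. \<forall>u\<in>R2. n\<cdot>u=0" "rs R1" using irreducible_cases[OF rs b False] by blast
    have c: "card R1 < card R" using P rsD(1)[OF rs] by (intro psubset_card_mono) auto
    have a1: "asys R1 p" by (rule asub[OF P(6)]) (use P(3) in blast)
    have st: "step_ok (span R1 \<times> {0}) (insert ?z (af R1 p ?v)) u" unfolding u_def by (rule IH[OF c a1 P(1) j])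
    have sp1: "span R1\<subseteq>span R" using P(3) by (intro span_mono) auto
    have n1: "x\<cdot>x~=0" if "x\<in>R" for x using nz(2)[OF that] by simp
    have st: "step_ok (span R1 \<times> {0}) (insert ?z (af R1 p ?v)\<union>af R2 p ?v) u"
    proof (rule step_ok_singles[OF st])
     show "finite (insert ?z (af R1 p ?v))" "finite (af R2 p ?v)"
      using af_finite[of ?v] by (auto intro: finite_subset[rotated] simp: af_def P(3))
     show "insert ?z (af R1 p ?v)\<inter>af R2 p ?v={}" using P(3,4) rsD(2)[OF rs] by (auto simp: af_def)
     show "l\<cdot>x=0" if "l\<in>af R2 p ?v" "x\<in>span R1 \<times> {0}" for l x
     proof -
      have "fst x\<cdot>fst l=0"
       by (rule span_orth[of R1 R2]) (use P(5) that in \<open>auto simp: af_def intro: span_base\<close>)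
      thus ?thesis using that(2) by (auto simp: inner_prod_def inner_commute)
     qed
     fix l a assume l: "l\<in>af R2 p ?v" and a: "a\<in>insert ?z (af R1 p ?v)\<union>af R2 p ?v"
      and sp: "span {u, l}=span {u, a}"
     obtain c s where cs: "l=(c, s)" by (cases l)
     have c: "c\<in>R2" "c\<in>R" "0 < c\<cdot>p + s" using l cs P(3) by (auto simp: af_def)
     have bc: "b\<cdot>c=0" using P(1,5) c(1) by blast
     have "a\<in>span {u, l}" unfolding sp by (rule span_base) simp
     then obtain x y where xy: "a=x*\<^sub>Ru + y*\<^sub>Rl" unfolding in_span2 by blast
     hence f: "fst a=x*\<^sub>Rb + y*\<^sub>Rc" by (simp add: u_def cs)
     have y0: "y~=0"
     proof
      assume "y=0"
      have "l\<in>span {u, a}" unfolding sp[symmetric] by (rule span_base) simp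
      then obtain x' y' where "l=x'*\<^sub>Ru + y'*\<^sub>Ra" unfolding in_span2 by blast
      hence "fst l=fst (x'*\<^sub>Ru + y'*\<^sub>Ra)" by simp
      hence "c=x'*\<^sub>Rb + y'*\<^sub>R(x*\<^sub>Rb)" using f \<open>y = 0\<close> by (simp add: cs u_def)
      hence "c\<cdot>c=(x'*\<^sub>Rb + y'*\<^sub>R(x*\<^sub>Rb))\<cdot>c" by simp
      thus False using bc n1[OF c(2)] by (simp add: inner_add_left)
     qed
     have fc: "fst a\<cdot>c=y * (c\<cdot>c)" unfolding f using bc by (simp add: inner_add_left)
     hence "fst a\<cdot>c~=0" using y0 n1[OF c(2)] by simp
     hence a2: "a\<in>af R2 p ?v" using a P(5) c(1) by (auto simp: af_def)
     hence "fst a\<in>R2" "fst a\<in>R" using P(3) by (auto simp: af_def)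
     hence "b\<cdot>fst a=0" using P(1,5) by blast
     hence "x * (b\<cdot>b)=0" unfolding f using bc by (simp add: inner_add_right)
     hence x0: "x=0" using n1[OF b] by simp
     have "fst a\<in>span {c}" unfolding in_span1 f x0 by auto
     hence "fst a=c \<or> fst a=- c" using par_fst[OF c(2) \<open>fst a \<in> R\<close>] by simp
     hence "y * (c\<cdot>c)=1 * (c\<cdot>c) \<or> y * (c\<cdot>c)=(- 1) * (c\<cdot>c)" using fc by auto
     hence "y=1 \<or> y=- 1" using n1[OF c(2)] mult_cancel_right by blast
     moreover have "y~=- 1"
     proof
      assume "y=- 1"
      hence "a\<cdot>(p, 1)=- (l\<cdot>(p, 1))" using xy x0 by simp
      thus False using a2 l by (simp add: af_def)
     qed
     ultimately show "l=a" using xy x0 by simp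
    qed
    moreover have "insert ?z (af R1 p ?v)\<union>af R2 p ?v=insert ?z (af R p ?v)" using P(3) by (auto simp: af_def)
    ultimately have "step_ok (span R1 \<times> {0}) (insert ?z (af R p ?v)) u" by simp
    thus ?thesis unfolding u_def by (rule step_ok_mono) (use sp1 in auto)
   next
    case irr: True
    let ?P = "af R p ?v"
    have np: "npar (insert u (insert ?z ?P))"
     by (rule npar_subset[OF npar_af[of "?v + 1"]]) (use b j in \<open>auto simp: u_def af_def\<close>)
    have uN: "u\<notin>insert ?z ?P" using nz(1)[OF b] by (auto simp: u_def af_def)
    have zP: "{?z}\<inter>?P={}" using rsD(2)[OF rs] by (auto simp: af_def)
    have low: "{?z}\<union>{c\<in>?P. c\<cdot>(p, 1) < h\<cdot>(p, 1)}=insert ?z (af R p (h\<cdot>(p, 1)))" if "h\<in>?P" for h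
     using that by (auto simp: af_def)
    have "\<exists>F. fbas ?E {?z} (dim ?E) (%_. 0) F" by (rule fbas_const[OF sE]) auto
    then obtain F0 where F0: "fbas ?E {?z} (dim R) (%_. 0) F0" unfolding dE by blast
    have "\<exists>e F. fbas ?E ({?z}\<union>?P) (dim R) e F \<and>
     (\<forall>t. card {i. i < dim R \<and> t < e i}=card {h\<in>?P. dd ({?z}\<union>{c\<in>?P. c\<cdot>(p, 1) < h\<cdot>(p, 1)}) h=t})"
    proof (rule fbas_chain[OF af_finite _ _ zP F0 sE])
     show "inj_on (%c. c\<cdot>(p, 1)) ?P" by (rule inj_onI, rule val_inj) (auto simp: af_def)
     show "npar ({?z}\<union>?P)" using npar_af by simp
     fix h assume h: "h\<in>?P"
     obtain c s where cs: "h=(c, s)" by (cases h)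
     obtain i where i: "s = of_int i" using h cs by (auto simp: af_def elim: Ints_cases)
     have h': "c\<in>R" "0 < c\<cdot>p + real_of_int i" "c\<cdot>p + real_of_int i < ?v" using h cs i by (auto simp: af_def)
     have "af R p (c\<cdot>p + real_of_int i) \<subset> ?P"
     proof
      show "af R p (c\<cdot>p + real_of_int i)\<subseteq>?P" using h'(3) by (auto simp: af_def)
      have "h\<notin>af R p (c\<cdot>p + real_of_int i)" using cs i by (simp add: af_def)
      thus "af R p (c\<cdot>p + real_of_int i)~=?P" using h by blast
     qed
     hence "card (af R p (c\<cdot>p + real_of_int i)) < card ?P" using af_finite by (intro psubset_card_mono) auto
     from less(1)[OF this h'(1,2)]
     show "step_ok ?E ({?z}\<union>{c\<in>?P. c\<cdot>(p, 1) < h\<cdot>(p, 1)}) h" unfolding low[OF h] unfolding cs i by simp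
    qed
    then obtain e F where eF: "fbas ?E (insert ?z ?P) (dim R) e F"
     "\<And>t. card {i. i < dim R \<and> t < e i}=card {h\<in>?P. dd ({?z}\<union>{c\<in>?P. c\<cdot>(p, 1) < h\<cdot>(p, 1)}) h=t}"
     by (elim exE conjE) simp
    \<comment> \<open>The comparison is with \<open>dim R\<close>, not with \<open>dim R - 1\<close>
      as in the finite case, because the hyperplane at infinity raises the rank of the normals by
      one.\<close>
    have few: "card {i. i < dim R \<and> dd (insert ?z ?P) u < e i} < dim R"
    proof -
     have "{h\<in>?P. dd ({?z}\<union>{c\<in>?P. c\<cdot>(p, 1) < h\<cdot>(p, 1)}) h=dd (insert ?z ?P) u} =
       {h\<in>?P. dd (insert (0, 1) (af R p (h\<cdot>(p, 1)))) h=dd (insert (0, 1) (af R p (u\<cdot>(p, 1)))) u}"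
      unfolding v by (intro Collect_cong conj_cong refl) (simp only: low)
     thus ?thesis unfolding eF(2) using aff_few[OF irr b j] by (simp add: u_def)
    qed
    have dimN: "dim R + 1\<le>dim (insert u (insert ?z ?P))"
    proof -
     let ?f = "%x. (x, 0::real)"
     have lf: "linear ?f" by (auto simp: linear_iff)
     have "dim (span R \<times> (UNIV::real set))=dim (span R) + dim (UNIV::real set)"
      by (rule dim_Times[OF subspace_span subspace_UNIV])
     hence d: "dim (span R \<times> (UNIV::real set))=dim R + 1" by (simp add: dim_span)
     have "span R \<times> (UNIV::real set)\<subseteq>span (insert u (insert ?z ?P))"
     proof
      fix w :: "'a \<times> real" assume w: "w\<in>span R \<times> UNIV"
      have pp: "?f ` pos R p\<subseteq>?P"
      proof
       fix h assume "h\<in>?f ` pos R p"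
       then obtain c where c: "c\<in>pos R p" "h=(c, 0)" by blast
       have "c\<cdot>p < 1 / 2" using small[OF posD(1)[OF c(1)]] unfolding abs_less_iff by simp
       moreover have "1 / 2 < ?v" using jn j0 sb by linarith
       ultimately show "h\<in>?P" using c by (simp add: af_def pos_def)
      qed
      have "fst w\<in>span (pos R p)"
      proof -
       have "span R\<subseteq>span (pos R p)" unfolding smp_span[symmetric] by (rule span_mono) (use smpD in blast)
       thus ?thesis using w by auto
      qed
      hence "?f (fst w)\<in>span (?f ` pos R p)" unfolding linear_span_image[OF lf] by (rule imageI)
      hence 1: "?f (fst w)\<in>span (insert u (insert ?z ?P))" using span_mono[of "?f ` pos R p" "insert u (insert ?z ?P)"] pp by blast
      have "w=?f (fst w) + snd w*\<^sub>R?z" by (cases w) simp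
      thus "w\<in>span (insert u (insert ?z ?P))" using span_add[OF 1 span_scale[OF span_base, of ?z _ "snd w"]] by simp
     qed
     hence "dim (span R \<times> (UNIV::real set))\<le>dim (insert u (insert ?z ?P))" using dim_subset[of "span R \<times> (UNIV::real set)" "span (insert u (insert ?z ?P))"] by (simp add: dim_span)
     thus ?thesis unfolding d .
    qed
    show ?thesis unfolding u_def[symmetric]
    proof (rule add_step[OF np uN eF(1) sE _ dimN few])
     fix x assume x: "x\<in>hyp u" "\<exists>a\<in>insert ?z ?P. a\<cdot>x~=0"
     obtain y t where yt: "x=(y, t)" by (cases x)
     show "step_ok ?E {a\<in>insert ?z ?P. a\<cdot>x=0} u"
     proof (cases "t=0")
      case True
      let ?R' = "R\<inter>hyp y"
      have a': "asys ?R' p" by (rule asub[OF rs_Int_subspace[OF rs subspace_hyp]]) auto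
      obtain a where a: "a\<in>insert ?z ?P" "a\<cdot>x~=0" using x(2) by blast
      hence "fst a\<cdot>y~=0" using True yt by (cases a) simp
      hence "fst a\<in>R - ?R'" using a(1) by (auto simp: af_def hyp_def inner_commute)
      hence c: "card ?R' < card R" using rsD(1)[OF rs] by (intro psubset_card_mono) auto
      have b': "b\<in>?R'" using b x(1) True yt by (simp add: hyp_def u_def inner_commute)
      have "{a\<in>insert ?z ?P. a\<cdot>x=0}=insert ?z (af ?R' p ?v)"
       using True yt by (auto simp: af_def hyp_def inner_commute)
      moreover have "step_ok (span ?R' \<times> {0}) (insert ?z (af ?R' p ?v)) u"
       unfolding u_def by (rule IH[OF c a' b' j])
      moreover have "span ?R' \<times> {0}\<subseteq>?E" using span_mono[of ?R' R] by auto
      ultimately show ?thesis using step_ok_mono by simp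
     next
      case False
      define q where "q=(1 / t)*\<^sub>Ry"
      have nx: "a\<cdot>x=t * (a\<cdot>(q, 1))" for a using False by (cases a) (simp add: yt q_def algebra_simps)
      have uq: "u\<cdot>(q, 1)=0" using x(1) nx[of u] False by (simp add: hyp_def)
      have ue: "u=phi q b" using pair_eq_phi[OF uq] by (simp add: u_def)
      have u': "fst u\<in>R" "snd u\<in>\<int>" using b by (auto simp: u_def)
      let ?R' = "{c\<in>R. c\<cdot>q\<in>\<int>}" and ?g = "p - q"
      have "{a\<in>insert ?z ?P. a\<cdot>x=0}={h\<in>?P. h\<cdot>(q, 1)=0}" using False nx by auto
      also have "\<dots>=phi q ` {c\<in>pos ?R' ?g. c\<cdot>?g < b\<cdot>?g}"
       using slice_eq[OF u' uq] unfolding v by (simp add: u_def)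
      finally have eq: "{a\<in>insert ?z ?P. a\<cdot>x=0}=phi q ` {c\<in>pos ?R' ?g. c\<cdot>?g < b\<cdot>?g}" .
      interpret R: rsys ?R' ?g using slice_rsys(1)[of UNIV q] by simp
      have injR: "inj_on (%c. c\<cdot>?g) ?R'" using slice_rsys(2)[of UNIV q] by simp
      have bq: "b\<cdot>q\<in>\<int>"
      proof -
       have "b\<cdot>q=- real_of_int j" using uq by (simp add: u_def)
       thus ?thesis by simp
      qed
      have bpos: "b\<in>pos ?R' ?g"
      proof -
       have "u\<cdot>(p, 1)=b\<cdot>?g" unfolding ue by (rule phi_val)
       thus ?thesis using b bq j v by (simp add: pos_def)
      qed
      show ?thesis unfolding eq ue
       by (rule step_ok_phi[OF fin_step[OF R.rs injR R.g bpos]]) (assumption, rule span_mono, blast)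
     qed
    qed
   qed
  qed
 qed
qed

lemma aff_basis:
 assumes "asys R p"
 shows "\<exists>e F. fbas (span R \<times> {0}) (insert (0, 1) (af R p v)) (dim R) e F"
proof -
 interpret asys R p by (rule assms)
 let ?z = "(0, 1) :: 'a \<times> real" and ?E = "span R \<times> {0::real}" and ?P = "af R p v"
 have sE: "subspace ?E" by (intro subspace_Times subspace_span) (simp add: subspace_def)
 have dE: "dim ?E=dim R"
 proof -
  have "dim ?E=dim (span R) + dim {0::real}" by (rule dim_Times[OF subspace_span]) (simp add: subspace_def)
  thus ?thesis by (simp add: dim_span)
 qed
 have "\<exists>F. fbas ?E {?z} (dim ?E) (%_. 0) F" by (rule fbas_const[OF sE]) auto
 then obtain F0 where F0: "fbas ?E {?z} (dim R) (%_. 0) F0" unfolding dE by blast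
 have "\<exists>e F. fbas ?E ({?z}\<union>?P) (dim R) e F \<and>
  (\<forall>t. card {i. i < dim R \<and> t < e i}=card {d\<in>?P. dd ({?z}\<union>{c\<in>?P. c\<cdot>(p, 1) < d\<cdot>(p, 1)}) d=t})"
 proof (rule fbas_chain[OF af_finite _ _ _ F0 sE])
  show "{?z}\<inter>?P={}" using rsD(2)[OF rs] by (auto simp: af_def)
  show "inj_on (%c. c\<cdot>(p, 1)) ?P" by (rule inj_onI, rule val_inj) (auto simp: af_def)
  show "npar ({?z}\<union>?P)" using npar_af by simp
  fix d assume d: "d\<in>?P"
  obtain c s where cs: "d=(c, s)" by (cases d)
  obtain i where i: "s = of_int i" using d cs by (auto simp: af_def elim: Ints_cases)
  have d': "c\<in>R" "0 < c\<cdot>p + real_of_int i" using d cs i by (auto simp: af_def)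
  have "{?z}\<union>{c\<in>?P. c\<cdot>(p, 1) < d\<cdot>(p, 1)}=insert ?z (af R p (d\<cdot>(p, 1)))" using d by (auto simp: af_def)
  thus "step_ok ?E ({?z}\<union>{c\<in>?P. c\<cdot>(p, 1) < d\<cdot>(p, 1)}) d"
   using aff_step[OF assms d'] unfolding cs i by simp
 qed
 thus ?thesis by auto
qed

abbreviation "lk \<equiv> Poly_Mapping.lookup"
abbreviation "ks \<equiv> Poly_Mapping.keys"
abbreviation "sg \<equiv> Poly_Mapping.single"

section \<open>Polynomials and polynomial functions\<close>

definition mon :: "('m::finite \<Rightarrow>\<^sub>0 nat) => real^'m => real" where
 "mon m x=(\<Prod>i\<in>UNIV. (x $ i) ^ lk m i)"

definition ev :: "'m::finite polyring => real^'m => real" where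
 "ev p x=(\<Sum>m\<in>ks p. lk p m * mon m x)"

definition mdeg :: "('m::finite \<Rightarrow>\<^sub>0 nat) => nat" where
 "mdeg m=(\<Sum>i\<in>UNIV. lk m i)"

definition hpart :: "nat => 'm::finite polyring => 'm polyring" where
 "hpart d p=(\<Sum>m\<in>{m\<in>ks p. mdeg m=d}. sg m (lk p m))"

lemma ev_superset:
 assumes "finite K" "ks p\<subseteq>K"
 shows "ev p x=(\<Sum>m\<in>K. lk p m * mon m x)"
 unfolding ev_def by (rule sum.mono_neutral_left) (use assms in \<open>auto simp: in_keys_iff\<close>)

lemma ev_add: "ev (p + q) x=ev p x + ev q x"
proof -
 let ?K = "ks p\<union>ks q"
 have "ev (p + q) x=(\<Sum>m\<in>?K. lk (p + q) m * mon m x)"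
  by (rule ev_superset) (use keys_add[of p q] in auto)
 also have "\<dots>=(\<Sum>m\<in>?K. lk p m * mon m x) + (\<Sum>m\<in>?K. lk q m * mon m x)"
  by (simp add: lookup_add distrib_right sum.distrib)
 also have "\<dots>=ev p x + ev q x" by (simp add: ev_superset[of ?K])
 finally show ?thesis .
qed

lemma ev_zero: "ev 0 x=0" by (simp add: ev_def)

lemma ev_single: "ev (sg m c) x=c * mon m x"
 using ev_superset[of "{m}" "sg m c" x] by simp

lemma ev_sum: "ev (\<Sum>i\<in>I. f i) x=(\<Sum>i\<in>I. ev (f i) x)"
 by (induction I rule: infinite_finite_induct) (simp_all add: ev_add ev_zero)

lemma mon_add: "mon (m + n) x=mon m x * mon n x" by (simp add: mon_def lookup_add power_add prod.distrib)

lemma sum_singles: "(\<Sum>m\<in>ks p. sg m (lk p m))=p"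
proof (rule poly_mapping_eqI)
 fix k
 have "lk (\<Sum>m\<in>ks p. sg m (lk p m)) k =
   (\<Sum>m\<in>ks p. if k=m then lk p m else 0)"
  unfolding lookup_sum by (intro sum.cong refl) (auto simp: lookup_single)
 thus "lk (\<Sum>m\<in>ks p. sg m (lk p m)) k =
   lk p k" by (simp add: in_keys_iff)
qed

lemma ev_mult: "ev (p * q) x=ev p x * ev q x"
proof -
 let ?s = "%p m. sg m (lk p m)"
 have "p * q=(\<Sum>m\<in>ks p. ?s p m) * (\<Sum>n\<in>ks q. ?s q n)"
  by (simp only: sum_singles)
 also have "\<dots>=(\<Sum>m\<in>ks p. \<Sum>n\<in>ks q. ?s p m * ?s q n)" by (rule sum_product)
 finally have "ev (p * q) x=(\<Sum>m\<in>ks p. \<Sum>n\<in>ks q.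
   (lk p m * mon m x) * (lk q n * mon n x))"
  by (simp add: ev_sum mult_single ev_single mon_add mult_ac)
 thus ?thesis by (simp add: ev_def sum_product)
qed

lemma ev_Const: "ev (Const c) x=c" by (simp add: Const_def ev_single mon_def)

lemma ev_one: "ev 1 x=1" using ev_Const[of 1 x] by (simp add: Const_def)

lemma ev_Var: "ev (Var i) x=x $ i"
proof -
 have "mon (sg i 1) x=(\<Prod>j\<in>UNIV. if j=i then x $ j else 1)"
  unfolding mon_def by (intro prod.cong refl) (auto simp: lookup_single)
 thus ?thesis by (simp add: Var_def ev_single)
qed

lemma ev_power: "ev (p ^ n) x=ev p x ^ n" by (induction n) (simp_all add: ev_one ev_mult)

lemma ev_prod: "ev (\<Prod>i\<in>I. f i) x=(\<Prod>i\<in>I. ev (f i) x)"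
 by (induction I rule: infinite_finite_induct) (simp_all add: ev_mult ev_one)

lemma ev_lin_form: "ev (lin_form a) x=a\<cdot>x"
 by (simp add: lin_form_def ev_sum ev_mult ev_Const ev_Var inner_vec_def)

lemma power_sum_zero:
 fixes c :: "nat => real"
 assumes "finite D" "\<And>t. (\<Sum>d\<in>D. t ^ d * c d)=0" "d\<in>D"
 shows "c d=0"
proof -
 define p where "p=(\<Sum>d\<in>D. monom (c d) d)"
 have "poly p t=poly 0 t" for t using assms(2)[of t] by (simp add: p_def poly_sum poly_monom mult.commute)
 hence "p=0" by (simp add: poly_eq_poly_eq_iff[symmetric] fun_eq_iff)
 moreover have "coeff p d=(\<Sum>e\<in>D. if d=e then c e else 0)"
  unfolding p_def coeff_sum by (intro sum.cong refl) auto
 ultimately show ?thesis using assms(1,3) by simp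
qed

text \<open>Induction on the variables: with the others fixed, the sum is a polynomial in one
  variable, so each group of terms with equal exponent of that variable vanishes by itself.\<close>

lemma monomials_independent:
 fixes c :: "'k => real" and e :: "'k => 'm => nat"
 assumes "finite I" "finite K" "\<And>k k'. k\<in>K ==> k'\<in>K ==> (\<And>i. i\<in>I ==> e k i=e k' i) ==> k=k'"
  "\<And>x :: 'm => real. (\<Sum>k\<in>K. c k * (\<Prod>i\<in>I. x i ^ e k i))=0" "k\<in>K"
 shows "c k=0" using assms
proof (induction I arbitrary: K k rule: finite_induct)
 case empty
 hence "K={k}" by auto
 thus ?case using empty(3)[of "%_. 0"] by simp
next
 case (insert j I)
 let ?D = "(%k. e k j) ` K"
 have z: "(\<Sum>k\<in>{k\<in>K. e k j=d}. c k * (\<Prod>i\<in>I. x i ^ e k i))=0" if d: "d\<in>?D" for d and x :: "'m => real"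
 proof (rule power_sum_zero[of ?D _ d])
  show "finite ?D" using insert(4) by simp
  fix t :: real
  have P: "(\<Prod>i\<in>insert j I. (x(j := t)) i ^ e k i)=t ^ e k j * (\<Prod>i\<in>I. x i ^ e k i)" for k
  proof -
   have "(\<Prod>i\<in>I. (x(j := t)) i ^ e k i)=(\<Prod>i\<in>I. x i ^ e k i)" by (rule prod.cong) (use insert(2) in auto)
   thus ?thesis using insert(1,2) by simp
  qed
  have "0=(\<Sum>k\<in>K. c k * (t ^ e k j * (\<Prod>i\<in>I. x i ^ e k i)))" using insert(6)[of "x(j := t)"] by (simp only: P)
  also have "\<dots>=(\<Sum>d\<in>?D. \<Sum>k\<in>{k\<in>K. e k j=d}. c k * (t ^ e k j * (\<Prod>i\<in>I. x i ^ e k i)))"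
   by (rule sum.image_gen[OF insert(4)])
  also have "\<dots>=(\<Sum>d\<in>?D. t ^ d * (\<Sum>k\<in>{k\<in>K. e k j=d}. c k * (\<Prod>i\<in>I. x i ^ e k i)))"
   by (intro sum.cong refl) (simp add: sum_distrib_left mult_ac)
  finally show "(\<Sum>d\<in>?D. t ^ d * (\<Sum>k\<in>{k\<in>K. e k j=d}. c k * (\<Prod>i\<in>I. x i ^ e k i)))=0" by simp
 qed (rule d)
 show ?case
 proof (rule insert(3))
  show "finite {k'\<in>K. e k' j=e k j}" using insert(4) by simp
  show "k\<in>{k'\<in>K. e k' j=e k j}" using insert(7) by simp
  show "(\<Sum>k\<in>{k'\<in>K. e k' j=e k j}. c k * (\<Prod>i\<in>I. x i ^ e k i))=0" for x :: "'m => real"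
   by (rule z) (use insert(7) in auto)
  show "k1=k2" if "k1\<in>{k'\<in>K. e k' j=e k j}" "k2\<in>{k'\<in>K. e k' j=e k j}"
   "\<And>i. i\<in>I ==> e k1 i=e k2 i" for k1 k2 by (rule insert(5)) (use that in auto)
 qed
qed

lemma ev_inj:
 assumes "\<And>x. ev p x=ev q x"
 shows "p=q"
proof -
 have "p - q=0"
 proof (rule poly_mapping_eqI)
  fix m
  have z: "ev (p - q) x=0" for x using assms[of x] ev_add[of "p - q" q x] by simp
  show "lk (p - q) m=lk 0 m"
  proof (cases "m\<in>ks (p - q)")
   case True
   have "lk (p - q) m=0"
   proof (rule monomials_independent[where I = UNIV and K = "ks (p - q)" and e = lk])
    show "k=k'" if "\<And>i. i\<in>UNIV ==> lk k i=lk k' i" for k k' :: "'a \<Rightarrow>\<^sub>0 nat"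
     by (rule poly_mapping_eqI) (use that in simp)
    show "(\<Sum>k\<in>ks (p - q). lk (p - q) k * (\<Prod>i\<in>UNIV. x i ^ lk k i))=0"
     for x :: "'a => real" using z[of "\<chi> i. x i"] by (simp add: ev_def mon_def)
   qed (use True in auto)
   thus ?thesis by simp
  next
   case False
   thus ?thesis by (simp add: in_keys_iff)
  qed
 qed
 thus ?thesis by simp
qed

lemma polyring_induct [case_names Const Var add mult]:
 fixes p :: "'m::finite polyring"
 assumes "\<And>c. P (Const c)" "\<And>i. P (Var i)" "\<And>p q. P p ==> P q ==> P (p + q)" "\<And>p q. P p ==> P q ==> P (p * q)"
 shows "P p"
proof -
 have c01: "Const 0=(0 :: 'm polyring)" "Const 1=(1 :: 'm polyring)" by (simp_all add: Const_def)
 have P0: "P 0" "P 1" using assms(1)[of 0] assms(1)[of 1] c01 by simp_all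
 have Ppow: "P (Var i ^ n)" for i n by (induction n) (use P0 assms(2,4) in auto)
 have Pprod: "P (\<Prod>i\<in>I. Var i ^ n i)" if "finite I" for I n
  using that by (induction I rule: finite_induct) (use P0 Ppow assms(4) in auto)
 have e: "sg m c=Const c * (\<Prod>i\<in>UNIV. Var i ^ lk m i)" for m :: "'m \<Rightarrow>\<^sub>0 nat" and c
  by (rule ev_inj) (simp add: ev_single ev_mult ev_Const ev_prod ev_power ev_Var mon_def)
 have Ps: "P (sg m c)" for m c unfolding e by (intro assms(4) assms(1) Pprod) simp
 have "P (\<Sum>m\<in>K. sg m (lk p m))" if "finite K" for K
  using that by (induction K rule: finite_induct) (use P0 Ps assms(3) in auto)
 from this[OF finite_keys[of p]] show ?thesis unfolding sum_singles .
qed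

lemma mon_hp: "hp (mdeg m) (mon m)"
proof -
 have "hp (\<Sum>i\<in>UNIV. 1 * lk m i) (%x. \<Prod>i\<in>UNIV. (axis i (1::real)\<cdot>x) ^ lk m i)"
  by (intro hp_prod hp_power) (auto simp: hp_linear)
 moreover have "axis i (1::real)\<cdot>x=x $ i" for i and x :: "real^'a" by (simp add: cart_eq_inner_axis inner_commute)
 ultimately show ?thesis by (simp add: mdeg_def mon_def[abs_def])
qed

lemma homogeneous_hp:
 assumes "homogeneous d p"
 shows "hp d (ev p)"
proof -
 have "hp d (%x. \<Sum>m\<in>ks p. lk p m * mon m x)"
 proof (intro hp_sum hp_cmult)
  fix m assume "m\<in>ks p"
  hence "mdeg m=d" using assms by (simp add: homogeneous_def mdeg_def)
  thus "hp d (mon m)" using mon_hp[of m] by simp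
 qed
 thus ?thesis by (simp add: ev_def[abs_def])
qed

lemma mdeg_add: "mdeg (m + n)=mdeg m + mdeg n" by (simp add: mdeg_def lookup_add sum.distrib)

lemma homogeneous_mult:
 assumes "homogeneous d p" "homogeneous e q"
 shows "homogeneous (d + e) (p * q)" unfolding homogeneous_def mdeg_def[symmetric]
proof
 fix m assume "m\<in>ks (p * q)"
 then obtain a b where ab: "a\<in>ks p" "b\<in>ks q" "m=a + b" using keys_mult[of p q] by blast
 thus "mdeg m=d + e" using assms by (simp add: homogeneous_def mdeg_def[symmetric] mdeg_add)
qed

lemma homogeneous_add: "homogeneous d p ==> homogeneous d q ==> homogeneous d (p + q)"
 using keys_add[of p q] unfolding homogeneous_def by blast

lemma homogeneous_zero: "homogeneous d 0" by (simp add: homogeneous_def)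

lemma homogeneous_sum: "(\<And>i. i\<in>I ==> homogeneous d (f i)) ==> homogeneous d (\<Sum>i\<in>I. f i)"
 by (induction I rule: infinite_finite_induct) (auto simp: homogeneous_zero homogeneous_add)

lemma homogeneous_Const: "homogeneous 0 (Const c)" by (cases "c=0") (auto simp: homogeneous_def Const_def)

lemma homogeneous_lin_form: "homogeneous 1 (lin_form a)"
proof -
 have "homogeneous 1 (Var i)" for i :: 'a by (simp add: homogeneous_def Var_def lookup_single when_def)
 from homogeneous_mult[OF homogeneous_Const this] show ?thesis
  unfolding lin_form_def by (intro homogeneous_sum) simp
qed

lemma hp_homogeneous:
 fixes f :: "real^'m::finite => real"
 assumes "hp d f"
 shows "\<exists>p. homogeneous d p \<and> ev p=f" using assms
proof (induction rule: hp.induct)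
 case (hp_const c)
 show ?case by (rule exI[of _ "Const c"]) (simp add: homogeneous_Const ev_Const[abs_def])
next
 case (hp_add d f g)
 then obtain p q where "homogeneous d p" "ev p=f" "homogeneous d q" "ev q=g" by blast
 thus ?case by (intro exI[of _ "p + q"]) (auto simp: homogeneous_add ev_add)
next
 case (hp_lin d f a)
 then obtain p where p: "homogeneous d p" "ev p=f" by blast
 show ?case
  by (rule exI[of _ "lin_form a * p"]) (use homogeneous_mult[OF homogeneous_lin_form p(1), of a] p(2) in \<open>auto simp: ev_mult ev_lin_form\<close>)
qed

lemma homogeneous_hpart: "homogeneous d (hpart d p)" unfolding hpart_def
 by (intro homogeneous_sum) (auto simp: homogeneous_def mdeg_def)

lemma hpart_sum:
 assumes "finite D" "mdeg ` ks p\<subseteq>D"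
 shows "(\<Sum>d\<in>D. hpart d p)=p"
proof -
 have "(\<Sum>d\<in>D. hpart d p)=(\<Sum>m\<in>ks p. sg m (lk p m))"
  unfolding hpart_def by (rule sum.group) (use assms in auto)
 thus ?thesis by (simp only: sum_singles)
qed

lemma hpart_vanish:
 assumes "\<And>t. ev p (t*\<^sub>Rx)=0"
 shows "ev (hpart d p) x=0"
proof -
 let ?D = "insert d (mdeg ` ks p)"
 have "(\<Sum>e\<in>?D. t ^ e * ev (hpart e p) x)=0" for t
 proof -
  have "(\<Sum>e\<in>?D. t ^ e * ev (hpart e p) x)=(\<Sum>e\<in>?D. ev (hpart e p) (t*\<^sub>Rx))"
   by (intro sum.cong refl) (simp add: hp_scale[OF homogeneous_hp[OF homogeneous_hpart]])
  also have "\<dots>=ev (\<Sum>e\<in>?D. hpart e p) (t*\<^sub>Rx)" by (simp only: ev_sum)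
  also have "(\<Sum>e\<in>?D. hpart e p)=p" by (rule hpart_sum) auto
  finally show ?thesis using assms by simp
 qed
 from power_sum_zero[OF _ this, of d] show ?thesis by simp
qed

text \<open>\<open>hyp a\<close> is closed under scaling, so the homogeneous parts of
  \<open>p\<close> vanish there separately, and each of them is divisible by
  \<open>hp_vanish\<close>.\<close>

lemma lin_form_dvd_iff: "lin_form a dvd p \<longleftrightarrow> (\<forall>x\<in>hyp a. ev p x=0)"
proof
 assume "lin_form a dvd p"
 then obtain q where "p=lin_form a * q" by (elim dvdE)
 thus "\<forall>x\<in>hyp a. ev p x=0" by (simp add: ev_mult ev_lin_form hyp_def)
next
 assume v: "\<forall>x\<in>hyp a. ev p x=0"
 have "lin_form a dvd hpart d p" for d
 proof -
  have vh: "ev (hpart d p) x=0" if "x\<in>hyp a" for x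
  proof (rule hpart_vanish)
   show "ev p (t*\<^sub>Rx)=0" for t using v subspace_scale[OF subspace_hyp that, of t] by blast
  qed
  have "\<exists>g. (if d=0 then g=(%_. 0) else hp (d - 1) g) \<and> (\<forall>x. ev (hpart d p) x=(a\<cdot>x) * g x) \<and> continuous_on UNIV g"
   by (rule hp_vanish[OF homogeneous_hp[OF homogeneous_hpart]]) (rule vh)
  then obtain g where
   g: "if d=0 then g=(%_. 0) else hp (d - 1) g" "\<forall>x. ev (hpart d p) x=(a\<cdot>x) * g x" by (elim exE conjE)
  have "\<exists>q. ev q=g"
  proof (cases "d=0")
   case True
   thus ?thesis using g(1) by (intro exI[of _ 0]) (simp add: ev_zero[abs_def])
  next
   case False
   thus ?thesis using g(1) hp_homogeneous[of "d - 1" g] by auto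
  qed
  then obtain q where q: "ev q=g" by blast
  have "hpart d p=lin_form a * q" by (rule ev_inj) (use g(2) q in \<open>simp add: ev_mult ev_lin_form\<close>)
  thus ?thesis by simp
 qed
 hence "lin_form a dvd (\<Sum>d\<in>mdeg ` ks p. hpart d p)" by (intro dvd_sum) simp
 also have "(\<Sum>d\<in>mdeg ` ks p. hpart d p)=p" by (rule hpart_sum) auto
 finally show "lin_form a dvd p" .
qed

text \<open>The derivation with prescribed values is the directional derivative along the corresponding field.\<close>

lemma Der_exists:
 fixes q :: "'m::finite => 'm polyring"
 shows "\<exists>w\<in>Der. \<forall>i. w (Var i)=q i"
proof -
 define Q where "Q x=(\<chi> i. ev (q i) x)" for x
 define R where "R p r \<longleftrightarrow> (\<forall>x. ((%t. ev p (x + t*\<^sub>RQ x)) has_real_derivative ev r x) (at 0))" for p r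
 have RC: "R (Const c) 0" for c unfolding R_def by (simp add: ev_Const ev_zero)
 have RV: "R (Var i) (q i)" for i unfolding R_def ev_Var
 proof
  fix x
  have "((%t. x $ i + t * (Q x $ i)) has_real_derivative Q x $ i) (at 0)" by (auto intro!: derivative_eq_intros)
  thus "((%t. (x + t*\<^sub>RQ x) $ i) has_real_derivative ev (q i) x) (at 0)" by (simp add: Q_def)
 qed
 have RA: "R (p + p') (r + r')" if "R p r" "R p' r'" for p p' r r'
  using that unfolding R_def ev_add by (auto intro: DERIV_add)
 have RM: "R (p * p') (r * p' + p * r')" if "R p r" "R p' r'" for p p' r r' unfolding R_def ev_add ev_mult
 proof
  fix x
  show "((%t. ev p (x + t*\<^sub>RQ x) * ev p' (x + t*\<^sub>RQ x)) has_real_derivative ev r x * ev p' x + ev p x * ev r' x) (at 0)"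
   using DERIV_mult[OF that(1)[unfolded R_def, rule_format, of x] that(2)[unfolded R_def, rule_format, of x]]
   by (simp add: mult_ac)
 qed
 have Ru: "r=r'" if "R p r" "R p r'" for p r r'
  by (rule ev_inj) (use that DERIV_unique in \<open>unfold R_def, blast\<close>)
 have Re: "\<exists>r. R p r" for p
 proof (induction p rule: polyring_induct)
  case (add p q)
  thus ?case using RA by blast
 next
  case (mult p q)
  thus ?case using RM by blast
 qed (use RC RV in blast)+
 define w where "w p=(SOME r. R p r)" for p
 have Rw: "R p (w p)" for p unfolding w_def by (rule someI_ex[OF Re])
 have eq: "w p=r" if "R p r" for p r using Ru[OF Rw that] .
 show ?thesis
 proof (rule bexI[of _ w])
  show "\<forall>i. w (Var i)=q i" using eq[OF RV] by blast
  have "w (p + p')=w p + w p'" for p p' by (rule eq[OF RA[OF Rw Rw]])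
  moreover have "w (p * p')=w p * p' + p * w p'" for p p' by (rule eq[OF RM[OF Rw Rw]])
  moreover have "w (Const c * p)=Const c * w p" for c p using eq[OF RM[OF RC Rw]] by simp
  ultimately show "w\<in>Der" by (simp add: Der_def)
 qed
qed

lemma Der_eqI:
 assumes "t\<in>Der" "h\<in>Der" "\<And>i. t (Var i)=h (Var i)"
 shows "t=(h :: 'm::finite polyring => 'm polyring)"
proof
 fix p
 have c: "t (Const c)=0" if "t\<in>Der" for t :: "'m polyring => 'm polyring" and c
 proof -
  have "t (1 * 1)=t 1 * 1 + 1 * t 1" using that unfolding Der_def by blast
  hence "t 1=0" by simp
  moreover have "t (Const c * 1)=Const c * t 1" using that unfolding Der_def by blast
  ultimately show ?thesis by simp
 qed
 show "t p=h p"
 proof (induction p rule: polyring_induct)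
  case (Const a)
  show ?case using c[OF assms(1)] c[OF assms(2)] by simp
 next
  case (add p q)
  thus ?case using assms(1,2) by (simp add: Der_def)
 next
  case (mult p q)
  thus ?case using assms(1,2) by (simp add: Der_def)
 qed (rule assms(3))
qed

lemma Der_lin_form:
 assumes "t\<in>Der"
 shows "ev (t (lin_form a)) x=a\<cdot>(\<chi> i. ev (t (Var i)) x)"
proof -
 have add: "t (p + q)=t p + t q" and cm: "t (Const c * p)=Const c * t p" for p q c
  using assms by (auto simp: Der_def)
 have z: "t 0=0" using add[of 0 0] by simp
 have s: "t (\<Sum>i\<in>I. f i)=(\<Sum>i\<in>I. t (f i))" for I and f :: "'a => 'a polyring"
  by (induction I rule: infinite_finite_induct) (simp_all add: z add)
 show ?thesis unfolding lin_form_def s cm by (simp add: ev_sum ev_mult ev_Const inner_vec_def)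
qed

section \<open>From bases of tangent fields to bases of logarithmic derivations\<close>

lemma sum_fun_at: "(\<Sum>i\<in>I. f i) x=(\<Sum>i\<in>I. (f i x :: 'b::comm_monoid_add))"
 by (induction I rule: infinite_finite_induct) simp_all

lemma Der_add: "t\<in>Der ==> h\<in>Der ==> t + h\<in>Der" by (auto simp: Der_def algebra_simps)

lemma Der_zero: "0\<in>Der" by (simp add: Der_def)

lemma Der_scale: "t\<in>Der ==> der_scale p t\<in>Der" by (auto simp: Der_def der_scale_def algebra_simps)

lemma Der_sum: "(\<And>i. i\<in>I ==> f i\<in>Der) ==> (\<Sum>i\<in>I. f i)\<in>Der"
 by (induction I rule: infinite_finite_induct) (auto simp: Der_zero intro: Der_add)

text \<open>Divisibility by a form is vanishing on its hyperplane, and all forms of one hyperplane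
  are proportional. This is the bridge from derivations to tangent fields.\<close>

lemma log_der_tang:
 assumes "u\<in>Der" and A: "\<A>=hyp ` N" and N0: "0\<notin>N"
 shows "u\<in>log_der \<A> \<longleftrightarrow> tang N (%x. \<chi> i. ev (u (Var i)) x)"
proof
 assume "u\<in>log_der \<A>"
 hence *: "\<And>v a. v\<in>N ==> hyp v={x. a\<cdot>x=0} ==> lin_form a dvd u (lin_form a)"
  unfolding log_der_def A by auto
 show "tang N (%x. \<chi> i. ev (u (Var i)) x)" unfolding tang_def
 proof (intro ballI)
  fix v x assume "v\<in>N" "x\<in>hyp v"
  thus "v\<cdot>(\<chi> i. ev (u (Var i)) x)=0"
   using *[of v v] unfolding lin_form_dvd_iff Der_lin_form[OF assms(1)] by (simp add: hyp_def)
 qed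
next
 assume t: "tang N (%x. \<chi> i. ev (u (Var i)) x)"
 show "u\<in>log_der \<A>" unfolding log_der_def mem_Collect_eq
 proof (intro conjI ballI allI impI)
  show "u\<in>Der" by (rule assms(1))
  fix H a assume H: "H\<in>\<A>" "H={x. a\<cdot>x=0}"
  then obtain v where v: "v\<in>N" "hyp v=hyp a" unfolding A hyp_def by auto
  have "a\<in>span {v}"
  proof (rule in_spanI)
   fix w assume "\<forall>y\<in>{v}. y\<cdot>w=0"
   hence "w\<in>hyp a" unfolding v(2)[symmetric] by (simp add: hyp_def)
   thus "w\<cdot>a=0" by (simp add: hyp_def inner_commute)
  qed
  then obtain c where c: "a=c*\<^sub>Rv" unfolding in_span1 by blast
  show "lin_form a dvd u (lin_form a)" unfolding lin_form_dvd_iff Der_lin_form[OF assms(1)] v(2)[symmetric]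
   using t v(1) unfolding tang_def c by simp
 qed
qed

text \<open>A logarithmic derivation need not be homogeneous. Its homogeneous components are tangent
  one by one; they are expanded by \<open>fbas\<close> and the coefficients are added up.\<close>

lemma free_from_basis:
 fixes N :: "(real^'m::finite) set"
 assumes fb: "fbas UNIV N r e F" and A: "\<A>=hyp ` N" and N0: "0\<notin>N"
 shows "free_arrangement \<A>"
proof -
 have "\<forall>i\<in>{..<r}. \<exists>D. D\<in>Der \<and> homogeneous_der (e i) D \<and> (\<forall>x. (\<chi> j. ev (D (Var j)) x)=F i x)"
 proof
  fix i assume "i\<in>{..<r}"
  hence hf: "hf (e i) (F i)" using fbasD(1)[OF fb] by simp
  have "\<forall>j\<in>UNIV. \<exists>q. homogeneous (e i) q \<and> ev q=(%x. F i x $ j)"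
  proof
   fix j :: 'm
   have "hp (e i) (%x. axis j 1\<cdot>F i x)" using hf by (simp add: hf_def)
   hence "hp (e i) (%x. F i x $ j)" by (simp add: cart_eq_inner_axis inner_commute)
   from hp_homogeneous[OF this] show "\<exists>q. homogeneous (e i) q \<and> ev q=(%x. F i x $ j)" .
  qed
  from bchoice[OF this] obtain q where q: "\<And>j. homogeneous (e i) (q j)" "\<And>j. ev (q j)=(%x. F i x $ j)" by auto
  obtain D where D: "D\<in>Der" "\<forall>j. D (Var j)=q j" using Der_exists[of q] by blast
  show "\<exists>D. D\<in>Der \<and> homogeneous_der (e i) D \<and> (\<forall>x. (\<chi> j. ev (D (Var j)) x)=F i x)"
   using D q by (intro exI[of _ D]) (simp add: homogeneous_der_def)
 qed
 from bchoice[OF this] obtain D where D: "\<And>i. i < r ==> D i\<in>Der" "\<And>i. i < r ==> homogeneous_der (e i) (D i)"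
  "\<And>i x. i < r ==> (\<chi> j. ev (D i (Var j)) x)=F i x" by auto
 have evD: "ev (D i (Var j)) x=F i x $ j" if "i < r" for i j x using D(3)[OF that, of x] by (metis vec_lambda_beta)
 have cont_ev: "continuous_on UNIV (ev p)" for p :: "'m polyring"
  unfolding ev_def mon_def by (intro continuous_intros)
 have indep: "u i=0" if z: "(\<Sum>i<r. der_scale (u i) (D i))=0" and i: "i < r" for u i
 proof (rule ev_inj)
  fix x
  have s: "(\<Sum>i<r. ev (u i) x*\<^sub>RF i x)=0" for x
  proof (rule vec_eq_iff[THEN iffD2], rule allI)
   fix j
   have "(\<Sum>i<r. u i * D i (Var j))=0"
    using fun_cong[OF z, of "Var j"] by (simp add: der_scale_def sum_fun_at)
   hence "ev (\<Sum>i<r. u i * D i (Var j)) x=0" by (simp add: ev_zero)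
   thus "(\<Sum>i<r. ev (u i) x*\<^sub>RF i x) $ j=0 $ j" by (simp add: ev_sum ev_mult evD)
  qed
  show "ev (u i) x=ev 0 x" unfolding ev_zero by (rule fbasD(5)[OF fb _ s i]) (rule cont_ev)
 qed
 \<comment> \<open>Independence and span refer to a set of derivations, so repetitions in the family
   have to be excluded before sums over the set become sums over indices.\<close>
 have injD: "inj_on D {..<r}"
 proof (rule inj_onI, rule ccontr)
  fix i j assume ij: "i\<in>{..<r}" "j\<in>{..<r}" "D i=D j" "i~=j"
  let ?u = "%k. if k=i then 1 else if k=j then - 1 else (0 :: 'm polyring)"
  have "(\<Sum>k<r. der_scale (?u k) (D k))=(\<Sum>k\<in>{i, j}. der_scale (?u k) (D k))"
   by (rule sum.mono_neutral_right) (use ij in \<open>auto simp: der_scale_def\<close>)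
  also have "\<dots>=0" using ij(3,4) by (auto simp: der_scale_def fun_eq_iff)
  finally have "?u i=0" by (rule indep) (use ij in simp)
  thus False by simp
 qed
 let ?B = "D ` {..<r}"
 have logD: "D i\<in>log_der \<A>" if "i < r" for i
  unfolding log_der_tang[OF D(1)[OF that] A N0] using fbasD(3)[OF fb that] D(3)[OF that] by (simp add: tang_def)
 have sub: "der.subspace (log_der \<A>)" unfolding der.subspace_def
 proof (intro conjI allI ballI)
  have add: "tang N (%x. \<chi> i. ev ((w + h) (Var i)) x)"
   if "tang N (%x. \<chi> i. ev (w (Var i)) x)" "tang N (%x. \<chi> i. ev (h (Var i)) x)" for w h :: "'m polyring => 'm polyring"
  proof -
   have e: "(\<chi> i. ev ((w + h) (Var i)) x)=(\<chi> i. ev (w (Var i)) x) + (\<chi> i. ev (h (Var i)) x)" for x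
    by (simp add: vec_eq_iff ev_add)
   show ?thesis using that unfolding tang_def e inner_add_right by simp
  qed
  have scale: "tang N (%x. \<chi> i. ev (der_scale p w (Var i)) x)"
   if "tang N (%x. \<chi> i. ev (w (Var i)) x)" for w :: "'m polyring => 'm polyring" and p
  proof -
   have e: "(\<chi> i. ev (der_scale p w (Var i)) x)=ev p x*\<^sub>R(\<chi> i. ev (w (Var i)) x)" for x
    by (simp add: vec_eq_iff der_scale_def ev_mult)
   show ?thesis using that unfolding tang_def e inner_scaleR_right by simp
  qed
  have Der: "w\<in>Der" if "w\<in>log_der \<A>" for w using that by (simp add: log_der_def)
  have t: "tang N (%x. \<chi> i. ev (w (Var i)) x)" if "w\<in>log_der \<A>" for w
   using that log_der_tang[OF Der[OF that] A N0] by simp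
  show "0\<in>log_der \<A>" unfolding log_der_tang[OF Der_zero A N0] by (simp add: tang_def ev_zero inner_vec_def)
  show "w + h\<in>log_der \<A>" if "w\<in>log_der \<A>" "h\<in>log_der \<A>" for w h
   unfolding log_der_tang[OF Der_add[OF Der[OF that(1)] Der[OF that(2)]] A N0] by (rule add[OF t[OF that(1)] t[OF that(2)]])
  show "der_scale p w\<in>log_der \<A>" if "w\<in>log_der \<A>" for p w
   unfolding log_der_tang[OF Der_scale[OF Der[OF that]] A N0] by (rule scale[OF t[OF that]])
 qed
 show ?thesis unfolding free_arrangement_def
 proof (intro exI[of _ ?B] conjI)
  show "\<forall>w\<in>?B. \<exists>d. homogeneous_der d w"
  proof
   fix w assume "w\<in>?B"
   then obtain i where i: "i < r" "w=D i" by auto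
   show "\<exists>d. homogeneous_der d w" unfolding i(2) by (rule exI[of _ "e i"], rule D(2)[OF i(1)])
  qed
  show "der.independent ?B"
  proof
   assume "der.dependent ?B"
   then obtain u where u': "\<exists>v\<in>?B. u v~=0" "(\<Sum>v\<in>?B. der_scale (u v) v)=0"
    by (subst (asm) der.dependent_finite, simp, elim exE conjE) (rule that)
   then obtain v where "v\<in>?B" "u v~=0" by (elim bexE)
   note u = this u'(2)
   then obtain i where i: "i < r" "v=D i" by blast
   have "(\<Sum>i<r. der_scale (u (D i)) (D i))=0" using u(3) by (simp add: sum.reindex[OF injD])
   from indep[OF this i(1)] show False using u(2) i(2) by simp
  qed
  show "der.span ?B=log_der \<A>"
  proof
   show "der.span ?B\<subseteq>log_der \<A>" by (rule der.span_minimal[OF _ sub]) (use logD in auto)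
   show "log_der \<A>\<subseteq>der.span ?B"
   proof
    fix w assume w: "w\<in>log_der \<A>"
    hence Dw: "w\<in>Der" by (simp add: log_der_def)
    have t: "tang N (%x. \<chi> i. ev (w (Var i)) x)" using w log_der_tang[OF Dw A N0] by simp
    let ?Dg = "\<Union>j. mdeg ` ks (w (Var j))"
    have finDg: "finite ?Dg" by simp
    define T where "T d x=(\<chi> j. ev (hpart d (w (Var j))) x)" for d x
    have hfT: "hf d (T d)" for d unfolding hf_def T_def inner_vec_def
     by (auto intro!: hp_sum hp_cmult homogeneous_hp homogeneous_hpart)
    have tT: "tang N (T d)" for d unfolding tang_def
    proof (intro ballI)
     fix a x assume a: "a\<in>N" "x\<in>hyp a"
     let ?D = "insert d ?Dg"
     have "(\<Sum>e\<in>?D. s ^ e * (a\<cdot>T e x))=0" for s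
     proof -
      have "(\<Sum>e\<in>?D. s ^ e * (a\<cdot>T e x))=(\<Sum>e\<in>?D. a\<cdot>T e (s*\<^sub>Rx))"
      by (smt (verit) hfT hp_scale sum.cong hf_def)
      also have "\<dots>=a\<cdot>(\<Sum>e\<in>?D. T e (s*\<^sub>Rx))" by (simp add: inner_sum_right)
      also have "(\<Sum>e\<in>?D. T e (s*\<^sub>Rx))=(\<chi> j. ev (w (Var j)) (s*\<^sub>Rx))"
      proof (rule vec_eq_iff[THEN iffD2], rule allI)
       fix j
       have "(\<Sum>e\<in>?D. hpart e (w (Var j)))=w (Var j)" by (rule hpart_sum) (use finDg in auto)
       thus "(\<Sum>e\<in>?D. T e (s*\<^sub>Rx)) $ j=(\<chi> j. ev (w (Var j)) (s*\<^sub>Rx)) $ j"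
        by (simp add: T_def ev_sum[symmetric] del: sum.insert)
      qed
      also have "a\<cdot>(\<chi> j. ev (w (Var j)) (s*\<^sub>Rx))=0"
       using t a(1) subspace_scale[OF subspace_hyp a(2), of s] by (simp add: tang_def)
      finally show ?thesis .
     qed
     from power_sum_zero[OF _ this, of d] finDg show "a\<cdot>T d x=0" by simp
    qed
    have "\<forall>d\<in>?Dg. \<exists>s. \<forall>x. T d x=(\<Sum>i<r. ev (s i) x*\<^sub>RF i x)"
    proof
     fix d assume "d\<in>?Dg"
     from fbasD(4)[OF fb hfT[of d] subset_UNIV tT[of d]] obtain f where
      f: "\<forall>i<r. hq d (e i) (f i)" "\<forall>x. T d x=(\<Sum>i<r. f i x*\<^sub>RF i x)"
      by (elim exE conjE)
     have "\<forall>i\<in>{..<r}. \<exists>q. ev q=f i"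
     proof
      fix i assume i: "i\<in>{..<r}"
      show "\<exists>q. ev q=f i"
      proof (cases "e i\<le>d")
       case True
       hence "hp (d - e i) (f i)" using f(1) i by auto
       from hp_homogeneous[OF this] show ?thesis by blast
      next
       case False
       hence "f i=(%_. 0)" using f(1) i by auto
       thus ?thesis by (intro exI[of _ 0]) (simp add: ev_zero[abs_def])
      qed
     qed
     from bchoice[OF this] obtain s where "\<And>i. i < r ==> ev (s i)=f i" by auto
     thus "\<exists>s. \<forall>x. T d x=(\<Sum>i<r. ev (s i) x*\<^sub>RF i x)" using f(2) by (intro exI[of _ s]) simp
    qed
    from bchoice[OF this] obtain s where s': "\<forall>d\<in>?Dg. \<forall>x. T d x=(\<Sum>i<r. ev (s d i) x*\<^sub>RF i x)" by (elim exE)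
    note s = s'[rule_format]
    define c where "c i=(\<Sum>d\<in>?Dg. s d i)" for i
    have "w=(\<Sum>i<r. der_scale (c i) (D i))"
    proof (rule Der_eqI[OF Dw])
     show "(\<Sum>i<r. der_scale (c i) (D i))\<in>Der" by (intro Der_sum Der_scale D(1)) simp
     fix j
     show "w (Var j)=(\<Sum>i<r. der_scale (c i) (D i)) (Var j)"
     proof (rule ev_inj)
      fix x
      have "(\<Sum>d\<in>?Dg. hpart d (w (Var j)))=w (Var j)" by (rule hpart_sum) (use finDg in auto)
      hence "ev (w (Var j)) x=(\<Sum>d\<in>?Dg. T d x $ j)" by (simp add: T_def ev_sum[symmetric])
      also have "\<dots>=(\<Sum>d\<in>?Dg. \<Sum>i<r. ev (s d i) x * F i x $ j)" by (intro sum.cong refl) (simp add: s)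
      also have "\<dots>=(\<Sum>i<r. \<Sum>d\<in>?Dg. ev (s d i) x * F i x $ j)" by (rule sum.swap)
      also have "\<dots>=(\<Sum>i<r. ev (c i) x * ev (D i (Var j)) x)"
       by (intro sum.cong refl) (simp add: c_def ev_sum sum_distrib_right evD)
      also have "\<dots>=ev ((\<Sum>i<r. der_scale (c i) (D i)) (Var j)) x"
       by (simp add: sum_fun_at der_scale_def ev_sum ev_mult)
      finally show "ev (w (Var j)) x=ev ((\<Sum>i<r. der_scale (c i) (D i)) (Var j)) x" .
     qed
    qed
    also have "\<dots>\<in>der.span ?B" by (intro der.span_sum der.span_scale der.span_base) auto
    finally show "w\<in>der.span ?B" .
   qed
  qed
 qed
qed

section \<open>Rigidity of the intersection lattice\<close>

lemma Inter_hyp_subset_iff: "(\<Inter>T\<in>S. hyp T)\<subseteq>hyp v \<longleftrightarrow> v\<in>span S"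
proof
 assume s: "(\<Inter>T\<in>S. hyp T)\<subseteq>hyp v"
 show "v\<in>span S"
 proof (rule in_spanI)
  fix w assume "\<forall>y\<in>S. y\<cdot>w=0"
  hence "w\<in>(\<Inter>T\<in>S. hyp T)" by (simp add: hyp_def)
  hence "w\<in>hyp v" using s by blast
  thus "w\<cdot>v=0" by (simp add: hyp_def inner_commute)
 qed
next
 assume "v\<in>span S"
 thus "(\<Inter>T\<in>S. hyp T)\<subseteq>hyp v"
 proof (induction rule: span_induct_alt)
  case (step c x y)
  thus ?case by (auto simp: hyp_def inner_add_left)
 qed (simp add: hyp_def)
qed

lemma hyp_subset_eq:
 assumes "hyp a\<subseteq>hyp b" "b~=0"
 shows "hyp a=hyp b"
proof -
 have "b\<in>span {a}" using assms(1) Inter_hyp_subset_iff[of "{a}" b] by simp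
 then obtain c where c: "b=c*\<^sub>Ra" unfolding in_span1 by blast
 hence "c~=0" using assms(2) by auto
 thus ?thesis unfolding c by (simp add: hyp_def)
qed

lemma linear_hyperplane_hyp: "linear_hyperplane H \<longleftrightarrow> (\<exists>a. a~=0 \<and> H=hyp a)"
 by (simp add: linear_hyperplane_def hyp_def)

lemma hyp_neq_UNIV: "a~=0 ==> hyp a~=UNIV"
proof
 assume "a~=0" "hyp a=UNIV"
 hence "a\<in>hyp a" by simp
 thus False using \<open>a \<noteq> 0\<close> by (simp add: hyp_def)
qed

lemma lattice_Inter: "S\<subseteq>intersection_lattice \<A> ==> \<Inter>S\<in>intersection_lattice \<A>"
proof -
 assume S: "S\<subseteq>intersection_lattice \<A>"
 let ?C = "{H\<in>\<A>. \<exists>X\<in>S. X\<subseteq>H}"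
 have "\<Inter>S=\<Inter>?C"
 proof (intro subset_antisym subsetI)
  fix x assume x: "x\<in>\<Inter>?C"
  show "x\<in>\<Inter>S"
  proof
   fix X assume X: "X\<in>S"
   then obtain B where B: "X=\<Inter>B" "B\<subseteq>\<A>" using S unfolding intersection_lattice_def by blast
   have "B\<subseteq>?C" using B X by blast
   thus "x\<in>X" using x B(1) by blast
  qed
 qed blast
 thus ?thesis unfolding intersection_lattice_def by blast
qed

lemma lattice_mem: "H\<in>\<A> ==> H\<in>intersection_lattice \<A>"
 unfolding intersection_lattice_def by (rule CollectI, rule exI[of _ "{H}"]) simp

locale lattice_iso =
 fixes \<A> :: "'v::euclidean_space set set" and \<B> :: "'w::euclidean_space set set" and f :: "'v set => 'w set"
 assumes A: "arrangement \<A>" and B: "arrangement \<B>"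
  and bij: "bij_betw f (intersection_lattice \<A>) (intersection_lattice \<B>)"
  and ord: "\<And>X Y. X\<in>intersection_lattice \<A> ==> Y\<in>intersection_lattice \<A> ==> Y\<subseteq>X \<longleftrightarrow> f Y\<subseteq>f X"
begin

lemma f_in: "X\<in>intersection_lattice \<A> ==> f X\<in>intersection_lattice \<B>" using bij by (auto simp: bij_betw_def)

lemma f_Inter:
 assumes "S\<subseteq>intersection_lattice \<A>"
 shows "f (\<Inter>S)=\<Inter>(f ` S)"
proof
 have S: "\<Inter>S\<in>intersection_lattice \<A>" by (rule lattice_Inter[OF assms])
 show "f (\<Inter>S)\<subseteq>\<Inter>(f ` S)"
 proof (rule Inter_greatest)
  fix Y assume "Y\<in>f ` S"
  then obtain X where X: "X\<in>S" "Y=f X" by blast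
  show "f (\<Inter>S)\<subseteq>Y" unfolding X(2) using ord[OF _ S, of X] X(1) assms by blast
 qed
 have "f ` S\<subseteq>intersection_lattice \<B>" using f_in assms by blast
 hence "\<Inter>(f ` S)\<in>f ` intersection_lattice \<A>" using lattice_Inter bij by (auto simp: bij_betw_def)
 then obtain Y where Y: "\<Inter>(f ` S)=f Y" "Y\<in>intersection_lattice \<A>" by blast
 have "Y\<subseteq>X" if X: "X\<in>S" for X
 proof -
  have XL: "X\<in>intersection_lattice \<A>" using X assms by blast
  have "f Y\<subseteq>f X" unfolding Y(1)[symmetric] using X by blast
  thus ?thesis using ord[OF XL Y(2)] by simp
 qed
 hence "Y\<subseteq>\<Inter>S" by blast
 thus "\<Inter>(f ` S)\<subseteq>f (\<Inter>S)" unfolding Y(1) using ord[OF S Y(2)] by simp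
qed

lemma f_UNIV: "f UNIV=UNIV" using f_Inter[of "{}"] by simp

lemma below:
 assumes "arrangement \<C>" "X\<in>intersection_lattice \<C>" "X~=UNIV"
 shows "\<exists>H\<in>\<C>. X\<subseteq>H"
proof -
 obtain D where D: "X=\<Inter>D" "D\<subseteq>\<C>" using assms(2) unfolding intersection_lattice_def by blast
 hence "D~={}" using assms(3) by auto
 thus ?thesis using D by blast
qed

text \<open>Hyperplanes are recognized by the order alone: they are the maximal members of the
  lattice other than the whole space.\<close>

lemma maps_hyperplane:
 assumes H: "H\<in>\<A>"
 shows "f H\<in>\<B>"
proof -
 have U: "UNIV\<in>intersection_lattice \<A>" using lattice_Inter[of "{}" \<A>] by simp
 obtain a where a: "a~=0" "H=hyp a" using A H unfolding arrangement_def linear_hyperplane_hyp by blast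
 have HL: "H\<in>intersection_lattice \<A>" by (rule lattice_mem[OF H])
 have inj: "inj_on f (intersection_lattice \<A>)" using bij by (simp add: bij_betw_def)
 have "f H~=UNIV" using inj_onD[OF inj _ HL U] f_UNIV a hyp_neq_UNIV by metis
 then obtain K where K: "K\<in>\<B>" "f H\<subseteq>K" using below[OF B f_in[OF HL]] by blast
 have "K\<in>f ` intersection_lattice \<A>" using lattice_mem[OF K(1)] bij by (simp add: bij_betw_def)
 then obtain X where X: "K=f X" "X\<in>intersection_lattice \<A>" by blast
 obtain b where b: "b~=0" "K=hyp b" using B K(1) unfolding arrangement_def linear_hyperplane_hyp by blast
 have "X~=UNIV" using X(1) f_UNIV b hyp_neq_UNIV by metis
 then obtain H' where H': "H'\<in>\<A>" "X\<subseteq>H'" using below[OF A X(2)] by blast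
 have HX: "H\<subseteq>X" using ord[OF X(2) HL] K(2) X(1) by simp
 obtain a' where a': "a'~=0" "H'=hyp a'" using A H'(1) unfolding arrangement_def linear_hyperplane_hyp by blast
 have "H=H'" using hyp_subset_eq[of a a'] HX H'(2) a a' by auto
 hence "X=H" using HX H'(2) by blast
 thus ?thesis using K(1) X(1) by simp
qed

end

text \<open>A lattice isomorphism is an isomorphism of the linear matroids of the normals.\<close>

lemma lattice_matroid:
 fixes \<A> :: "'w::euclidean_space set set" and N :: "'u::euclidean_space set" and \<kappa> :: "'w => 'u"
 assumes A: "arrangement \<A>" and N: "finite N" "0\<notin>N" and \<kappa>: "linear \<kappa>" "surj \<kappa>"
  and iso: "lattice_isomorphic (intersection_lattice \<A>) (intersection_lattice ((%v. {x. v\<cdot>\<kappa> x=0}) ` N))"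
 shows "\<exists>m. \<A>=hyp ` m ` N \<and> (\<forall>v\<in>N. \<forall>S\<subseteq>N. v\<in>span S \<longleftrightarrow> m v\<in>span (m ` S))"
proof -
 let ?H = "%v. {x. v\<cdot>\<kappa> x=0}" and ?L = intersection_lattice
 let ?B = "?H ` N"
 have H: "?H v=hyp (adjoint \<kappa> v)" for v
  unfolding hyp_def using adjoint_works[OF \<kappa>(1)] by (simp add: inner_commute)
 have sub: "(\<Inter>s\<in>S. ?H s)\<subseteq>?H v \<longleftrightarrow> v\<in>span S" for S v
 proof -
  have "(\<Inter>s\<in>S. ?H s)\<subseteq>?H v \<longleftrightarrow> (\<Inter>s\<in>S. hyp s)\<subseteq>hyp v"
  proof
   assume l: "(\<Inter>s\<in>S. ?H s)\<subseteq>?H v"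
   show "(\<Inter>s\<in>S. hyp s)\<subseteq>hyp v"
   proof
    fix y assume y: "y\<in>(\<Inter>s\<in>S. hyp s)"
    obtain x where x: "y=\<kappa> x" using \<kappa>(2) by (rule surjE)
    have "x\<in>(\<Inter>s\<in>S. ?H s)" using y x by (simp add: hyp_def)
    thus "y\<in>hyp v" using l x by (auto simp: hyp_def)
   qed
  next
   assume r: "(\<Inter>s\<in>S. hyp s)\<subseteq>hyp v"
   show "(\<Inter>s\<in>S. ?H s)\<subseteq>?H v"
   proof
    fix x assume "x\<in>(\<Inter>s\<in>S. ?H s)"
    hence "\<kappa> x\<in>(\<Inter>s\<in>S. hyp s)" by (simp add: hyp_def)
    thus "x\<in>?H v" using r by (auto simp: hyp_def)
   qed
  qed
  thus ?thesis unfolding Inter_hyp_subset_iff .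
 qed
 have Bar: "arrangement ?B" unfolding arrangement_def linear_hyperplane_hyp
 proof (intro conjI ballI)
  show "finite ?B" using N(1) by simp
  fix K assume "K\<in>?B"
  then obtain v where v: "v\<in>N" "K=?H v" by blast
  have "adjoint \<kappa> v~=0"
  proof
   assume "adjoint \<kappa> v=0"
   hence "(\<Inter>s\<in>{}. ?H s)\<subseteq>?H v" unfolding H by (simp add: hyp_0)
   thus False using sub[of "{}" v] v(1) N(2) by simp
  qed
  thus "\<exists>a. a~=0 \<and> K=hyp a" using v(2) H by blast
 qed
 obtain f where f: "bij_betw f (?L \<A>) (?L ?B)" "\<forall>X\<in>?L \<A>. \<forall>Y\<in>?L \<A>. X \<supseteq> Y \<longleftrightarrow> f X \<supseteq> f Y"
  using iso unfolding lattice_isomorphic_def by (elim exE conjE)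
 interpret F: lattice_iso \<A> ?B f by unfold_locales (use A Bar f in auto)
 define g where "g=inv_into (?L \<A>) f"
 have gb: "bij_betw g (?L ?B) (?L \<A>)" unfolding g_def by (rule bij_betw_inv_into[OF f(1)])
 have fg: "f (g Y)=Y" if "Y\<in>?L ?B" for Y unfolding g_def by (rule bij_betw_inv_into_right[OF f(1) that])
 have gf: "g (f X)=X" if "X\<in>?L \<A>" for X unfolding g_def by (rule bij_betw_inv_into_left[OF f(1) that])
 interpret G: lattice_iso ?B \<A> g
 proof
  fix X Y assume XY: "X\<in>?L ?B" "Y\<in>?L ?B"
  have "g X\<in>?L \<A>" "g Y\<in>?L \<A>" using XY gb by (auto simp: bij_betw_def)
  from F.ord[OF this] show "Y\<subseteq>X \<longleftrightarrow> g Y\<subseteq>g X" using fg XY by simp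
 qed (use A Bar gb in auto)
 have gB: "\<A>=g ` ?B"
 using gf lattice_mem G.maps_hyperplane subset_antisym subsetI F.maps_hyperplane imageI by fastforce
 have "\<forall>v\<in>N. \<exists>a. a~=0 \<and> g (?H v)=hyp a"
 proof
  fix v assume "v\<in>N"
  hence "g (?H v)\<in>\<A>" using G.maps_hyperplane by blast
  thus "\<exists>a. a~=0 \<and> g (?H v)=hyp a" using A unfolding arrangement_def linear_hyperplane_hyp by blast
 qed
 from bchoice[OF this] obtain m where m: "\<forall>v\<in>N. m v~=0 \<and> g (?H v)=hyp (m v)" by (elim exE)
 have HL: "?H v\<in>?L ?B" if "v\<in>N" for v by (rule lattice_mem) (use that in blast)
 show ?thesis
 proof (intro exI[of _ m] conjI ballI allI impI)
  show "\<A>=hyp ` m ` N" unfolding gB image_image by (rule image_cong) (use m in auto)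
  fix v S assume v: "v\<in>N" and S: "S\<subseteq>N"
  have SL: "?H ` S\<subseteq>?L ?B" using HL S by blast
  have "v\<in>span S \<longleftrightarrow> \<Inter>(?H ` S)\<subseteq>?H v" using sub[of S v] by simp
  also have "\<dots> \<longleftrightarrow> g (\<Inter>(?H ` S))\<subseteq>g (?H v)" by (rule G.ord[OF HL[OF v] lattice_Inter[OF SL]])
  also have "g (\<Inter>(?H ` S))=\<Inter>(g ` ?H ` S)" by (rule G.f_Inter[OF SL])
  also have "g ` ?H ` S=hyp ` m ` S" unfolding image_image by (rule image_cong) (use m S in auto)
  also have "g (?H v)=hyp (m v)" using m v by blast
  also have "\<Inter>(hyp ` m ` S)\<subseteq>hyp (m v) \<longleftrightarrow> m v\<in>span (m ` S)" by (rule Inter_hyp_subset_iff)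
  finally show "v\<in>span S \<longleftrightarrow> m v\<in>span (m ` S)" .
 qed
qed

section \<open>Reconstruction of the Catalan normals from their linear dependences\<close>

definition catn :: "'v::euclidean_space set => 'v => nat => ('v \<times> real) set" where
 "catn R p k=insert (0, 1) {(c, real_of_int j) | c j. c\<in>pos R p \<and> \<bar>j\<bar>\<le>int k}"

locale rigid = rsys R p for R :: "'v::euclidean_space set" and p :: 'v +
 fixes k :: nat and m :: "'v \<times> real => 'w::euclidean_space"
 assumes irr: "irreducible_roots R" and dim2: "dim R\<ge>2" and full: "span R=UNIV" and k: "k\<ge>1"
  and dimW: "DIM('w)=DIM('v) + 1"
  and mat: "\<And>v S. v\<in>catn R p k ==> S\<subseteq>catn R p k ==> v\<in>span S \<longleftrightarrow> m v\<in>span (m ` S)"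
begin

abbreviation "N \<equiv> catn R p k"
abbreviation (input) z :: "'v \<times> real" where "z \<equiv> (0, 1)"
abbreviation (input) K :: "'v => int => 'v \<times> real" where "K c j \<equiv> (c, real_of_int j)"

lemma zN: "z\<in>N" by (simp add: catn_def)
lemma KN: "c\<in>Pos ==> \<bar>j\<bar>\<le>int k ==> K c j\<in>N" by (auto simp: catn_def)

lemma m_dep: "v\<in>N ==> a\<in>N ==> b\<in>N ==> v\<in>span {a, b} ==> m v\<in>span {m a, m b}"
 using mat[of v "{a, b}"] by simp

lemma dimPsi: "dim R=DIM('v)" using full dim_span[of R] by simp

text \<open>The simple roots at level 0 together with \<open>z\<close> form a basis, which leaves
  the scaling of each axis free. Matching level 1 as well fixes it.\<close>

lemma base_map:
 "\<exists>S. linear S \<and> inj S \<and> surj S \<and> m z=S z \<and>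
  (\<forall>u\<in>Smp. m (u, 0)\<in>span {S (u, 0)} \<and> m (u, 1)\<in>span {S (u, 1)})"
proof -
 have uN: "(u, 0)\<in>N" "(u, 1)\<in>N" if "u\<in>Smp" for u
  using KN[OF smpD[OF that], of 0] KN[OF smpD[OF that], of 1] k by simp_all
 have "\<forall>u\<in>Smp. \<exists>x y. x~=0 \<and> y~=0 \<and> m (u, 1)=x*\<^sub>Rm (u, 0) + y*\<^sub>Rm z"
 proof
  fix u assume u: "u\<in>Smp"
  have u0: "u~=0" using nz(1)[OF posD(1)[OF smpD[OF u]]] .
  have "(u, 1)\<in>span {(u, 0), z}" unfolding in_span2 by (intro exI[of _ 1]) simp
  from m_dep[OF uN(2)[OF u] uN(1)[OF u] zN this] obtain x y where
   xy: "m (u, 1)=x*\<^sub>Rm (u, 0) + y*\<^sub>Rm z" unfolding in_span2 by blast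
  have "x~=0"
  proof
   assume "x=0"
   hence "m (u, 1)\<in>span (m ` {z})" unfolding xy by (simp add: span_mul span_base)
   hence "(u, 1)\<in>span {z}" using mat[OF uN(2)[OF u], of "{z}"] zN by simp
   thus False unfolding in_span1 using u0 by auto
  qed
  moreover have "y~=0"
  proof
   assume "y=0"
   hence "m (u, 1)\<in>span (m ` {(u, 0)})" unfolding xy by (simp add: span_mul span_base)
   hence "(u, 1::real)\<in>span {(u, 0)}" using mat[OF uN(2)[OF u], of "{(u, 0)}"] uN(1)[OF u] by simp
   thus False unfolding in_span1 by auto
  qed
  ultimately show "\<exists>x y. x~=0 \<and> y~=0 \<and> m (u, 1)=x*\<^sub>Rm (u, 0) + y*\<^sub>Rm z" using xy by blast
 qed
 from bchoice[OF this] obtain x where "\<forall>u\<in>Smp. \<exists>y. x u~=0 \<and> y~=0 \<and> m (u, 1)=x u*\<^sub>Rm (u, 0) + y*\<^sub>Rm z"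
  by (elim exE)
 from bchoice[OF this] obtain y where xy: "\<forall>u\<in>Smp. x u~=0 \<and> y u~=0 \<and> m (u, 1)=x u*\<^sub>Rm (u, 0) + y u*\<^sub>Rm z"
  by (elim exE)
 let ?i = "%u. (u, 0::real)"
 define B where "B=insert z (?i ` Smp)"
 have BN: "B\<subseteq>N" unfolding B_def using zN uN(1) by blast
 have zi: "z\<notin>span (?i ` Smp)"
 proof
  have "snd w=0" if "w\<in>span (?i ` Smp)" for w using that
  proof (induction rule: span_induct_alt)
   case (step c x y)
   hence "snd x=0" by (elim imageE) simp
   thus ?case using step(2) by simp
  qed simp
  moreover assume "z\<in>span (?i ` Smp)"
  ultimately have "snd z=0" by blast
  thus False by simp
 qed
 have "linear ?i" by (auto simp: linear_iff)
 hence "independent (?i ` Smp)"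
  by (rule linear_independent_injective_image[OF _ smp_indep]) (auto simp: inj_on_def)
 hence indB: "independent B" unfolding B_def by (rule independent_insertI[OF zi])
 have cB: "card B=DIM('w)"
 proof -
  have "card (?i ` Smp)=card (Smp)" by (rule card_image) (simp add: inj_on_def)
  moreover have "z\<notin>?i ` Smp" by auto
  ultimately show ?thesis unfolding B_def using finS card_smp dimPsi dimW by simp
 qed
 have mi: "m b\<notin>span (m ` (B - {b}))" if b: "b\<in>B" for b
 proof -
  have "b\<notin>span (B - {b})" using indB b unfolding dependent_def by blast
  moreover have "b\<in>N" "B - {b}\<subseteq>N" using b BN by blast+
  ultimately show ?thesis using mat by blast
 qed
 have injm: "inj_on m B"
 proof (rule inj_onI, rule ccontr)
  fix a b assume ab: "a\<in>B" "b\<in>B" "m a=m b" "a~=b"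
  have "m b\<in>m ` (B - {a})" by (rule imageI) (use ab in simp)
  hence "m a\<in>span (m ` (B - {a}))" unfolding ab(3) by (rule span_base)
  thus False using mi[OF ab(1)] by blast
 qed
 have indm: "independent (m ` B)" unfolding dependent_def
 proof
  assume "\<exists>a\<in>m ` B. a\<in>span (m ` B - {a})"
  then obtain b where b: "b\<in>B" "m b\<in>span (m ` B - {m b})" by blast
  have "m ` B - {m b}\<subseteq>m ` (B - {b})" by blast
  from span_mono[OF this] b(2) mi[OF b(1)] show False by blast
 qed
 have "card (m ` B)=DIM('w)" using card_image[OF injm] cB by simp
 hence spm: "span (m ` B)=UNIV" using indm card_eq_dim[of "m ` B" UNIV] by (metis dim_UNIV independent_imp_finite subset_UNIV top.extremum_uniqueI)
 \<comment> \<open>If \<open>m (u, 1)\<close> is \<open>x\<close> times \<open>m (u, 0)\<close> plus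
   \<open>y\<close> times \<open>m z\<close>, then scaling \<open>m (u, 0)\<close> by
   \<open>x / y\<close> makes \<open>m (u, 1)\<close> equal to \<open>y\<close> times
   \<open>S (u, 1)\<close>.\<close>
 define v where "v b=(if b=z then m z else (x (fst b) / y (fst b))*\<^sub>Rm b)" for b
 obtain S where S: "linear S" "\<forall>b\<in>B. S b=v b" using linear_independent_extend[OF indB, of v] by (elim exE conjE)
 have zB: "z\<in>B" and iB: "\<And>u. u\<in>Smp ==> (u, 0)\<in>B" by (auto simp: B_def)
 have Sz: "S z=m z" using S(2) zB by (simp add: v_def)
 have S0: "S (u, 0)=(x u / y u)*\<^sub>Rm (u, 0)" if "u\<in>Smp" for u
  using S(2)[rule_format, OF iB[OF that]] by (simp add: v_def)
 have m0: "m (u, 0)=(y u / x u)*\<^sub>RS (u, 0)" if "u\<in>Smp" for u using xy that by (simp add: S0)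
 have "m ` B\<subseteq>range S"
 proof
  fix w assume "w\<in>m ` B"
  then consider "w=m z" | u where "u\<in>Smp" "w=m (u, 0)" unfolding B_def by blast
  thus "w\<in>range S"
  proof cases
   case 1
   thus ?thesis using Sz by (metis rangeI)
  next
   case 2
   have "w=S ((y u / x u)*\<^sub>R(u, 0))" unfolding linear_scale[OF S(1)] 2(2) by (rule m0[OF 2(1)])
   thus ?thesis by blast
  qed
 qed
 hence "span (m ` B)\<subseteq>range S" by (rule span_minimal[OF _ linear_subspace_image[OF S(1) subspace_UNIV]])
 hence surj: "surj S" using spm by blast
 have inj: "inj S" by (rule linear_surjective_imp_injective[OF S(1) surj]) (simp add: dimW)
 show ?thesis
 proof (intro exI[of _ S] conjI ballI S(1) surj inj)
  show "m z=S z" using Sz by simp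
  fix u assume u: "u\<in>Smp"
  show "m (u, 0)\<in>span {S (u, 0)}" unfolding m0[OF u] by (simp add: span_mul span_base)
  have "S (u, 1)=S ((u, 0) + z)" by simp
  also have "\<dots>=S (u, 0) + S z" by (rule linear_add[OF S(1)])
  finally have "S (u, 1)=(x u / y u)*\<^sub>Rm (u, 0) + m z" unfolding S0[OF u] Sz .
  hence "m (u, 1)=y u*\<^sub>RS (u, 1)" using xy u by (simp add: scaleR_add_right)
  thus "m (u, 1)\<in>span {S (u, 1)}" by (simp add: span_mul span_base)
 qed
qed

end

locale rigid_map = rigid R p k m
 for R :: "'v::euclidean_space set" and p :: 'v and k :: nat and m :: "'v \<times> real => 'w::euclidean_space" +
 fixes S :: "'v \<times> real => 'w"
 assumes S: "linear S" "inj S" and Sz: "m z=S z"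
  and Ss: "\<And>a. a\<in>smp R p ==> m (a, 0)\<in>span {S (a, 0)} \<and> m (a, 1)\<in>span {S (a, 1)}"
begin

definition "gd1 c j \<longleftrightarrow> c\<in>Pos \<and> \<bar>j\<bar>\<le>int k \<and> m (K c j)\<in>span {S (K c j)}"

lemma span2_image:
 assumes "v\<in>N" "a\<in>N" "b\<in>N" "v\<in>span {a, b}" "m a\<in>span {S a}" "m b\<in>span {S b}"
 shows "m v\<in>S ` span {a, b}"
proof -
 have "m v\<in>span {m a, m b}" by (rule m_dep[OF assms(1-4)])
 moreover have "span {m a, m b}\<subseteq>span (S ` {a, b})"
 proof (rule span_minimal[OF _ subspace_span])
  have "span {S a}\<subseteq>span (S ` {a, b})" "span {S b}\<subseteq>span (S ` {a, b})" by (auto intro!: span_mono)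
  thus "{m a, m b}\<subseteq>span (S ` {a, b})" using assms(5,6) by blast
 qed
 ultimately show ?thesis unfolding linear_span_image[OF S(1)] by blast
qed

text \<open>Only linear dependences are preserved by \<open>m\<close>. If \<open>v\<close> spans the
  intersection of two planes generated by vectors on which \<open>m\<close> and \<open>S\<close>
  already agree up to scalars, they agree on \<open>v\<close> too.\<close>

lemma two_planes:
 assumes N: "v\<in>N" "a\<in>N" "b\<in>N" "c\<in>N" "d\<in>N"
  and v: "v\<in>span {a, b}" "v\<in>span {c, d}"
  and g: "m a\<in>span {S a}" "m b\<in>span {S b}" "m c\<in>span {S c}" "m d\<in>span {S d}"
  and i: "\<And>x. x\<in>span {a, b} ==> x\<in>span {c, d} ==> x\<in>span {v}"
 shows "m v\<in>span {S v}"
proof -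
 obtain x where x: "x\<in>span {a, b}" "m v=S x" using span2_image[OF N(1-3) v(1) g(1,2)] by blast
 obtain y where y: "y\<in>span {c, d}" "m v=S y" using span2_image[OF N(1,4,5) v(2) g(3,4)] by blast
 have "x=y" using S(2) x(2) y(2) by (auto dest: injD)
 hence "x\<in>span {v}" using i x(1) y(1) by blast
 hence "S x\<in>S ` span {v}" by (rule imageI)
 thus ?thesis unfolding x(2) using linear_span_image[OF S(1), of "{v}"] by simp
qed

text \<open>One of the two planes contains \<open>z\<close> and hence every level of the root
  \<open>d\<close>. So after one level of \<open>d\<close>, any other needs only a single further
  dependence.\<close>

lemma with_z:
 assumes a: "gd1 a i" "gd1 b j" and ab: "a\<notin>span {b}" "b\<notin>span {a}"
  and d: "gd1 d n'" "\<bar>n\<bar>\<le>int k" and v: "K d n\<in>span {K a i, K b j}"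
 shows "gd1 d n"
proof -
 have "m (K d n)\<in>span {S (K d n)}"
 proof (rule two_planes[of _ "K a i" "K b j" z "K d n'"])
  show "K d n\<in>N" "K a i\<in>N" "K b j\<in>N" "z\<in>N" "K d n'\<in>N" using a d KN zN by (auto simp: gd1_def)
  show "m (K a i)\<in>span {S (K a i)}" "m (K b j)\<in>span {S (K b j)}" "m (K d n')\<in>span {S (K d n')}"
   using a d by (auto simp: gd1_def)
  show "m z\<in>span {S z}" unfolding Sz by (simp add: span_base)
  show "K d n\<in>span {K a i, K b j}" by (rule v)
  show "K d n\<in>span {z, K d n'}" unfolding in_span2
   by (intro exI[of _ "real_of_int (n - n')"] exI[of _ 1]) simp
  fix x assume x: "x\<in>span {K a i, K b j}" "x\<in>span {z, K d n'}"
  obtain s t where st: "x=s*\<^sub>Rz + t*\<^sub>RK d n'" using x(2) unfolding in_span2 by blast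
  define s' where "s'=s - t * real_of_int (n - n')"
  have x2: "x=s'*\<^sub>Rz + t*\<^sub>RK d n" unfolding st s'_def by (simp add: algebra_simps)
  have "x - t*\<^sub>RK d n\<in>span {K a i, K b j}" by (intro span_diff span_scale x(1) v)
  then obtain y h where "s'*\<^sub>Rz=y*\<^sub>RK a i + h*\<^sub>RK b j" unfolding x2 in_span2 by auto
  hence e: "y*\<^sub>Ra + h*\<^sub>Rb=0" "s'=y * real_of_int i + h * real_of_int j" by simp_all
  have "y=0"
  proof (rule ccontr)
   assume "y~=0"
   have "y*\<^sub>Ra=(- h)*\<^sub>Rb" using e(1) by (simp add: eq_neg_iff_add_eq_0)
   hence "(1 / y)*\<^sub>R(y*\<^sub>Ra)=(1 / y)*\<^sub>R((- h)*\<^sub>Rb)" by simp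
   hence "a=(- h / y)*\<^sub>Rb" using \<open>y \<noteq> 0\<close> by simp
   thus False using ab(1) unfolding in_span1 by blast
  qed
  moreover have "b~=0" using ab(2) span_zero by blast
  ultimately have "s'=0" using e by simp
  thus "x\<in>span {K d n}" unfolding x2 in_span1 by auto
 qed
 thus ?thesis using d by (simp add: gd1_def)
qed

lemma pos_indep: "a\<in>Pos ==> b\<in>Pos ==> a~=b ==> a\<notin>span {b} \<and> b\<notin>span {a}"
 using pos_not_par[of a b] pos_not_par[of b a] by simp

text \<open>Level 1 of the sum arises as \<open>1 + 0\<close> and as \<open>0 + 1\<close>, which
  gives two planes through it; level 0 then follows by \<open>with_z\<close>.\<close>

lemma sum_step:
 assumes "gd1 a 0" "gd1 a 1" "gd1 b 0" "gd1 b 1" "a + b\<in>Pos" "a~=b"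
 shows "gd1 (a + b) 0" "gd1 (a + b) 1"
proof -
 have ab: "a\<in>Pos" "b\<in>Pos" using assms by (auto simp: gd1_def)
 have ind: "a\<notin>span {b}" "b\<notin>span {a}" using pos_indep[OF ab assms(6)] by auto
 have k1: "\<bar>1\<bar>\<le>int k" using k by simp
 have "m (K (a + b) 1)\<in>span {S (K (a + b) 1)}"
 proof (rule two_planes[of _ "K a 1" "K b 0" "K a 0" "K b 1"])
  show "K (a + b) 1\<in>N" "K a 1\<in>N" "K b 0\<in>N" "K a 0\<in>N" "K b 1\<in>N"
   using ab assms(5) KN[of _ 0] KN[OF _ k1] by simp_all
  show "K (a + b) 1\<in>span {K a 1, K b 0}" "K (a + b) 1\<in>span {K a 0, K b 1}"
   unfolding in_span2 by (auto intro!: exI[of _ 1])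
  show "m (K a 1)\<in>span {S (K a 1)}" "m (K b 0)\<in>span {S (K b 0)}" "m (K a 0)\<in>span {S (K a 0)}" "m (K b 1)\<in>span {S (K b 1)}"
   using assms(1-4) by (auto simp: gd1_def)
  fix x assume x: "x\<in>span {K a 1, K b 0}" "x\<in>span {K a 0, K b 1}"
  obtain s t where st: "x=s*\<^sub>RK a 1 + t*\<^sub>RK b 0" using x(1) unfolding in_span2 by blast
  obtain s' t' where st': "x=s'*\<^sub>RK a 0 + t'*\<^sub>RK b 1" using x(2) unfolding in_span2 by blast
  have e: "s*\<^sub>Ra + t*\<^sub>Rb=s'*\<^sub>Ra + t'*\<^sub>Rb" "s=t'"
  proof -
   have "s*\<^sub>RK a 1 + t*\<^sub>RK b 0=s'*\<^sub>RK a 0 + t'*\<^sub>RK b 1" by (simp only: st[symmetric] st'[symmetric])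
   from arg_cong[OF this, of fst] arg_cong[OF this, of snd]
   show "s*\<^sub>Ra + t*\<^sub>Rb=s'*\<^sub>Ra + t'*\<^sub>Rb" "s=t'" by (simp only: fst_add fst_scaleR fst_conv, simp)
  qed
  have "(s - s')*\<^sub>Ra=(t' - t)*\<^sub>Rb" using e(1) by (simp add: algebra_simps)
  moreover have "t' - t=0"
  proof (rule ccontr)
   assume "t' - t~=0"
   have "(1 / (t' - t))*\<^sub>R((s - s')*\<^sub>Ra)=(1 / (t' - t))*\<^sub>R((t' - t)*\<^sub>Rb)"
    by (simp only: \<open>(s - s') *\<^sub>R a = (t' - t) *\<^sub>R b\<close>)
   hence "b=((s - s') / (t' - t))*\<^sub>Ra" using \<open>t' - t \<noteq> 0\<close> by simp
   thus False using ind(2) unfolding in_span1 by blast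
  qed
  ultimately have "t=s" using e(2) by simp
  hence "x=s*\<^sub>RK (a + b) 1" unfolding st by (simp add: algebra_simps)
  thus "x\<in>span {K (a + b) 1}" unfolding in_span1 by blast
 qed
 thus 1: "gd1 (a + b) 1" using assms(5) k1 by (simp add: gd1_def)
 show "gd1 (a + b) 0" by (rule with_z[OF assms(1,3) ind 1]) (auto simp: in_span2 intro!: exI[of _ 1])
qed

lemma pos01: "c\<in>Pos ==> gd1 c 0 \<and> gd1 c 1"
proof -
 assume c: "c\<in>Pos"
 have k1: "\<bar>1\<bar>\<le>int k" using k by simp
 have "gd1 c 0 \<and> gd1 c 1" if "c\<in>Pos" "ht c=real n" for c n using that
 proof (induction n arbitrary: c rule: less_induct)
  case (less n)
  show ?case
  proof (cases "c\<in>Smp")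
   case True
   thus ?thesis using Ss[OF True] smpD[OF True] k1 by (simp add: gd1_def)
  next
   case False
   obtain b where b: "b\<in>Smp" "c - b\<in>Pos" using nonsimple_descend[OF less(2) False] by blast
   obtain n' where n': "(c - b)\<cdot>rho R p=real n'" using ht_nat[OF b(2)] by blast
   have "n' < n" using n' less(3) rho_smp(2)[OF b(1)] by (simp add: inner_diff_left)
   from less(1)[OF this b(2) n'] have g: "gd1 (c - b) 0" "gd1 (c - b) 1" by auto
   have a: "gd1 b 0" "gd1 b 1" using Ss[OF b(1)] smpD[OF b(1)] k1 by (simp_all add: gd1_def)
   have ne: "c - b~=b"
   proof
    assume e: "c - b=b"
    hence "c=2*\<^sub>Rb" by (simp add: scaleR_2 diff_eq_eq)
    hence "c\<in>span {b}" unfolding in_span1 by blast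
    hence "c=b" by (rule smp_multiple[OF less(2) b(1)])
    thus False using False b(1) by simp
   qed
   have e: "(c - b) + b=c" by simp
   show ?thesis using sum_step[OF g a _ ne] less(2) unfolding e by blast
  qed
 qed
 thus ?thesis using c ht_nat[OF c] by blast
qed

text \<open>Levels add along the relation for the sum and subtract back. Level \<open>n + 1\<close>
  of the sum comes from levels \<open>n\<close> and 1; then \<open>a\<close> and \<open>b\<close> at
  level \<open>n + 1\<close> come from it and level 0 of the other. So no level beyond
  \<open>k\<close> is used. Level -1 arises as \<open>0 - 1\<close>.\<close>

lemma triple_all:
 assumes a: "a\<in>Pos" and b: "b\<in>Pos" and ab: "a + b\<in>Pos" "a~=b" and n: "n\<le>k"
 shows "gd1 a (int n) \<and> gd1 b (int n) \<and> gd1 (a + b) (int n) \<and> gd1 a (- int n) \<and> gd1 b (- int n) \<and> gd1 (a + b) (- int n)"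
proof -
 let ?c = "a + b"
 have g: "gd1 a 0" "gd1 a 1" "gd1 b 0" "gd1 b 1" "gd1 ?c 0" "gd1 ?c 1" using pos01 a b ab by auto
 have iab: "a\<notin>span {b}" "b\<notin>span {a}" using pos_indep[OF a b ab(2)] by auto
 have "?c~=b" "?c~=a" using nz(1)[OF posD(1)[OF a]] nz(1)[OF posD(1)[OF b]] by auto
 hence icb: "?c\<notin>span {b}" "b\<notin>span {?c}" and ica: "?c\<notin>span {a}" "a\<notin>span {?c}"
  using pos_indep[OF ab(1) b] pos_indep[OF ab(1) a] by auto
 have up: "gd1 ?c (i + j)" if "gd1 a i" "gd1 b j" "\<bar>i + j\<bar>\<le>int k" for i j
  by (rule with_z[OF that(1,2) iab g(5) that(3)]) (auto simp: in_span2 intro!: exI[of _ 1])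
 have da: "gd1 a (i - j)" if "gd1 ?c i" "gd1 b j" "\<bar>i - j\<bar>\<le>int k" for i j
  by (rule with_z[OF that(1,2) icb g(1) that(3)]) (unfold in_span2, rule exI[of _ 1], rule exI[of _ "- 1"], simp)
 have db: "gd1 b (i - j)" if "gd1 ?c i" "gd1 a j" "\<bar>i - j\<bar>\<le>int k" for i j
  by (rule with_z[OF that(1,2) ica g(3) that(3)]) (unfold in_span2, rule exI[of _ 1], rule exI[of _ "- 1"], simp)
 have k1: "\<bar>0 - 1\<bar>\<le>int k" using k by simp
 have ma: "gd1 a (- 1)" and mb: "gd1 b (- 1)" using da[OF g(5,4) k1] db[OF g(5,2) k1] by simp_all
 show ?thesis using n
 proof (induction n)
  case 0
  thus ?case using g by simp
 next
  case (Suc n)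
  hence ih: "gd1 a (int n)" "gd1 b (int n)" "gd1 ?c (int n)" "gd1 a (- int n)" "gd1 b (- int n)" "gd1 ?c (- int n)"
   by auto
  have b1: "\<bar>int n + 1\<bar>\<le>int k" "\<bar>- int n + - 1\<bar>\<le>int k" using Suc(2) by auto
  have c1: "gd1 ?c (int n + 1)" "gd1 ?c (- int n + - 1)" using up[OF ih(1) g(4) b1(1)] up[OF ih(4) mb b1(2)] by auto
  have "gd1 a (int n + 1 - 0)" "gd1 a (- int n + - 1 - 0)" by (rule da[OF c1(1) g(3)], use b1 in simp, rule da[OF c1(2) g(3)], use b1 in simp)
  moreover have "gd1 b (int n + 1 - 0)" "gd1 b (- int n + - 1 - 0)" by (rule db[OF c1(1) g(1)], use b1 in simp, rule db[OF c1(2) g(1)], use b1 in simp)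
  ultimately show ?case using c1 by (simp add: algebra_simps)
 qed
qed

text \<open>Every positive root belongs to a relation of the kind treated in
  \<open>triple_all\<close>: a non-simple root as a sum, a simple one through a non-orthogonal
  simple neighbour, which exists in rank at least two.\<close>

lemma all_good:
 assumes "v\<in>N"
 shows "m v\<in>span {S v}"
proof (cases "v=z")
 case True
 thus ?thesis using Sz by (simp add: span_base)
next
 case False
 then obtain c j where c: "c\<in>Pos" "\<bar>j\<bar>\<le>int k" "v=K c j" using assms by (auto simp: catn_def)
 have jn: "j=int (nat \<bar>j\<bar>) \<or> j=- int (nat \<bar>j\<bar>)" "nat \<bar>j\<bar>\<le>k" using c(2) by auto
 have "gd1 c j"
 proof (cases "c\<in>Smp")
  case False
  obtain a where a: "a\<in>Smp" "c - a\<in>Pos" using nonsimple_descend[OF c(1) False] by blast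
  have ne: "c - a~=a"
  proof
   assume e: "c - a=a"
   hence "c=2*\<^sub>Ra" by (simp add: scaleR_2 diff_eq_eq)
   hence "c\<in>span {a}" unfolding in_span1 by blast
   hence "c=a" by (rule smp_multiple[OF c(1) a(1)])
   thus False using False a(1) by simp
  qed
  have e: "(c - a) + a=c" by simp
  show ?thesis using triple_all[OF a(2) smpD[OF a(1)] _ ne jn(2)] c(1) jn(1) unfolding e by auto
 next
  case True
  have "\<exists>b\<in>Smp. b~=c \<and> c\<cdot>b~=0"
  proof (rule ccontr)
   assume n: "\<not> ?thesis"
   have e: "{c}=Smp" by (rule smp_connected[OF irr]) (use True n in auto)
   have "card (Smp)=1" unfolding e[symmetric] by simp
   thus False unfolding card_smp using dim2 by linarith
  qed
  then obtain b where b: "b\<in>Smp" "b~=c" "c\<cdot>b~=0" by blast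
  have bp: "b\<in>Pos" by (rule smpD[OF b(1)])
  have neg: "c\<cdot>b < 0" using smp_obtuse[OF True b(1)] b(2,3) by force
  have "c~=- b" using posD(2)[OF c(1)] posD(2)[OF bp] by auto
  hence "c + b\<in>R" by (rule root_add[OF rs posD(1)[OF c(1)] posD(1)[OF bp] neg])
  moreover have "(c + b)\<cdot>p > 0" using posD(2)[OF c(1)] posD(2)[OF bp] by (simp add: inner_add_left)
  ultimately have "c + b\<in>Pos" by (simp add: pos_def)
  from triple_all[OF c(1) bp this _ jn(2)] b(2) jn(1) show ?thesis by auto
 qed
 thus ?thesis unfolding c(3) by (simp add: gd1_def)
qed

end

lemma (in rigid) rigidity:
 "\<exists>S. linear S \<and> inj S \<and> surj S \<and> (\<forall>v\<in>N. hyp (m v)=hyp (S v))"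
proof -
 obtain S where S: "linear S" "inj S" "surj S" "m z=S z"
  "\<forall>a\<in>smp R p. m (a, 0)\<in>span {S (a, 0)} \<and> m (a, 1)\<in>span {S (a, 1)}" using base_map by (elim exE conjE)
 interpret R: rigid_map R p k m S
 proof
  show "S (b1 + b2)=S b1 + S b2" "S (r*\<^sub>Rb1)=r*\<^sub>RS b1" for b1 b2 r
   by (rule linear_add[OF S(1)], rule linear_scale[OF S(1)])
  show "inj S" "m z=S z" by (rule S)+
  show "m (a, 0)\<in>span {S (a, 0)} \<and> m (a, 1)\<in>span {S (a, 1)}" if "a\<in>smp R p" for a
   by (rule bspec[OF S(5) that])
 qed
 have "hyp (m v)=hyp (S v)" if v: "v\<in>N" for v
 proof -
  obtain t where t: "m v=t*\<^sub>RS v" using R.all_good[OF v] unfolding in_span1 by blast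
  have "t~=0"
  proof
   assume "t=0"
   hence "m v\<in>span (m ` {})" using t by (simp add: span_zero)
   hence "v\<in>span {}" using mat[OF v, of "{}"] by simp
   hence "v=0" by simp
   thus False using v nz(1) posD(1) by (auto simp: catn_def zero_prod_def)
  qed
  thus ?thesis unfolding t hyp_def by simp
 qed
 thus ?thesis using S by blast
qed

section \<open>Transport to lattice-isomorphic arrangements\<close>

text \<open>Subtracting the Euler field times the quotient of \<open>Z \<cdot> G\<close> by the form
  \<open>Z\<close> moves a tangent field into \<open>hyp Z\<close>, where the given basis
  applies.\<close>

lemma fbas_add_euler:
 fixes Z :: "'a::euclidean_space"
 assumes fb: "fbas (hyp Z) N r e F" and Z: "Z\<in>N" "Z~=0"
 shows "\<exists>e' F'. fbas UNIV N (Suc r) e' F'"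
proof -
 let ?e = "e(r := Suc 0)" and ?F = "F(r := (%x. x))"
 note Fi = fbasD(1-3)[OF fb]
 have "fbas UNIV N (Suc r) ?e ?F" unfolding fbas_def
 proof (intro conjI allI impI)
  fix i assume i: "i < Suc r"
  show "hf (?e i) (?F i)" using Fi(1)[of i] i by (cases "i=r") (auto simp: hf_def hp_linear)
  show "tang N (?F i)" using Fi(3)[of i] i by (cases "i=r") (auto simp: tang_def hyp_def)
 next
  fix d and G :: "'a => 'a" assume G: "hf d G" "tang N G"
  have v: "Z\<cdot>G x=0" if "x\<in>hyp Z" for x using G(2) Z(1) that by (simp add: tang_def)
  have "hp d (%x. Z\<cdot>G x)" using G(1) by (simp add: hf_def)
  hence "\<exists>g. (if d=0 then g=(%_. 0) else hp (d - 1) g) \<and> (\<forall>x. Z\<cdot>G x=(Z\<cdot>x) * g x) \<and> continuous_on UNIV g"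
   by (rule hp_vanish) (rule v)
  then obtain g where g: "if d=0 then g=(%_. 0) else hp (d - 1) g" "\<forall>x. Z\<cdot>G x=(Z\<cdot>x) * g x"
   by (elim exE conjE)
  define G' where "G' x=G x - g x*\<^sub>Rx" for x
  have "hf d (%x. g x*\<^sub>Rx)"
  proof (cases "d=0")
   case True
   thus ?thesis using g(1) by (simp add: hf_def hp_zero)
  next
   case False
   have "hf (Suc 0) (%x::'a. x)" by (simp add: hf_def hp_linear)
   from hf_scale[OF _ this, of "d - 1" g] show ?thesis using g(1) False by simp
  qed
  hence 1: "hf d G'" unfolding G'_def by (rule hf_diff[OF G(1)])
  have 2: "range G'\<subseteq>hyp Z" using g(2) by (auto simp: G'_def hyp_def inner_diff_right)
  have 3: "tang N G'" using G(2) by (auto simp: tang_def G'_def inner_diff_right hyp_def)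
  from fbasD(4)[OF fb 1 2 3] obtain f where
   f: "\<forall>i<r. hq d (e i) (f i)" "\<forall>x. G' x=(\<Sum>i<r. f i x*\<^sub>RF i x)"
   by (elim exE conjE)
  show "\<exists>f. (\<forall>i<Suc r. hq d (?e i) (f i)) \<and>
    (\<forall>x. G x=(\<Sum>i<Suc r. f i x*\<^sub>R?F i x))"
  proof (rule exI[of _ "f(r := g)"], intro conjI allI impI)
   fix i assume i: "i < Suc r"
   show "if ?e i\<le>d then hp (d - ?e i) ((f(r := g)) i) else (f(r := g)) i=(%_. 0)"
   proof (cases "i=r")
    case True
    thus ?thesis using g(1) by (cases "d=0") simp_all
   next
    case False
    thus ?thesis using f(1)[rule_format, of i] i by simp
   qed
  next
   fix x
   have "G x=G' x + g x*\<^sub>Rx" by (simp add: G'_def)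
   also have "G' x=(\<Sum>i<r. (f(r := g)) i x*\<^sub>R?F i x)" unfolding f(2)[rule_format] by (rule sum.cong) auto
   finally show "G x=(\<Sum>i<Suc r. (f(r := g)) i x*\<^sub>R?F i x)" by simp
  qed
 next
  fix f :: "nat => 'a => real" and j x
  assume c: "\<forall>i<Suc r. continuous_on UNIV (f i)" and z: "\<forall>x. (\<Sum>i<Suc r. f i x*\<^sub>R?F i x)=0" and j: "j < Suc r"
  have eq: "(\<Sum>i<r. f i x*\<^sub>RF i x) + f r x*\<^sub>Rx=0" for x
  proof -
   have "(\<Sum>i<r. f i x*\<^sub>R?F i x)=(\<Sum>i<r. f i x*\<^sub>RF i x)" by (rule sum.cong) auto
   thus ?thesis using z[rule_format, of x] by simp
  qed
  have "(Z\<cdot>x) * f r x=0" for x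
  proof -
   have "Z\<cdot>F i x=0" if "i < r" for i using Fi(2)[OF that, of x] by (simp add: hyp_def)
   hence "Z\<cdot>(\<Sum>i<r. f i x*\<^sub>RF i x)=0" by (simp add: inner_sum_right)
   thus ?thesis using arg_cong[OF eq[of x], of "%y. Z\<cdot>y"] by (simp add: inner_add_right mult.commute)
  qed
  hence fr: "f r x=0" for x using hyp_dense[OF Z(2), of "f r"] c by blast
  have s: "(\<Sum>i<r. f i x*\<^sub>RF i x)=0" for x using eq[of x] fr[of x] by simp
  show "f j x=0"
  proof (cases "j=r")
   case True
   thus ?thesis using fr by simp
  next
   case False
   show ?thesis by (rule fbasD(5)[OF fb _ s]) (use c j False in auto)
  qed
 qed simp
 thus ?thesis by blast
qed

text \<open>Normals are moved by \<open>S\<close> and points by the inverse \<open>R\<close> of its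
  adjoint \<open>T\<close>, so the fields are conjugated by \<open>R\<close>.\<close>

lemma fbas_transport:
 fixes S :: "'u::euclidean_space => 'w::euclidean_space"
 assumes fb: "fbas UNIV N r e F" and S: "linear S" "inj S" "surj S"
 shows "\<exists>F'. fbas UNIV (S ` N) r e F'"
proof -
 define T where "T=adjoint S"
 have T: "linear T" unfolding T_def by (rule adjoint_linear[OF S(1)])
 have adj: "S u\<cdot>x=u\<cdot>T x" for u x unfolding T_def using adjoint_works[OF S(1)] by simp
 have injT: "inj T" unfolding linear_injective_0[OF T]
 proof (intro allI impI)
  fix x assume "T x=0"
  hence "S u\<cdot>x=0" for u using adj by simp
  moreover obtain u where "x=S u" using S(3) by (rule surjE)
  ultimately have "x\<cdot>x=0" by metis
  thus "x=0" by simp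
 qed
 have d: "DIM('w)=DIM('u)" using dim_image_eq[OF S(1), of UNIV] S(2,3) by simp
 have surjT: "surj T" by (rule linear_injective_imp_surjective[OF T injT]) (simp add: d)
 define R where "R=inv T"
 have TR: "T (R u)=u" for u unfolding R_def by (rule surj_f_inv_f[OF surjT])
 have RT: "R (T x)=x" for x unfolding R_def by (rule inv_f_f[OF injT])
 have R: "linear R"
 proof (rule linearI)
  show "R (a + b)=R a + R b" for a b by (rule injD[OF injT]) (simp add: TR linear_add[OF T])
  show "R (c*\<^sub>Ra)=c*\<^sub>RR a" for c a by (rule injD[OF injT]) (simp add: TR linear_scale[OF T])
 qed
 note Fi = fbasD(1,3)[OF fb]
 let ?F = "%i x. R (F i (T x))"
 have hfc: "hf d (%x. A (G (B x)))" if "hf d G" "linear A" "linear B"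
  for d and G :: "'c::euclidean_space => 'c" and A :: "'c => 'd::euclidean_space" and B unfolding hf_def
 proof
  fix v
  have "v\<cdot>A (G (B x))=adjoint A v\<cdot>G (B x)" for x
   using adjoint_works[OF that(2)] by (simp add: inner_commute)
  moreover have "hp d (%x. adjoint A v\<cdot>G (B x))"
   using hp_compose[OF that(3), of d "%x. adjoint A v\<cdot>G x"] that(1) by (simp add: hf_def)
  ultimately show "hp d (%x. v\<cdot>A (G (B x)))" by simp
 qed
 have "fbas UNIV (S ` N) r e ?F" unfolding fbas_def
 proof (intro conjI allI impI)
  fix i assume i: "i < r"
  show "hf (e i) (?F i)" by (rule hfc[OF Fi(1)[OF i] R T])
  show "tang (S ` N) (?F i)" unfolding tang_def
  proof (intro ballI)
   fix h x assume "h\<in>S ` N" "x\<in>hyp h"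
   then obtain w where w: "w\<in>N" "h=S w" "w\<cdot>T x=0" by (auto simp: hyp_def adj)
   hence "w\<cdot>F i (T x)=0" using Fi(2)[OF i] by (simp add: tang_def hyp_def)
   thus "h\<cdot>?F i x=0" unfolding w(2) adj TR .
  qed
 next
  fix d and G :: "'w => 'w" assume G: "hf d G" "tang (S ` N) G"
  let ?G = "%u. T (G (R u))"
  have 1: "hf d ?G" by (rule hfc[OF G(1) T R])
  have 2: "tang N ?G" unfolding tang_def
  proof (intro ballI)
   fix w u assume w: "w\<in>N" "u\<in>hyp w"
   have "S w\<cdot>R u=0" unfolding adj TR using w(2) by (simp add: hyp_def)
   hence "S w\<cdot>G (R u)=0" using G(2) w(1) by (simp add: tang_def hyp_def)
   thus "w\<cdot>?G u=0" unfolding adj .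
  qed
  from fbasD(4)[OF fb 1 subset_UNIV 2] obtain f where
   f: "\<forall>i<r. hq d (e i) (f i)" "\<forall>x. ?G x=(\<Sum>i<r. f i x*\<^sub>RF i x)"
   by (elim exE conjE)
  show "\<exists>f. (\<forall>i<r. hq d (e i) (f i)) \<and> (\<forall>x. G x=(\<Sum>i<r. f i x*\<^sub>R?F i x))"
  proof (rule exI[of _ "%i x. f i (T x)"], intro conjI allI impI)
   fix i assume i: "i < r"
   show "hq d (e i) (%x. f i (T x))"
    using f(1)[rule_format, OF i] hp_compose[OF T, of "d - e i" "f i"] by (cases "e i\<le>d") simp_all
  next
   fix x
   have "G x=R (?G (T x))" by (simp add: RT)
   also have "\<dots>=(\<Sum>i<r. f i (T x)*\<^sub>R?F i x)"
    unfolding f(2)[rule_format] linear_sum[OF R] linear_scale[OF R] ..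
   finally show "G x=(\<Sum>i<r. f i (T x)*\<^sub>R?F i x)" .
  qed
 next
  fix f :: "nat => 'w => real" and j x
  assume c: "\<forall>i<r. continuous_on UNIV (f i)" and z: "\<forall>x. (\<Sum>i<r. f i x*\<^sub>R?F i x)=0" and j: "j < r"
  have cR: "continuous_on UNIV R" by (rule linear_continuous_on[OF linear_conv_bounded_linear[THEN iffD1, OF R]])
  have s: "(\<Sum>i<r. f i (R u)*\<^sub>RF i u)=0" for u
  proof -
   have "T (\<Sum>i<r. f i (R u)*\<^sub>R?F i (R u))=0" using z linear_0[OF T] by simp
   thus ?thesis unfolding linear_sum[OF T] linear_scale[OF T] TR .
  qed
  have ci: "continuous_on UNIV (%u. f i (R u))" if "i < r" for i
   by (rule continuous_on_compose2[OF _ cR]) (use c that in auto)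
  have "f j (R (T x))=0" by (rule fbasD(5)[OF fb ci s j])
  thus "f j x=0" unfolding RT .
 qed simp
 thus ?thesis by blast
qed

text \<open>In a plane all lines have the same trace on \<open>hyp a\<close>, so for nonempty
  \<open>N\<close> the degree \<open>dd N a\<close> is \<open>card N - 1\<close>. A constant field
  along one line times the forms of the other lines is transversal and has this degree.\<close>

lemma plane_basis:
 fixes N :: "'a::euclidean_space set"
 assumes "npar N" and d2: "DIM('a)=2"
 shows "\<exists>e F. fbas UNIV N 2 e F"
proof -
 have "finite N" using assms(1) by (simp add: npar_def)
 thus ?thesis using assms(1)
 proof (induction N rule: finite_induct)
  case empty
  have "\<exists>F. fbas (UNIV :: 'a set) {} (dim (UNIV :: 'a set)) (%_. 0) F" by (rule fbas_const) auto
  thus ?case using d2 by auto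
 next
  case (insert a N)
  have npN: "npar N" by (rule npar_subset[OF insert(4)]) auto
  obtain e F where fb: "fbas UNIV N 2 e F" using insert(3)[OF npN] by (elim exE)
  have a0: "a~=0" using insert(4) by (auto simp: npar_def)
  have "step_ok UNIV N a"
  proof (cases "N={}")
   case True
   have "a\<cdot>a~=0" "(0::'a)\<in>hyp a" using a0 by (auto simp: hyp_def)
   thus ?thesis unfolding step_ok_def True
    by (intro exI[of _ "%_. a"] conjI bexI[of _ 0]) (auto simp: dd_def hf_const tang_def)
  next
   case False
   then obtain v0 where v0: "v0\<in>N" by blast
   have na: "a\<notin>span {v}" "v\<notin>span {a}" if "v\<in>N" for v
    using insert(2,4) that unfolding npar_def by (metis insertCI)+
   have "span {a, v}=UNIV" if "v\<in>N" for v
   proof -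
    have "independent {v}" using npN that by (auto simp: npar_def dependent_single)
    hence i: "independent {a, v}" by (rule independent_insertI[OF na(1)[OF that]])
    have "a~=v" using na(1)[OF that] by (auto intro: span_base)
    hence "card {a, v}=dim (UNIV :: 'a set)" using d2 by simp
    hence "UNIV\<subseteq>span {a, v}" by (intro card_ge_dim_independent[OF subset_UNIV i]) simp
    thus ?thesis by blast
   qed
   hence "(%v. span {a, v}) ` N={UNIV}" using v0 by auto
   hence dd: "dd N a=card (N - {v0}) + 0" unfolding dd_def using insert(1) v0 by simp
   obtain w where w: "v0\<cdot>w=0" "a\<cdot>w~=0" using ortho_witness[OF na(1)[OF v0]] by auto
   let ?t = "%x. (\<Prod>v\<in>N - {v0}. v\<cdot>x)*\<^sub>Rw"
   have "\<exists>x\<in>hyp a. (\<Prod>v\<in>N - {v0}. v\<cdot>x)~=0"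
   proof (rule hp_prod_lin_nonzero[OF _ subspace_hyp])
    fix v assume "v\<in>N - {v0}"
    hence "v\<notin>span {a}" using na(2) by simp
    from ortho_witness[OF this] show "\<exists>x\<in>hyp a. v\<cdot>x~=0" by (auto simp: hyp_def)
   qed (use insert(1) in simp)
   then obtain x where x: "x\<in>hyp a" "(\<Prod>v\<in>N - {v0}. v\<cdot>x)~=0" by blast
   have "tang N ?t" unfolding tang_def
   proof (intro ballI)
    fix v y assume v: "v\<in>N" "y\<in>hyp v"
    show "v\<cdot>?t y=0"
    proof (cases "v=v0")
     case True
     thus ?thesis using w(1) by simp
    next
     case False
     hence "(\<Prod>v\<in>N - {v0}. v\<cdot>y)=0" using v insert(1) by (auto simp: hyp_def)
     thus ?thesis by simp
    qed
   qed
   moreover have "hf (dd N a) ?t" unfolding dd by (rule hf_scale[OF hp_prod_lin hf_const])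
   moreover have "a\<cdot>?t x~=0" using x(2) w(2) by simp
   ultimately show ?thesis unfolding step_ok_def using x(1) by blast
  qed
  from step_fbas[OF insert(4,2) fb this subspace_UNIV] show ?case by blast
 qed
qed

lemma arrangement_normals:
 assumes "arrangement \<A>"
 shows "\<exists>N. npar N \<and> \<A>=hyp ` N"
proof -
 have "\<forall>H\<in>\<A>. \<exists>a. a~=0 \<and> H=hyp a" using assms by (simp add: arrangement_def linear_hyperplane_hyp)
 from bchoice[OF this] obtain n where n: "\<forall>H\<in>\<A>. n H~=0 \<and> H=hyp (n H)" by (elim exE)
 have "npar (n ` \<A>)" unfolding npar_def
 proof (intro conjI ballI impI notI)
  show "finite (n ` \<A>)" using assms by (simp add: arrangement_def)
  show False if "0\<in>n ` \<A>" using that n by force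
  fix u v assume *: "u\<in>n ` \<A>" "v\<in>n ` \<A>" "u~=v" "u\<in>span {v}"
  then obtain H K where HK: "H\<in>\<A>" "K\<in>\<A>" "u=n H" "v=n K" by blast
  obtain t where t: "u=t*\<^sub>Rv" using *(4) unfolding in_span1 by blast
  have "t~=0" using t n HK by auto
  hence "hyp u=hyp v" unfolding t hyp_def by simp
  hence "H=K" using n HK by metis
  thus False using *(3) HK by simp
 qed
 moreover have "\<A>=hyp ` n ` \<A>" unfolding image_image using n by force
 ultimately show ?thesis by blast
qed

lemma generic_point:
 assumes rs: "rs (R :: 'v::euclidean_space set)"
 shows "\<exists>p. asys R p"
proof -
 let ?D = "(%(c, d). c - d) ` {(c, d). c\<in>R \<and> d\<in>R \<and> c~=d}"
 have fin: "finite R" by (rule rsD(1)[OF rs])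
 have fD: "finite ?D" by (rule finite_imageI[OF finite_subset[of _ "R \<times> R"]]) (use fin in auto)
 have "\<exists>x\<in>UNIV. (\<Prod>v\<in>R\<union>?D. v\<cdot>x)~=0"
 proof (rule hp_prod_lin_nonzero[OF _ subspace_UNIV])
  show "finite (R\<union>?D)" using fin fD by simp
  fix v assume "v\<in>R\<union>?D"
  hence "v~=0" using rsD(2)[OF rs] by auto
  thus "\<exists>x\<in>UNIV. v\<cdot>x~=0" by (intro bexI[of _ v]) auto
 qed
 then obtain x where x: "(\<Prod>v\<in>R\<union>?D. v\<cdot>x)~=0" by blast
 hence nz: "v\<cdot>x~=0" if "v\<in>R\<union>?D" for v using that fin fD by (auto simp: prod_zero_iff)
 \<comment> \<open>Division by \<open>M\<close> brings all values of roots below 1/2 without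
   disturbing genericity.\<close>
 define M where "M=2 * (\<Sum>c\<in>R. \<bar>c\<cdot>x\<bar>) + 1"
 have M: "M > 0" unfolding M_def by (simp add: add_nonneg_pos sum_nonneg)
 have le: "2 * \<bar>c\<cdot>x\<bar> < M" if "c\<in>R" for c
 proof -
  have "\<bar>c\<cdot>x\<bar>\<le>(\<Sum>c\<in>R. \<bar>c\<cdot>x\<bar>)" by (rule member_le_sum[OF that _ fin]) simp
  thus ?thesis by (simp add: M_def)
 qed
 have "asys R ((1 / M)*\<^sub>Rx)"
 proof
  show "rs R" by (rule rs)
  show "inj_on (%c. c\<cdot>(1 / M)*\<^sub>Rx) R"
  proof (rule inj_onI, rule ccontr)
   fix c d assume cd: "c\<in>R" "d\<in>R" "c\<cdot>(1 / M)*\<^sub>Rx=d\<cdot>(1 / M)*\<^sub>Rx" "c~=d"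
   hence "c - d\<in>?D" by (intro image_eqI[of _ _ "(c, d)"]) auto
   hence "(c - d)\<cdot>x~=0" using nz by blast
   thus False using cd(3) M by (simp add: inner_diff_left)
  qed
  fix c assume c: "c\<in>R"
  have "\<bar>c\<cdot>x\<bar> / M < 1 / 2" using le[OF c] M by (simp add: field_simps)
  thus "c\<cdot>(1 / M)*\<^sub>Rx~=0 \<and> \<bar>c\<cdot>(1 / M)*\<^sub>Rx\<bar> < 1 / 2" using nz[of c] c M by (simp add: abs_divide)
 qed
 thus ?thesis by blast
qed

lemma (in asys) catn_af:
 assumes S: "linear S"
 shows "hyp ` S ` catn R p k=hyp ` S ` insert (0, 1) (af R p (real k + 1 / 2))"
proof -
 have neg: "hyp (S (- v))=hyp (S v)" for v unfolding linear_neg[OF S] by (simp add: hyp_def)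
 have sm: "- 1 < 2 * (c\<cdot>p)" "2 * (c\<cdot>p) < 1" if "c\<in>R" for c
  using small[OF that] unfolding abs_less_iff by simp_all
 show ?thesis unfolding image_image
 proof (intro subset_antisym subsetI)
  fix H assume "H\<in>(%v. hyp (S v)) ` catn R p k"
  then obtain v where v: "v\<in>catn R p k" "H=hyp (S v)" by blast
  show "H\<in>(%v. hyp (S v)) ` insert (0, 1) (af R p (real k + 1 / 2))"
  proof (cases "v=(0, 1)")
   case True
   thus ?thesis using v(2) by blast
  next
   case False
   then obtain c j where c: "c\<in>pos R p" "\<bar>j\<bar>\<le>int k" "v=(c, real_of_int j)" using v(1) by (auto simp: catn_def)
   have cR: "c\<in>R" "0 < c\<cdot>p" using posD[OF c(1)] by auto
   have "v\<in>af R p (real k + 1 / 2) \<or> - v\<in>af R p (real k + 1 / 2)"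
   proof (cases "j\<ge>0")
    case True
    hence "0 < c\<cdot>p + real_of_int j" "c\<cdot>p + real_of_int j < real k + 1 / 2"
     using c(2) cR sm[OF cR(1)] by linarith+
    thus ?thesis using cR c(3) by (simp add: af_def)
   next
    case False
    hence "0 < - (c\<cdot>p) - real_of_int j" "- (c\<cdot>p) - real_of_int j < real k + 1 / 2"
     using c(2) cR sm[OF cR(1)] by linarith+
    thus ?thesis using rsD(6)[OF rs cR(1)] c(3) by (simp add: af_def)
   qed
   thus ?thesis using v(2) neg[of v] by (metis image_eqI insertI2)
  qed
 next
  fix H assume "H\<in>(%v. hyp (S v)) ` insert (0, 1) (af R p (real k + 1 / 2))"
  then obtain v where v: "v\<in>insert (0, 1) (af R p (real k + 1 / 2))" "H=hyp (S v)" by blast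
  show "H\<in>(%v. hyp (S v)) ` catn R p k"
  proof (cases "v=(0, 1)")
   case True
   thus ?thesis using v(2) by (auto simp: catn_def)
  next
   case False
   obtain c s where cs: "v=(c, s)" by (cases v)
   have c: "c\<in>R" "s\<in>\<int>" "0 < c\<cdot>p + s" "c\<cdot>p + s < real k + 1 / 2" using v(1) False cs by (auto simp: af_def)
   obtain i where i: "s = of_int i" using c(2) by (auto elim: Ints_cases)
   have "\<bar>i\<bar>\<le>int k" using c(3,4) sm[OF c(1)] unfolding i by linarith
   moreover have "c\<in>pos R p \<or> - c\<in>pos R p" using pos_neg[OF c(1)] by blast
   ultimately have "v\<in>catn R p k \<or> - v\<in>catn R p k"
    unfolding cs i catn_def by (auto intro: exI[of _ "- i"])
   thus ?thesis using v(2) neg[of v] by (metis image_eqI)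
  qed
 qed
qed

text \<open>Passing to the positive system of \<open>p\<close> replaces some \<open>(c, j)\<close>
  by \<open>(- c, - j)\<close>, which defines the same hyperplane; the range of levels is
  symmetric.\<close>

lemma Cat_catn:
 assumes rs: "rs \<Phi>" and P: "positive_system \<Phi> P" and p: "\<And>c. c\<in>\<Phi> ==> c\<cdot>p~=0"
 shows "Cat P k=(%v. {x. v\<cdot>(base_part x, x $ None)=0}) ` catn \<Phi> p k"
proof -
 let ?H = "%v. {x. v\<cdot>(base_part x, x $ None)=0}"
 have ch: "cat_hyperplane c j=?H (c, real_of_int (- j))" for c :: "real^'n" and j
  by (auto simp: cat_hyperplane_def)
 have neg: "cat_hyperplane (- c) (- j)=cat_hyperplane c j" for c :: "real^'n" and j
  by (auto simp: cat_hyperplane_def)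
 obtain d where d: "\<forall>a\<in>\<Phi>. a\<cdot>d~=0" "P={a\<in>\<Phi>. a\<cdot>d > 0}" using P unfolding positive_system_def by blast
 have sub: "cat_hyperplane c j\<in>{cat_hyperplane a j | a j. a\<in>{a\<in>\<Phi>. a\<cdot>g > 0} \<and> - int k\<le>j \<and> j\<le>int k}"
  if g: "\<forall>a\<in>\<Phi>. a\<cdot>g~=0" and c: "c\<in>\<Phi>" "- int k\<le>j" "j\<le>int k" for g c j
 proof (cases "c\<cdot>g > 0")
  case True
  thus ?thesis using c by blast
 next
  case False
  hence "- c\<in>{a\<in>\<Phi>. a\<cdot>g > 0}" using g c(1) rsD(6)[OF rs c(1)] by (auto simp: not_less order_less_le)
  moreover have "- int k\<le>- j" "- j\<le>int k" using c by auto
  ultimately have "cat_hyperplane (- c) (- j)\<in>{cat_hyperplane a j | a j. a\<in>{a\<in>\<Phi>. a\<cdot>g > 0} \<and> - int k\<le>j \<and> j\<le>int k}"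
   by blast
  thus ?thesis unfolding neg .
 qed
 have p': "\<forall>a\<in>\<Phi>. a\<cdot>p~=0" using p by blast
 have "{cat_hyperplane a j | a j. a\<in>P \<and> - int k\<le>j \<and> j\<le>int k} =
   {cat_hyperplane a j | a j. a\<in>pos \<Phi> p \<and> - int k\<le>j \<and> j\<le>int k}" (is "?L=?R")
 proof (intro subset_antisym subsetI)
  show "H\<in>?R" if "H\<in>?L" for H using that sub[OF p'] d(2) unfolding pos_def by blast
  show "H\<in>?L" if "H\<in>?R" for H using that sub[OF d(1)] d(2) unfolding pos_def by blast
 qed
 also have "?R=?H ` {(c, real_of_int j) | c j. c\<in>pos \<Phi> p \<and> \<bar>j\<bar>\<le>int k}"
 proof (intro subset_antisym subsetI)
  fix H assume "H\<in>?R"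
  then obtain a j where *: "H=cat_hyperplane a j" "a\<in>pos \<Phi> p" "- int k\<le>j" "j\<le>int k" by blast
  hence "\<bar>- j\<bar>\<le>int k" by simp
  thus "H\<in>?H ` {(c, real_of_int j) | c j. c\<in>pos \<Phi> p \<and> \<bar>j\<bar>\<le>int k}" unfolding *(1) ch using *(2) by blast
 next
  fix H assume "H\<in>?H ` {(c, real_of_int j) | c j. c\<in>pos \<Phi> p \<and> \<bar>j\<bar>\<le>int k}"
  then obtain c j where *: "H=?H (c, real_of_int j)" "c\<in>pos \<Phi> p" "\<bar>j\<bar>\<le>int k" by blast
  have "H=cat_hyperplane c (- j)" unfolding *(1) ch by simp
  moreover have "- int k\<le>- j" "- j\<le>int k" using *(3) by auto
  ultimately show "H\<in>?R" using *(2) by blast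
 qed
 finally have "Cat P k=?H ` {(c, real_of_int j) | c j. c\<in>pos \<Phi> p \<and> \<bar>j\<bar>\<le>int k}\<union>{?H (0, 1)}"
  unfolding Cat_def by simp
 thus ?thesis unfolding catn_def by blast
qed

theorem theorem5p2:
 fixes \<Phi> P :: "(real^'n::finite) set" and k :: nat
  and \<A> :: "(real^('n option)) set set"
 assumes "root_system \<Phi>" and "crystallographic \<Phi>" and "irreducible_roots \<Phi>"
  and "positive_system \<Phi> P"
  and "k \<ge> 1"
  and "arrangement \<A>"
  and "lattice_isomorphic (intersection_lattice \<A>) (intersection_lattice (Cat P k))"
 shows "free_arrangement \<A>"
proof (cases "CARD('n) = 1")
 case True
 obtain N where N: "npar N" "\<A> = hyp ` N" using arrangement_normals[OF assms(6)] by blast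
 have "DIM(real^('n option)) = 2" using True by simp
 from plane_basis[OF N(1) this] obtain e F where "fbas UNIV N 2 e F" by (elim exE)
 from free_from_basis[OF this N(2)] show ?thesis using N(1) by (simp add: npar_def)
next
 case False
 have rs: "rs \<Phi>" unfolding rs_def
 proof (intro conjI)
  show "finite \<Phi>" "0 \<notin> \<Phi>" "\<forall>\<alpha>\<in>\<Phi>. \<Phi> \<inter> span {\<alpha>} = {\<alpha>, - \<alpha>}" using assms(1) by (simp_all add: root_system_def)
  show "\<forall>\<alpha>\<in>\<Phi>. \<forall>\<beta>\<in>\<Phi>. refl_along \<alpha> \<beta> \<in> \<Phi>" using assms(1) unfolding root_system_def by blast
  show "\<forall>\<alpha>\<in>\<Phi>. \<forall>\<beta>\<in>\<Phi>. cn \<beta> \<alpha> \<in> \<int>" using assms(2) by (simp add: crystallographic_def cn_def)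
 qed
 have full: "span \<Phi> = UNIV" using assms(1) by (simp add: root_system_def)
 have dim\<Phi>: "dim \<Phi> = CARD('n)" using full dim_span[of \<Phi>] by simp
 have "CARD('n) > 0" by simp
 hence dim2: "dim \<Phi> \<ge> 2" using False dim\<Phi> by linarith
 obtain p where p: "asys \<Phi> p" using generic_point[OF rs] by blast
 interpret asys \<Phi> p by (rule p)
 let ?N = "catn \<Phi> p k"
 define \<kappa> where "\<kappa> x = (base_part x, x $ None)" for x :: "real^('n option)"
 have \<kappa>: "linear \<kappa>" unfolding \<kappa>_def by (auto simp: linear_iff base_part_def vec_eq_iff)
 have \<kappa>s: "surj \<kappa>"
 proof (rule surjI)
  fix u :: "(real^'n) \<times> real"
  show "\<kappa> (\<chi> i. case i of None \<Rightarrow> snd u | Some j \<Rightarrow> fst u $ j) = u"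
   by (cases u) (simp add: \<kappa>_def base_part_def vec_eq_iff)
 qed
 have C: "Cat P k = (\<lambda>\<nu>. {x. \<nu> \<bullet> \<kappa> x = 0}) ` ?N"
  unfolding \<kappa>_def by (rule Cat_catn[OF rs assms(4)]) (use small in blast)
 have finN: "finite ?N"
 proof -
  have "?N \<subseteq> insert (0, 1) (pos \<Phi> p \<times> real_of_int ` {- int k..int k})" 
   by (auto simp: catn_def intro!: imageI)
  thus ?thesis by (rule finite_subset) (use finP in simp)
 qed
 have N0: "0 \<notin> ?N" using nz(1) posD(1) by (auto simp: catn_def zero_prod_def)
 obtain m where m: "\<A> = hyp ` m ` ?N" "\<forall>\<nu>\<in>?N. \<forall>S\<subseteq>?N. \<nu> \<in> span S \<longleftrightarrow> m \<nu> \<in> span (m ` S)"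
  using lattice_matroid[OF assms(6) finN N0 \<kappa> \<kappa>s assms(7)[unfolded C]] by (elim exE conjE)
 interpret rigid \<Phi> p k m
 proof
  show "irreducible_roots \<Phi>" "2 \<le> dim \<Phi>" "span \<Phi> = UNIV" "1 \<le> k" by (rule assms(3) dim2 full assms(5))+
  show "DIM(real^('n option)) = DIM(real^'n) + 1" by simp
  show "\<nu> \<in> span S \<longleftrightarrow> m \<nu> \<in> span (m ` S)" if "\<nu> \<in> ?N" "S \<subseteq> ?N" for \<nu> S using m(2) that by blast
 qed
 obtain S where S: "linear S" "inj S" "surj S" "\<forall>\<nu>\<in>?N. hyp (m \<nu>) = hyp (S \<nu>)" using rigidity by (elim exE conjE)
 let ?M = "insert (0, 1) (af \<Phi> p (real k + 1 / 2))"
 have "\<A> = hyp ` S ` ?N" unfolding m(1) image_image by (rule image_cong) (use S(4) in auto)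
 hence A: "\<A> = hyp ` S ` ?M" using catn_af[OF S(1), of k] by simp
 have E: "span \<Phi> \<times> {0} = hyp ((0, 1) :: (real^'n) \<times> real)" unfolding full by (auto simp: hyp_def)
 obtain e F where "fbas (hyp (0, 1)) ?M (dim \<Phi>) e F" using aff_basis[OF p] unfolding E by blast
 hence "\<exists>e F. fbas UNIV ?M (Suc (dim \<Phi>)) e F" by (rule fbas_add_euler) (auto simp: zero_prod_def)
 then obtain e F where "fbas UNIV ?M (Suc (dim \<Phi>)) e F" by (elim exE)
 from fbas_transport[OF this S(1-3)] obtain F' where "fbas UNIV (S ` ?M) (Suc (dim \<Phi>)) e F'" by (elim exE)
 thus ?thesis
 proof (rule free_from_basis[OF _ A])
  have "0 \<notin> ?M" using npar_af[of "real k + 1 / 2"] unfolding npar_def by blast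
  moreover have "\<nu> = 0" if "S \<nu> = 0" for \<nu> using that S(2) linear_0[OF S(1)] by (metis injD)
  ultimately show "0 \<notin> S ` ?M" by (metis imageE)
 qed
qed

end
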